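(* For every $n\geq 1$, $C(O_n^{-1})$ is the quantum symmetry algebra of the cube graph $K_n$ ($2^n$ vertices, $n2^{n-1}$ edges): the Hopf algebras $C(O_n^{-1})$ and $A_{K_n}$ are isomorphic.
   Context: All algebras are unital $C^*$-algebras. A square matrix $u=(u_{ij})$ over a $C^*$-algebra is orthogonal if all $u_{ij}$ are self-adjoint and $u$ is unitary; it is a magic unitary if all $u_{ij}$ are projections which on each row and each column are mutually orthogonal and sum to $1$. $A_o(n)$ (respectively $A_s(n)$) is the universal $C^*$-algebra generated by the entries of an $n\times n$ orthogonal matrix (respectively magic unitary). These, and the quotients below, are Hopf algebras with comultiplication $\Delta(u_{ij})=\sum_k u_{ik}\otimes u_{kj}$, counit $\varepsilon(u_{ij})=\delta_{ij}$ and antipode $S(u_{ij})=u_{ji}$. $C(O_n^{-1})$ is the quotient of $A_o(n)$ by the relations: (1) $u_{ij}u_{ik}=-u_{ik}u_{ij}$ and $u_{ji}u_{ki}=-u_{ki}u_{ji}$ for all $i$ and all $j\neq k$; (2) $u_{ij}u_{kl}=u_{kl}u_{ij}$ for $i\neq k$, $j\neq l$. For a finite graph $X$ with vertices labelled $1,\ldots,N$ and adjacency matrix $d$, the quantum symmetry algebra of $X$ is $A_X=A_s(N)/I$, where $I$ is the ideal generated by the $N^2$ relations coming from the equality $du=ud$. $K_n$ is the graph whose vertices and edges are those of the cube in $\mathbb R^n$. *)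

theory Defs
  imports Complex_Main "HOL-Algebra.QuotRing" "HOL-Algebra.Module" "HOL-Library.Poly_Mapping"
begin

section \<open>Unital star-algebras and C*-algebras\<close>

definition complex_ring :: "complex ring" where
  "complex_ring = \<lparr>carrier = UNIV, mult = (*), one = 1, zero = 0, add = (+)\<rparr>"

record 'a star_alg = "(complex, 'a) module" +
  star :: "'a \<Rightarrow> 'a"

record 'a cstar_alg = "'a star_alg" +
  cnorm :: "'a \<Rightarrow> real"

locale star_algebra = ring A + module complex_ring A for A (structure) +
  assumes smult_mult_left:
      "\<lbrakk>x \<in> carrier A; y \<in> carrier A\<rbrakk> \<Longrightarrow> (c \<odot> x) \<otimes> y = c \<odot> (x \<otimes> y)"
    and smult_mult_right:
      "\<lbrakk>x \<in> carrier A; y \<in> carrier A\<rbrakk> \<Longrightarrow> x \<otimes> (c \<odot> y) = c \<odot> (x \<otimes> y)"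
    and star_closed: "x \<in> carrier A \<Longrightarrow> star A x \<in> carrier A"
    and star_star: "x \<in> carrier A \<Longrightarrow> star A (star A x) = x"
    and star_add:
      "\<lbrakk>x \<in> carrier A; y \<in> carrier A\<rbrakk> \<Longrightarrow> star A (x \<oplus> y) = star A x \<oplus> star A y"
    and star_smult: "x \<in> carrier A \<Longrightarrow> star A (c \<odot> x) = cnj c \<odot> star A x"
    and star_mult:
      "\<lbrakk>x \<in> carrier A; y \<in> carrier A\<rbrakk> \<Longrightarrow> star A (x \<otimes> y) = star A y \<otimes> star A x"

definition cstar_seminorm :: "('a, 'm) star_alg_scheme \<Rightarrow> ('a \<Rightarrow> real) \<Rightarrow> bool" where
  "cstar_seminorm A p \<longleftrightarrow>
     (\<forall>x\<in>carrier A. 0 \<le> p x) \<and>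
     (\<forall>x\<in>carrier A. \<forall>y\<in>carrier A. p (x \<oplus>\<^bsub>A\<^esub> y) \<le> p x + p y) \<and>
     (\<forall>c. \<forall>x\<in>carrier A. p (c \<odot>\<^bsub>A\<^esub> x) = cmod c * p x) \<and>
     (\<forall>x\<in>carrier A. \<forall>y\<in>carrier A. p (x \<otimes>\<^bsub>A\<^esub> y) \<le> p x * p y) \<and>
     (\<forall>x\<in>carrier A. p (star A x \<otimes>\<^bsub>A\<^esub> x) = (p x)\<^sup>2)"

definition cauchy_in :: "('a, 'm) star_alg_scheme \<Rightarrow> ('a \<Rightarrow> real) \<Rightarrow> (nat \<Rightarrow> 'a) \<Rightarrow> bool" where
  "cauchy_in A p x \<longleftrightarrow>
     (\<forall>k. x k \<in> carrier A) \<and>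
     (\<forall>e>0. \<exists>M. \<forall>k\<ge>M. \<forall>l\<ge>M. p (x k \<ominus>\<^bsub>A\<^esub> x l) < e)"

locale cstar_algebra = star_algebra A for A :: "('a, 'm) cstar_alg_scheme" (structure) +
  assumes cnorm_seminorm: "cstar_seminorm A (cnorm A)"
    and cnorm_definite: "\<lbrakk>x \<in> carrier A; cnorm A x = 0\<rbrakk> \<Longrightarrow> x = \<zero>"
    and cnorm_complete:
      "cauchy_in A (cnorm A) s \<Longrightarrow>
         \<exists>x\<in>carrier A. (\<lambda>k. cnorm A (s k \<ominus> x)) \<longlonglongrightarrow> 0"

definition star_hom ::
  "('a, 'm) star_alg_scheme \<Rightarrow> ('b, 'n) star_alg_scheme \<Rightarrow> ('a \<Rightarrow> 'b) set" where
  "star_hom A B = {f \<in> ring_hom A B.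
     (\<forall>c. \<forall>x\<in>carrier A. f (c \<odot>\<^bsub>A\<^esub> x) = c \<odot>\<^bsub>B\<^esub> f x) \<and>
     (\<forall>x\<in>carrier A. f (star A x) = star B (f x))}"

definition complex_cstar :: "complex cstar_alg" where
  "complex_cstar = \<lparr>carrier = UNIV, mult = (*), one = 1, zero = 0, add = (+),
     smult = (*), star = cnj, cnorm = cmod\<rparr>"

definition opposite :: "('a, 'm) star_alg_scheme \<Rightarrow> ('a, 'm) star_alg_scheme" where
  "opposite A = A\<lparr>mult := \<lambda>x y. y \<otimes>\<^bsub>A\<^esub> x\<rparr>"


section \<open>Universal C*-algebras given by generators and relations\<close>

text \<open>The free monoid on letters \<open>g\<close> (flag \<open>False\<close>) and \<open>g*\<close> (flag \<open>True\<close>); its complex monoid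
  algebra is the free unital star-algebra.\<close>

datatype 'g word = Word (letters: "('g \<times> bool) list")

instantiation word :: (type) monoid_add
begin

definition zero_word :: "'a word" where
  "0 = Word []"

definition plus_word :: "'a word \<Rightarrow> 'a word \<Rightarrow> 'a word" where
  "v + w = Word (letters v @ letters w)"

instance
  by standard (simp_all add: zero_word_def plus_word_def)

end

type_synonym 'g free_alg = "'g word \<Rightarrow>\<^sub>0 complex"

definition word_star :: "'g word \<Rightarrow> 'g word" where
  "word_star w = Word (rev (map (\<lambda>(g, b). (g, \<not> b)) (letters w)))"

definition free_star_algebra :: "'g set \<Rightarrow> 'g free_alg star_alg" where
  "free_star_algebra G = \<lparr>
     carrier = {p. \<forall>w\<in>Poly_Mapping.keys p. fst ` set (letters w) \<subseteq> G},
     mult = (*), one = 1, zero = 0, add = (+),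
     smult = (\<lambda>c p. Poly_Mapping.single 0 c * p),
     star = (\<lambda>p. \<Sum>w\<in>Poly_Mapping.keys p.
                Poly_Mapping.single (word_star w) (cnj (Poly_Mapping.lookup p w)))\<rparr>"

definition gen :: "'g \<Rightarrow> 'g free_alg" where
  "gen g = Poly_Mapping.single (Word [(g, False)]) 1"

text \<open>The largest C*-seminorm on \<open>A\<close> that vanishes on \<open>R\<close>.  It is meaningful only when these
  seminorms are pointwise bounded, as is the case for all relations considered below.\<close>

definition max_seminorm :: "('a, 'm) star_alg_scheme \<Rightarrow> 'a set \<Rightarrow> 'a \<Rightarrow> real" where
  "max_seminorm A R x = (SUP p\<in>{p. cstar_seminorm A p \<and> (\<forall>r\<in>R. p r = 0)}. p x)"

type_synonym 'a completion = "(nat \<Rightarrow> 'a) set"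

text \<open>Separated completion of \<open>A\<close> with respect to \<open>p\<close>: Cauchy sequences modulo null sequences.\<close>

definition cauchy_class ::
  "('a, 'm) star_alg_scheme \<Rightarrow> ('a \<Rightarrow> real) \<Rightarrow> (nat \<Rightarrow> 'a) \<Rightarrow> 'a completion" where
  "cauchy_class A p x =
     {y. cauchy_in A p y \<and> (\<lambda>k. p (y k \<ominus>\<^bsub>A\<^esub> x k)) \<longlonglongrightarrow> 0}"

definition completion ::
  "('a, 'm) star_alg_scheme \<Rightarrow> ('a \<Rightarrow> real) \<Rightarrow> 'a completion cstar_alg" where
  "completion A p = \<lparr>
     carrier = cauchy_class A p ` {x. cauchy_in A p x},
     mult = (\<lambda>X Y. \<Union>x\<in>X. \<Union>y\<in>Y. cauchy_class A p (\<lambda>k. x k \<otimes>\<^bsub>A\<^esub> y k)),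
     one = cauchy_class A p (\<lambda>k. \<one>\<^bsub>A\<^esub>),
     zero = cauchy_class A p (\<lambda>k. \<zero>\<^bsub>A\<^esub>),
     add = (\<lambda>X Y. \<Union>x\<in>X. \<Union>y\<in>Y. cauchy_class A p (\<lambda>k. x k \<oplus>\<^bsub>A\<^esub> y k)),
     smult = (\<lambda>c X. \<Union>x\<in>X. cauchy_class A p (\<lambda>k. c \<odot>\<^bsub>A\<^esub> x k)),
     star = (\<lambda>X. \<Union>x\<in>X. cauchy_class A p (\<lambda>k. star A (x k))),
     cnorm = (\<lambda>X. THE r. \<forall>x\<in>X. (\<lambda>k. p (x k)) \<longlonglongrightarrow> r)\<rparr>"

definition universal_cstar ::
  "'g set \<Rightarrow> 'g free_alg set \<Rightarrow> 'g free_alg completion cstar_alg" where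
  "universal_cstar G R =
     completion (free_star_algebra G) (max_seminorm (free_star_algebra G) R)"

definition universal_gen ::
  "'g set \<Rightarrow> 'g free_alg set \<Rightarrow> 'g \<Rightarrow> 'g free_alg completion" where
  "universal_gen G R g =
     cauchy_class (free_star_algebra G) (max_seminorm (free_star_algebra G) R) (\<lambda>k. gen g)"


section \<open>Quotients\<close>

definition closed_in :: "('a, 'm) cstar_alg_scheme \<Rightarrow> 'a set \<Rightarrow> bool" where
  "closed_in A I \<longleftrightarrow>
     (\<forall>x\<in>carrier A. (\<forall>e>0. \<exists>y\<in>I. cnorm A (x \<ominus>\<^bsub>A\<^esub> y) < e) \<longrightarrow> x \<in> I)"

definition closed_ideal_gen :: "('a, 'm) cstar_alg_scheme \<Rightarrow> 'a set \<Rightarrow> 'a set" where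
  "closed_ideal_gen A S = \<Inter>{I. ideal I A \<and> closed_in A I \<and> S \<subseteq> I}"

definition cstar_quotient :: "('a, 'm) cstar_alg_scheme \<Rightarrow> 'a set \<Rightarrow> 'a set cstar_alg" where
  "cstar_quotient A I = \<lparr>
     carrier = carrier (A Quot I), mult = mult (A Quot I), one = one (A Quot I),
     zero = zero (A Quot I), add = add (A Quot I),
     smult = (\<lambda>c X. \<Union>x\<in>X. I +>\<^bsub>A\<^esub> (c \<odot>\<^bsub>A\<^esub> x)),
     star = (\<lambda>X. \<Union>x\<in>X. I +>\<^bsub>A\<^esub> (star A x)),
     cnorm = (\<lambda>X. INF x\<in>X. cnorm A x)\<rparr>"


section \<open>Orthogonal matrices and magic unitaries\<close>

text \<open>Relations are encoded as sets of elements required to vanish.\<close>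

definition orthogonal_rels ::
  "('a, 'm) star_alg_scheme \<Rightarrow> 'i set \<Rightarrow> ('i \<Rightarrow> 'i \<Rightarrow> 'a) \<Rightarrow> 'a set" where
  "orthogonal_rels A I u =
     {star A (u i j) \<ominus>\<^bsub>A\<^esub> u i j | i j. i \<in> I \<and> j \<in> I} \<union>
     {(\<Oplus>\<^bsub>A\<^esub>k\<in>I. u i k \<otimes>\<^bsub>A\<^esub> star A (u j k)) \<ominus>\<^bsub>A\<^esub> (if i = j then \<one>\<^bsub>A\<^esub> else \<zero>\<^bsub>A\<^esub>)
        | i j. i \<in> I \<and> j \<in> I} \<union>
     {(\<Oplus>\<^bsub>A\<^esub>k\<in>I. star A (u k i) \<otimes>\<^bsub>A\<^esub> u k j) \<ominus>\<^bsub>A\<^esub> (if i = j then \<one>\<^bsub>A\<^esub> else \<zero>\<^bsub>A\<^esub>)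
        | i j. i \<in> I \<and> j \<in> I}"

definition magic_unitary_rels ::
  "('a, 'm) star_alg_scheme \<Rightarrow> 'i set \<Rightarrow> ('i \<Rightarrow> 'i \<Rightarrow> 'a) \<Rightarrow> 'a set" where
  "magic_unitary_rels A I u =
     {star A (u i j) \<ominus>\<^bsub>A\<^esub> u i j | i j. i \<in> I \<and> j \<in> I} \<union>
     {u i j \<otimes>\<^bsub>A\<^esub> u i j \<ominus>\<^bsub>A\<^esub> u i j | i j. i \<in> I \<and> j \<in> I} \<union>
     {u i j \<otimes>\<^bsub>A\<^esub> u i k | i j k. i \<in> I \<and> j \<in> I \<and> k \<in> I \<and> j \<noteq> k} \<union>
     {u j i \<otimes>\<^bsub>A\<^esub> u k i | i j k. i \<in> I \<and> j \<in> I \<and> k \<in> I \<and> j \<noteq> k} \<union>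
     {(\<Oplus>\<^bsub>A\<^esub>j\<in>I. u i j) \<ominus>\<^bsub>A\<^esub> \<one>\<^bsub>A\<^esub> | i. i \<in> I} \<union>
     {(\<Oplus>\<^bsub>A\<^esub>i\<in>I. u i j) \<ominus>\<^bsub>A\<^esub> \<one>\<^bsub>A\<^esub> | j. j \<in> I}"

type_synonym 'i matrix_univ = "('i \<times> 'i) free_alg completion"

abbreviation gen_matrix :: "'i \<Rightarrow> 'i \<Rightarrow> ('i \<times> 'i) free_alg" where
  "gen_matrix i j \<equiv> gen (i, j)"

definition A_o_rels :: "nat \<Rightarrow> (nat \<times> nat) free_alg set" where
  "A_o_rels n = orthogonal_rels (free_star_algebra ({1..n} \<times> {1..n})) {1..n} gen_matrix"

definition A_o :: "nat \<Rightarrow> nat matrix_univ cstar_alg" where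
  "A_o n = universal_cstar ({1..n} \<times> {1..n}) (A_o_rels n)"

definition A_o_gen :: "nat \<Rightarrow> nat \<Rightarrow> nat \<Rightarrow> nat matrix_univ" where
  "A_o_gen n i j = universal_gen ({1..n} \<times> {1..n}) (A_o_rels n) (i, j)"

text \<open>\<open>A_s V\<close> has its generating matrix indexed by an arbitrary finite set \<open>V\<close>, so that graphs need
  no numbering of their vertices.\<close>

definition A_s_rels :: "'v set \<Rightarrow> ('v \<times> 'v) free_alg set" where
  "A_s_rels V = magic_unitary_rels (free_star_algebra (V \<times> V)) V gen_matrix"

definition A_s :: "'v set \<Rightarrow> 'v matrix_univ cstar_alg" where
  "A_s V = universal_cstar (V \<times> V) (A_s_rels V)"

definition A_s_gen :: "'v set \<Rightarrow> 'v \<Rightarrow> 'v \<Rightarrow> 'v matrix_univ" where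
  "A_s_gen V i j = universal_gen (V \<times> V) (A_s_rels V) (i, j)"


section \<open>The algebra of functions on the quantum group \<open>O_n^{-1}\<close>\<close>

definition O_neg_rels ::
  "('a, 'm) star_alg_scheme \<Rightarrow> 'i set \<Rightarrow> ('i \<Rightarrow> 'i \<Rightarrow> 'a) \<Rightarrow> 'a set" where
  "O_neg_rels A I u =
     {u i j \<otimes>\<^bsub>A\<^esub> u i k \<oplus>\<^bsub>A\<^esub> u i k \<otimes>\<^bsub>A\<^esub> u i j | i j k. i \<in> I \<and> j \<in> I \<and> k \<in> I \<and> j \<noteq> k} \<union>
     {u j i \<otimes>\<^bsub>A\<^esub> u k i \<oplus>\<^bsub>A\<^esub> u k i \<otimes>\<^bsub>A\<^esub> u j i | i j k. i \<in> I \<and> j \<in> I \<and> k \<in> I \<and> j \<noteq> k} \<union>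
     {u i j \<otimes>\<^bsub>A\<^esub> u k l \<ominus>\<^bsub>A\<^esub> u k l \<otimes>\<^bsub>A\<^esub> u i j
        | i j k l. i \<in> I \<and> j \<in> I \<and> k \<in> I \<and> l \<in> I \<and> i \<noteq> k \<and> j \<noteq> l}"

definition C_O_neg_ideal :: "nat \<Rightarrow> nat matrix_univ set" where
  "C_O_neg_ideal n = closed_ideal_gen (A_o n) (O_neg_rels (A_o n) {1..n} (A_o_gen n))"

definition C_O_neg :: "nat \<Rightarrow> nat matrix_univ set cstar_alg" where
  "C_O_neg n = cstar_quotient (A_o n) (C_O_neg_ideal n)"

definition C_O_neg_gen :: "nat \<Rightarrow> nat \<Rightarrow> nat \<Rightarrow> nat matrix_univ set" where
  "C_O_neg_gen n i j = C_O_neg_ideal n +>\<^bsub>A_o n\<^esub> A_o_gen n i j"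


section \<open>Quantum symmetry algebras of finite graphs\<close>

text \<open>A graph is given by its vertex set \<open>V\<close> and its set \<open>E\<close> of edges, which are two-element
  subsets of \<open>V\<close>.\<close>

definition adjacency :: "'v set set \<Rightarrow> 'v \<Rightarrow> 'v \<Rightarrow> complex" where
  "adjacency E i j = (if {i, j} \<in> E then 1 else 0)"

definition commutation_rels ::
  "('a, 'm) star_alg_scheme \<Rightarrow> 'i set \<Rightarrow> ('i \<Rightarrow> 'i \<Rightarrow> complex) \<Rightarrow> ('i \<Rightarrow> 'i \<Rightarrow> 'a) \<Rightarrow> 'a set" where
  "commutation_rels A I d u =
     {(\<Oplus>\<^bsub>A\<^esub>k\<in>I. d i k \<odot>\<^bsub>A\<^esub> u k j) \<ominus>\<^bsub>A\<^esub> (\<Oplus>\<^bsub>A\<^esub>k\<in>I. d k j \<odot>\<^bsub>A\<^esub> u i k) | i j. i \<in> I \<and> j \<in> I}"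

definition quantum_sym_ideal :: "'v set \<Rightarrow> 'v set set \<Rightarrow> 'v matrix_univ set" where
  "quantum_sym_ideal V E =
     closed_ideal_gen (A_s V) (commutation_rels (A_s V) V (adjacency E) (A_s_gen V))"

definition quantum_sym :: "'v set \<Rightarrow> 'v set set \<Rightarrow> 'v matrix_univ set cstar_alg" where
  "quantum_sym V E = cstar_quotient (A_s V) (quantum_sym_ideal V E)"

definition quantum_sym_gen ::
  "'v set \<Rightarrow> 'v set set \<Rightarrow> 'v \<Rightarrow> 'v \<Rightarrow> 'v matrix_univ set" where
  "quantum_sym_gen V E i j = quantum_sym_ideal V E +>\<^bsub>A_s V\<^esub> A_s_gen V i j"

text \<open>Points of \<open>R^n\<close> are functions on \<open>{1..n}\<close>; the cube is \<open>[0,1]^n\<close>.\<close>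

definition cube_vertices :: "nat \<Rightarrow> (nat \<Rightarrow> real) set" where
  "cube_vertices n = {1..n} \<rightarrow>\<^sub>E {0, 1}"

definition cube_edges :: "nat \<Rightarrow> (nat \<Rightarrow> real) set set" where
  "cube_edges n = {{x, y} | x y. x \<in> cube_vertices n \<and> y \<in> cube_vertices n \<and>
                                 (\<exists>!i. i \<in> {1..n} \<and> x i \<noteq> y i)}"


section \<open>Tensor products and Hopf algebras\<close>

text \<open>The star-algebra generated by symbols \<open>a \<otimes> b\<close> subject to these relations is the algebraic tensor
  product, so \<open>cstar_tensor A B\<close> is its completion in the largest C*-seminorm.\<close>

definition tensor_rels ::
  "('a, 'm) star_alg_scheme \<Rightarrow> ('b, 'n) star_alg_scheme \<Rightarrow> ('a \<times> 'b) free_alg set" where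
  "tensor_rels A B = (let F = free_star_algebra (carrier A \<times> carrier B) in
     {gen (a \<oplus>\<^bsub>A\<^esub> a', b) \<ominus>\<^bsub>F\<^esub> (gen (a, b) \<oplus>\<^bsub>F\<^esub> gen (a', b))
        | a a' b. a \<in> carrier A \<and> a' \<in> carrier A \<and> b \<in> carrier B} \<union>
     {gen (a, b \<oplus>\<^bsub>B\<^esub> b') \<ominus>\<^bsub>F\<^esub> (gen (a, b) \<oplus>\<^bsub>F\<^esub> gen (a, b'))
        | a b b'. a \<in> carrier A \<and> b \<in> carrier B \<and> b' \<in> carrier B} \<union>
     {gen (c \<odot>\<^bsub>A\<^esub> a, b) \<ominus>\<^bsub>F\<^esub> c \<odot>\<^bsub>F\<^esub> gen (a, b) | c a b. a \<in> carrier A \<and> b \<in> carrier B} \<union>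
     {gen (a, c \<odot>\<^bsub>B\<^esub> b) \<ominus>\<^bsub>F\<^esub> c \<odot>\<^bsub>F\<^esub> gen (a, b) | c a b. a \<in> carrier A \<and> b \<in> carrier B} \<union>
     {gen (a, b) \<otimes>\<^bsub>F\<^esub> gen (a', b') \<ominus>\<^bsub>F\<^esub> gen (a \<otimes>\<^bsub>A\<^esub> a', b \<otimes>\<^bsub>B\<^esub> b')
        | a a' b b'. a \<in> carrier A \<and> a' \<in> carrier A \<and> b \<in> carrier B \<and> b' \<in> carrier B} \<union>
     {star F (gen (a, b)) \<ominus>\<^bsub>F\<^esub> gen (star A a, star B b) | a b. a \<in> carrier A \<and> b \<in> carrier B} \<union>
     {gen (\<one>\<^bsub>A\<^esub>, \<one>\<^bsub>B\<^esub>) \<ominus>\<^bsub>F\<^esub> \<one>\<^bsub>F\<^esub>})"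

definition cstar_tensor ::
  "('a, 'm) cstar_alg_scheme \<Rightarrow> ('b, 'n) cstar_alg_scheme \<Rightarrow>
     ('a \<times> 'b) free_alg completion cstar_alg" where
  "cstar_tensor A B = universal_cstar (carrier A \<times> carrier B) (tensor_rels A B)"

definition pure_tensor ::
  "('a, 'm) cstar_alg_scheme \<Rightarrow> ('b, 'n) cstar_alg_scheme \<Rightarrow> 'a \<Rightarrow> 'b \<Rightarrow>
     ('a \<times> 'b) free_alg completion" where
  "pure_tensor A B a b = universal_gen (carrier A \<times> carrier B) (tensor_rels A B) (a, b)"

text \<open>\<open>D\<close>, \<open>e\<close>, \<open>S\<close> are the comultiplication, counit and antipode of the C*-algebra \<open>A\<close> generated by
  the entries of the matrix \<open>u\<close>.  The antipode is a star-antihomomorphism, since the algebras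
  considered here are generated by self-adjoint entries with \<open>S(u_ij) = u_ji\<close>.\<close>

definition hopf_structure ::
  "'a cstar_alg \<Rightarrow> 'i set \<Rightarrow> ('i \<Rightarrow> 'i \<Rightarrow> 'a) \<Rightarrow>
     ('a \<Rightarrow> ('a \<times> 'a) free_alg completion) \<Rightarrow> ('a \<Rightarrow> complex) \<Rightarrow> ('a \<Rightarrow> 'a) \<Rightarrow> bool" where
  "hopf_structure A I u D e S \<longleftrightarrow>
     cstar_algebra A \<and>
     D \<in> star_hom A (cstar_tensor A A) \<and>
     (\<forall>i\<in>I. \<forall>j\<in>I. D (u i j) = (\<Oplus>\<^bsub>cstar_tensor A A\<^esub>k\<in>I. pure_tensor A A (u i k) (u k j))) \<and>
     e \<in> star_hom A complex_cstar \<and>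
     (\<forall>i\<in>I. \<forall>j\<in>I. e (u i j) = (if i = j then 1 else 0)) \<and>
     S \<in> star_hom A (opposite A) \<and>
     (\<forall>i\<in>I. \<forall>j\<in>I. S (u i j) = u j i)"

text \<open>\<open>T\<close> below is \<open>f \<otimes> f\<close>.  All maps are determined by their values on generators, so the
  existential quantifiers over structure maps only assert their existence.\<close>

definition hopf_isomorphic ::
  "'a cstar_alg \<Rightarrow> 'i set \<Rightarrow> ('i \<Rightarrow> 'i \<Rightarrow> 'a) \<Rightarrow> 'b cstar_alg \<Rightarrow> 'j set \<Rightarrow> ('j \<Rightarrow> 'j \<Rightarrow> 'b) \<Rightarrow> bool"
  where
  "hopf_isomorphic A I u B J v \<longleftrightarrow>
     (\<exists>D\<^sub>A e\<^sub>A S\<^sub>A D\<^sub>B e\<^sub>B S\<^sub>B f T.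
        hopf_structure A I u D\<^sub>A e\<^sub>A S\<^sub>A \<and>
        hopf_structure B J v D\<^sub>B e\<^sub>B S\<^sub>B \<and>
        f \<in> star_hom A B \<and> bij_betw f (carrier A) (carrier B) \<and>
        T \<in> star_hom (cstar_tensor A A) (cstar_tensor B B) \<and>
        (\<forall>x\<in>carrier A. \<forall>y\<in>carrier A. T (pure_tensor A A x y) = pure_tensor B B (f x) (f y)) \<and>
        (\<forall>x\<in>carrier A. T (D\<^sub>A x) = D\<^sub>B (f x)) \<and>
        (\<forall>x\<in>carrier A. e\<^sub>B (f x) = e\<^sub>A x) \<and>
        (\<forall>x\<in>carrier A. f (S\<^sub>A x) = S\<^sub>B (f x)))"

end

theory Submission
  imports Defs
begin

text \<open>The coordinate characters \<open>chi i x = \<plusminus>1\<close> span the eigenspace of the adjacency matrix of the cube for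
  the eigenvalue \<open>n - 2\<close>.  Hence a magic unitary \<open>v\<close> commuting with that matrix preserves this eigenspace,
  that is, \<open>\<Sum>y. chi i y v x y = \<Sum>j. chi j x u j i\<close> for certain elements \<open>u j i\<close>.  Since the rows of \<open>v\<close>
  are partitions of unity, the left-hand sides are, for fixed \<open>x\<close>, commuting reflections; expanding this
  in products of characters gives the defining relations of \<open>C(O_n^{-1})\<close> for \<open>u\<close>.  Conversely, these
  relations say that for every \<open>x\<close> the right-hand sides are commuting reflections, and their joint spectral
  projections \<open>v x y\<close> form a magic unitary commuting with the adjacency matrix.  The two passages are
  mutually inverse and compatible with the formula \<open>\<Sum>k. u i k \<otimes> u k j\<close>, so the Hopf algebra structure
  of the quantum symmetry algebra transports.\<close>

section \<open>Star-algebras and C*-seminorms\<close>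

text \<open>The algebras are concrete completions and quotients, so their universal properties must
  be earned before the cube appears. Three facts carry them: star-homomorphisms between C*-algebras
  are contractive, quotients by closed ideals are C*-algebras, and the seminorms under the supremum
  in \<open>max_seminorm\<close> are bounded on generators. In place of spectral theory they rest on
  two devices: the square root of \<open>1 - k\<close> for self-adjoint \<open>k\<close> of norm
  below 1, found by iteration, and the inverse of \<open>1 + i s y\<close> for self-adjoint
  \<open>y\<close>, whose norm is at most 1 for every real \<open>s\<close>. Afterwards a
  homomorphism out of either algebra is just a matrix satisfying relations, and equality is tested
  on generators. The passage from \<open>v\<close> to \<open>u\<close> is a Fourier coefficient,
  linear in \<open>v\<close>, which is why homomorphisms, transposition and comultiplication pass
  through it easily; the passage back needs joint spectral projections, and their uniqueness is what
  makes the two maps inverse to each other. No structure map is constructed on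
  \<open>C(O_n^{-1})\<close> from its own relations.\<close>

lemma complex_ring_simps [simp]:
  "carrier complex_ring = UNIV" "mult complex_ring = (*)" "one complex_ring = 1"
  "zero complex_ring = 0" "add complex_ring = (+)"
  by (simp_all add: complex_ring_def)

lemma cring_complex_ring: "cring complex_ring"
proof (rule cringI)
  show "abelian_group complex_ring"
    by (rule abelian_groupI) (auto simp: algebra_simps intro: exI[of _ "- _"])
  show "comm_monoid complex_ring"
    by (rule comm_monoidI) (auto simp: algebra_simps)
qed (simp add: algebra_simps)

context star_algebra
begin

lemma ring_A: "ring A" ..

lemma abelian_group_A: "abelian_group A"
  by (rule ring.is_abelian_group[OF ring_A])

lemma abelian_monoid_A: "abelian_monoid A"
  by (rule abelian_group.axioms(1)[OF abelian_group_A])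

lemmas alg_a_inv_closed = abelian_group.a_inv_closed[OF abelian_group_A]
lemmas alg_minus_equality = abelian_group.minus_equality[OF abelian_group_A]
lemmas alg_minus_minus = abelian_group.minus_minus[OF abelian_group_A]
lemmas alg_minus_add = abelian_group.minus_add[OF abelian_group_A]
lemmas alg_r_neg = abelian_group.r_neg[OF abelian_group_A]
lemmas alg_l_neg = abelian_group.l_neg[OF abelian_group_A]
lemmas alg_r_neg1 = abelian_group.r_neg1[OF abelian_group_A]
lemmas alg_r_neg2 = abelian_group.r_neg2[OF abelian_group_A]
lemmas alg_minus_eq = abelian_group.minus_eq[OF abelian_group_A]
lemmas alg_minus_closed = abelian_group.minus_closed[OF abelian_group_A]
lemmas alg_a_closed = abelian_monoid.a_closed[OF abelian_monoid_A]
lemmas alg_zero_closed = abelian_monoid.zero_closed[OF abelian_monoid_A]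
lemmas alg_l_zero = abelian_monoid.l_zero[OF abelian_monoid_A]
lemmas alg_r_zero = abelian_monoid.r_zero[OF abelian_monoid_A]
lemmas alg_a_assoc = abelian_monoid.a_assoc[OF abelian_monoid_A]
lemmas alg_a_comm = abelian_monoid.a_comm[OF abelian_monoid_A]
lemmas alg_a_ac = abelian_monoid.a_ac[OF abelian_monoid_A]
lemmas alg_finsum_closed = abelian_monoid.finsum_closed[OF abelian_monoid_A]
lemmas alg_finsum_cong' = abelian_monoid.finsum_cong'[OF abelian_monoid_A]
lemmas alg_finsum_insert = abelian_monoid.finsum_insert[OF abelian_monoid_A]
lemmas alg_finsum_zero = abelian_monoid.finsum_zero[OF abelian_monoid_A]
lemmas alg_finsum_addf = abelian_monoid.finsum_addf[OF abelian_monoid_A]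
lemmas alg_finsum_reindex = abelian_monoid.finsum_reindex[OF abelian_monoid_A]
lemmas alg_finsum_Un_disjoint = abelian_monoid.finsum_Un_disjoint[OF abelian_monoid_A]

lemma mult_closed [simp, intro]: "x \<in> carrier A \<Longrightarrow> y \<in> carrier A \<Longrightarrow> x \<otimes> y \<in> carrier A"
  and unit_closed [simp, intro]: "\<one> \<in> carrier A"
  and mult_unit_left [simp]: "x \<in> carrier A \<Longrightarrow> \<one> \<otimes> x = x"
  and mult_unit_right [simp]: "x \<in> carrier A \<Longrightarrow> x \<otimes> \<one> = x"
  and mult_assoc: "x \<in> carrier A \<Longrightarrow> y \<in> carrier A \<Longrightarrow> z \<in> carrier A \<Longrightarrow>
    (x \<otimes> y) \<otimes> z = x \<otimes> (y \<otimes> z)"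
  and distrib_left: "x \<in> carrier A \<Longrightarrow> y \<in> carrier A \<Longrightarrow> z \<in> carrier A \<Longrightarrow>
    z \<otimes> (x \<oplus> y) = z \<otimes> x \<oplus> z \<otimes> y"
  and distrib_right: "x \<in> carrier A \<Longrightarrow> y \<in> carrier A \<Longrightarrow> z \<in> carrier A \<Longrightarrow>
    (x \<oplus> y) \<otimes> z = x \<otimes> z \<oplus> y \<otimes> z"
  and mult_zero_left [simp]: "x \<in> carrier A \<Longrightarrow> \<zero> \<otimes> x = \<zero>"
  and mult_zero_right [simp]: "x \<in> carrier A \<Longrightarrow> x \<otimes> \<zero> = \<zero>"
  and minus_mult_left: "x \<in> carrier A \<Longrightarrow> y \<in> carrier A \<Longrightarrow> \<ominus> x \<otimes> y = \<ominus> (x \<otimes> y)"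
  and minus_mult_right: "x \<in> carrier A \<Longrightarrow> y \<in> carrier A \<Longrightarrow> x \<otimes> \<ominus> y = \<ominus> (x \<otimes> y)"
  using ring.ring_simprules[OF ring_A]
  by (simp_all add: monoid.m_closed monoid.r_one ring.is_monoid[OF ring_A])

lemma diff_distrib_left: "x \<in> carrier A \<Longrightarrow> y \<in> carrier A \<Longrightarrow> z \<in> carrier A \<Longrightarrow>
    z \<otimes> (x \<ominus> y) = z \<otimes> x \<ominus> z \<otimes> y"
  and diff_distrib_right: "x \<in> carrier A \<Longrightarrow> y \<in> carrier A \<Longrightarrow> z \<in> carrier A \<Longrightarrow>
    (x \<ominus> y) \<otimes> z = x \<otimes> z \<ominus> y \<otimes> z"
  by (simp_all add: alg_minus_eq distrib_left distrib_right minus_mult_left minus_mult_right)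

lemma scale_closed [simp, intro]: "x \<in> carrier A \<Longrightarrow> c \<odot> x \<in> carrier A"
  and scale_add_left: "x \<in> carrier A \<Longrightarrow> (c + d) \<odot> x = c \<odot> x \<oplus> d \<odot> x"
  and scale_add_right: "x \<in> carrier A \<Longrightarrow> y \<in> carrier A \<Longrightarrow> c \<odot> (x \<oplus> y) = c \<odot> x \<oplus> c \<odot> y"
  and scale_scale [simp]: "x \<in> carrier A \<Longrightarrow> c \<odot> (d \<odot> x) = (c * d) \<odot> x"
  and scale_one [simp]: "x \<in> carrier A \<Longrightarrow> 1 \<odot> x = x"
  and scale_zero_left [simp]: "x \<in> carrier A \<Longrightarrow> 0 \<odot> x = \<zero>"
  and scale_zero_right [simp]: "c \<odot> \<zero> = \<zero>"
  using smult_closed[of c x] smult_l_distr[of c d x] smult_r_distr[of c x y]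
    smult_assoc1[of c d x] smult_one[of x] smult_l_null[of x] smult_r_null[of c]
  by simp_all

lemma scale_minus_one: "x \<in> carrier A \<Longrightarrow> (-1) \<odot> x = \<ominus> x"
  using scale_add_left[of x 1 "-1"] alg_minus_equality[of "(-1) \<odot> x" x] 
  by (simp add: alg_a_comm)

lemma scale_uminus: "x \<in> carrier A \<Longrightarrow> (- c) \<odot> x = \<ominus> (c \<odot> x)"
  using scale_minus_one[of "c \<odot> x"] by simp

lemma scale_minus: "x \<in> carrier A \<Longrightarrow> c \<odot> (\<ominus> x) = \<ominus> (c \<odot> x)"
  using scale_minus_one[of x, symmetric] scale_minus_one[of "c \<odot> x", symmetric]
  by simp

lemma minus_as_scale: "x \<in> carrier A \<Longrightarrow> y \<in> carrier A \<Longrightarrow> x \<ominus> y = x \<oplus> (-1) \<odot> y"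
  by (simp add: alg_minus_eq scale_minus_one)

lemma scale_diff_right: "x \<in> carrier A \<Longrightarrow> y \<in> carrier A \<Longrightarrow> c \<odot> (x \<ominus> y) = c \<odot> x \<ominus> c \<odot> y"
  by (simp add: alg_minus_eq scale_add_right scale_minus)

lemma scale_diff_left: "x \<in> carrier A \<Longrightarrow> (c - d) \<odot> x = c \<odot> x \<ominus> d \<odot> x"
  using scale_add_left[of x c "-d"] by (simp add: alg_minus_eq scale_uminus)

lemma scale_collect:
  "x \<in> carrier A \<Longrightarrow> c \<odot> x \<oplus> d \<odot> x = (c + d) \<odot> x"
  "x \<in> carrier A \<Longrightarrow> y \<in> carrier A \<Longrightarrow> c \<odot> x \<oplus> (d \<odot> x \<oplus> y) = (c + d) \<odot> x \<oplus> y"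
  by (simp_all add: scale_add_left alg_a_assoc)

lemma scale_cancel: "x \<in> carrier A \<Longrightarrow> c \<noteq> 0 \<Longrightarrow> c \<odot> x = \<zero> \<Longrightarrow> x = \<zero>"
  using scale_scale[of x "inverse c" c] by simp

lemma diff_zero_iff: "x \<in> carrier A \<Longrightarrow> y \<in> carrier A \<Longrightarrow> x \<ominus> y = \<zero> \<longleftrightarrow> x = y"
  by (metis alg_minus_eq alg_minus_equality alg_minus_minus alg_r_neg alg_a_inv_closed)

lemmas scale_mult_left = smult_mult_left
lemmas scale_mult_right = smult_mult_right

declare star_closed [simp, intro] star_star [simp]

lemma star_unit [simp]: "star A \<one> = \<one>"
  by (metis star_closed star_mult star_star mult_unit_left mult_unit_right unit_closed)

lemma star_null [simp]: "star A \<zero> = \<zero>"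
  using star_smult[of \<zero> 0] by simp

lemma star_minus: "x \<in> carrier A \<Longrightarrow> star A (\<ominus> x) = \<ominus> star A x"
  using star_smult[of x "-1"] by (simp add: scale_minus_one)

lemma star_diff: "x \<in> carrier A \<Longrightarrow> y \<in> carrier A \<Longrightarrow> star A (x \<ominus> y) = star A x \<ominus> star A y"
  by (simp add: alg_minus_eq star_add star_minus)

lemma sum_closed [simp, intro]: "(\<And>i. i \<in> K \<Longrightarrow> f i \<in> carrier A) \<Longrightarrow> finsum A f K \<in> carrier A"
  by (rule alg_finsum_closed) auto

lemma sum_cong: "K = L \<Longrightarrow> (\<And>i. i \<in> L \<Longrightarrow> f i = g i) \<Longrightarrow> (\<And>i. i \<in> L \<Longrightarrow> g i \<in> carrier A) \<Longrightarrow>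
    finsum A f K = finsum A g L"
  by (rule alg_finsum_cong') auto

lemma sum_insert: "finite K \<Longrightarrow> j \<notin> K \<Longrightarrow> (\<And>i. i \<in> K \<Longrightarrow> f i \<in> carrier A) \<Longrightarrow> f j \<in> carrier A \<Longrightarrow>
    finsum A f (insert j K) = f j \<oplus> finsum A f K"
  by (rule alg_finsum_insert) auto

lemma sum_add: "(\<And>i. i \<in> K \<Longrightarrow> f i \<in> carrier A) \<Longrightarrow> (\<And>i. i \<in> K \<Longrightarrow> g i \<in> carrier A) \<Longrightarrow>
    (\<Oplus>i\<in>K. f i \<oplus> g i) = finsum A f K \<oplus> finsum A g K"
  by (rule alg_finsum_addf) auto

lemma sum_null: "(\<And>i. i \<in> K \<Longrightarrow> f i = \<zero>) \<Longrightarrow> finsum A f K = \<zero>"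
  using sum_cong[of K K f "\<lambda>_. \<zero>"] alg_finsum_zero[of K] by simp

lemma sum_scale: "finite K \<Longrightarrow> (\<And>i. i \<in> K \<Longrightarrow> f i \<in> carrier A) \<Longrightarrow>
    c \<odot> finsum A f K = (\<Oplus>i\<in>K. c \<odot> f i)"
  by (rule finsum_smult_ldistr) auto

lemma sum_minus: "finite K \<Longrightarrow> (\<And>i. i \<in> K \<Longrightarrow> f i \<in> carrier A) \<Longrightarrow>
    \<ominus> finsum A f K = (\<Oplus>i\<in>K. \<ominus> f i)"
  using sum_scale[of K f "-1"] by (simp add: scale_minus_one cong: sum_cong)

lemma sum_diff: "finite K \<Longrightarrow> (\<And>i. i \<in> K \<Longrightarrow> f i \<in> carrier A) \<Longrightarrow> (\<And>i. i \<in> K \<Longrightarrow> g i \<in> carrier A) \<Longrightarrow>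
    (\<Oplus>i\<in>K. f i \<ominus> g i) = finsum A f K \<ominus> finsum A g K"
  using sum_add[of K f "\<lambda>i. \<ominus> g i"] by (simp add: alg_minus_eq sum_minus)

lemma semiring_A: "semiring A" ..

lemma sum_mult_right: "finite K \<Longrightarrow> (\<And>i. i \<in> K \<Longrightarrow> f i \<in> carrier A) \<Longrightarrow> x \<in> carrier A \<Longrightarrow>
    finsum A f K \<otimes> x = (\<Oplus>i\<in>K. f i \<otimes> x)"
  by (rule semiring.finsum_ldistr[OF semiring_A]) auto

lemma sum_mult_left: "finite K \<Longrightarrow> (\<And>i. i \<in> K \<Longrightarrow> f i \<in> carrier A) \<Longrightarrow> x \<in> carrier A \<Longrightarrow>
    x \<otimes> finsum A f K = (\<Oplus>i\<in>K. x \<otimes> f i)"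
  by (rule semiring.finsum_rdistr[OF semiring_A]) auto

lemma sum_star: "finite K \<Longrightarrow> (\<And>i. i \<in> K \<Longrightarrow> f i \<in> carrier A) \<Longrightarrow>
    star A (finsum A f K) = (\<Oplus>i\<in>K. star A (f i))"
  by (induction K rule: finite_induct) (simp_all add: sum_insert star_add)

lemma sum_swap: "finite K \<Longrightarrow> finite L \<Longrightarrow>
    (\<And>i j. i \<in> K \<Longrightarrow> j \<in> L \<Longrightarrow> f i j \<in> carrier A) \<Longrightarrow>
    (\<Oplus>i\<in>K. \<Oplus>j\<in>L. f i j) = (\<Oplus>j\<in>L. \<Oplus>i\<in>K. f i j)"
proof (induction K rule: finite_induct)
  case empty
  then show ?case by (simp add: sum_null)
next
  case (insert k K)
  have "(\<Oplus>i\<in>insert k K. \<Oplus>j\<in>L. f i j) = (\<Oplus>j\<in>L. f k j) \<oplus> (\<Oplus>j\<in>L. \<Oplus>i\<in>K. f i j)"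
    using insert by (simp add: sum_insert)
  also have "\<dots> = (\<Oplus>j\<in>L. f k j \<oplus> (\<Oplus>i\<in>K. f i j))"
    using insert by (simp add: sum_add)
  also have "\<dots> = (\<Oplus>j\<in>L. \<Oplus>i\<in>insert k K. f i j)"
    using insert by (intro sum_cong) (auto simp: sum_insert)
  finally show ?case .
qed

lemma sum_single: "finite K \<Longrightarrow> j \<in> K \<Longrightarrow> f j \<in> carrier A \<Longrightarrow> (\<And>i. i \<in> K \<Longrightarrow> i \<noteq> j \<Longrightarrow> f i = \<zero>) \<Longrightarrow>
    finsum A f K = f j"
  using sum_insert[of "K - {j}" j f] sum_null[of "K - {j}" f]
  by (auto simp: insert_absorb)

lemma sum_const_scale: "finite K \<Longrightarrow> x \<in> carrier A \<Longrightarrow> (\<Oplus>i\<in>K. c i \<odot> x) = (\<Sum>i\<in>K. c i) \<odot> x"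
  by (induction K rule: finite_induct) (simp_all add: sum_insert scale_add_left)

lemma sum_reindex: "inj_on h K \<Longrightarrow> (\<And>i. i \<in> h ` K \<Longrightarrow> f i \<in> carrier A) \<Longrightarrow>
    finsum A f (h ` K) = (\<Oplus>i\<in>K. f (h i))"
  by (rule alg_finsum_reindex) auto

lemma sum_union_disjoint: "finite K \<Longrightarrow> finite L \<Longrightarrow> K \<inter> L = {} \<Longrightarrow>
    (\<And>i. i \<in> K \<union> L \<Longrightarrow> f i \<in> carrier A) \<Longrightarrow> finsum A f (K \<union> L) = finsum A f K \<oplus> finsum A f L"
  by (rule alg_finsum_Un_disjoint) auto

lemma sum_restrict: "finite L \<Longrightarrow> K \<subseteq> L \<Longrightarrow> (\<And>i. i \<in> L \<Longrightarrow> f i \<in> carrier A) \<Longrightarrow>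
    (\<And>i. i \<in> L - K \<Longrightarrow> f i = \<zero>) \<Longrightarrow> finsum A f L = finsum A f K"
  using sum_union_disjoint[of K "L - K" f] sum_null[of "L - K" f]
  by (simp add: finite_subset Un_absorb1 subset_iff)

end

text \<open>Definiteness and completeness are left out because the same estimates are needed on free
  algebras before completion and for seminorms pulled back along homomorphisms.\<close>

locale cstar_seminormed = star_algebra A for A :: "('a, 'm) star_alg_scheme" (structure) +
  fixes p :: "'a \<Rightarrow> real"
  assumes seminorm: "cstar_seminorm A p"
begin

lemma p_nonneg [simp]: "x \<in> carrier A \<Longrightarrow> 0 \<le> p x"
  and p_add: "x \<in> carrier A \<Longrightarrow> y \<in> carrier A \<Longrightarrow> p (x \<oplus> y) \<le> p x + p y"
  and p_scale: "x \<in> carrier A \<Longrightarrow> p (c \<odot> x) = cmod c * p x"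
  and p_mult: "x \<in> carrier A \<Longrightarrow> y \<in> carrier A \<Longrightarrow> p (x \<otimes> y) \<le> p x * p y"
  and p_star_mult: "x \<in> carrier A \<Longrightarrow> p (star A x \<otimes> x) = (p x)\<^sup>2"
  using seminorm unfolding cstar_seminorm_def by auto

lemma p_zero [simp]: "p \<zero> = 0"
  using p_scale[of \<zero> 0] by simp

lemma p_minus [simp]: "x \<in> carrier A \<Longrightarrow> p (\<ominus> x) = p x"
  using p_scale[of x "-1"] by (simp add: scale_minus_one)

lemma p_diff: "x \<in> carrier A \<Longrightarrow> y \<in> carrier A \<Longrightarrow> p (x \<ominus> y) \<le> p x + p y"
  using p_add[of x "\<ominus> y"] by (simp add: alg_minus_eq)

lemma p_diff_commute: "x \<in> carrier A \<Longrightarrow> y \<in> carrier A \<Longrightarrow> p (x \<ominus> y) = p (y \<ominus> x)"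
  using p_minus[of "x \<ominus> y"] by (simp add: alg_minus_eq alg_minus_add alg_a_comm)

lemma p_triangle: "x \<in> carrier A \<Longrightarrow> y \<in> carrier A \<Longrightarrow> z \<in> carrier A \<Longrightarrow>
    p (x \<ominus> z) \<le> p (x \<ominus> y) + p (y \<ominus> z)"
proof -
  assume *: "x \<in> carrier A" "y \<in> carrier A" "z \<in> carrier A"
  then have "x \<ominus> z = (x \<ominus> y) \<oplus> (y \<ominus> z)"
    by (simp add: alg_minus_eq alg_a_assoc alg_r_neg1 alg_r_neg2)
  then show ?thesis using p_add[of "x \<ominus> y" "y \<ominus> z"] * by simp
qed

lemma p_diff_diff: "x \<in> carrier A \<Longrightarrow> y \<in> carrier A \<Longrightarrow> \<bar>p x - p y\<bar> \<le> p (x \<ominus> y)"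
  using p_triangle[of x y \<zero>] p_triangle[of y x \<zero>] p_diff_commute[of x y]
  by (simp add: alg_minus_eq)

text \<open>Cancelling \<open>p x\<close> in the C*-identity gives one inequality, which applied to
  \<open>star A x\<close> gives the other.\<close>

lemma p_star [simp]: "x \<in> carrier A \<Longrightarrow> p (star A x) = p x"
proof -
  have le: "p x \<le> p (star A x)" if "x \<in> carrier A" for x
  proof (cases "p x = 0")
    case False
    then have "0 < p x" using p_nonneg[OF that] by linarith
    moreover have "p x * p x \<le> p (star A x) * p x"
      using p_star_mult[OF that] p_mult[of "star A x" x] that by (simp add: power2_eq_square)
    ultimately show ?thesis by simp
  qed (use that in simp)
  assume "x \<in> carrier A"
  then show ?thesis using le[of x] le[of "star A x"] by simp
qed

text \<open>By the C*-identity the value of \<open>p\<close> at the unit equals its own square; the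
  value 0 does occur, since the zero seminorm is allowed.\<close>

lemma p_one_le: "p \<one> \<le> 1"
  using p_star_mult[of \<one>] p_nonneg[of \<one>] by (auto simp: power2_eq_square)

lemma p_sum: "finite K \<Longrightarrow> (\<And>i. i \<in> K \<Longrightarrow> f i \<in> carrier A) \<Longrightarrow> p (finsum A f K) \<le> (\<Sum>i\<in>K. p (f i))"
proof (induction K rule: finite_induct)
  case (insert k K)
  then show ?case using p_add[of "f k" "finsum A f K"] by (fastforce simp: sum_insert)
qed simp

lemma p_mult_diff:
  assumes "x \<in> carrier A" "y \<in> carrier A" "x' \<in> carrier A" "y' \<in> carrier A"
  shows "p (x \<otimes> y \<ominus> x' \<otimes> y') \<le> p x * p (y \<ominus> y') + p (x \<ominus> x') * p y'"
proof -
  have "x \<otimes> y \<ominus> x' \<otimes> y' = (x \<otimes> y \<ominus> x \<otimes> y') \<oplus> (x \<otimes> y' \<ominus> x' \<otimes> y')"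
    using assms by (simp add: alg_minus_eq alg_a_assoc alg_r_neg1 alg_r_neg2)
  then have eq: "x \<otimes> y \<ominus> x' \<otimes> y' = x \<otimes> (y \<ominus> y') \<oplus> (x \<ominus> x') \<otimes> y'"
    using assms by (simp add: diff_distrib_left diff_distrib_right)
  show ?thesis unfolding eq
    using assms p_add[of "x \<otimes> (y \<ominus> y')" "(x \<ominus> x') \<otimes> y'"] p_mult[of x "y \<ominus> y'"] p_mult[of "x \<ominus> x'" y']
    by simp
qed

lemma diff_add_add: "x \<in> carrier A \<Longrightarrow> y \<in> carrier A \<Longrightarrow> x' \<in> carrier A \<Longrightarrow> y' \<in> carrier A \<Longrightarrow>
   (x \<oplus> y) \<ominus> (x' \<oplus> y') = (x \<ominus> x') \<oplus> (y \<ominus> y')"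
  by (simp add: alg_minus_eq alg_minus_add alg_a_ac)

lemma p_add_diff:
  assumes "x \<in> carrier A" "y \<in> carrier A" "x' \<in> carrier A" "y' \<in> carrier A"
  shows "p ((x \<oplus> y) \<ominus> (x' \<oplus> y')) \<le> p (x \<ominus> x') + p (y \<ominus> y')"
  using p_add[of "x \<ominus> x'" "y \<ominus> y'"] assms by (simp add: diff_add_add)

lemma p_scale_diff:
  assumes "x \<in> carrier A" "y \<in> carrier A"
  shows "p (c \<odot> x \<ominus> c \<odot> y) = cmod c * p (x \<ominus> y)"
  using assms by (simp flip: scale_diff_right add: p_scale)

lemma p_star_diff:
  assumes "x \<in> carrier A" "y \<in> carrier A"
  shows "p (star A x \<ominus> star A y) = p (x \<ominus> y)"
  using assms by (simp flip: star_diff)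

text \<open>The limit is determined only up to \<open>p\<close>-distance 0; genuine uniqueness,
  \<open>lim_in_eq\<close>, needs definiteness.\<close>

definition lim_in :: "(nat \<Rightarrow> 'a) \<Rightarrow> 'a \<Rightarrow> bool" where
  "lim_in x l \<longleftrightarrow> (\<forall>k. x k \<in> carrier A) \<and> l \<in> carrier A \<and> (\<lambda>k. p (x k \<ominus> l)) \<longlonglongrightarrow> 0"

lemma lim_inD:
  assumes "lim_in x l"
  shows "x k \<in> carrier A" "l \<in> carrier A" "(\<lambda>k. p (x k \<ominus> l)) \<longlonglongrightarrow> 0"
  using assms by (auto simp: lim_in_def)

lemma null_bound:
  assumes "g \<longlonglongrightarrow> 0" "\<And>k. 0 \<le> f k" "\<And>k. f k \<le> g k"
  shows "f \<longlonglongrightarrow> (0::real)"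
  by (rule tendsto_sandwich[of "\<lambda>_. 0" f sequentially g]) (use assms in auto)

lemma lim_in_const: "a \<in> carrier A \<Longrightarrow> lim_in (\<lambda>_. a) a"
  by (simp add: lim_in_def alg_minus_eq alg_r_neg)

lemma lim_in_norm:
  assumes "lim_in x l"
  shows "(\<lambda>k. p (x k)) \<longlonglongrightarrow> p l"
proof -
  note x = lim_inD[OF assms]
  have "(\<lambda>k. \<bar>p (x k) - p l\<bar>) \<longlonglongrightarrow> 0"
    by (rule null_bound[OF x(3)]) (auto intro!: p_diff_diff x)
  then show ?thesis by (simp only: tendsto_rabs_zero_iff LIM_zero_iff)
qed

lemma lim_in_add:
  assumes "lim_in x a" "lim_in y b"
  shows "lim_in (\<lambda>k. x k \<oplus> y k) (a \<oplus> b)"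
proof -
  note x = lim_inD[OF assms(1)] and y = lim_inD[OF assms(2)]
  have "(\<lambda>k. p (x k \<ominus> a) + p (y k \<ominus> b)) \<longlonglongrightarrow> 0"
    using tendsto_add[OF x(3) y(3)] by simp
  then have "(\<lambda>k. p ((x k \<oplus> y k) \<ominus> (a \<oplus> b))) \<longlonglongrightarrow> 0"
    by (rule null_bound) (auto intro!: p_add_diff x y p_nonneg)
  then show ?thesis using x y by (simp add: lim_in_def)
qed

lemma lim_in_mult:
  assumes "lim_in x a" "lim_in y b"
  shows "lim_in (\<lambda>k. x k \<otimes> y k) (a \<otimes> b)"
proof -
  note x = lim_inD[OF assms(1)] and y = lim_inD[OF assms(2)]
  have "(\<lambda>k. p (x k) * p (y k \<ominus> b) + p (x k \<ominus> a) * p b) \<longlonglongrightarrow> p a * 0 + 0 * p b"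
    by (intro tendsto_add tendsto_mult tendsto_const x(3) y(3) lim_in_norm[OF assms(1)])
  then have "(\<lambda>k. p (x k) * p (y k \<ominus> b) + p (x k \<ominus> a) * p b) \<longlonglongrightarrow> 0"
    by simp
  then have "(\<lambda>k. p ((x k \<otimes> y k) \<ominus> (a \<otimes> b))) \<longlonglongrightarrow> 0"
    by (rule null_bound) (simp_all add: p_mult_diff x(1,2) y(1,2))
  then show ?thesis using x y by (simp add: lim_in_def)
qed

lemma lim_in_scale:
  assumes "lim_in x a"
  shows "lim_in (\<lambda>k. c \<odot> x k) (c \<odot> a)"
proof -
  note x = lim_inD[OF assms(1)]
  have "(\<lambda>k. p (c \<odot> x k \<ominus> c \<odot> a)) \<longlonglongrightarrow> 0"
    using tendsto_mult_left[OF x(3), of "cmod c"] x by (simp add: p_scale_diff)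
  then show ?thesis using x by (simp add: lim_in_def)
qed

lemma lim_in_star:
  assumes "lim_in x a"
  shows "lim_in (\<lambda>k. star A (x k)) (star A a)"
  using assms by (auto simp: lim_in_def p_star_diff)

lemma lim_in_diff:
  assumes "lim_in x a" "lim_in y b"
  shows "lim_in (\<lambda>k. x k \<ominus> y k) (a \<ominus> b)"
  using lim_in_add[OF assms(1) lim_in_scale[OF assms(2), of "-1"]] assms
  by (simp add: lim_in_def minus_as_scale)

lemma lim_in_unique: "lim_in x a \<Longrightarrow> lim_in x b \<Longrightarrow> p (a \<ominus> b) = 0"
  using lim_in_norm[OF lim_in_diff[of x a x b]] lim_inD(1)[of x a]
  by (simp add: alg_minus_eq alg_r_neg LIMSEQ_const_iff)

lemma lim_in_Suc: "lim_in x a \<Longrightarrow> lim_in (\<lambda>k. x (Suc k)) a"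
  by (auto simp: lim_in_def intro: LIMSEQ_Suc)

lemma cauchy_inD:
  assumes "cauchy_in A p x"
  shows "x k \<in> carrier A" "e > 0 \<Longrightarrow> \<exists>M. \<forall>k\<ge>M. \<forall>l\<ge>M. p (x k \<ominus> x l) < e"
  using assms by (auto simp: cauchy_in_def)

lemma cauchy_norm_convergent:
  assumes "cauchy_in A p x"
  shows "convergent (\<lambda>k. p (x k))"
proof -
  note x = cauchy_inD[OF assms]
  have "Cauchy (\<lambda>k. p (x k))"
  proof (rule CauchyI)
    fix e :: real assume "e > 0"
    then obtain M where "\<forall>k\<ge>M. \<forall>l\<ge>M. p (x k \<ominus> x l) < e" using x(2) by blast
    then have "\<forall>k\<ge>M. \<forall>l\<ge>M. norm (p (x k) - p (x l)) < e"
      using p_diff_diff[OF x(1) x(1)] by (metis real_norm_def le_less_trans)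
    then show "\<exists>M. \<forall>k\<ge>M. \<forall>l\<ge>M. norm (p (x k) - p (x l)) < e" by blast
  qed
  then show ?thesis by (rule Cauchy_convergent)
qed

lemma cauchy_bounded:
  assumes "cauchy_in A p x"
  obtains C where "C > 0" "\<And>k. p (x k) \<le> C"
proof -
  have "Bseq (\<lambda>k. p (x k))" using cauchy_norm_convergent[OF assms] by (rule convergent_imp_Bseq)
  then show ?thesis using that by (metis Bseq_def abs_le_D1 real_norm_def)
qed

lemma lim_in_cauchy:
  assumes "lim_in x a"
  shows "cauchy_in A p x"
  unfolding cauchy_in_def
proof (intro conjI allI impI)
  note x = lim_inD[OF assms]
  show "x k \<in> carrier A" for k by fact
  fix e :: real assume "e > 0"
  then obtain M where M: "\<forall>k\<ge>M. norm (p (x k \<ominus> a) - 0) < e/2"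
    using LIMSEQ_D[OF x(3), of "e/2"] by auto
  have "p (x k \<ominus> x l) < e" if "k \<ge> M" "l \<ge> M" for k l
  proof -
    have "p (x k \<ominus> a) < e/2" "p (x l \<ominus> a) < e/2" using M that by (auto simp: abs_less_iff)
    then show ?thesis
      using p_triangle[OF x(1)[of k] x(2) x(1)[of l]] p_diff_commute[OF x(1)[of l] x(2)] by linarith
  qed
  then show "\<exists>M. \<forall>k\<ge>M. \<forall>l\<ge>M. p (x k \<ominus> x l) < e" by blast
qed

end

section \<open>C*-algebras\<close>

lemma (in star_algebra) add_diff_cancel:
  "x \<in> carrier A \<Longrightarrow> y \<in> carrier A \<Longrightarrow> (x \<oplus> y) \<ominus> x = y"
  by (simp add: alg_minus_eq alg_a_comm[of x y] alg_a_assoc alg_r_neg)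

lemma (in star_algebra) add_diff_inverse:
  "x \<in> carrier A \<Longrightarrow> y \<in> carrier A \<Longrightarrow> x \<oplus> (y \<ominus> x) = y"
  by (simp add: alg_minus_eq alg_a_comm[of y] alg_r_neg1 alg_r_neg2)

lemma (in star_algebra) add_diff_diff:
  "x \<in> carrier A \<Longrightarrow> y \<in> carrier A \<Longrightarrow> z \<in> carrier A \<Longrightarrow> (x \<oplus> y) \<ominus> (x \<ominus> z) = y \<oplus> z"
  by (simp add: alg_minus_eq alg_a_comm[of x y] alg_minus_add alg_minus_minus alg_a_assoc alg_r_neg1 alg_r_neg2)

context cstar_seminormed
begin

lemma geometric_cauchy:
  assumes x: "\<And>k. x k \<in> carrier A" and r: "0 \<le> r" "r < 1"
    and step: "\<And>k. p (x (Suc k) \<ominus> x k) \<le> C * r ^ k"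
  shows "cauchy_in A p x"
proof -
  have C: "0 \<le> C" using step[of 0] p_nonneg[of "x (Suc 0) \<ominus> x 0"] x by (simp del: p_nonneg)
  \<comment> \<open>\<open>D\<close> is the sum of the series with terms \<open>C * r ^ k\<close>;
    the bounds in \<open>tail\<close> are its exact partial sums, so the induction closes.\<close>
  define D where "D = C / (1 - r)"
  have D: "0 \<le> D" "C = D * (1 - r)" using C r by (auto simp: D_def)
  have tail: "p (x (k + j) \<ominus> x k) \<le> D * r ^ k * (1 - r ^ j)" for k j
  proof (induction j)
    case 0
    then show ?case using x by (simp add: alg_minus_eq alg_r_neg)
  next
    case (Suc j)
    have "p (x (k + Suc j) \<ominus> x k) \<le> p (x (Suc (k + j)) \<ominus> x (k + j)) + p (x (k + j) \<ominus> x k)"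
      using p_triangle[of "x (Suc (k + j))" "x (k + j)" "x k"] x by simp
    also have "\<dots> \<le> C * r ^ (k + j) + D * r ^ k * (1 - r ^ j)"
      using step[of "k + j"] Suc by linarith
    also have "\<dots> = D * r ^ k * (1 - r ^ Suc j)"
      by (simp add: D(2) power_add algebra_simps)
    finally show ?case .
  qed
  have tail': "p (x l \<ominus> x k) \<le> D * r ^ k" if "k \<le> l" for k l
  proof -
    have "p (x l \<ominus> x k) \<le> D * r ^ k * (1 - r ^ (l - k))" using tail[of k "l - k"] that by simp
    also have "\<dots> \<le> D * r ^ k * 1" by (rule mult_left_mono) (use D r in auto)
    finally show ?thesis by simp
  qed
  have "(\<lambda>k. 2 * D * r ^ k) \<longlonglongrightarrow> 2 * D * 0"
    using r by (intro tendsto_mult tendsto_const LIMSEQ_realpow_zero)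
  then have lim: "(\<lambda>k. 2 * D * r ^ k) \<longlonglongrightarrow> 0" by simp
  show ?thesis unfolding cauchy_in_def
  proof (intro conjI allI impI)
    show "x k \<in> carrier A" for k by (rule x)
    fix e :: real assume "e > 0"
    then obtain M where M: "2 * D * r ^ M < e"
      using order_tendstoD(2)[OF lim, of e] by (auto simp: eventually_sequentially)
    have "p (x k \<ominus> x l) < e" if "k \<ge> M" "l \<ge> M" for k l
      using p_triangle[of "x k" "x M" "x l"] p_diff_commute[of "x M" "x l"] tail'[OF that(1)]
        tail'[OF that(2)] M x by (simp del: p_nonneg)
    then show "\<exists>M. \<forall>k\<ge>M. \<forall>l\<ge>M. p (x k \<ominus> x l) < e" by blast
  qed
qed

text \<open>\<open>a + \<i> c\<close> is a multiple of a unitary, whose C*-seminorm is known.\<close>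

lemma sum_squares_bound:
  assumes a: "a \<in> carrier A" "star A a = a" and c: "c \<in> carrier A" "star A c = c"
    and comm: "a \<otimes> c = c \<otimes> a" and sum: "a \<otimes> a \<oplus> c \<otimes> c = of_real t \<odot> \<one>" and t: "0 \<le> t"
  shows "(p a)\<^sup>2 \<le> t"
proof -
  define u where "u = a \<oplus> \<i> \<odot> c"
  have u: "u \<in> carrier A" and su: "star A u = a \<oplus> (-\<i>) \<odot> c"
    using a c by (simp_all add: u_def star_add star_smult)
  have "star A u \<otimes> u = (a \<otimes> a \<oplus> \<i> \<odot> (a \<otimes> c)) \<oplus> ((-\<i>) \<odot> (c \<otimes> a) \<oplus> c \<otimes> c)"
    unfolding su using a c
    by (simp add: u_def distrib_left distrib_right scale_mult_left scale_mult_right scale_add_right alg_a_ac)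
  also have "\<dots> = a \<otimes> a \<oplus> (\<i> \<odot> (a \<otimes> c) \<oplus> (-\<i>) \<odot> (a \<otimes> c)) \<oplus> c \<otimes> c"
    using a c by (simp add: comm[symmetric] alg_a_assoc)
  also have "\<dots> = of_real t \<odot> \<one>"
    using a c by (simp add: scale_collect sum[symmetric])
  finally have "(p u)\<^sup>2 = t * p \<one>"
    using p_star_mult[OF u] t by (simp add: p_scale)
  also have "\<dots> \<le> t" using p_one_le t by (simp add: mult_left_le)
  finally have pu: "(p u)\<^sup>2 \<le> t" .
  \<comment> \<open>\<open>a\<close> is the real part of \<open>u\<close>, so its seminorm is at
    most that of \<open>u\<close>.\<close>
  have "u \<oplus> star A u = (a \<oplus> a) \<oplus> (\<i> \<odot> c \<oplus> (-\<i>) \<odot> c)"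
    unfolding su using a c by (simp add: u_def alg_a_ac)
  also have "\<dots> = 2 \<odot> a"
    using a c scale_collect(1)[of a 1 1] by (simp add: scale_collect)
  finally have "a = (1/2) \<odot> (u \<oplus> star A u)" using a by simp
  then have "p a = (1/2) * p (u \<oplus> star A u)" using u by (metis p_scale star_closed alg_a_closed
     norm_divide norm_one norm_numeral)
  also have "\<dots> \<le> p u" using p_add[of u "star A u"] u by simp
  finally have "(p a)\<^sup>2 \<le> (p u)\<^sup>2" using a by (intro power_mono) auto
  with pu show ?thesis by linarith
qed

end

section \<open>Square roots, automatic contractivity and resolvents\<close>

sublocale cstar_algebra \<subseteq> cstar_seminormed A "cnorm A"
  by unfold_locales (rule cnorm_seminorm)

context cstar_algebra
begin

lemma cauchy_converges: "cauchy_in A (cnorm A) x \<Longrightarrow> \<exists>l. lim_in x l"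
  using cnorm_complete[of x] cauchy_inD(1)[of x] by (auto simp: lim_in_def)

lemma eq_if_cnorm_diff: "x \<in> carrier A \<Longrightarrow> y \<in> carrier A \<Longrightarrow> cnorm A (x \<ominus> y) = 0 \<Longrightarrow> x = y"
  using cnorm_definite[of "x \<ominus> y"] diff_zero_iff[of x y] by (auto simp del: p_nonneg)

lemma lim_in_eq: "lim_in x a \<Longrightarrow> lim_in x b \<Longrightarrow> a = b"
  using lim_in_unique[of x a b] eq_if_cnorm_diff[of a b] lim_inD(2)[of x] by blast

text \<open>The map sending \<open>z\<close> to \<open>(k + z z) / 2\<close> is iterated from 0: a
  fixed point \<open>l\<close> satisfies \<open>2 l = k + l l\<close>, so \<open>1 - l\<close>
  squares to \<open>1 - k\<close>. Self-adjointness, and commutation with whatever commutes with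
  \<open>k\<close>, hold for every iterate and survive the limit.\<close>

lemma square_root:
  assumes k: "k \<in> carrier A" "star A k = k" "cnorm A k < 1"
  obtains c where "c \<in> carrier A" "star A c = c" "c \<otimes> c = \<one> \<ominus> k"
    "\<And>z. z \<in> carrier A \<Longrightarrow> z \<otimes> k = k \<otimes> z \<Longrightarrow> z \<otimes> c = c \<otimes> z"
proof -
  define y where "y = rec_nat \<zero> (\<lambda>_ z. (1/2) \<odot> (k \<oplus> z \<otimes> z))"
  have y0: "y 0 = \<zero>" and ySuc: "\<And>m. y (Suc m) = (1/2) \<odot> (k \<oplus> y m \<otimes> y m)"
    by (simp_all add: y_def)
  have y: "y m \<in> carrier A" for m by (induction m) (simp_all add: y0 ySuc k)
  \<comment> \<open>\<open>r\<close> is the smaller solution of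
    \<open>r = (cnorm A k + r^2) / 2\<close>. Hence the iterates stay in the ball of radius
    \<open>r\<close>, on which the iteration contracts by the factor \<open>r < 1\<close>.\<close>
  define s r where "s = sqrt (1 - cnorm A k)" and "r = 1 - s"
  have s: "0 < s" "s \<le> 1" "s\<^sup>2 = 1 - cnorm A k" using k by (simp_all add: s_def)
  have "cnorm A k + r\<^sup>2 = 2 * r" using s(3) by (simp add: r_def power2_diff)
  then have r: "0 \<le> r" "r < 1" "(cnorm A k + r\<^sup>2) / 2 = r"
    using s by (simp_all add: r_def)
  have ynorm: "cnorm A (y m) \<le> r" for m
  proof (induction m)
    case (Suc m)
    have "cnorm A (y (Suc m)) = (1/2) * cnorm A (k \<oplus> y m \<otimes> y m)"
      using k y by (simp add: ySuc p_scale)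
    also have "\<dots> \<le> (1/2) * (cnorm A k + cnorm A (y m) * cnorm A (y m))"
      using p_add[of k "y m \<otimes> y m"] p_mult[OF y y, of m m] k y by simp
    also have "\<dots> \<le> (1/2) * (cnorm A k + r * r)"
      using mult_mono[OF Suc Suc] y r by simp
    also have "\<dots> = r" using r(3) by (simp add: power2_eq_square)
    finally show ?case .
  qed (simp add: y0 r)
  have step: "cnorm A (y (Suc m) \<ominus> y m) \<le> r * r ^ m" for m
  proof (induction m)
    case 0
    then show ?case using ynorm[of 1] y0 y by (simp add: alg_minus_eq ring.minus_zero[OF ring_A])
  next
    case (Suc m)
    have "cnorm A (y (Suc (Suc m)) \<ominus> y (Suc m))
        = (1/2) * cnorm A ((k \<oplus> y (Suc m) \<otimes> y (Suc m)) \<ominus> (k \<oplus> y m \<otimes> y m))"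
      using k y by (simp add: ySuc p_scale_diff del: scale_scale)
    also have "\<dots> \<le> (1/2) * (cnorm A (k \<ominus> k) + cnorm A (y (Suc m) \<otimes> y (Suc m) \<ominus> y m \<otimes> y m))"
      using p_add_diff[of k "y (Suc m) \<otimes> y (Suc m)" k "y m \<otimes> y m"] k y by simp
    also have "\<dots> = (1/2) * cnorm A (y (Suc m) \<otimes> y (Suc m) \<ominus> y m \<otimes> y m)"
      using k by (simp add: alg_minus_eq alg_r_neg)
    also have "\<dots> \<le> (1/2) * (cnorm A (y (Suc m)) * cnorm A (y (Suc m) \<ominus> y m)
        + cnorm A (y (Suc m) \<ominus> y m) * cnorm A (y m))"
      using p_mult_diff[OF y y y y, of "Suc m" "Suc m" m m] by simp
    also have "\<dots> \<le> (1/2) * (r * cnorm A (y (Suc m) \<ominus> y m) + cnorm A (y (Suc m) \<ominus> y m) * r)"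
      using ynorm y by (intro mult_left_mono add_mono mult_right_mono) auto
    also have "\<dots> \<le> r * (r * r ^ m)" using mult_left_mono[OF Suc r(1)] by simp
    finally show ?case by simp
  qed
  obtain l where l: "lim_in y l"
    using cauchy_converges[OF geometric_cauchy[OF y r(1,2) step]] by blast
  note l' = lim_inD(2)[OF l]
  have "lim_in (\<lambda>m. (1/2) \<odot> (k \<oplus> y m \<otimes> y m)) ((1/2) \<odot> (k \<oplus> l \<otimes> l))"
    by (intro lim_in_scale lim_in_add lim_in_mult lim_in_const l k)
  then have "l = (1/2) \<odot> (k \<oplus> l \<otimes> l)"
    using lim_in_eq[OF lim_in_Suc[OF l]] unfolding ySuc by blast
  then have "2 \<odot> l = 2 \<odot> ((1/2) \<odot> (k \<oplus> l \<otimes> l))" by (rule arg_cong)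
  then have l2: "2 \<odot> l = k \<oplus> l \<otimes> l" using l' k by simp
  have star_y: "star A (y m) = y m" for m
    by (induction m) (simp_all add: y0 ySuc star_smult star_add star_mult y k)
  have "star A l = l" using lim_in_eq[OF lim_in_star[OF l]] l unfolding star_y by blast
  moreover have "(\<one> \<ominus> l) \<otimes> (\<one> \<ominus> l) = \<one> \<ominus> k"
  proof -
    have "(\<one> \<ominus> l) \<otimes> (\<one> \<ominus> l) = \<one> \<ominus> (l \<oplus> l) \<oplus> l \<otimes> l"
      using l' by (simp add: alg_minus_eq alg_minus_add alg_minus_minus distrib_left distrib_right minus_mult_left
          minus_mult_right alg_a_ac)
    also have "l \<oplus> l = k \<oplus> l \<otimes> l" using scale_collect(1)[of l 1 1] l' l2 by simp
    also have "\<one> \<ominus> (k \<oplus> l \<otimes> l) \<oplus> l \<otimes> l = \<one> \<ominus> k"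
      using l' k by (simp add: alg_minus_eq alg_minus_add alg_a_assoc alg_l_neg)
    finally show ?thesis .
  qed
  moreover have "z \<otimes> (\<one> \<ominus> l) = (\<one> \<ominus> l) \<otimes> z" if z: "z \<in> carrier A" "z \<otimes> k = k \<otimes> z" for z
  proof -
    have zy: "z \<otimes> y m = y m \<otimes> z" for m
    proof (induction m)
      case (Suc m)
      have "z \<otimes> (y m \<otimes> y m) = (y m \<otimes> y m) \<otimes> z"
        using Suc y z by (metis mult_assoc)
      then show ?case using k y z
        by (simp add: ySuc scale_mult_left scale_mult_right distrib_left distrib_right)
    qed (simp add: y0 z)
    have "lim_in (\<lambda>m. z \<otimes> y m) (z \<otimes> l)" "lim_in (\<lambda>m. y m \<otimes> z) (l \<otimes> z)"
      using z l by (auto intro: lim_in_mult lim_in_const)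
    then have "z \<otimes> l = l \<otimes> z" unfolding zy by (rule lim_in_eq)
    then show ?thesis using z l' by (simp add: diff_distrib_left diff_distrib_right)
  qed
  ultimately show ?thesis using that[of "\<one> \<ominus> l"] l' by (simp add: star_diff)
qed

text \<open>The iterates of the map sending \<open>v\<close> to \<open>1 + z v\<close> are the
  partial sums of the geometric series of \<open>z\<close>. They all commute with \<open>z\<close>,
  so the limit is a two-sided inverse.\<close>

lemma neumann_inverse:
  assumes z: "z \<in> carrier A" "cnorm A z < 1"
  obtains w where "w \<in> carrier A" "w \<otimes> (\<one> \<ominus> z) = \<one>" "(\<one> \<ominus> z) \<otimes> w = \<one>"
proof -
  define y where "y = rec_nat \<zero> (\<lambda>_ v. \<one> \<oplus> z \<otimes> v)"
  have y0: "y 0 = \<zero>" and ySuc: "\<And>m. y (Suc m) = \<one> \<oplus> z \<otimes> y m"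
    by (simp_all add: y_def)
  have y: "y m \<in> carrier A" for m by (induction m) (simp_all add: y0 ySuc z)
  have step: "cnorm A (y (Suc m) \<ominus> y m) \<le> cnorm A \<one> * cnorm A z ^ m" for m
  proof (induction m)
    case 0
    then show ?case using z by (simp add: ySuc y0 alg_minus_eq ring.minus_zero[OF ring_A])
  next
    case (Suc m)
    have "y (Suc (Suc m)) \<ominus> y (Suc m) = z \<otimes> (y (Suc m) \<ominus> y m)"
      using z y by (simp add: ySuc[of "Suc m"] ySuc[of m] diff_distrib_left diff_add_add
         del: ) (simp add: alg_minus_eq alg_r_neg)
    then have "cnorm A (y (Suc (Suc m)) \<ominus> y (Suc m)) \<le> cnorm A z * cnorm A (y (Suc m) \<ominus> y m)"
      using p_mult[of z "y (Suc m) \<ominus> y m"] z y by simp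
    also have "\<dots> \<le> cnorm A z * (cnorm A \<one> * cnorm A z ^ m)"
      by (rule mult_left_mono[OF Suc]) (simp add: z)
    finally show ?case by (simp add: ac_simps)
  qed
  obtain l where l: "lim_in y l"
    using cauchy_converges[OF geometric_cauchy[OF y _ z(2) step]] z by auto
  note l' = lim_inD(2)[OF l]
  have "lim_in (\<lambda>m. \<one> \<oplus> z \<otimes> y m) (\<one> \<oplus> z \<otimes> l)"
    by (intro lim_in_add lim_in_mult lim_in_const l z unit_closed)
  then have lfix: "l = \<one> \<oplus> z \<otimes> l"
    using lim_in_eq[OF lim_in_Suc[OF l]] unfolding ySuc by blast
  have zy: "z \<otimes> y m = y m \<otimes> z" for m
  proof (induction m)
    case (Suc m)
    have "z \<otimes> y (Suc m) = z \<oplus> z \<otimes> (z \<otimes> y m)"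
      using y z by (simp add: ySuc distrib_left)
    also have "\<dots> = y (Suc m) \<otimes> z"
      using y z by (simp add: ySuc distrib_right mult_assoc flip: Suc)
    finally show ?case .
  qed (simp add: y0 z)
  have "lim_in (\<lambda>m. z \<otimes> y m) (z \<otimes> l)" "lim_in (\<lambda>m. y m \<otimes> z) (l \<otimes> z)"
    using z l by (auto intro: lim_in_mult lim_in_const)
  then have zl: "z \<otimes> l = l \<otimes> z" unfolding zy by (rule lim_in_eq)
  have "l \<ominus> z \<otimes> l = \<one>"
    using z l' by (subst lfix) (simp add: alg_minus_eq alg_a_assoc alg_r_neg del: mult_zero_right)
  then have "(\<one> \<ominus> z) \<otimes> l = \<one>" "l \<otimes> (\<one> \<ominus> z) = \<one>"
    using z l' by (simp_all add: diff_distrib_left diff_distrib_right zl)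
  then show ?thesis using that l' by blast
qed

text \<open>Taking \<open>c\<close> as the square root of \<open>1 - a a\<close> makes
  \<open>a\<close> the real part of the unitary \<open>a + i c\<close>, the shape required by
  \<open>sum_squares_bound\<close>.\<close>

lemma dilation:
  assumes a: "a \<in> carrier A" "star A a = a" "cnorm A a < 1"
  obtains c where "c \<in> carrier A" "star A c = c" "a \<otimes> c = c \<otimes> a" "a \<otimes> a \<oplus> c \<otimes> c = \<one>"
proof -
  have "cnorm A (a \<otimes> a) \<le> cnorm A a * cnorm A a" using p_mult a by blast
  also have "\<dots> < 1" using mult_strict_mono'[OF a(3) a(3)] a(1) by simp
  finally have lt: "cnorm A (a \<otimes> a) < 1" .
  have aa: "a \<otimes> a \<in> carrier A" "star A (a \<otimes> a) = a \<otimes> a" using a by (simp_all add: star_mult)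
  obtain c where c: "c \<in> carrier A" "star A c = c" "c \<otimes> c = \<one> \<ominus> a \<otimes> a"
    "\<And>z. z \<in> carrier A \<Longrightarrow> z \<otimes> (a \<otimes> a) = (a \<otimes> a) \<otimes> z \<Longrightarrow> z \<otimes> c = c \<otimes> z"
    using square_root[OF aa lt] by blast
  have "a \<otimes> a \<oplus> c \<otimes> c = \<one>"
    using a by (simp add: c add_diff_inverse)
  then show ?thesis using that[OF c(1,2)] c(4)[of a] a by (simp add: mult_assoc)
qed

text \<open>A self-adjoint element of norm below 1 is by \<open>dilation\<close> the real part of a
  unitary, so every C*-seminorm is at most 1 on it. Rescaling settles self-adjoint elements, and the
  C*-identity reduces \<open>x\<close> to the product of \<open>star A x\<close> and
  \<open>x\<close>. The norm is thus the largest C*-seminorm, from which contractivity of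
  homomorphisms follows.\<close>

theorem cstar_seminorm_le_cnorm:
  assumes q: "cstar_seminorm A q" and x: "x \<in> carrier A"
  shows "q x \<le> cnorm A x"
proof -
  interpret q: cstar_seminormed A q by unfold_locales (rule q)
  have sa: "q a \<le> cnorm A a" if a: "a \<in> carrier A" "star A a = a" for a
  proof (rule dense_ge)
    fix s assume s: "cnorm A a < s"
    then have s0: "0 < s" using p_nonneg[OF a(1)] by linarith
    define b where "b = complex_of_real (1/s) \<odot> a"
    have b: "b \<in> carrier A" "star A b = b" using a by (simp_all add: b_def star_smult)
    have "cnorm A b = cnorm A a / s" using a s0 by (simp add: b_def p_scale norm_divide)
    then have "cnorm A b < 1" using s s0 by simp
    then obtain c where "c \<in> carrier A" "star A c = c" "b \<otimes> c = c \<otimes> b" "b \<otimes> b \<oplus> c \<otimes> c = \<one>"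
      using dilation b by blast
    then have "(q b)\<^sup>2 \<le> 1" using q.sum_squares_bound[OF b, of c 1] by simp
    then have "q b \<le> 1" using b power2_le_imp_le[of "q b" 1] by simp
    moreover have "q b = q a / s" using a s0 by (simp add: b_def q.p_scale norm_divide)
    ultimately show "q a \<le> s" using s0 by simp
  qed
  have "(q x)\<^sup>2 = q (star A x \<otimes> x)" using q.p_star_mult x by simp
  also have "\<dots> \<le> cnorm A (star A x \<otimes> x)" using x by (intro sa) (auto simp: star_mult)
  also have "\<dots> = (cnorm A x)\<^sup>2" using p_star_mult x by simp
  finally show ?thesis using power2_le_imp_le p_nonneg x by blast
qed

text \<open>Positivity of \<open>h h\<close>, expressed by norms alone: after rescaling, its
  difference from the scalar \<open>t\<close> is \<open>t\<close> times the square of the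
  contraction \<open>c\<close> that \<open>dilation\<close> supplies. Estimates of this form can be
  added, which gives positivity of sums of squares.\<close>

lemma square_near_scalar:
  assumes h: "h \<in> carrier A" "star A h = h" and t: "(cnorm A h)\<^sup>2 < t"
  shows "cnorm A (of_real t \<odot> \<one> \<ominus> h \<otimes> h) \<le> t"
proof -
  have t0: "0 < t" using t zero_le_power2[of "cnorm A h"] by linarith
  define a where "a = complex_of_real (1 / sqrt t) \<odot> h"
  have a: "a \<in> carrier A" "star A a = a" using h by (simp_all add: a_def star_smult)
  have "cnorm A h < sqrt t" using t h real_less_rsqrt by blast
  then have "cnorm A a < 1" using h t0 by (simp add: a_def p_scale norm_divide)
  then obtain c where c: "c \<in> carrier A" "star A c = c" "a \<otimes> c = c \<otimes> a" "a \<otimes> a \<oplus> c \<otimes> c = \<one>"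
    using dilation a by blast
  have "(cnorm A c)\<^sup>2 \<le> 1"
    using sum_squares_bound[OF c(1,2) a c(3)[symmetric], of 1] c a by (simp add: alg_a_comm)
  moreover have "cnorm A (c \<otimes> c) = (cnorm A c)\<^sup>2" using p_star_mult[OF c(1)] c(2) by simp
  ultimately have cc: "cnorm A (c \<otimes> c) \<le> 1" by simp
  have "(complex_of_real (sqrt t))\<^sup>2 = of_real t" using t0 by (simp flip: of_real_power)
  then have "of_real t * (1 / complex_of_real (sqrt t) * (1 / complex_of_real (sqrt t))) = 1"
    using t0 by (simp add: power2_eq_square)
  then have hh: "of_real t \<odot> (a \<otimes> a) = h \<otimes> h"
    using h by (simp add: a_def scale_mult_left scale_mult_right)
  have "of_real t \<odot> \<one> \<ominus> h \<otimes> h = of_real t \<odot> (c \<otimes> c)"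
    unfolding hh[symmetric] using a c(1)
    by (simp flip: c(4) add: scale_add_right add_diff_cancel)
  then show ?thesis using c cc t0 by (simp add: p_scale)
qed

text \<open>The sum reads \<open>h j h j + b = 1\<close>, where \<open>b\<close> is a sum of squares
  and commutes with \<open>h j\<close>. Adding the estimates of \<open>square_near_scalar\<close>
  shows that \<open>b\<close> is positive enough for \<open>b + e\<close> to have a self-adjoint
  square root \<open>d\<close>; then \<open>h j h j + d d = 1 + e\<close>, and
  \<open>sum_squares_bound\<close> applies. This is what bounds the entries of an orthogonal
  matrix.\<close>

lemma square_le_unit_bound:
  assumes K: "finite K" and h: "\<And>k. k \<in> K \<Longrightarrow> h k \<in> carrier A" "\<And>k. k \<in> K \<Longrightarrow> star A (h k) = h k"
    and sum: "(\<Oplus>k\<in>K. h k \<otimes> h k) = \<one>" and j: "j \<in> K"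
  shows "cnorm A (h j) \<le> 1"
proof -
  define L where "L = K - {j}"
  have L: "finite L" "j \<notin> L" "K = insert j L" "\<And>k. k \<in> L \<Longrightarrow> k \<in> K" using K j by (auto simp: L_def)
  note hj = h(1)[OF j] h(2)[OF j]
  define b where "b = (\<Oplus>k\<in>L. h k \<otimes> h k)"
  have b: "b \<in> carrier A" "star A b = b"
    using L h by (auto simp: b_def sum_star star_mult intro!: sum_cong)
  have one: "h j \<otimes> h j \<oplus> b = \<one>"
    using sum L h by (simp add: b_def sum_insert)
  have comm_b: "h j \<otimes> b = b \<otimes> h j"
  proof -
    have "h j \<otimes> (h j \<otimes> h j \<oplus> b) = (h j \<otimes> h j \<oplus> b) \<otimes> h j" using hj by (simp add: one)
    then have "h j \<otimes> (h j \<otimes> h j) \<oplus> h j \<otimes> b = h j \<otimes> (h j \<otimes> h j) \<oplus> b \<otimes> h j"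
      using hj b by (simp add: distrib_left distrib_right mult_assoc)
    then have "(h j \<otimes> (h j \<otimes> h j) \<oplus> h j \<otimes> b) \<ominus> h j \<otimes> (h j \<otimes> h j)
        = (h j \<otimes> (h j \<otimes> h j) \<oplus> b \<otimes> h j) \<ominus> h j \<otimes> (h j \<otimes> h j)"
      by (rule arg_cong)
    then show ?thesis using hj b by (simp only: add_diff_cancel mult_closed)
  qed
  \<comment> \<open>The summand 1 makes \<open>t\<close> strictly larger than each squared norm, as
    \<open>square_near_scalar\<close> demands.\<close>
  define t where "t = 1 + (\<Sum>k\<in>K. (cnorm A (h k))\<^sup>2)"
  have t: "(cnorm A (h k))\<^sup>2 < t" if "k \<in> K" for k
    using member_le_sum[OF that, of "\<lambda>k. (cnorm A (h k))\<^sup>2"] K by (simp add: t_def)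
  have t0: "0 < t" using t[OF j] zero_le_power2[of "cnorm A (h j)"] by linarith
  define T where "T = card L * t"
  have T0: "0 \<le> T" using t0 by (simp add: T_def)
  have eq: "of_real T \<odot> \<one> \<ominus> b = (\<Oplus>k\<in>L. of_real t \<odot> \<one> \<ominus> h k \<otimes> h k)"
    using L h by (simp add: sum_diff b_def sum_const_scale T_def)
  have Tb: "cnorm A (of_real T \<odot> \<one> \<ominus> b) \<le> T"
  proof -
    have "cnorm A (of_real T \<odot> \<one> \<ominus> b) \<le> (\<Sum>k\<in>L. cnorm A (of_real t \<odot> \<one> \<ominus> h k \<otimes> h k))"
      unfolding eq using L h by (intro p_sum) auto
    also have "\<dots> \<le> (\<Sum>k\<in>L. t)"
      using L h t by (intro sum_mono square_near_scalar) auto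
    finally show ?thesis by (simp add: T_def)
  qed
  have "(cnorm A (h j))\<^sup>2 \<le> 1 + e" if e: "0 < e" for e
  proof -
    \<comment> \<open>\<open>e + b\<close> equals \<open>S (1 - z)\<close>, where \<open>z\<close>
      has norm at most \<open>T / S < 1\<close>; adding \<open>e\<close> is what makes this
      inequality strict.\<close>
    define S where "S = T + e"
    have S: "0 < S" using T0 e by (simp add: S_def)
    define z where "z = complex_of_real (1/S) \<odot> (of_real T \<odot> \<one> \<ominus> b)"
    have z: "z \<in> carrier A" "star A z = z" using b by (simp_all add: z_def star_smult star_diff)
    have "cnorm A z = cnorm A (of_real T \<odot> \<one> \<ominus> b) / S"
      using b S by (simp add: z_def p_scale norm_divide)
    also have "\<dots> \<le> T / S" using Tb S by (simp add: divide_right_mono)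
    also have "\<dots> < 1" using S e by (simp add: S_def)
    finally have zlt: "cnorm A z < 1" .
    obtain c where c: "c \<in> carrier A" "star A c = c" "c \<otimes> c = \<one> \<ominus> z"
      "\<And>x. x \<in> carrier A \<Longrightarrow> x \<otimes> z = z \<otimes> x \<Longrightarrow> x \<otimes> c = c \<otimes> x"
      using square_root[OF z zlt] by blast
    define d where "d = complex_of_real (sqrt S) \<odot> c"
    have d: "d \<in> carrier A" "star A d = d" using c by (simp_all add: d_def star_smult)
    have "(complex_of_real (sqrt S))\<^sup>2 = of_real S" using S by (simp flip: of_real_power)
    then have "complex_of_real (sqrt S) * complex_of_real (sqrt S) = of_real S"
      by (simp add: power2_eq_square)
    then have "d \<otimes> d = of_real S \<odot> (\<one> \<ominus> z)"
      unfolding c(3)[symmetric] using c(1) by (simp add: d_def scale_mult_left scale_mult_right)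
    also have "\<dots> = of_real S \<odot> \<one> \<ominus> (of_real T \<odot> \<one> \<ominus> b)"
      using z b S by (simp add: scale_diff_right z_def)
    also have "\<dots> = of_real e \<odot> \<one> \<oplus> b"
      using b by (simp add: S_def scale_add_left add_diff_diff)
    finally have dd: "d \<otimes> d = of_real e \<odot> \<one> \<oplus> b" .
    have "h j \<otimes> h j \<oplus> d \<otimes> d = (h j \<otimes> h j \<oplus> b) \<oplus> of_real e \<odot> \<one>"
      unfolding dd using hj b by (simp add: alg_a_ac)
    also have "\<dots> = of_real (1 + e) \<odot> \<one>" by (simp add: one scale_add_left)
    finally have sum': "h j \<otimes> h j \<oplus> d \<otimes> d = of_real (1 + e) \<odot> \<one>" .
    have "h j \<otimes> z = z \<otimes> h j"
      using hj b by (simp add: z_def scale_mult_left scale_mult_right diff_distrib_left diff_distrib_right comm_b)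
    then have "h j \<otimes> c = c \<otimes> h j" by (rule c(4)[OF hj(1)])
    then have "h j \<otimes> d = d \<otimes> h j" using hj(1) c(1) by (simp add: d_def scale_mult_left scale_mult_right)
    from sum_squares_bound[OF hj d this sum'] show ?thesis using e by simp
  qed
  then have "(cnorm A (h j))\<^sup>2 \<le> 1" by (rule field_le_epsilon)
  then show ?thesis using power2_le_imp_le[of "cnorm A (h j)" 1] by simp
qed

text \<open>Since \<open>E\<close> and its adjoint add up to 2, multiplying their sum by
  \<open>star A w\<close> on the left and \<open>w\<close> on the right shows that the product of
  \<open>star A w\<close> and \<open>w\<close> is the real part of \<open>w\<close>. Any
  \<open>v\<close> with this property has squared norm at most its norm; \<open>1 - w\<close> has
  the property as well.\<close>

lemma resolvent_contractive:
  assumes y: "y \<in> carrier A" "star A y = y" and w: "w \<in> carrier A"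
    and inv: "(\<one> \<oplus> (\<i> * of_real s) \<odot> y) \<otimes> w = \<one>"
  shows "cnorm A w \<le> 1" "cnorm A (\<one> \<ominus> w) \<le> 1"
proof -
  define E where "E = \<one> \<oplus> (\<i> * of_real s) \<odot> y"
  have E: "E \<in> carrier A" using y by (simp add: E_def)
  have Ew: "E \<otimes> w = \<one>" using inv by (simp add: E_def)
  then have "star A (E \<otimes> w) = \<one>" by simp
  then have wE: "star A w \<otimes> star A E = \<one>" using E w by (simp add: star_mult)
  have "E \<oplus> star A E = (\<one> \<oplus> \<one>) \<oplus> ((\<i> * of_real s) \<odot> y \<oplus> (-(\<i> * of_real s)) \<odot> y)"
    using y by (simp add: E_def star_add star_smult alg_a_ac)
  also have "\<dots> = 2 \<odot> \<one>" using y scale_collect(1)[of \<one> 1 1] by (simp add: scale_collect)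
  finally have E2: "E \<oplus> star A E = 2 \<odot> \<one>" .
  have "2 \<odot> (star A w \<otimes> w) = star A w \<otimes> (E \<oplus> star A E) \<otimes> w"
    using w by (simp add: E2 scale_mult_left scale_mult_right)
  also have "\<dots> = star A w \<otimes> (E \<otimes> w) \<oplus> (star A w \<otimes> star A E) \<otimes> w"
    using w E by (simp add: distrib_left distrib_right mult_assoc)
  also have "\<dots> = w \<oplus> star A w" using w by (simp add: Ew wE alg_a_comm)
  finally have "(1/2) \<odot> (2 \<odot> (star A w \<otimes> w)) = (1/2) \<odot> (w \<oplus> star A w)" by simp
  then have ww: "star A w \<otimes> w = (1/2) \<odot> (w \<oplus> star A w)" using w by simp
  have contr: "cnorm A v \<le> 1" if v: "v \<in> carrier A" "star A v \<otimes> v = (1/2) \<odot> (v \<oplus> star A v)" for v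
  proof -
    have "(cnorm A v)\<^sup>2 = (1/2) * cnorm A (v \<oplus> star A v)"
      using p_star_mult[OF v(1)] v by (simp add: p_scale)
    also have "\<dots> \<le> cnorm A v" using p_add[of v "star A v"] v(1) by simp
    finally have "cnorm A v * cnorm A v \<le> cnorm A v * 1" by (simp add: power2_eq_square)
    then show ?thesis using p_nonneg[OF v(1)] by (cases "cnorm A v = 0") (auto simp: mult_le_cancel_left)
  qed
  show "cnorm A w \<le> 1" by (rule contr[OF w ww])
  show "cnorm A (\<one> \<ominus> w) \<le> 1"
  proof (rule contr)
    show "\<one> \<ominus> w \<in> carrier A" using w by simp
    define x where "x = w \<oplus> star A w"
    have x: "x \<in> carrier A" using w by (simp add: x_def)
    have "star A (\<one> \<ominus> w) \<otimes> (\<one> \<ominus> w) = \<one> \<ominus> x \<oplus> star A w \<otimes> w"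
      using w by (simp add: x_def star_add star_minus alg_minus_eq alg_minus_add alg_minus_minus distrib_left distrib_right
          minus_mult_left minus_mult_right alg_a_ac)
    also have "\<dots> = \<one> \<oplus> (-1/2) \<odot> x"
      using x scale_collect(1)[of x "-1" "1/2"] by (simp add: ww minus_as_scale alg_a_assoc flip: x_def)
    also have "\<dots> = (1/2) \<odot> (2 \<odot> \<one> \<ominus> x)"
      using x by (simp add: minus_as_scale scale_add_right)
    also have "2 \<odot> \<one> = \<one> \<oplus> \<one>"
      using scale_collect(1)[of \<one> 1 1] by simp
    also have "\<one> \<oplus> \<one> \<ominus> x = (\<one> \<ominus> w) \<oplus> star A (\<one> \<ominus> w)"
      using w by (simp add: x_def star_add star_minus alg_minus_eq alg_minus_add alg_a_ac)
    finally show "star A (\<one> \<ominus> w) \<otimes> (\<one> \<ominus> w) = (1/2) \<odot> ((\<one> \<ominus> w) \<oplus> star A (\<one> \<ominus> w))" .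
  qed
qed

text \<open>Continuation in steps of the fixed length \<open>t = 1 / (cnorm A y + 1)\<close>: adding
  \<open>i t y\<close> to \<open>E\<close> amounts to multiplying it on the right by
  \<open>1 + i t w y\<close>. Because \<open>w\<close> has norm at most 1 no matter how many steps
  were made, this factor is always invertible by the Neumann series.\<close>

lemma resolvent_exists:
  assumes y: "y \<in> carrier A" "star A y = y"
  obtains w where "w \<in> carrier A" "(\<one> \<oplus> (\<i> * of_real (real m / (cnorm A y + 1))) \<odot> y) \<otimes> w = \<one>"
proof -
  define t where "t = 1 / (cnorm A y + 1)"
  have y0: "0 \<le> cnorm A y" using y by simp
  have t: "0 < t" "t * cnorm A y < 1" using y0 by (simp_all add: t_def)
  have "\<exists>w\<in>carrier A. (\<one> \<oplus> (\<i> * of_real (real m * t)) \<odot> y) \<otimes> w = \<one>"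
  proof (induction m)
    case 0
    show ?case using y by (intro bexI[of _ \<one>]) simp_all
  next
    case (Suc m)
    define E where "E = \<one> \<oplus> (\<i> * of_real (real m * t)) \<odot> y"
    have E: "E \<in> carrier A" using y by (simp add: E_def)
    obtain w where w: "w \<in> carrier A" "E \<otimes> w = \<one>" using Suc by (auto simp: E_def)
    have wn: "cnorm A w \<le> 1" by (rule resolvent_contractive(1)[OF y w(1) w(2)[unfolded E_def]])
    define z where "z = (-(\<i> * of_real t)) \<odot> (w \<otimes> y)"
    have z: "z \<in> carrier A" using w y by (simp add: z_def)
    have "cnorm A z = t * cnorm A (w \<otimes> y)" using w y t by (simp add: z_def p_scale norm_mult)
    also have "\<dots> \<le> t * (1 * cnorm A y)"
      using p_mult[OF w(1) y(1)] mult_right_mono[OF wn y0] t by (intro mult_left_mono) auto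
    also have "\<dots> < 1" using t by simp
    finally obtain v where v: "v \<in> carrier A" "(\<one> \<ominus> z) \<otimes> v = \<one>" using neumann_inverse z by blast
    have "E \<otimes> (w \<otimes> y) = y" using mult_assoc[of E w y] E w y by simp
    then have "E \<otimes> (\<one> \<ominus> z) = E \<oplus> (\<i> * of_real t) \<odot> y"
      using E w y by (simp add: z_def minus_as_scale distrib_left scale_mult_right)
    also have "\<dots> = \<one> \<oplus> (\<i> * of_real (real (Suc m) * t)) \<odot> y"
      using y by (simp add: E_def alg_a_assoc scale_collect algebra_simps)
    finally have "(\<one> \<oplus> (\<i> * of_real (real (Suc m) * t)) \<odot> y) \<otimes> (v \<otimes> w) = (E \<otimes> (\<one> \<ominus> z)) \<otimes> (v \<otimes> w)"
      by (simp only:)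
    also have "\<dots> = E \<otimes> (((\<one> \<ominus> z) \<otimes> v) \<otimes> w)"
      using E z v(1) w(1) by (simp only: mult_assoc alg_minus_closed unit_closed mult_closed)
    also have "\<dots> = \<one>" using w v(2) by simp
    finally show ?case using v w by blast
  qed
  moreover have "real m * t = real m / (cnorm A y + 1)" by (simp add: t_def)
  ultimately show ?thesis using that by auto
qed

text \<open>The resolvents \<open>(1 + \<i> s y)\<^sup>-\<^sup>1\<close> replace the approximate unit in the proof that the quotient norm is a
  C*-norm.\<close>

lemma damping:
  assumes y: "y \<in> carrier A" "star A y = y" and e: "0 < e"
  obtains w z where "w \<in> carrier A" "z \<in> carrier A" "cnorm A w \<le> 1" "cnorm A (y \<otimes> w) \<le> e"
    "\<one> \<ominus> w = y \<otimes> z"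
proof -
  have y0: "0 \<le> cnorm A y" using y by simp
  obtain m :: nat where m: "(cnorm A y + 1) / e < real m" using reals_Archimedean2 by blast
  define s where "s = real m / (cnorm A y + 1)"
  have "1 / e < s" using m y0 e by (simp add: s_def field_simps)
  moreover have "0 < 1 / e" using e by simp
  ultimately have s: "1 / e < s" "0 < s" by linarith+
  obtain w where w: "w \<in> carrier A" "(\<one> \<oplus> (\<i> * of_real s) \<odot> y) \<otimes> w = \<one>"
    unfolding s_def by (rule resolvent_exists[OF y])
  note n = resolvent_contractive[OF y w]
  have "w \<oplus> (\<i> * of_real s) \<odot> (y \<otimes> w) = \<one>"
    using w y by (simp add: distrib_right scale_mult_left)
  \<comment> \<open>This identity gives both claims: \<open>1 - w\<close> is a multiple of
    \<open>y w\<close>, and as its norm is at most 1, that of \<open>y w\<close> is at most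
    \<open>1 / s\<close>.\<close>
  then have eq: "\<one> \<ominus> w = (\<i> * of_real s) \<odot> (y \<otimes> w)"
    using add_diff_cancel[of w "(\<i> * of_real s) \<odot> (y \<otimes> w)"] w y by simp
  then have "s * cnorm A (y \<otimes> w) \<le> 1" using n(2) w y s by (simp add: p_scale norm_mult)
  then have "cnorm A (y \<otimes> w) \<le> 1 / s" using s by (simp add: field_simps)
  also have "\<dots> \<le> e" using s e by (simp add: field_simps)
  finally have "cnorm A (y \<otimes> w) \<le> e" .
  moreover have "\<one> \<ominus> w = y \<otimes> ((\<i> * of_real s) \<odot> w)" using eq w y by (simp add: scale_mult_right)
  ultimately show ?thesis using that[of w "(\<i> * of_real s) \<odot> w"] w n by simp
qed

end

section \<open>Homomorphisms\<close>

locale star_algebra_hom = A: star_algebra A + B: star_algebra B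
  for A :: "('a, 'm) star_alg_scheme" and B :: "('b, 'n) star_alg_scheme" +
  fixes f :: "'a \<Rightarrow> 'b"
  assumes hom: "f \<in> star_hom A B"
begin

lemma hom_closed [simp, intro]: "x \<in> carrier A \<Longrightarrow> f x \<in> carrier B"
  and hom_add: "x \<in> carrier A \<Longrightarrow> y \<in> carrier A \<Longrightarrow> f (x \<oplus>\<^bsub>A\<^esub> y) = f x \<oplus>\<^bsub>B\<^esub> f y"
  and hom_mult: "x \<in> carrier A \<Longrightarrow> y \<in> carrier A \<Longrightarrow> f (x \<otimes>\<^bsub>A\<^esub> y) = f x \<otimes>\<^bsub>B\<^esub> f y"
  and hom_one: "f \<one>\<^bsub>A\<^esub> = \<one>\<^bsub>B\<^esub>"
  and hom_scale: "x \<in> carrier A \<Longrightarrow> f (c \<odot>\<^bsub>A\<^esub> x) = c \<odot>\<^bsub>B\<^esub> f x"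
  and hom_star: "x \<in> carrier A \<Longrightarrow> f (star A x) = star B (f x)"
  using hom by (auto simp: star_hom_def dest: ring_hom_closed ring_hom_add ring_hom_mult ring_hom_one)

lemma hom_zero: "f \<zero>\<^bsub>A\<^esub> = \<zero>\<^bsub>B\<^esub>"
  using hom_scale[of "\<one>\<^bsub>A\<^esub>" 0] by simp

lemma hom_diff: "x \<in> carrier A \<Longrightarrow> y \<in> carrier A \<Longrightarrow> f (x \<ominus>\<^bsub>A\<^esub> y) = f x \<ominus>\<^bsub>B\<^esub> f y"
  by (simp add: A.minus_as_scale B.minus_as_scale hom_add hom_scale)

lemma hom_sum: "finite K \<Longrightarrow> (\<And>i. i \<in> K \<Longrightarrow> g i \<in> carrier A) \<Longrightarrow>
    f (finsum A g K) = (\<Oplus>\<^bsub>B\<^esub>i\<in>K. f (g i))"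
  by (induction K rule: finite_induct) (simp_all add: A.sum_insert B.sum_insert hom_add hom_zero)

lemma seminorm_pullback: "cstar_seminorm B q \<Longrightarrow> cstar_seminorm A (\<lambda>x. q (f x))"
  unfolding cstar_seminorm_def by (simp add: hom_add hom_mult hom_scale flip: hom_star)
     (metis hom_closed hom_star hom_mult A.star_closed)

end

lemma star_homI:
  assumes "\<And>x. x \<in> carrier A \<Longrightarrow> f x \<in> carrier B"
    "\<And>x y. x \<in> carrier A \<Longrightarrow> y \<in> carrier A \<Longrightarrow> f (x \<oplus>\<^bsub>A\<^esub> y) = f x \<oplus>\<^bsub>B\<^esub> f y"
    "\<And>x y. x \<in> carrier A \<Longrightarrow> y \<in> carrier A \<Longrightarrow> f (x \<otimes>\<^bsub>A\<^esub> y) = f x \<otimes>\<^bsub>B\<^esub> f y"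
    "f \<one>\<^bsub>A\<^esub> = \<one>\<^bsub>B\<^esub>"
    "\<And>c x. x \<in> carrier A \<Longrightarrow> f (c \<odot>\<^bsub>A\<^esub> x) = c \<odot>\<^bsub>B\<^esub> f x"
    "\<And>x. x \<in> carrier A \<Longrightarrow> f (star A x) = star B (f x)"
  shows "f \<in> star_hom A B"
  unfolding star_hom_def using assms by (auto intro: ring_hom_memI)

lemma star_hom_compose: "f \<in> star_hom A B \<Longrightarrow> g \<in> star_hom B C \<Longrightarrow> g \<circ> f \<in> star_hom A C"
  unfolding star_hom_def by (auto intro: ring_hom_trans dest: ring_hom_closed)

lemma star_hom_id: "(\<lambda>x. x) \<in> star_hom A A"
  by (rule star_homI) auto

text \<open>The norm of \<open>B\<close> pulled back along \<open>f\<close> is a C*-seminorm on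
  \<open>A\<close>, hence lies below the norm of \<open>A\<close>.\<close>

lemma star_hom_contractive:
  assumes "cstar_algebra A" "cstar_algebra B" "f \<in> star_hom A B" "x \<in> carrier A"
  shows "cnorm B (f x) \<le> cnorm A x"
proof -
  interpret A: cstar_algebra A by fact
  interpret B: cstar_algebra B by fact
  interpret star_algebra_hom A B f by unfold_locales fact
  show ?thesis by (rule A.cstar_seminorm_le_cnorm[OF seminorm_pullback[OF B.seminorm] assms(4)])
qed

section \<open>Completions\<close>

text \<open>Operations on classes are defined as unions over all representatives; once the resulting
  class does not depend on them, the union is one of a constant nonempty family.\<close>

lemma UN2_const:
  assumes "x \<in> X" "y \<in> Y" "\<And>x' y'. x' \<in> X \<Longrightarrow> y' \<in> Y \<Longrightarrow> F x' y' = c"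
  shows "(\<Union>x'\<in>X. \<Union>y'\<in>Y. F x' y') = c"
  using assms by blast

lemma UN1_const:
  assumes "x \<in> X" "\<And>x'. x' \<in> X \<Longrightarrow> F x' = c"
  shows "(\<Union>x'\<in>X. F x') = c"
  using assms by blast

context cstar_seminormed
begin

definition asymp :: "(nat \<Rightarrow> 'a) \<Rightarrow> (nat \<Rightarrow> 'a) \<Rightarrow> bool" where
  "asymp x y \<longleftrightarrow> (\<lambda>k. p (x k \<ominus> y k)) \<longlonglongrightarrow> 0"

lemma asymp_refl: "(\<And>k. x k \<in> carrier A) \<Longrightarrow> asymp x x"
  by (simp add: asymp_def alg_minus_eq alg_r_neg)

lemma asymp_sym: "cauchy_in A p x \<Longrightarrow> cauchy_in A p y \<Longrightarrow> asymp x y \<Longrightarrow> asymp y x"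
  by (simp add: asymp_def p_diff_commute[of "y _"] cauchy_inD(1))

lemma asymp_trans:
  assumes c: "cauchy_in A p x" "cauchy_in A p y" "cauchy_in A p z"
    and xy: "asymp x y" and yz: "asymp y z"
  shows "asymp x z"
  unfolding asymp_def
proof (rule null_bound)
  show "(\<lambda>k. p (x k \<ominus> y k) + p (y k \<ominus> z k)) \<longlonglongrightarrow> 0"
    using tendsto_add[OF xy[unfolded asymp_def] yz[unfolded asymp_def]] by simp
qed (simp_all add: p_triangle c[THEN cauchy_inD(1)])

lemma cauchy_const: "a \<in> carrier A \<Longrightarrow> cauchy_in A p (\<lambda>_. a)"
  by (rule lim_in_cauchy[OF lim_in_const])

lemma cauchy_in_bound:
  assumes x: "cauchy_in A p x" and y: "cauchy_in A p y" and z: "\<And>k. z k \<in> carrier A"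
    and C: "\<And>k l. p (z k \<ominus> z l) \<le> C * p (x k \<ominus> x l) + D * p (y k \<ominus> y l)" and "0 < C" "0 < D"
  shows "cauchy_in A p z"
  unfolding cauchy_in_def
proof (intro conjI allI impI)
  show "z k \<in> carrier A" for k by (rule z)
  fix e :: real assume e: "e > 0"
  obtain M where M: "\<forall>k\<ge>M. \<forall>l\<ge>M. p (x k \<ominus> x l) < e / (2 * C)"
    using cauchy_inD(2)[OF x, of "e / (2 * C)"] e \<open>0 < C\<close> by auto
  obtain N where N: "\<forall>k\<ge>N. \<forall>l\<ge>N. p (y k \<ominus> y l) < e / (2 * D)"
    using cauchy_inD(2)[OF y, of "e / (2 * D)"] e \<open>0 < D\<close> by auto
  have "p (z k \<ominus> z l) < e" if "k \<ge> max M N" "l \<ge> max M N" for k l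
  proof -
    have "p (x k \<ominus> x l) < e / (2 * C)" "p (y k \<ominus> y l) < e / (2 * D)" using M N that by auto
    then have "C * p (x k \<ominus> x l) < e / 2" "D * p (y k \<ominus> y l) < e / 2"
      using \<open>0 < C\<close> \<open>0 < D\<close> by (simp_all add: field_simps)
    then show ?thesis using C[of k l] by linarith
  qed
  then show "\<exists>M. \<forall>k\<ge>M. \<forall>l\<ge>M. p (z k \<ominus> z l) < e" by blast
qed

lemma cauchy_add:
  assumes x: "cauchy_in A p x" and y: "cauchy_in A p y"
  shows "cauchy_in A p (\<lambda>k. x k \<oplus> y k)"
  by (rule cauchy_in_bound[OF x y, where C = 1 and D = 1])
    (use cauchy_inD(1)[OF x] cauchy_inD(1)[OF y] in \<open>simp_all add: p_add_diff\<close>)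

lemma cauchy_mult:
  assumes x: "cauchy_in A p x" and y: "cauchy_in A p y"
  shows "cauchy_in A p (\<lambda>k. x k \<otimes> y k)"
proof -
  note xc = cauchy_inD(1)[OF x] and yc = cauchy_inD(1)[OF y]
  obtain C where C: "0 < C" "\<And>k. p (x k) \<le> C" using cauchy_bounded[OF x] by blast
  obtain D where D: "0 < D" "\<And>k. p (y k) \<le> D" using cauchy_bounded[OF y] by blast
  show ?thesis
  proof (rule cauchy_in_bound[OF x y, where C = D and D = C])
    fix k l
    have "p (x k \<otimes> y k \<ominus> x l \<otimes> y l) \<le> p (x k) * p (y k \<ominus> y l) + p (x k \<ominus> x l) * p (y l)"
      by (rule p_mult_diff) (use xc yc in auto)
    also have "\<dots> \<le> C * p (y k \<ominus> y l) + p (x k \<ominus> x l) * D"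
      by (intro add_mono mult_right_mono mult_left_mono C D p_nonneg alg_minus_closed xc yc)
    finally show "p (x k \<otimes> y k \<ominus> x l \<otimes> y l) \<le> D * p (x k \<ominus> x l) + C * p (y k \<ominus> y l)"
      by (simp add: mult.commute)
  qed (use xc yc C D in auto)
qed

lemma cauchy_scale:
  assumes x: "cauchy_in A p x"
  shows "cauchy_in A p (\<lambda>k. c \<odot> x k)"
proof (rule cauchy_in_bound[OF x x, where C = "cmod c + 1" and D = 1])
  note xc = cauchy_inD(1)[OF x]
  fix k l
  have "p (c \<odot> x k \<ominus> c \<odot> x l) = cmod c * p (x k \<ominus> x l)" using xc by (simp add: p_scale_diff)
  also have "\<dots> \<le> (cmod c + 1) * p (x k \<ominus> x l) + 1 * p (x k \<ominus> x l)"
    using p_nonneg[of "x k \<ominus> x l"] xc by (simp add: ring_distribs del: p_nonneg)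
  finally show "p (c \<odot> x k \<ominus> c \<odot> x l) \<le> (cmod c + 1) * p (x k \<ominus> x l) + 1 * p (x k \<ominus> x l)" .
qed (use cauchy_inD(1)[OF x] norm_ge_zero[of c] in \<open>auto simp del: norm_ge_zero\<close>)

lemma cauchy_star: "cauchy_in A p x \<Longrightarrow> cauchy_in A p (\<lambda>k. star A (x k))"
  unfolding cauchy_in_def by (simp add: p_star_diff)

lemma asymp_mult:
  assumes x: "cauchy_in A p x" "cauchy_in A p x'" "asymp x x'"
    and y: "cauchy_in A p y" "cauchy_in A p y'" "asymp y y'"
  shows "asymp (\<lambda>k. x k \<otimes> y k) (\<lambda>k. x' k \<otimes> y' k)"
proof -
  note c = cauchy_inD(1)[OF x(1)] cauchy_inD(1)[OF x(2)] cauchy_inD(1)[OF y(1)] cauchy_inD(1)[OF y(2)]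
  obtain C where C: "0 < C" "\<And>k. p (x k) \<le> C" using cauchy_bounded[OF x(1)] by blast
  obtain D where D: "0 < D" "\<And>k. p (y' k) \<le> D" using cauchy_bounded[OF y(2)] by blast
  show ?thesis
    unfolding asymp_def
  proof (rule null_bound)
  have "(\<lambda>k. C * p (y k \<ominus> y' k) + p (x k \<ominus> x' k) * D) \<longlonglongrightarrow> C * 0 + 0 * D"
    by (intro tendsto_add tendsto_mult tendsto_const x(3)[unfolded asymp_def] y(3)[unfolded asymp_def])
  then show "(\<lambda>k. C * p (y k \<ominus> y' k) + p (x k \<ominus> x' k) * D) \<longlonglongrightarrow> 0" by simp
  fix k
  show "0 \<le> p (x k \<otimes> y k \<ominus> x' k \<otimes> y' k)" using c by simp
  have "p (x k \<otimes> y k \<ominus> x' k \<otimes> y' k) \<le> p (x k) * p (y k \<ominus> y' k) + p (x k \<ominus> x' k) * p (y' k)"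
    by (rule p_mult_diff) (use c in auto)
  also have "\<dots> \<le> C * p (y k \<ominus> y' k) + p (x k \<ominus> x' k) * D"
    by (intro add_mono mult_right_mono mult_left_mono C D p_nonneg alg_minus_closed c)
  finally show "p (x k \<otimes> y k \<ominus> x' k \<otimes> y' k) \<le> C * p (y k \<ominus> y' k) + p (x k \<ominus> x' k) * D" .
  qed
qed

lemma asymp_add:
  assumes "cauchy_in A p x" "cauchy_in A p x'" "asymp x x'" "cauchy_in A p y" "cauchy_in A p y'" "asymp y y'"
  shows "asymp (\<lambda>k. x k \<oplus> y k) (\<lambda>k. x' k \<oplus> y' k)"
  unfolding asymp_def
proof (rule null_bound)
  show "(\<lambda>k. p (x k \<ominus> x' k) + p (y k \<ominus> y' k)) \<longlonglongrightarrow> 0"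
    using tendsto_add[OF assms(3)[unfolded asymp_def] assms(6)[unfolded asymp_def]] by simp
qed (simp_all add: p_add_diff assms(1,2,4,5)[THEN cauchy_inD(1)])

lemma asymp_scale:
  assumes "cauchy_in A p x" "cauchy_in A p x'" "asymp x x'"
  shows "asymp (\<lambda>k. c \<odot> x k) (\<lambda>k. c \<odot> x' k)"
  using tendsto_mult_left[OF assms(3)[unfolded asymp_def], of "cmod c"] assms(1,2)[THEN cauchy_inD(1)]
  by (simp add: asymp_def p_scale_diff)

lemma asymp_star:
  assumes "cauchy_in A p x" "cauchy_in A p x'" "asymp x x'"
  shows "asymp (\<lambda>k. star A (x k)) (\<lambda>k. star A (x' k))"
  using assms by (simp add: asymp_def p_star_diff cauchy_inD(1))

abbreviation cls :: "(nat \<Rightarrow> 'a) \<Rightarrow> 'a completion" where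
  "cls \<equiv> cauchy_class A p"

abbreviation C :: "'a completion cstar_alg" where
  "C \<equiv> completion A p"

lemma mem_cls: "y \<in> cls x \<longleftrightarrow> cauchy_in A p y \<and> asymp y x"
  by (simp add: cauchy_class_def asymp_def)

lemma self_mem_cls: "cauchy_in A p x \<Longrightarrow> x \<in> cls x"
  by (simp add: mem_cls asymp_refl cauchy_inD(1))

lemma cls_eqI: "cauchy_in A p x \<Longrightarrow> cauchy_in A p y \<Longrightarrow> asymp x y \<Longrightarrow> cls x = cls y"
  by (intro equalityI subsetI; simp add: mem_cls; blast intro: asymp_trans asymp_sym)

lemma completion_carrier: "X \<in> carrier C \<longleftrightarrow> (\<exists>x. cauchy_in A p x \<and> X = cls x)"
  by (auto simp: completion_def)

lemma cls_closed [simp]: "cauchy_in A p x \<Longrightarrow> cls x \<in> carrier C"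
  by (auto simp: completion_carrier)

lemma completion_cases:
  assumes "X \<in> carrier C"
  obtains x where "cauchy_in A p x" "X = cls x"
  using assms by (auto simp: completion_carrier)

lemma cls_add:
  assumes x: "cauchy_in A p x" and y: "cauchy_in A p y"
  shows "cls x \<oplus>\<^bsub>C\<^esub> cls y = cls (\<lambda>k. x k \<oplus> y k)"
  unfolding completion_def
  by (simp, rule UN2_const[OF self_mem_cls[OF x] self_mem_cls[OF y]], rule cls_eqI)
    (simp_all add: mem_cls x y cauchy_add asymp_add)

lemma cls_mult:
  assumes x: "cauchy_in A p x" and y: "cauchy_in A p y"
  shows "cls x \<otimes>\<^bsub>C\<^esub> cls y = cls (\<lambda>k. x k \<otimes> y k)"
  unfolding completion_def
  by (simp, rule UN2_const[OF self_mem_cls[OF x] self_mem_cls[OF y]], rule cls_eqI)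
    (simp_all add: mem_cls x y cauchy_mult asymp_mult)

lemma cls_scale:
  assumes x: "cauchy_in A p x"
  shows "c \<odot>\<^bsub>C\<^esub> cls x = cls (\<lambda>k. c \<odot> x k)"
  unfolding completion_def
  by (simp, rule UN1_const[OF self_mem_cls[OF x]], rule cls_eqI)
    (simp_all add: mem_cls x cauchy_scale asymp_scale)

lemma cls_star:
  assumes x: "cauchy_in A p x"
  shows "star C (cls x) = cls (\<lambda>k. star A (x k))"
  unfolding completion_def
  by (simp, rule UN1_const[OF self_mem_cls[OF x]], rule cls_eqI)
    (simp_all add: mem_cls x cauchy_star asymp_star)

lemma cls_one: "\<one>\<^bsub>C\<^esub> = cls (\<lambda>_. \<one>)"
  and cls_zero: "\<zero>\<^bsub>C\<^esub> = cls (\<lambda>_. \<zero>)"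
  by (simp_all add: completion_def)

lemmas cauchy_ops = cauchy_add cauchy_mult cauchy_scale cauchy_star
  cauchy_const[OF unit_closed] cauchy_const[OF alg_zero_closed]
lemmas cls_ops = cls_add cls_mult cls_scale cls_star cls_one cls_zero

lemma completion_star_algebra: "star_algebra C"
proof -
  have neg: "\<exists>y\<in>carrier C. y \<oplus>\<^bsub>C\<^esub> X = \<zero>\<^bsub>C\<^esub>" if X: "X \<in> carrier C" for X
  proof -
    obtain x where x: "cauchy_in A p x" "X = cls x" by (rule completion_cases[OF X])
    have "(\<lambda>k. (-1) \<odot> x k \<oplus> x k) = (\<lambda>_. \<zero>)"
      using cauchy_inD(1)[OF x(1)] by (simp add: scale_minus_one alg_l_neg fun_eq_iff)
    then have "cls (\<lambda>k. (-1) \<odot> x k) \<oplus>\<^bsub>C\<^esub> X = \<zero>\<^bsub>C\<^esub>"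
      using x by (simp add: cls_ops cauchy_ops)
    then show ?thesis using x cauchy_scale cls_closed by blast
  qed
  note [simp] = cls_ops cauchy_ops cauchy_inD(1)
  have "abelian_group C"
  proof (rule abelian_groupI)
    show "\<exists>Y\<in>carrier C. Y \<oplus>\<^bsub>C\<^esub> X = \<zero>\<^bsub>C\<^esub>" if "X \<in> carrier C" for X by (rule neg[OF that])
  qed (((elim completion_cases)?, simp add: alg_a_ac alg_l_zero)+)
  moreover have "Group.monoid C"
    by (rule monoidI; (elim completion_cases)?; simp add: mult_assoc)
  ultimately have "ring C"
    by (rule ringI; elim completion_cases; simp add: distrib_left distrib_right)
  moreover have "module complex_ring C"
    by (rule moduleI[OF cring_complex_ring \<open>abelian_group C\<close>]; elim completion_cases;
      simp add: scale_add_left scale_add_right)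
  moreover have "star_algebra_axioms C"
    by (unfold_locales; elim completion_cases;
      simp add: scale_mult_left scale_mult_right star_add star_mult star_smult)
  ultimately show ?thesis by (rule star_algebra.intro)
qed

lemma cls_norm:
  assumes x: "cauchy_in A p x"
  shows "(\<lambda>k. p (x k)) \<longlonglongrightarrow> cnorm C (cls x)"
proof -
  obtain r where r: "(\<lambda>k. p (x k)) \<longlonglongrightarrow> r"
    using cauchy_norm_convergent[OF x] by (auto simp: convergent_def)
  have all: "(\<lambda>k. p (y k)) \<longlonglongrightarrow> r" if y: "y \<in> cls x" for y
  proof -
    have yc: "cauchy_in A p y" "asymp y x" using y by (simp_all add: mem_cls)
    have "(\<lambda>k. \<bar>p (y k) - p (x k)\<bar>) \<longlonglongrightarrow> 0"
      by (rule null_bound[OF yc(2)[unfolded asymp_def]])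
        (auto intro!: p_diff_diff cauchy_inD(1)[OF x] cauchy_inD(1)[OF yc(1)])
    then have "(\<lambda>k. p (y k) - p (x k)) \<longlonglongrightarrow> 0" by (simp only: tendsto_rabs_zero_iff)
    from tendsto_add[OF this r] show ?thesis by simp
  qed
  have "cnorm C (cls x) = (THE r. \<forall>y\<in>cls x. (\<lambda>k. p (y k)) \<longlonglongrightarrow> r)"
    by (simp add: completion_def)
  also have "\<dots> = r"
    by (rule the_equality) (use all self_mem_cls[OF x] r LIMSEQ_unique in blast)+
  finally show ?thesis using r by simp
qed

lemma completion_seminorm: "cstar_seminorm C (cnorm C)"
  unfolding cstar_seminorm_def
proof (intro conjI ballI allI)
  fix X assume "X \<in> carrier C"
  then obtain x where x: "cauchy_in A p x" "X = cls x" by (rule completion_cases)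
  note xc = cauchy_inD(1)[OF x(1)] and xn = cls_norm[OF x(1)]
  show "0 \<le> cnorm C X"
    unfolding x(2) by (rule LIMSEQ_le_const[OF xn]) (use xc in auto)
  show "cnorm C (c \<odot>\<^bsub>C\<^esub> X) = cmod c * cnorm C X" for c
    using LIMSEQ_unique[OF cls_norm[OF cauchy_scale[OF x(1)]], of c] tendsto_mult_left[OF xn, of "cmod c"] x xc
    by (simp add: cls_ops p_scale)
  show "cnorm C (star C X \<otimes>\<^bsub>C\<^esub> X) = (cnorm C X)\<^sup>2"
    using LIMSEQ_unique[OF cls_norm[OF cauchy_mult[OF cauchy_star[OF x(1)] x(1)]]]
      tendsto_power[OF xn, of 2] x xc
    by (simp add: cls_ops cauchy_ops p_star_mult)
  fix Y assume "Y \<in> carrier C"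
  then obtain y where y: "cauchy_in A p y" "Y = cls y" by (rule completion_cases)
  note yc = cauchy_inD(1)[OF y(1)] and yn = cls_norm[OF y(1)]
  show "cnorm C (X \<oplus>\<^bsub>C\<^esub> Y) \<le> cnorm C X + cnorm C Y"
    unfolding x(2) y(2) cls_add[OF x(1) y(1)]
    by (rule LIMSEQ_le[OF cls_norm[OF cauchy_add[OF x(1) y(1)]] tendsto_add[OF xn yn]])
      (use xc yc p_add in auto)
  show "cnorm C (X \<otimes>\<^bsub>C\<^esub> Y) \<le> cnorm C X * cnorm C Y"
    unfolding x(2) y(2) cls_mult[OF x(1) y(1)]
    by (rule LIMSEQ_le[OF cls_norm[OF cauchy_mult[OF x(1) y(1)]] tendsto_mult[OF xn yn]])
      (use xc yc p_mult in auto)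
qed

end

text \<open>A separate locale, because a sublocale declaration inside \<^locale>\<open>cstar_seminormed\<close> would unfold
  forever.\<close>

locale cstar_completion = cstar_seminormed

sublocale cstar_completion \<subseteq> comp: cstar_seminormed C "cnorm C"
  by (rule cstar_seminormed.intro[OF completion_star_algebra cstar_seminormed_axioms.intro])
    (rule completion_seminorm)

context cstar_completion
begin

definition emb :: "'a \<Rightarrow> 'a completion" where
  "emb a = cls (\<lambda>_. a)"

lemma emb_hom: "emb \<in> star_hom A C"
  by (rule star_homI) (simp_all add: emb_def cls_ops cauchy_const)

sublocale emb: star_algebra_hom A C emb
  by unfold_locales (rule emb_hom)

lemma cls_diff:
  assumes "cauchy_in A p x" "cauchy_in A p y"
  shows "cls x \<ominus>\<^bsub>C\<^esub> cls y = cls (\<lambda>k. x k \<ominus> y k)"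
  using assms cauchy_inD(1)[OF assms(1)] cauchy_inD(1)[OF assms(2)]
  by (simp add: comp.minus_as_scale minus_as_scale cls_ops cauchy_ops)

lemma cnorm_emb: "a \<in> carrier A \<Longrightarrow> cnorm C (emb a) = p a"
  using cls_norm[OF cauchy_const[of a]] by (simp add: emb_def LIMSEQ_const_iff)

text \<open>The distance from \<open>emb (x k)\<close> to the class of \<open>x\<close> is the limit
  over \<open>l\<close> of the distances from \<open>x k\<close> to \<open>x l\<close>, which the
  Cauchy condition makes small.\<close>

lemma emb_dense:
  assumes x: "cauchy_in A p x"
  shows "comp.lim_in (\<lambda>k. emb (x k)) (cls x)"
  unfolding comp.lim_in_def
proof (intro conjI allI)
  note xc = cauchy_inD(1)[OF x]
  show "emb (x k) \<in> carrier C" for k using xc by simp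
  show "cls x \<in> carrier C" using x by simp
  show "(\<lambda>k. cnorm C (emb (x k) \<ominus>\<^bsub>C\<^esub> cls x)) \<longlonglongrightarrow> 0"
  proof (rule LIMSEQ_I)
    fix e :: real assume "0 < e"
    then obtain M where M: "\<forall>k\<ge>M. \<forall>l\<ge>M. p (x k \<ominus> x l) < e / 2"
      using cauchy_inD(2)[OF x, of "e / 2"] by auto
    have "cnorm C (emb (x k) \<ominus>\<^bsub>C\<^esub> cls x) < e" if k: "k \<ge> M" for k
    proof -
      have eq: "emb (x k) \<ominus>\<^bsub>C\<^esub> cls x = cls (\<lambda>l. x k \<ominus> x l)"
        using x xc by (simp add: emb_def cls_diff cauchy_const)
      have "cauchy_in A p (\<lambda>l. x k \<oplus> (-1) \<odot> x l)"
        by (intro cauchy_add cauchy_scale cauchy_const x xc)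
      then have "cauchy_in A p (\<lambda>l. x k \<ominus> x l)" using xc by (simp add: minus_as_scale)
      from cls_norm[OF this] have "cnorm C (cls (\<lambda>l. x k \<ominus> x l)) \<le> e / 2"
        by (rule LIMSEQ_le_const2) (use M k less_imp_le in blast)
      then show ?thesis using \<open>0 < e\<close> by (simp add: eq)
    qed
    then show "\<exists>M. \<forall>k\<ge>M. norm (cnorm C (emb (x k) \<ominus>\<^bsub>C\<^esub> cls x) - 0) < e"
      using x xc by (intro exI[of _ M]) (simp del: comp.p_nonneg add: comp.p_nonneg)
  qed
qed

lemma emb_approx:
  assumes "X \<in> carrier C" "0 < e"
  obtains a where "a \<in> carrier A" "cnorm C (X \<ominus>\<^bsub>C\<^esub> emb a) < e"
proof -
  obtain x where x: "cauchy_in A p x" "X = cls x" by (rule completion_cases[OF assms(1)])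
  note lim = comp.lim_inD[OF emb_dense[OF x(1)]]
  obtain k where "cnorm C (emb (x k) \<ominus>\<^bsub>C\<^esub> X) < e"
    using order_tendstoD(2)[OF lim(3) assms(2)] x(2) by (auto simp: eventually_sequentially)
  then show ?thesis
    using that[of "x k"] cauchy_inD(1)[OF x(1)] comp.p_diff_commute[of X "emb (x k)"] assms(1) by simp
qed

text \<open>For completeness, the k-th term of a Cauchy sequence of classes is replaced by an
  element \<open>a k\<close> of \<open>A\<close> at distance less than \<open>1 / (k + 1)\<close>;
  the sequence \<open>a\<close> is then Cauchy in \<open>A\<close>, and its own class is the
  limit.\<close>

theorem completion_cstar_algebra: "cstar_algebra C"
proof (rule cstar_algebra.intro[OF completion_star_algebra], unfold_locales)
  show "cstar_seminorm C (cnorm C)" by (rule completion_seminorm)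
  show "X = \<zero>\<^bsub>C\<^esub>" if X: "X \<in> carrier C" "cnorm C X = 0" for X
  proof -
    obtain x where x: "cauchy_in A p x" "X = cls x" by (rule completion_cases[OF X(1)])
    have "asymp x (\<lambda>_. \<zero>)"
      using cls_norm[OF x(1)] cauchy_inD(1)[OF x(1)] X(2) x(2)
      by (simp add: asymp_def alg_minus_eq ring.minus_zero[OF ring_A] alg_r_zero)
    then show ?thesis using x by (simp add: cls_zero cls_eqI cauchy_ops)
  qed
  fix S assume S: "cauchy_in C (cnorm C) S"
  note Sc = comp.cauchy_inD(1)[OF S]
  have "\<forall>k. \<exists>a. a \<in> carrier A \<and> cnorm C (S k \<ominus>\<^bsub>C\<^esub> emb a) < inverse (real (Suc k))"
    using emb_approx[OF Sc] by (metis inverse_positive_iff_positive of_nat_0_less_iff zero_less_Suc)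
  then obtain a where a: "\<And>k. a k \<in> carrier A"
    "\<And>k. cnorm C (S k \<ominus>\<^bsub>C\<^esub> emb (a k)) < inverse (real (Suc k))"
    by metis
  have near: "(\<lambda>k. cnorm C (S k \<ominus>\<^bsub>C\<^esub> emb (a k))) \<longlonglongrightarrow> 0"
    by (rule null_bound[OF LIMSEQ_inverse_real_of_nat _ less_imp_le[OF a(2)]]) (simp add: a Sc)
  have ca: "cauchy_in A p a"
    unfolding cauchy_in_def
  proof (intro conjI allI impI)
    show "a k \<in> carrier A" for k by (rule a)
    fix e :: real assume e: "0 < e"
    obtain M where M: "\<forall>k\<ge>M. \<forall>l\<ge>M. cnorm C (S k \<ominus>\<^bsub>C\<^esub> S l) < e / 3"
      using comp.cauchy_inD(2)[OF S, of "e / 3"] e by auto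
    obtain N where N: "\<forall>k\<ge>N. cnorm C (S k \<ominus>\<^bsub>C\<^esub> emb (a k)) < e / 3"
      using order_tendstoD(2)[OF near, of "e / 3"] e by (auto simp: eventually_sequentially)
    have "p (a k \<ominus> a l) < e" if "k \<ge> max M N" "l \<ge> max M N" for k l
    proof -
      have m: "emb (a k) \<in> carrier C" "emb (a l) \<in> carrier C" using a by simp_all
      have "p (a k \<ominus> a l) = cnorm C (emb (a k) \<ominus>\<^bsub>C\<^esub> emb (a l))"
        using a(1) by (simp add: cnorm_emb flip: emb.hom_diff)
      also have "\<dots> \<le> cnorm C (emb (a k) \<ominus>\<^bsub>C\<^esub> S k) + cnorm C (S k \<ominus>\<^bsub>C\<^esub> emb (a l))"
        by (rule comp.p_triangle[OF m(1) Sc m(2)])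
      also have "\<dots> \<le> cnorm C (emb (a k) \<ominus>\<^bsub>C\<^esub> S k) + (cnorm C (S k \<ominus>\<^bsub>C\<^esub> S l) + cnorm C (S l \<ominus>\<^bsub>C\<^esub> emb (a l)))"
        by (intro add_left_mono comp.p_triangle[OF Sc Sc m(2)])
      also have "cnorm C (emb (a k) \<ominus>\<^bsub>C\<^esub> S k) = cnorm C (S k \<ominus>\<^bsub>C\<^esub> emb (a k))"
        by (rule comp.p_diff_commute[OF m(1) Sc])
      also have "cnorm C (S k \<ominus>\<^bsub>C\<^esub> emb (a k)) < e / 3" using N that by simp
      also have "cnorm C (S k \<ominus>\<^bsub>C\<^esub> S l) < e / 3" using M that by simp
      also have "cnorm C (S l \<ominus>\<^bsub>C\<^esub> emb (a l)) < e / 3" using N that by simp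
      finally show ?thesis by simp
    qed
    then show "\<exists>M. \<forall>k\<ge>M. \<forall>l\<ge>M. p (a k \<ominus> a l) < e" by blast
  qed
  note lim = comp.lim_inD[OF emb_dense[OF ca]]
  have "(\<lambda>k. cnorm C (S k \<ominus>\<^bsub>C\<^esub> cls a)) \<longlonglongrightarrow> 0"
  proof (rule null_bound)
    show "(\<lambda>k. cnorm C (S k \<ominus>\<^bsub>C\<^esub> emb (a k)) + cnorm C (emb (a k) \<ominus>\<^bsub>C\<^esub> cls a)) \<longlonglongrightarrow> 0"
      using tendsto_add[OF near lim(3)] by simp
  qed (use comp.p_triangle[OF Sc lim(1) lim(2)] Sc lim(1,2) in simp_all)
  then show "\<exists>X\<in>carrier C. (\<lambda>k. cnorm C (S k \<ominus>\<^bsub>C\<^esub> X)) \<longlonglongrightarrow> 0" using lim(2) by blast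
qed

text \<open>Homomorphisms are contractive, hence continuous, and \<open>emb\<close> has dense
  range.\<close>

theorem completion_hom_unique:
  assumes B: "cstar_algebra B" and f: "f \<in> star_hom C B" and g: "g \<in> star_hom C B"
    and eq: "\<And>a. a \<in> carrier A \<Longrightarrow> f (emb a) = g (emb a)" and X: "X \<in> carrier C"
  shows "f X = g X"
proof -
  interpret B: cstar_algebra B by fact
  interpret f: star_algebra_hom C B f by unfold_locales fact
  interpret g: star_algebra_hom C B g by unfold_locales fact
  obtain x where x: "cauchy_in A p x" "X = cls x" by (rule completion_cases[OF X])
  note lim = comp.lim_inD[OF emb_dense[OF x(1)]] and xc = cauchy_inD(1)[OF x(1)]
  have lim_hom: "B.lim_in (\<lambda>k. h (emb (x k))) (h X)" if h: "h \<in> star_hom C B" for h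
  proof -
    interpret h: star_algebra_hom C B h by unfold_locales fact
    have "(\<lambda>k. cnorm B (h (emb (x k)) \<ominus>\<^bsub>B\<^esub> h X)) \<longlonglongrightarrow> 0"
      unfolding x(2)
      by (rule null_bound[OF lim(3)])
        (use lim(1,2) star_hom_contractive[OF completion_cstar_algebra B h] in \<open>simp_all flip: h.hom_diff\<close>)
    then show ?thesis using lim(1,2) x(2) by (simp add: B.lim_in_def)
  qed
  have "(\<lambda>k. f (emb (x k))) = (\<lambda>k. g (emb (x k)))" using eq xc by simp
  then show ?thesis using B.lim_in_eq[OF lim_hom[OF f]] lim_hom[OF g] by metis
qed

text \<open>The bound makes \<open>h\<close> carry Cauchy sequences to Cauchy sequences and
  asymptotic ones to sequences with the same limit, so the limit along any representative defines
  the extension.\<close>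

theorem completion_extension:
  assumes B: "cstar_algebra B" and h: "h \<in> star_hom A B"
    and bound: "\<And>a. a \<in> carrier A \<Longrightarrow> cnorm B (h a) \<le> p a"
  shows "\<exists>f\<in>star_hom C B. \<forall>a\<in>carrier A. f (emb a) = h a"
proof -
  interpret B: cstar_algebra B by fact
  interpret h: star_algebra_hom A B h by unfold_locales fact
  define f where "f X = (THE b. \<forall>x\<in>X. B.lim_in (\<lambda>k. h (x k)) b)" for X
  have f: "B.lim_in (\<lambda>k. h (x k)) (f (cls x))" if x: "cauchy_in A p x" for x
  proof -
    note xc = cauchy_inD(1)[OF x]
    have hd: "cnorm B (h a \<ominus>\<^bsub>B\<^esub> h b) \<le> p (a \<ominus> b)" if "a \<in> carrier A" "b \<in> carrier A" for a b
      using that bound[of "a \<ominus> b"] by (simp flip: h.hom_diff)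
    have "cauchy_in B (cnorm B) (\<lambda>k. h (x k))"
      unfolding cauchy_in_def
    proof (intro conjI allI impI)
      show "h (x k) \<in> carrier B" for k using xc by simp
      fix e :: real assume "0 < e"
      then obtain M where "\<forall>k\<ge>M. \<forall>l\<ge>M. p (x k \<ominus> x l) < e" using cauchy_inD(2)[OF x] by blast
      then show "\<exists>M. \<forall>k\<ge>M. \<forall>l\<ge>M. cnorm B (h (x k) \<ominus>\<^bsub>B\<^esub> h (x l)) < e"
        using hd[OF xc xc] by (meson le_less_trans)
    qed
    then obtain b where b: "B.lim_in (\<lambda>k. h (x k)) b" using B.cauchy_converges by blast
    note b' = B.lim_inD[OF b]
    have all: "B.lim_in (\<lambda>k. h (y k)) b" if y: "y \<in> cls x" for y
    proof -
      have y: "cauchy_in A p y" "asymp y x" using y by (simp_all add: mem_cls)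
      note yc = cauchy_inD(1)[OF y(1)]
      have "(\<lambda>k. p (y k \<ominus> x k) + cnorm B (h (x k) \<ominus>\<^bsub>B\<^esub> b)) \<longlonglongrightarrow> 0"
        using tendsto_add[OF y(2)[unfolded asymp_def] b'(3)] by simp
      then have "(\<lambda>k. cnorm B (h (y k) \<ominus>\<^bsub>B\<^esub> b)) \<longlonglongrightarrow> 0"
      proof (rule null_bound)
        show "0 \<le> cnorm B (h (y k) \<ominus>\<^bsub>B\<^esub> b)" for k using yc b'(2) by simp
        show "cnorm B (h (y k) \<ominus>\<^bsub>B\<^esub> b) \<le> p (y k \<ominus> x k) + cnorm B (h (x k) \<ominus>\<^bsub>B\<^esub> b)" for k
          using B.p_triangle[of "h (y k)" "h (x k)" b] hd[OF yc xc, of k k] yc xc b'(2) by force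
      qed
      then show ?thesis using yc b'(2) by (simp add: B.lim_in_def)
    qed
    have "f (cls x) = b" unfolding f_def
    proof (rule the_equality)
      show "\<forall>y\<in>cls x. B.lim_in (\<lambda>k. h (y k)) b" using all by blast
      fix b2 assume "\<forall>y\<in>cls x. B.lim_in (\<lambda>k. h (y k)) b2"
      then have "B.lim_in (\<lambda>k. h (x k)) b2" using self_mem_cls[OF x] by blast
      then show "b2 = b" by (rule B.lim_in_eq[OF _ b])
    qed
    then show ?thesis using b by simp
  qed
  note fc = B.lim_inD(2)[OF f]
  have femb: "f (emb a) = h a" if "a \<in> carrier A" for a
    unfolding emb_def by (rule B.lim_in_eq[OF f B.lim_in_const]) (use that cauchy_const in auto)
  have "f \<in> star_hom C B"
  proof (rule star_homI)
    show "f \<one>\<^bsub>C\<^esub> = \<one>\<^bsub>B\<^esub>" using femb[of \<one>] by (simp add: emb.hom_one h.hom_one)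
    fix X assume "X \<in> carrier C"
    then obtain x where x: "cauchy_in A p x" "X = cls x" by (rule completion_cases)
    note xc = cauchy_inD(1)[OF x(1)]
    show "f X \<in> carrier B" using fc x by simp
    have "B.lim_in (\<lambda>k. h (star A (x k))) (star B (f X))"
      using B.lim_in_star[OF f[OF x(1)]] xc x(2) by (simp add: h.hom_star)
    then show "f (star C X) = star B (f X)"
      using B.lim_in_eq[OF f[OF cauchy_star[OF x(1)]]] x by (simp add: cls_ops)
    have "B.lim_in (\<lambda>k. h (c \<odot> x k)) (c \<odot>\<^bsub>B\<^esub> f X)" for c
      using B.lim_in_scale[OF f[OF x(1)]] xc x(2) by (simp add: h.hom_scale)
    then show "f (c \<odot>\<^bsub>C\<^esub> X) = c \<odot>\<^bsub>B\<^esub> f X" for c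
      using B.lim_in_eq[OF f[OF cauchy_scale[OF x(1)]]] x by (simp add: cls_ops)
    fix Y assume "Y \<in> carrier C"
    then obtain y where y: "cauchy_in A p y" "Y = cls y" by (rule completion_cases)
    note yc = cauchy_inD(1)[OF y(1)]
    have "B.lim_in (\<lambda>k. h (x k \<oplus> y k)) (f X \<oplus>\<^bsub>B\<^esub> f Y)"
      using B.lim_in_add[OF f[OF x(1)] f[OF y(1)]] xc yc x(2) y(2) by (simp add: h.hom_add)
    then show "f (X \<oplus>\<^bsub>C\<^esub> Y) = f X \<oplus>\<^bsub>B\<^esub> f Y"
      using B.lim_in_eq[OF f[OF cauchy_add[OF x(1) y(1)]]] x y by (simp add: cls_ops)
    have "B.lim_in (\<lambda>k. h (x k \<otimes> y k)) (f X \<otimes>\<^bsub>B\<^esub> f Y)"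
      using B.lim_in_mult[OF f[OF x(1)] f[OF y(1)]] xc yc x(2) y(2) by (simp add: h.hom_mult)
    then show "f (X \<otimes>\<^bsub>C\<^esub> Y) = f X \<otimes>\<^bsub>B\<^esub> f Y"
      using B.lim_in_eq[OF f[OF cauchy_mult[OF x(1) y(1)]]] x y by (simp add: cls_ops)
  qed
  with femb show ?thesis by blast
qed

end

section \<open>Free star-algebras\<close>

lemma letters_plus [simp]: "letters (v + w) = letters v @ letters w"
  and letters_zero [simp]: "letters 0 = []"
  by (simp_all add: plus_word_def zero_word_def)

lemma letters_word_star: "letters (word_star w) = rev (map (\<lambda>(g, b). (g, \<not> b)) (letters w))"
  by (simp add: word_star_def)

lemma word_star_involution [simp]: "word_star (word_star w) = w"
  by (cases w) (simp add: word_star_def rev_map[symmetric] case_prod_beta comp_def)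

lemma word_star_plus: "word_star (v + w) = word_star w + word_star v"
  and word_star_zero [simp]: "word_star 0 = 0"
  by (simp_all add: word_star_def plus_word_def zero_word_def)

lemma word_star_eq_iff: "word_star v = w \<longleftrightarrow> v = word_star w"
  by auto

definition words_over :: "'g set \<Rightarrow> 'g word set" where
  "words_over G = {w. fst ` set (letters w) \<subseteq> G}"

lemma words_over_plus: "v \<in> words_over G \<Longrightarrow> w \<in> words_over G \<Longrightarrow> v + w \<in> words_over G"
  and words_over_zero: "0 \<in> words_over G"
  and words_over_star: "w \<in> words_over G \<Longrightarrow> word_star w \<in> words_over G"
  by (force simp: words_over_def letters_word_star image_image case_prod_beta)+

text \<open>A copy of the field \<open>star\<close> without the parameter \<open>G\<close>, so that
  its laws are stated once for all generating sets.\<close>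

definition free_star :: "'g free_alg \<Rightarrow> 'g free_alg" where
  "free_star p = (\<Sum>w\<in>Poly_Mapping.keys p.
     Poly_Mapping.single (word_star w) (cnj (Poly_Mapping.lookup p w)))"

lemma free_simps [simp]:
  "mult (free_star_algebra G) = (*)" "one (free_star_algebra G) = 1"
  "zero (free_star_algebra G) = 0" "add (free_star_algebra G) = (+)"
  "smult (free_star_algebra G) = (\<lambda>c p. Poly_Mapping.single 0 c * p)"
  "star (free_star_algebra G) = free_star"
  by (simp_all add: free_star_algebra_def free_star_def fun_eq_iff)

lemma free_carrier: "p \<in> carrier (free_star_algebra G) \<longleftrightarrow> Poly_Mapping.keys p \<subseteq> words_over G"
  by (auto simp: free_star_algebra_def words_over_def)

lemma single_in_free: "w \<in> words_over G \<Longrightarrow> Poly_Mapping.single w c \<in> carrier (free_star_algebra G)"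
  by (simp add: free_carrier)

lemma sum_of_singles: "(\<Sum>w\<in>Poly_Mapping.keys p. Poly_Mapping.single w (Poly_Mapping.lookup p w)) = p"
proof (rule poly_mapping_eqI)
  fix v
  have "Poly_Mapping.lookup (\<Sum>w\<in>Poly_Mapping.keys p. Poly_Mapping.single w (Poly_Mapping.lookup p w)) v
      = (\<Sum>w\<in>Poly_Mapping.keys p. if v = w then Poly_Mapping.lookup p w else 0)"
    unfolding lookup_sum by (intro sum.cong refl) (auto simp: lookup_single when_def)
  also have "\<dots> = Poly_Mapping.lookup p v" by (simp add: in_keys_iff)
  finally show "Poly_Mapping.lookup (\<Sum>w\<in>Poly_Mapping.keys p. Poly_Mapping.single w (Poly_Mapping.lookup p w)) v
      = Poly_Mapping.lookup p v" .
qed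

lemma free_induct [consumes 1, case_names zero add]:
  assumes p: "p \<in> carrier (free_star_algebra G)" and zero: "P 0"
    and add: "\<And>p w c. p \<in> carrier (free_star_algebra G) \<Longrightarrow> w \<in> words_over G \<Longrightarrow> P p \<Longrightarrow>
      P (p + Poly_Mapping.single w c)"
  shows "P p"
proof -
  have "P (\<Sum>w\<in>K. Poly_Mapping.single w (f w)) \<and>
      (\<Sum>w\<in>K. Poly_Mapping.single w (f w)) \<in> carrier (free_star_algebra G)"
    if "finite K" "K \<subseteq> words_over G" for K and f :: "'a word \<Rightarrow> complex"
    using that
  proof (induction K rule: finite_induct)
    case empty
    then show ?case using zero by (simp add: free_carrier)
  next
    case (insert w K)
    let ?s = "\<Sum>w\<in>K. Poly_Mapping.single w (f w)"
    have eq: "(\<Sum>w\<in>insert w K. Poly_Mapping.single w (f w)) = ?s + Poly_Mapping.single w (f w)"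
      using insert by (simp add: add.commute)
    have "?s + Poly_Mapping.single w (f w) \<in> carrier (free_star_algebra G)"
      using insert keys_add[of ?s "Poly_Mapping.single w (f w)"]
      by (auto simp: free_carrier split: if_splits)
    then show ?case unfolding eq using insert add by auto
  qed
  from this[of "Poly_Mapping.keys p" "Poly_Mapping.lookup p"] show ?thesis
    using p by (simp add: free_carrier sum_of_singles)
qed

lemma free_induct_UNIV [case_names zero add]:
  assumes "P 0" "\<And>p w c. P p \<Longrightarrow> P (p + Poly_Mapping.single w c)"
  shows "P (p :: 'g free_alg)"
proof -
  have "p \<in> carrier (free_star_algebra UNIV)" by (auto simp: free_carrier words_over_def)
  then show ?thesis by (induction rule: free_induct) (use assms in auto)
qed

lemma lookup_free_star: "Poly_Mapping.lookup (free_star p) w = cnj (Poly_Mapping.lookup p (word_star w))"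
proof -
  have "Poly_Mapping.lookup (free_star p) w
      = (\<Sum>v\<in>Poly_Mapping.keys p. if word_star w = v then cnj (Poly_Mapping.lookup p v) else 0)"
    unfolding free_star_def lookup_sum
    by (intro sum.cong refl) (auto simp: lookup_single when_def word_star_eq_iff)
  also have "\<dots> = cnj (Poly_Mapping.lookup p (word_star w))" by (simp add: in_keys_iff)
  finally show ?thesis .
qed

lemma free_star_add: "free_star (p + q) = free_star p + free_star q"
  by (rule poly_mapping_eqI) (simp add: lookup_free_star lookup_add)

lemma free_star_star: "free_star (free_star p) = p"
  by (rule poly_mapping_eqI) (simp add: lookup_free_star)

lemma free_star_single: "free_star (Poly_Mapping.single w c) = Poly_Mapping.single (word_star w) (cnj c)"
  by (rule poly_mapping_eqI) (auto simp: lookup_free_star lookup_single when_def)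

lemma free_star_zero: "free_star 0 = 0"
  by (rule poly_mapping_eqI) (simp add: lookup_free_star)

lemma free_star_mult: "free_star (p * q) = free_star q * free_star p"
proof (induction p rule: free_induct_UNIV)
  case (add p v a)
  have "free_star (Poly_Mapping.single v a * q) = free_star q * free_star (Poly_Mapping.single v a)"
    by (induction q rule: free_induct_UNIV)
      (simp_all add: free_star_zero distrib_left distrib_right free_star_add mult_single free_star_single
        word_star_plus mult.commute)
  then show ?case using add by (simp add: distrib_left distrib_right free_star_add)
qed (simp add: free_star_zero)

text \<open>Scalar multiplication is multiplication by a multiple of the empty word; scalars can be
  pulled out of a right factor because these elements are central.\<close>

lemma scalar_central: "Poly_Mapping.single 0 c * p = p * Poly_Mapping.single (0 :: 'g word) (c :: complex)"
  by (induction p rule: free_induct_UNIV) (simp_all add: distrib_left distrib_right mult_single mult.commute)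

lemma free_mult_closed:
  "p \<in> carrier (free_star_algebra G) \<Longrightarrow> q \<in> carrier (free_star_algebra G) \<Longrightarrow>
     p * q \<in> carrier (free_star_algebra G)"
  using keys_mult[of p q] words_over_plus unfolding free_carrier by blast

lemma free_add_closed:
  "p \<in> carrier (free_star_algebra G) \<Longrightarrow> q \<in> carrier (free_star_algebra G) \<Longrightarrow>
     p + q \<in> carrier (free_star_algebra G)"
  using keys_add[of p q] unfolding free_carrier by blast

lemma free_star_closed:
  assumes "p \<in> carrier (free_star_algebra G)"
  shows "free_star p \<in> carrier (free_star_algebra G)"
proof -
  have "w \<in> words_over G" if "w \<in> Poly_Mapping.keys (free_star p)" for w
    using that assms words_over_star[of "word_star w" G] by (auto simp: free_carrier in_keys_iff lookup_free_star)
  then show ?thesis by (auto simp: free_carrier)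
qed

lemma free_star_algebra: "star_algebra (free_star_algebra G)"
proof -
  note closed = free_mult_closed free_add_closed free_star_closed single_in_free[OF words_over_zero]
  have one: "1 \<in> carrier (free_star_algebra G)" and zero: "0 \<in> carrier (free_star_algebra G)"
    by (simp_all add: free_carrier words_over_zero)
  have "\<exists>q\<in>carrier (free_star_algebra G). q + p = 0" if "p \<in> carrier (free_star_algebra G)" for p
    by (rule bexI[of _ "Poly_Mapping.single 0 (-1) * p"])
      (simp add: single_uminus, intro closed that)
  then have ab: "abelian_group (free_star_algebra G)"
    by (intro abelian_groupI) (simp_all add: closed zero add.assoc add.commute)
  moreover have "Group.monoid (free_star_algebra G)"
    by (rule monoidI) (simp_all add: closed one mult.assoc)
  ultimately have "ring (free_star_algebra G)"
    by (rule ringI) (simp_all add: distrib_left distrib_right)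
  moreover have "module complex_ring (free_star_algebra G)"
    by (rule moduleI[OF cring_complex_ring ab])
      (simp_all add: closed single_add distrib_left distrib_right mult_single flip: mult.assoc)
  moreover have "star_algebra_axioms (free_star_algebra G)"
  proof (unfold_locales, simp_all add: closed free_star_star free_star_add free_star_mult mult.assoc)
    show "p * (Poly_Mapping.single 0 c * q) = Poly_Mapping.single 0 c * (p * q)" for c and p q :: "'a free_alg"
      by (metis scalar_central mult.assoc)
    show "free_star p * free_star (Poly_Mapping.single 0 c) = Poly_Mapping.single 0 (cnj c) * free_star p"
      for c and p :: "'a free_alg"
      by (simp add: free_star_single scalar_central)
  qed
  ultimately show ?thesis by (rule star_algebra.intro)
qed

lemma gen_closed: "g \<in> G \<Longrightarrow> gen g \<in> carrier (free_star_algebra G)"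
  by (simp add: gen_def single_in_free words_over_def)

text \<open>Each word is a product of letters, and a starred letter is the adjoint of a generator;
  so a property that the star-algebra operations preserve needs to be checked only on the unit and
  on \<open>gen g\<close>.\<close>

lemma free_generated [consumes 1, case_names gen one add mult scale star]:
  assumes p: "p \<in> carrier (free_star_algebra G)"
    and gen: "\<And>g. g \<in> G \<Longrightarrow> P (gen g)" and one: "P 1"
    and add: "\<And>p q. p \<in> carrier (free_star_algebra G) \<Longrightarrow> q \<in> carrier (free_star_algebra G) \<Longrightarrow>
      P p \<Longrightarrow> P q \<Longrightarrow> P (p + q)"
    and mult: "\<And>p q. p \<in> carrier (free_star_algebra G) \<Longrightarrow> q \<in> carrier (free_star_algebra G) \<Longrightarrow>
      P p \<Longrightarrow> P q \<Longrightarrow> P (p * q)"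
    and scale: "\<And>c p. p \<in> carrier (free_star_algebra G) \<Longrightarrow> P p \<Longrightarrow> P (Poly_Mapping.single 0 c * p)"
    and star: "\<And>p. p \<in> carrier (free_star_algebra G) \<Longrightarrow> P p \<Longrightarrow> P (free_star p)"
  shows "P p"
proof -
  have letter: "P (Poly_Mapping.single (Word [(g, b)]) 1)" if "g \<in> G" for g b
    using gen[OF that] star[OF gen_closed[OF that] gen[OF that]]
    by (cases b) (simp_all add: gen_def free_star_single word_star_def)
  have word: "P (Poly_Mapping.single (Word ls) 1)" if "Word ls \<in> words_over G" for ls
    using that
  proof (induction ls)
    case Nil
    then show ?case using one by (simp flip: zero_word_def)
  next
    case (Cons l ls)
    obtain g b where l: "l = (g, b)" by (cases l)
    have g: "g \<in> G" and ls: "Word ls \<in> words_over G" using Cons.prems by (auto simp: words_over_def l)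
    have "P (Poly_Mapping.single (Word [(g, b)]) 1 * Poly_Mapping.single (Word ls) 1)"
      using g ls Cons.IH letter by (intro mult single_in_free) (auto simp: words_over_def)
    then show ?case by (simp add: mult_single plus_word_def l)
  qed
  show ?thesis using p
  proof (induction rule: free_induct)
    case zero
    \<comment> \<open>No premise covers 0, so it is produced as the scalar 0 times the unit.\<close>
    have "P (Poly_Mapping.single 0 0 * 1)" using one by (intro scale) (simp_all add: free_carrier words_over_zero)
    then show ?case by simp
  next
    case (add p w c)
    have "P (Poly_Mapping.single 0 c * Poly_Mapping.single w 1)"
      using word[of "letters w"] add single_in_free[of w G] by (intro scale) auto
    then have "P (Poly_Mapping.single w c)" by (simp add: mult_single)
    then show ?case using add single_in_free[of w G] by (intro assms(4)) auto
  qed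
qed

lemma free_hom_unique:
  assumes B: "star_algebra B" and f: "f \<in> star_hom (free_star_algebra G) B"
    and h: "h \<in> star_hom (free_star_algebra G) B"
    and eq: "\<And>g. g \<in> G \<Longrightarrow> f (gen g) = h (gen g)" and p: "p \<in> carrier (free_star_algebra G)"
  shows "f p = h p"
proof -
  interpret B: star_algebra B by fact
  interpret F: star_algebra "free_star_algebra G" by (rule free_star_algebra)
  interpret f: star_algebra_hom "free_star_algebra G" B f by unfold_locales fact
  interpret h: star_algebra_hom "free_star_algebra G" B h by unfold_locales fact
  show ?thesis using p
    by (induction rule: free_generated)
      (use eq f.hom_one h.hom_one f.hom_add h.hom_add f.hom_mult h.hom_mult f.hom_scale h.hom_scale
        f.hom_star h.hom_star in simp_all)
qed

context star_algebra
begin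

definition word_eval :: "('g \<Rightarrow> 'a) \<Rightarrow> 'g word \<Rightarrow> 'a" where
  "word_eval b w = foldr (\<lambda>(g, s) x. (if s then star A (b g) else b g) \<otimes> x) (letters w) \<one>"

definition free_eval :: "('g \<Rightarrow> 'a) \<Rightarrow> 'g free_alg \<Rightarrow> 'a" where
  "free_eval b p = (\<Oplus>w\<in>Poly_Mapping.keys p. Poly_Mapping.lookup p w \<odot> word_eval b w)"

context
  fixes b :: "'g \<Rightarrow> 'a"
  assumes b: "\<And>g. b g \<in> carrier A"
begin

lemma word_eval_closed [simp]: "word_eval b w \<in> carrier A"
proof (cases w)
  case (Word ls)
  show ?thesis unfolding Word by (induction ls) (auto simp: word_eval_def b)
qed

lemma word_eval_plus: "word_eval b (v + w) = word_eval b v \<otimes> word_eval b w"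
proof (cases v)
  case (Word ls)
  have c: "foldr (\<lambda>(g, s) x. (if s then star A (b g) else b g) \<otimes> x) ms y \<in> carrier A" if "y \<in> carrier A" for ms y
    by (induction ms) (use that in \<open>auto simp: b\<close>)
  show ?thesis unfolding Word
    by (induction ls) (auto simp: word_eval_def b mult_assoc c)
qed

lemma word_eval_star: "word_eval b (word_star w) = star A (word_eval b w)"
proof (cases w)
  case (Word ls)
  show ?thesis unfolding Word
  proof (induction ls)
    case Nil
    then show ?case by (simp add: word_eval_def word_star_def)
  next
    case (Cons l ls)
    obtain g s where l: "l = (g, s)" by (cases l)
    have 1: "Word (l # ls) = Word [l] + Word ls" by (simp add: plus_word_def)
    have 2: "word_eval b (word_star (Word [l])) = star A (word_eval b (Word [l]))"
      by (simp add: l word_eval_def word_star_def b)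
    show ?case unfolding 1 word_star_plus word_eval_plus 2 Cons by (simp add: star_mult)
  qed
qed

lemma word_eval_zero: "word_eval b 0 = \<one>"
  by (simp add: word_eval_def)

lemma free_eval_closed [simp]: "free_eval b p \<in> carrier A"
  by (simp add: free_eval_def)

text \<open>Different polynomials have different supports; summing over a common finite superset
  makes additivity a termwise statement.\<close>

lemma free_eval_superset:
  "finite K \<Longrightarrow> Poly_Mapping.keys p \<subseteq> K \<Longrightarrow>
     free_eval b p = (\<Oplus>w\<in>K. Poly_Mapping.lookup p w \<odot> word_eval b w)"
  unfolding free_eval_def by (rule sum_restrict[symmetric]) (auto simp: in_keys_iff)

lemma free_eval_add: "free_eval b (p + q) = free_eval b p \<oplus> free_eval b q"
proof -
  let ?K = "Poly_Mapping.keys p \<union> Poly_Mapping.keys q"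
  have K: "finite ?K" "Poly_Mapping.keys (p + q) \<subseteq> ?K" using keys_add[of p q] by auto
  have "free_eval b (p + q)
      = (\<Oplus>w\<in>?K. Poly_Mapping.lookup p w \<odot> word_eval b w \<oplus> Poly_Mapping.lookup q w \<odot> word_eval b w)"
    by (simp only: free_eval_superset[OF K] lookup_add) (simp add: scale_add_left)
  also have "\<dots> = free_eval b p \<oplus> free_eval b q"
    by (subst sum_add) (simp_all add: free_eval_superset[OF K(1)])
  finally show ?thesis .
qed

lemma free_eval_single: "free_eval b (Poly_Mapping.single w c) = c \<odot> word_eval b w"
  by (subst free_eval_superset[of "{w}"]) (simp_all add: sum_insert alg_r_zero)

lemma free_eval_zero: "free_eval b 0 = \<zero>"
  by (simp add: free_eval_def)

lemma free_eval_mult: "free_eval b (p * q) = free_eval b p \<otimes> free_eval b q"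
proof (induction p rule: free_induct_UNIV)
  case (add p v a)
  have "free_eval b (Poly_Mapping.single v a * q) = free_eval b (Poly_Mapping.single v a) \<otimes> free_eval b q"
    by (induction q rule: free_induct_UNIV)
      (simp_all add: free_eval_zero Rings.distrib_left distrib_left free_eval_add mult_single free_eval_single
        word_eval_plus scale_mult_left scale_mult_right mult.commute)
  then show ?case using add by (simp add: Rings.distrib_right distrib_right free_eval_add)
qed (simp add: free_eval_zero)

lemma free_eval_star: "free_eval b (free_star p) = star A (free_eval b p)"
  by (induction p rule: free_induct_UNIV)
    (simp_all add: free_eval_zero free_star_zero free_star_add free_eval_add star_add free_star_single
      free_eval_single word_eval_star star_smult)

lemma free_eval_hom: "free_eval b \<in> star_hom (free_star_algebra G) A"
proof (rule star_homI)
  have "free_eval b (Poly_Mapping.single 0 1) = \<one>" by (simp add: free_eval_single word_eval_zero del: single_one)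
  then show "free_eval b \<one>\<^bsub>free_star_algebra G\<^esub> = \<one>" by simp
qed (simp_all add: free_eval_add free_eval_mult free_eval_star free_eval_single word_eval_zero scale_mult_left)

lemma free_eval_gen: "free_eval b (gen g) = b g"
  by (simp add: gen_def free_eval_single word_eval_def b)

end

theorem free_hom_exists:
  assumes "\<And>g. g \<in> G \<Longrightarrow> b g \<in> carrier A"
  obtains h where "h \<in> star_hom (free_star_algebra G) A" "\<And>g. g \<in> G \<Longrightarrow> h (gen g) = b g"
proof -
  \<comment> \<open>Evaluation is set up for maps with all values in the carrier, so
    \<open>b\<close> is extended by 0 outside \<open>G\<close>.\<close>
  define b' where "b' g = (if g \<in> G then b g else \<zero>)" for g
  have b': "b' g \<in> carrier A" for g using assms by (simp add: b'_def)
  show ?thesis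
    by (rule that[OF free_eval_hom[of b', OF b']]) (simp add: free_eval_gen[of b', OF b'] b'_def)
qed

end

section \<open>Universal C*-algebras\<close>

definition admissible :: "'g set \<Rightarrow> 'g free_alg set \<Rightarrow> ('g free_alg \<Rightarrow> real) \<Rightarrow> bool" where
  "admissible G R q \<longleftrightarrow> cstar_seminorm (free_star_algebra G) q \<and> (\<forall>r\<in>R. q r = 0)"

text \<open>Boundedness is demanded of generators only; \<open>seminorms_bounded\<close> spreads it
  to the whole free algebra, so that the supremum defining \<open>max_seminorm\<close> is finite
  everywhere.\<close>

locale presentation =
  fixes G :: "'g set" and R :: "'g free_alg set"
  assumes rels_closed: "R \<subseteq> carrier (free_star_algebra G)"
    and gen_bounded: "g \<in> G \<Longrightarrow> \<exists>C. \<forall>q. admissible G R q \<longrightarrow> q (gen g) \<le> C"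
begin

abbreviation F :: "'g free_alg star_alg" where
  "F \<equiv> free_star_algebra G"

abbreviation U :: "'g free_alg completion cstar_alg" where
  "U \<equiv> universal_cstar G R"

lemma admissible_seminormed: "admissible G R q \<Longrightarrow> cstar_seminormed F q"
  by (rule cstar_seminormed.intro[OF free_star_algebra cstar_seminormed_axioms.intro])
    (simp add: admissible_def)

lemma seminorms_bounded:
  assumes "p \<in> carrier F"
  shows "\<exists>C. \<forall>q. admissible G R q \<longrightarrow> q p \<le> C"
  using assms
proof (induction rule: free_generated)
  case (gen g)
  then show ?case by (rule gen_bounded)
next
  case one
  have "q 1 \<le> 1" if "admissible G R q" for q
    using cstar_seminormed.p_one_le[OF admissible_seminormed[OF that]] by simp
  then show ?case by blast
next
  case (add p p')
  then obtain C C' where C: "\<And>q. admissible G R q \<Longrightarrow> q p \<le> C" "\<And>q. admissible G R q \<Longrightarrow> q p' \<le> C'"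
    by blast
  have "q (p + p') \<le> C + C'" if "admissible G R q" for q
    using cstar_seminormed.p_add[OF admissible_seminormed[OF that], of p p'] C[OF that] add by simp
  then show ?case by blast
next
  case (mult p p')
  then obtain C C' where C: "\<And>q. admissible G R q \<Longrightarrow> q p \<le> C" "\<And>q. admissible G R q \<Longrightarrow> q p' \<le> C'"
    by blast
  have "q (p * p') \<le> \<bar>C\<bar> * \<bar>C'\<bar>" if "admissible G R q" for q
  proof -
    interpret cstar_seminormed F q by (rule admissible_seminormed[OF that])
    have "q (p * p') \<le> q p * q p'" using p_mult[of p p'] mult by simp
    also have "\<dots> \<le> \<bar>C\<bar> * \<bar>C'\<bar>"
      using C[OF that] p_nonneg[of p] p_nonneg[of p'] mult by (intro mult_mono) auto
    finally show ?thesis .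
  qed
  then show ?case by blast
next
  case (scale c p)
  then obtain C where C: "\<And>q. admissible G R q \<Longrightarrow> q p \<le> C" by blast
  have "q (Poly_Mapping.single 0 c * p) \<le> cmod c * C" if "admissible G R q" for q
    using cstar_seminormed.p_scale[OF admissible_seminormed[OF that], of p c] C[OF that] scale
    by (simp add: mult_left_mono)
  then show ?case by blast
next
  case (star p)
  have "q (free_star p) = q p" if "admissible G R q" for q
    using cstar_seminormed.p_star[OF admissible_seminormed[OF that], of p] star by simp
  then show ?case using star(2) by metis
qed

abbreviation p_max :: "'g free_alg \<Rightarrow> real" where
  "p_max \<equiv> max_seminorm F R"

lemma p_max_eq: "p_max x = (SUP q\<in>{q. admissible G R q}. q x)"
  by (simp add: max_seminorm_def admissible_def)

text \<open>Keeps the supremum over a nonempty set and yields that \<open>p_max\<close> is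
  nonnegative.\<close>

lemma admissible_zero: "admissible G R (\<lambda>_. 0)"
  by (simp add: admissible_def cstar_seminorm_def)

lemma p_max_upper: "x \<in> carrier F \<Longrightarrow> admissible G R q \<Longrightarrow> q x \<le> p_max x"
  unfolding p_max_eq by (rule cSUP_upper) (use seminorms_bounded[of x] in \<open>auto simp: bdd_above_def\<close>)

lemma p_max_least: "(\<And>q. admissible G R q \<Longrightarrow> q x \<le> c) \<Longrightarrow> p_max x \<le> c"
  unfolding p_max_eq by (rule cSUP_least) (use admissible_zero in auto)

text \<open>The inequalities pass to a pointwise supremum directly. The reverse halves of
  homogeneity and of the C*-identity take a detour: each admissible \<open>q x\<close> is first
  bounded by a quotient by \<open>cmod c\<close>, respectively by a square root, and only then is
  the supremum taken.\<close>

lemma p_max_seminorm: "cstar_seminorm F p_max"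
proof -
  interpret F: star_algebra F by (rule free_star_algebra)
  note adm = admissible_seminormed
  have nonneg: "0 \<le> p_max x" if "x \<in> carrier F" for x
    using p_max_upper[OF that admissible_zero] by simp
  show ?thesis
    unfolding cstar_seminorm_def
  proof (intro conjI ballI allI)
    fix x assume x: "x \<in> carrier F"
    show "0 \<le> p_max x" by (rule nonneg[OF x])
    show "p_max (c \<odot>\<^bsub>F\<^esub> x) = cmod c * p_max x" for c
    proof (rule antisym)
      show "p_max (c \<odot>\<^bsub>F\<^esub> x) \<le> cmod c * p_max x"
        by (rule p_max_least)
          (simp only: cstar_seminormed.p_scale[OF adm x] mult_left_mono[OF p_max_upper[OF x]] norm_ge_zero)
      show "cmod c * p_max x \<le> p_max (c \<odot>\<^bsub>F\<^esub> x)"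
      proof (cases "c = 0")
        case True
        then show ?thesis using nonneg[OF F.scale_closed[OF x, of c]] by simp
      next
        case False
        have "p_max x \<le> p_max (c \<odot>\<^bsub>F\<^esub> x) / cmod c"
        proof (rule p_max_least)
          fix q assume q: "admissible G R q"
          have "cmod c * q x \<le> p_max (c \<odot>\<^bsub>F\<^esub> x)"
            using p_max_upper[OF F.scale_closed[OF x] q, of c] cstar_seminormed.p_scale[OF adm[OF q] x, of c] by simp
          then show "q x \<le> p_max (c \<odot>\<^bsub>F\<^esub> x) / cmod c" using False by (simp add: field_simps)
        qed
        then show ?thesis using False by (simp add: field_simps)
      qed
    qed
    show "p_max (star F x \<otimes>\<^bsub>F\<^esub> x) = (p_max x)\<^sup>2"
    proof (rule antisym)
      have xx: "star F x \<otimes>\<^bsub>F\<^esub> x \<in> carrier F" using x by (intro F.mult_closed F.star_closed)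
      show "p_max (star F x \<otimes>\<^bsub>F\<^esub> x) \<le> (p_max x)\<^sup>2"
      proof (rule p_max_least)
        fix q assume q: "admissible G R q"
        show "q (star F x \<otimes>\<^bsub>F\<^esub> x) \<le> (p_max x)\<^sup>2"
          unfolding cstar_seminormed.p_star_mult[OF adm[OF q] x]
          by (intro power_mono p_max_upper[OF x q] cstar_seminormed.p_nonneg[OF adm[OF q] x])
      qed
      have "p_max x \<le> sqrt (p_max (star F x \<otimes>\<^bsub>F\<^esub> x))"
      proof (rule p_max_least)
        fix q assume q: "admissible G R q"
        have "(q x)\<^sup>2 \<le> p_max (star F x \<otimes>\<^bsub>F\<^esub> x)"
          using p_max_upper[OF xx q] unfolding cstar_seminormed.p_star_mult[OF adm[OF q] x] .
        then show "q x \<le> sqrt (p_max (star F x \<otimes>\<^bsub>F\<^esub> x))" by (rule real_le_rsqrt)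
      qed
      then have "(p_max x)\<^sup>2 \<le> (sqrt (p_max (star F x \<otimes>\<^bsub>F\<^esub> x)))\<^sup>2"
        by (intro power_mono nonneg[OF x])
      then show "(p_max x)\<^sup>2 \<le> p_max (star F x \<otimes>\<^bsub>F\<^esub> x)"
        using nonneg[OF xx] by (simp only: real_sqrt_pow2)
    qed
    fix y assume y: "y \<in> carrier F"
    show "p_max (x \<oplus>\<^bsub>F\<^esub> y) \<le> p_max x + p_max y"
    proof (rule p_max_least)
      fix q assume q: "admissible G R q"
      show "q (x \<oplus>\<^bsub>F\<^esub> y) \<le> p_max x + p_max y"
        using cstar_seminormed.p_add[OF adm[OF q] x y] p_max_upper[OF x q] p_max_upper[OF y q] by linarith
    qed
    show "p_max (x \<otimes>\<^bsub>F\<^esub> y) \<le> p_max x * p_max y"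
    proof (rule p_max_least)
      fix q assume q: "admissible G R q"
      have "q (x \<otimes>\<^bsub>F\<^esub> y) \<le> q x * q y" by (rule cstar_seminormed.p_mult[OF adm[OF q] x y])
      also have "\<dots> \<le> p_max x * p_max y"
        by (intro mult_mono p_max_upper[OF x q] p_max_upper[OF y q] nonneg[OF x]
            cstar_seminormed.p_nonneg[OF adm[OF q] y])
      finally show "q (x \<otimes>\<^bsub>F\<^esub> y) \<le> p_max x * p_max y" .
    qed
  qed
qed

lemma p_max_rel: "r \<in> R \<Longrightarrow> p_max r = 0"
  by (rule antisym[OF p_max_least]) (use p_max_upper[OF _ admissible_zero] rels_closed in \<open>auto simp: admissible_def\<close>)

end

sublocale presentation \<subseteq> cstar_completion F p_max
  by (rule cstar_completion.intro, rule cstar_seminormed.intro[OF free_star_algebra cstar_seminormed_axioms.intro])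
    (rule p_max_seminorm)

context presentation
begin

lemma universal_cstar_algebra: "cstar_algebra U"
  unfolding universal_cstar_def by (rule completion_cstar_algebra)

lemma universal_gen_eq: "universal_gen G R g = emb (gen g)"
  by (simp add: universal_gen_def emb_def)

lemma universal_hom: "emb \<in> star_hom F U"
  unfolding universal_cstar_def by (rule emb_hom)

lemma universal_rel: "r \<in> R \<Longrightarrow> emb r = \<zero>\<^bsub>U\<^esub>"
proof -
  assume r: "r \<in> R"
  interpret U: cstar_algebra U by (rule universal_cstar_algebra)
  interpret E: star_algebra_hom F U emb by unfold_locales (rule universal_hom)
  have rc: "r \<in> carrier F" using r rels_closed by blast
  have "cnorm U (emb r) = 0" using cnorm_emb[OF rc] p_max_rel[OF r] by (simp add: universal_cstar_def)
  then show ?thesis using U.cnorm_definite[of "emb r"] rc by simp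
qed

lemma universal_gen_closed: "g \<in> G \<Longrightarrow> universal_gen G R g \<in> carrier U"
  unfolding universal_gen_eq universal_cstar_def by (rule emb.hom_closed[OF gen_closed])

text \<open>The norm of \<open>B\<close>, pulled back along the free homomorphism, is one of the
  seminorms under the supremum; so that homomorphism is bounded by \<open>p_max\<close> and extends
  to the completion. The premise \<open>rels\<close> speaks of all \<open>h\<close> with the
  prescribed values because the free homomorphism is only obtained inside the proof.\<close>

theorem universal_hom_exists:
  assumes B: "cstar_algebra B" and b: "\<And>g. g \<in> G \<Longrightarrow> b g \<in> carrier B"
    and rels: "\<And>h r. h \<in> star_hom F B \<Longrightarrow> (\<And>g. g \<in> G \<Longrightarrow> h (gen g) = b g) \<Longrightarrow> r \<in> R \<Longrightarrow> h r = \<zero>\<^bsub>B\<^esub>"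
  obtains f where "f \<in> star_hom U B" "\<And>g. g \<in> G \<Longrightarrow> f (universal_gen G R g) = b g"
proof -
  interpret B: cstar_algebra B by fact
  obtain h where h: "h \<in> star_hom F B" "\<And>g. g \<in> G \<Longrightarrow> h (gen g) = b g"
    using B.free_hom_exists[of G b] b by blast
  interpret h: star_algebra_hom F B h by unfold_locales fact
  have "admissible G R (\<lambda>x. cnorm B (h x))"
    using h.seminorm_pullback[OF B.seminorm] rels[OF h] by (simp add: admissible_def)
  then have "cnorm B (h x) \<le> p_max x" if "x \<in> carrier F" for x
    using p_max_upper[OF that] by blast
  then obtain f where f: "f \<in> star_hom U B" "\<And>x. x \<in> carrier F \<Longrightarrow> f (emb x) = h x"
    using completion_extension[OF B h(1)] unfolding universal_cstar_def by blast
  show ?thesis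
    by (rule that[OF f(1)]) (simp add: universal_gen_eq f(2)[OF gen_closed] h(2))
qed

theorem universal_hom_unique:
  assumes B: "cstar_algebra B" and f: "f \<in> star_hom U B" and h: "h \<in> star_hom U B"
    and eq: "\<And>g. g \<in> G \<Longrightarrow> f (universal_gen G R g) = h (universal_gen G R g)" and X: "X \<in> carrier U"
  shows "f X = h X"
proof -
  have "f (emb x) = h (emb x)" if "x \<in> carrier F" for x
  proof -
    have "(f \<circ> emb) x = (h \<circ> emb) x"
    proof (rule free_hom_unique[OF cstar_algebra.axioms(1)[OF B] _ _ _ that])
      show "f \<circ> emb \<in> star_hom F B" by (rule star_hom_compose[OF universal_hom f])
      show "h \<circ> emb \<in> star_hom F B" by (rule star_hom_compose[OF universal_hom h])
    qed (use eq in \<open>simp add: universal_gen_eq\<close>)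
    then show ?thesis by simp
  qed
  then show ?thesis
    using completion_hom_unique[OF B, of f h] f h X unfolding universal_cstar_def by blast
qed

end

section \<open>Quotients by closed ideals\<close>

lemma (in star_algebra) ideal_criterion:
  assumes "J \<subseteq> carrier A" "\<zero> \<in> J" "\<And>x y. x \<in> J \<Longrightarrow> y \<in> J \<Longrightarrow> x \<oplus> y \<in> J" "\<And>x. x \<in> J \<Longrightarrow> \<ominus> x \<in> J"
    "\<And>a x. a \<in> carrier A \<Longrightarrow> x \<in> J \<Longrightarrow> a \<otimes> x \<in> J" "\<And>a x. a \<in> carrier A \<Longrightarrow> x \<in> J \<Longrightarrow> x \<otimes> a \<in> J"
  shows "ideal J A"
proof (rule idealI[OF ring_A])
  show "subgroup J (add_monoid A)"
    using assms by (intro subgroup.intro) (auto simp: a_inv_def)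
qed (use assms in auto)

locale cstar_ideal = cstar_algebra A for A :: "('a, 'm) cstar_alg_scheme" (structure) +
  fixes I :: "'a set"
  assumes ideal: "ideal I A" and closed: "closed_in A I"
    and star_I: "x \<in> I \<Longrightarrow> star A x \<in> I"
begin

abbreviation Q :: "'a set cstar_alg" where
  "Q \<equiv> cstar_quotient A I"

abbreviation proj :: "'a \<Rightarrow> 'a set" where
  "proj x \<equiv> I +> x"

lemma I_carrier: "x \<in> I \<Longrightarrow> x \<in> carrier A"
  and I_zero: "\<zero> \<in> I"
  and I_add: "x \<in> I \<Longrightarrow> y \<in> I \<Longrightarrow> x \<oplus> y \<in> I"
  and I_minus: "x \<in> I \<Longrightarrow> \<ominus> x \<in> I"
  and I_left: "a \<in> carrier A \<Longrightarrow> x \<in> I \<Longrightarrow> a \<otimes> x \<in> I"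
  and I_right: "a \<in> carrier A \<Longrightarrow> x \<in> I \<Longrightarrow> x \<otimes> a \<in> I"
  using ideal.axioms(1)[OF ideal] additive_subgroup.a_Hcarr[of I A x] additive_subgroup.zero_closed[of I A]
    additive_subgroup.a_closed[of I A x y] additive_subgroup.a_inv_closed[of I A x]
    ideal.I_l_closed[OF ideal, of x a] ideal.I_r_closed[OF ideal, of x a]
  by auto

lemma I_scale: "x \<in> I \<Longrightarrow> c \<odot> x \<in> I"
  using I_left[of "c \<odot> \<one>" x] I_carrier[of x] by (simp add: scale_mult_left)

lemma mem_proj: "x \<in> carrier A \<Longrightarrow> y \<in> proj x \<longleftrightarrow> y \<in> carrier A \<and> y \<ominus> x \<in> I"
proof -
  assume x: "x \<in> carrier A"
  have "(h \<oplus> x) \<ominus> x = h" if "h \<in> I" for h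
    using x I_carrier[OF that] by (simp add: alg_minus_eq alg_a_assoc alg_r_neg alg_r_zero)
  moreover have "y = (y \<ominus> x) \<oplus> x" if "y \<in> carrier A"
    using x that by (simp add: alg_minus_eq alg_a_assoc alg_l_neg alg_r_zero)
  ultimately show ?thesis using x I_carrier by (auto simp: a_r_coset_def')
qed

lemma self_mem_proj: "x \<in> carrier A \<Longrightarrow> x \<in> proj x"
  by (simp add: mem_proj alg_minus_eq alg_r_neg I_zero)

lemma proj_eqI:
  assumes x: "x \<in> carrier A" and y: "y \<in> carrier A" and xy: "x \<ominus> y \<in> I"
  shows "proj x = proj y"
proof -
  have yx: "y \<ominus> x \<in> I"
    using I_minus[OF xy] x y by (simp add: alg_minus_eq alg_minus_add alg_minus_minus alg_a_comm)
  have tr: "z \<ominus> v \<in> I" if "z \<in> carrier A" "u \<in> carrier A" "v \<in> carrier A" "z \<ominus> u \<in> I" "u \<ominus> v \<in> I" for u v z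
  proof -
    have "z \<ominus> v = (z \<ominus> u) \<oplus> (u \<ominus> v)"
      using that(1-3) by (simp add: alg_minus_eq alg_a_assoc alg_r_neg1 alg_r_neg2)
    then show ?thesis using I_add that by simp
  qed
  show ?thesis
    unfolding set_eq_iff mem_proj[OF x] mem_proj[OF y] using tr[OF _ x y _ xy] tr[OF _ y x _ yx] by blast
qed

lemma proj_mem_eq: "x \<in> carrier A \<Longrightarrow> y \<in> proj x \<Longrightarrow> proj y = proj x"
  by (rule proj_eqI) (auto simp: mem_proj)

lemma quotient_carrier: "X \<in> carrier Q \<longleftrightarrow> (\<exists>x\<in>carrier A. X = proj x)"
  by (auto simp: cstar_quotient_def FactRing_def A_RCOSETS_def')

lemma proj_closed [simp]: "x \<in> carrier A \<Longrightarrow> proj x \<in> carrier Q"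
  by (auto simp: quotient_carrier)

lemma quotient_cases:
  assumes "X \<in> carrier Q"
  obtains x where "x \<in> carrier A" "X = proj x"
  using assms by (auto simp: quotient_carrier)

lemma abelian_subgroup_I: "abelian_subgroup I A"
proof -
  interpret ideal I A by (rule ideal)
  show ?thesis ..
qed

lemma proj_add: "x \<in> carrier A \<Longrightarrow> y \<in> carrier A \<Longrightarrow> proj x \<oplus>\<^bsub>Q\<^esub> proj y = proj (x \<oplus> y)"
  using abelian_subgroup.a_rcos_sum[OF abelian_subgroup_I, of x y]
  by (simp add: cstar_quotient_def FactRing_def)

lemma proj_mult: "x \<in> carrier A \<Longrightarrow> y \<in> carrier A \<Longrightarrow> proj x \<otimes>\<^bsub>Q\<^esub> proj y = proj (x \<otimes> y)"
  using ideal.rcoset_mult_add[OF ideal, of x y]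
  by (simp add: cstar_quotient_def FactRing_def)

lemma proj_scale:
  assumes x: "x \<in> carrier A"
  shows "c \<odot>\<^bsub>Q\<^esub> proj x = proj (c \<odot> x)"
  unfolding cstar_quotient_def
  by (simp, rule UN1_const[OF self_mem_proj[OF x]], rule proj_eqI)
    (use x in \<open>auto simp: mem_proj I_scale simp flip: scale_diff_right\<close>)

lemma proj_star:
  assumes x: "x \<in> carrier A"
  shows "star Q (proj x) = proj (star A x)"
  unfolding cstar_quotient_def
  by (simp, rule UN1_const[OF self_mem_proj[OF x]], rule proj_eqI)
    (use x in \<open>auto simp: mem_proj star_I simp flip: star_diff\<close>)

lemma proj_one: "\<one>\<^bsub>Q\<^esub> = proj \<one>"
  by (simp add: cstar_quotient_def FactRing_def)

lemma proj_zero: "\<zero>\<^bsub>Q\<^esub> = proj \<zero>"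
proof -
  have "proj \<zero> = I"
    using I_carrier by (auto simp: mem_proj alg_minus_eq ring.minus_zero[OF ring_A] alg_r_zero)
  then show ?thesis by (simp add: cstar_quotient_def FactRing_def)
qed

lemmas proj_ops = proj_add proj_mult proj_scale proj_star proj_one proj_zero

lemma quotient_star_algebra: "star_algebra Q"
proof -
  note [simp] = proj_ops
  have ab: "abelian_group Q"
  proof (rule abelian_groupI)
    fix X assume "X \<in> carrier Q"
    then obtain x where x: "x \<in> carrier A" "X = proj x" by (rule quotient_cases)
    have "proj (\<ominus> x) \<oplus>\<^bsub>Q\<^esub> X = \<zero>\<^bsub>Q\<^esub>" using x by (simp add: alg_l_neg)
    then show "\<exists>Y\<in>carrier Q. Y \<oplus>\<^bsub>Q\<^esub> X = \<zero>\<^bsub>Q\<^esub>" using x by (intro bexI[of _ "proj (\<ominus> x)"]) auto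
  qed (((elim quotient_cases)?, simp add: alg_a_ac alg_l_zero)+)
  moreover have "Group.monoid Q"
    by (rule monoidI; (elim quotient_cases)?; simp add: mult_assoc)
  ultimately have "ring Q"
    by (rule ringI; elim quotient_cases; simp add: distrib_left distrib_right)
  moreover have "module complex_ring Q"
    by (rule moduleI[OF cring_complex_ring ab]; elim quotient_cases;
      simp add: scale_add_left scale_add_right)
  moreover have "star_algebra_axioms Q"
    by (unfold_locales; elim quotient_cases;
      simp add: scale_mult_left scale_mult_right star_add star_mult star_smult)
  ultimately show ?thesis by (rule star_algebra.intro)
qed

lemma proj_hom: "(\<lambda>x. proj x) \<in> star_hom A Q"
  by (rule star_homI) (simp_all add: proj_ops)

lemma qnorm_eq: "cnorm Q X = (INF x\<in>X. cnorm A x)"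
  by (simp add: cstar_quotient_def)

lemma norm_bdd_below: "x \<in> carrier A \<Longrightarrow> bdd_below (cnorm A ` proj x)"
  by (rule bdd_belowI[of _ 0]) (auto simp: mem_proj)

lemma qnorm_le: "x \<in> carrier A \<Longrightarrow> y \<in> proj x \<Longrightarrow> cnorm Q (proj x) \<le> cnorm A y"
  unfolding qnorm_eq by (rule cINF_lower[OF norm_bdd_below])

lemma qnorm_le_norm: "x \<in> carrier A \<Longrightarrow> cnorm Q (proj x) \<le> cnorm A x"
  by (rule qnorm_le[OF _ self_mem_proj])

lemma qnorm_less:
  assumes x: "x \<in> carrier A" and c: "cnorm Q (proj x) < c"
  obtains y where "y \<in> proj x" "y \<in> carrier A" "proj y = proj x" "cnorm A y < c"
proof -
  have "\<exists>y\<in>proj x. cnorm A y < c"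
    using c self_mem_proj[OF x] unfolding qnorm_eq
    by (subst cINF_less_iff[symmetric]) (auto intro: norm_bdd_below[OF x])
  then show ?thesis using that mem_proj[OF x] proj_mem_eq[OF x] by blast
qed

lemma qnorm_nonneg: "x \<in> carrier A \<Longrightarrow> 0 \<le> cnorm Q (proj x)"
  unfolding qnorm_eq using self_mem_proj[of x] by (intro cINF_greatest) (auto simp: mem_proj)

lemma qnorm_add:
  assumes x: "x \<in> carrier A" and y: "y \<in> carrier A"
  shows "cnorm Q (proj (x \<oplus> y)) \<le> cnorm Q (proj x) + cnorm Q (proj y)"
proof (rule field_le_epsilon)
  fix e :: real assume e: "0 < e"
  obtain x' where x': "x' \<in> carrier A" "proj x' = proj x" "cnorm A x' < cnorm Q (proj x) + e / 2"
    using qnorm_less[OF x, of "cnorm Q (proj x) + e / 2"] e by auto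
  obtain y' where y': "y' \<in> carrier A" "proj y' = proj y" "cnorm A y' < cnorm Q (proj y) + e / 2"
    using qnorm_less[OF y, of "cnorm Q (proj y) + e / 2"] e by auto
  have "proj (x \<oplus> y) = proj (x' \<oplus> y')" using proj_add[OF x y] proj_add[OF x'(1) y'(1)] x' y' by simp
  then have "cnorm Q (proj (x \<oplus> y)) \<le> cnorm A (x' \<oplus> y')" using qnorm_le_norm x' y' by simp
  also have "\<dots> \<le> cnorm A x' + cnorm A y'" by (rule p_add[OF x'(1) y'(1)])
  finally show "cnorm Q (proj (x \<oplus> y)) \<le> cnorm Q (proj x) + cnorm Q (proj y) + e"
    using x'(3) y'(3) by simp
qed

lemma qnorm_mult:
  assumes x: "x \<in> carrier A" and y: "y \<in> carrier A"
  shows "cnorm Q (proj (x \<otimes> y)) \<le> cnorm Q (proj x) * cnorm Q (proj y)"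
proof -
  let ?e = "\<lambda>k. inverse (real (Suc k))"
  have "(\<lambda>k. (cnorm Q (proj x) + ?e k) * (cnorm Q (proj y) + ?e k))
      \<longlonglongrightarrow> (cnorm Q (proj x) + 0) * (cnorm Q (proj y) + 0)"
    by (intro tendsto_mult tendsto_add tendsto_const LIMSEQ_inverse_real_of_nat)
  moreover have "cnorm Q (proj (x \<otimes> y)) \<le> (cnorm Q (proj x) + ?e k) * (cnorm Q (proj y) + ?e k)" for k
  proof -
    obtain x' where x': "x' \<in> carrier A" "proj x' = proj x" "cnorm A x' < cnorm Q (proj x) + ?e k"
      using qnorm_less[OF x, of "cnorm Q (proj x) + ?e k"] by auto
    obtain y' where y': "y' \<in> carrier A" "proj y' = proj y" "cnorm A y' < cnorm Q (proj y) + ?e k"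
      using qnorm_less[OF y, of "cnorm Q (proj y) + ?e k"] by auto
    have "proj (x \<otimes> y) = proj (x' \<otimes> y')" using proj_mult[OF x y] proj_mult[OF x'(1) y'(1)] x' y' by simp
    then have "cnorm Q (proj (x \<otimes> y)) \<le> cnorm A (x' \<otimes> y')" using qnorm_le_norm x' y' by simp
    also have "\<dots> \<le> cnorm A x' * cnorm A y'" by (rule p_mult[OF x'(1) y'(1)])
    also have "\<dots> \<le> (cnorm Q (proj x) + ?e k) * (cnorm Q (proj y) + ?e k)"
      using x'(3) y'(3) qnorm_nonneg[OF x] p_nonneg[OF x'(1)] p_nonneg[OF y'(1)] by (intro mult_mono) linarith+
    finally show ?thesis .
  qed
  ultimately show ?thesis
    using LIMSEQ_le_const[of _ "cnorm Q (proj x) * cnorm Q (proj y)"] by simp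
qed

lemma qnorm_scale_le:
  assumes x: "x \<in> carrier A"
  shows "cnorm Q (proj (c \<odot> x)) \<le> cmod c * cnorm Q (proj x)"
proof (cases "c = 0")
  case True
  then show ?thesis using qnorm_le_norm[of \<zero>] x by simp
next
  case False
  have "cnorm Q (proj (c \<odot> x)) / cmod c \<le> cnorm Q (proj x)"
    unfolding qnorm_eq[of "proj x"]
  proof (rule cINF_greatest)
    fix y assume y: "y \<in> proj x"
    have yc: "y \<in> carrier A" using y x by (simp add: mem_proj)
    have "proj (c \<odot> x) = proj (c \<odot> y)" using proj_scale[OF x] proj_scale[OF yc] proj_mem_eq[OF x y] by metis
    then have "cnorm Q (proj (c \<odot> x)) \<le> cmod c * cnorm A y"
      using qnorm_le_norm[of "c \<odot> y"] yc by (simp add: p_scale)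
    then show "cnorm Q (proj (c \<odot> x)) / cmod c \<le> cnorm A y" using False by (simp add: field_simps)
  qed (use self_mem_proj[OF x] in blast)
  then show ?thesis using False by (simp add: field_simps)
qed

lemma qnorm_scale:
  assumes x: "x \<in> carrier A"
  shows "cnorm Q (proj (c \<odot> x)) = cmod c * cnorm Q (proj x)"
proof (cases "c = 0")
  case True
  then show ?thesis using qnorm_scale_le[OF x, of 0] qnorm_nonneg[of "0 \<odot> x"] x by simp
next
  case False
  then have "cnorm Q (proj x) \<le> cnorm Q (proj (c \<odot> x)) / cmod c"
    using qnorm_scale_le[of "c \<odot> x" "1 / c"] x by (simp add: norm_divide)
  then have "cmod c * cnorm Q (proj x) \<le> cnorm Q (proj (c \<odot> x))"
    using False by (simp add: field_simps)
  then show ?thesis using qnorm_scale_le[OF x, of c] by simp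
qed

lemma qnorm_star_le:
  assumes x: "x \<in> carrier A"
  shows "cnorm Q (proj (star A x)) \<le> cnorm Q (proj x)"
  unfolding qnorm_eq[of "proj x"]
proof (rule cINF_greatest)
  fix y assume y: "y \<in> proj x"
  have yc: "y \<in> carrier A" using y x by (simp add: mem_proj)
  have "proj (star A x) = proj (star A y)" using proj_star[OF x] proj_star[OF yc] proj_mem_eq[OF x y] by metis
  then show "cnorm Q (proj (star A x)) \<le> cnorm A y" using qnorm_le_norm[of "star A y"] yc by simp
qed (use self_mem_proj[OF x] in blast)

text \<open>The difficult half compares \<open>x\<close> with \<open>h\<close>, the product of
  \<open>star A x\<close> and \<open>x\<close>. A nearly optimal representative of \<open>h\<close>
  can be made self-adjoint, so \<open>h = d - y\<close> with \<open>y\<close> self-adjoint in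
  \<open>I\<close>. By \<open>damping\<close> there is a contraction \<open>w\<close> with
  \<open>1 - w\<close> in \<open>I\<close> and \<open>y w\<close> small; \<open>x w\<close> then
  represents the class of \<open>x\<close>, and its squared norm, that of the product of
  \<open>star A w\<close>, \<open>h\<close> and \<open>w\<close>, is at most the norm of
  \<open>d\<close> plus that of \<open>y w\<close>.\<close>

lemma qnorm_star_mult:
  assumes x: "x \<in> carrier A"
  shows "cnorm Q (proj (star A x \<otimes> x)) = (cnorm Q (proj x))\<^sup>2"
proof (rule antisym)
  have "cnorm Q (proj (star A x \<otimes> x)) \<le> cnorm Q (proj (star A x)) * cnorm Q (proj x)"
    by (rule qnorm_mult) (use x in auto)
  also have "\<dots> \<le> cnorm Q (proj x) * cnorm Q (proj x)"
    by (rule mult_right_mono[OF qnorm_star_le[OF x] qnorm_nonneg[OF x]])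
  finally show "cnorm Q (proj (star A x \<otimes> x)) \<le> (cnorm Q (proj x))\<^sup>2" by (simp add: power2_eq_square)
next
  define h where "h = star A x \<otimes> x"
  have h: "h \<in> carrier A" "star A h = h" using x by (simp_all add: h_def star_mult)
  show "(cnorm Q (proj x))\<^sup>2 \<le> cnorm Q (proj (star A x \<otimes> x))"
    unfolding h_def[symmetric]
  proof (rule field_le_epsilon)
    fix e :: real assume e: "0 < e"
    obtain b where b: "b \<in> carrier A" "b \<in> proj h" "cnorm A b < cnorm Q (proj h) + e / 2"
      using qnorm_less[OF h(1), of "cnorm Q (proj h) + e / 2"] e by auto
    \<comment> \<open>Averaging \<open>b - h\<close> with its adjoint keeps it in \<open>I\<close>;
      since \<open>h\<close> is self-adjoint, \<open>h + y\<close> is the real part of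
      \<open>b\<close>, of no larger norm.\<close>
    define y where "y = (1/2) \<odot> ((b \<ominus> h) \<oplus> star A (b \<ominus> h))"
    have bh: "b \<ominus> h \<in> I" using b h by (simp add: mem_proj)
    have y: "y \<in> carrier A" "star A y = y" and yI: "y \<in> I"
      using b h bh I_scale I_add star_I by (simp_all add: y_def star_smult star_add alg_a_comm)
    define d where "d = (1/2) \<odot> (b \<oplus> star A b)"
    have d: "d \<in> carrier A" using b by (simp add: d_def)
    have hd: "h = d \<ominus> y"
    proof -
      have "(b \<ominus> h) \<oplus> star A (b \<ominus> h) = (b \<oplus> star A b) \<ominus> (h \<oplus> h)"
        using b h by (simp add: star_add star_minus alg_minus_eq alg_minus_add alg_a_ac)
      then have "y = d \<ominus> (1/2) \<odot> (h \<oplus> h)" using b h by (simp add: y_def d_def scale_diff_right)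
      also have "(1/2) \<odot> (h \<oplus> h) = h" using h scale_collect(1)[of h "1/2" "1/2"] by (simp add: scale_add_right)
      finally show ?thesis using d h by (simp add: alg_minus_eq alg_minus_add alg_minus_minus alg_r_neg1 alg_r_neg2)
    qed
    have dn: "cnorm A d < cnorm Q (proj h) + e / 2"
      using p_add[of b "star A b"] b by (simp add: d_def p_scale)
    obtain w z where w: "w \<in> carrier A" "z \<in> carrier A" "cnorm A w \<le> 1" "cnorm A (y \<otimes> w) \<le> e / 2"
      "\<one> \<ominus> w = y \<otimes> z"
      using damping[OF y, of "e / 2"] e by auto
    have "x \<ominus> x \<otimes> w = x \<otimes> (\<one> \<ominus> w)" using x w(1) by (simp add: diff_distrib_left)
    also have "\<dots> \<in> I" unfolding w(5) using yI x w by (intro I_left I_right)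
    finally have "proj x = proj (x \<otimes> w)" using x w(1) by (intro proj_eqI) auto
    then have "cnorm Q (proj x) \<le> cnorm A (x \<otimes> w)" using qnorm_le_norm x w by simp
    then have "(cnorm Q (proj x))\<^sup>2 \<le> (cnorm A (x \<otimes> w))\<^sup>2" by (intro power_mono qnorm_nonneg[OF x])
    also have "\<dots> = cnorm A (star A w \<otimes> h \<otimes> w)"
      using x w by (simp add: h_def star_mult mult_assoc flip: p_star_mult)
    also have "star A w \<otimes> h \<otimes> w = star A w \<otimes> d \<otimes> w \<ominus> star A w \<otimes> (y \<otimes> w)"
      unfolding hd using w d y by (simp add: diff_distrib_left diff_distrib_right mult_assoc)
    also have "cnorm A \<dots> \<le> cnorm A (star A w \<otimes> d \<otimes> w) + cnorm A (star A w \<otimes> (y \<otimes> w))"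
      by (rule p_diff) (use w d y in auto)
    also have "cnorm A (star A w \<otimes> d \<otimes> w) \<le> 1 * cnorm A d * 1"
      using w d by (intro order_trans[OF p_mult] mult_mono) auto
    also have "cnorm A (star A w \<otimes> (y \<otimes> w)) \<le> 1 * (e / 2)"
      using p_mult[of "star A w" "y \<otimes> w"] mult_mono[OF w(3,4)] w(1) y(1) by simp
    finally show "(cnorm Q (proj x))\<^sup>2 \<le> cnorm Q (proj h) + e" using dn by simp
  qed
qed

lemma quotient_seminorm: "cstar_seminorm Q (cnorm Q)"
  unfolding cstar_seminorm_def
  by (intro conjI ballI allI; elim quotient_cases;
    simp add: proj_ops qnorm_nonneg qnorm_add qnorm_mult qnorm_scale qnorm_star_mult)

end

sublocale cstar_ideal \<subseteq> quot: cstar_seminormed Q "cnorm Q"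
  by (rule cstar_seminormed.intro[OF quotient_star_algebra cstar_seminormed_axioms.intro])
    (rule quotient_seminorm)

sublocale cstar_ideal \<subseteq> proj: star_algebra_hom A Q "\<lambda>x. proj x"
  by unfold_locales (rule proj_hom)

context cstar_ideal
begin

text \<open>Along a subsequence with steps below \<open>(1/2) ^ k\<close>, representatives can be
  chosen one after another, each step being lifted within this bound. The lifted sequence converges
  in \<open>A\<close>, its limit projects to the limit of the subsequence, and a Cauchy sequence
  converges once a subsequence does.\<close>

lemma quotient_complete:
  assumes S: "cauchy_in Q (cnorm Q) S"
  shows "\<exists>X\<in>carrier Q. (\<lambda>k. cnorm Q (S k \<ominus>\<^bsub>Q\<^esub> X)) \<longlonglongrightarrow> 0"
proof -
  note Sc = quot.cauchy_inD(1)[OF S]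
  have "\<forall>k. \<exists>M. \<forall>i\<ge>M. \<forall>j\<ge>M. cnorm Q (S i \<ominus>\<^bsub>Q\<^esub> S j) < (1/2) ^ k"
    using quot.cauchy_inD(2)[OF S] by simp
  then obtain M where M: "\<And>k i j. i \<ge> M k \<Longrightarrow> j \<ge> M k \<Longrightarrow> cnorm Q (S i \<ominus>\<^bsub>Q\<^esub> S j) < (1/2) ^ k"
    by metis
  \<comment> \<open>Partial sums make both \<open>n k\<close> and \<open>n (Suc k)\<close> at least
    \<open>M k\<close>, as the step estimate requires.\<close>
  define n where "n k = (\<Sum>i\<le>k. M i)" for k
  have n: "M k \<le> n k" for k unfolding n_def by (rule member_le_sum) auto
  have n': "M k \<le> n (Suc k)" for k using n[of k] by (simp add: n_def)
  have "\<exists>x. \<forall>k. (x k \<in> carrier A \<and> proj (x k) = S (n k)) \<and> cnorm A (x (Suc k) \<ominus> x k) < (1/2) ^ k"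
  proof (rule dependent_nat_choice)
    show "\<exists>x. x \<in> carrier A \<and> proj x = S (n 0)" using quotient_cases[OF Sc] by metis
    fix x k assume x: "x \<in> carrier A \<and> proj x = S (n k)"
    obtain y where y: "y \<in> carrier A" "S (n (Suc k)) = proj y" using quotient_cases[OF Sc] by metis
    have "cnorm Q (proj (y \<ominus> x)) < (1/2) ^ k"
      using M[OF n' n, of k] x y by (simp add: proj.hom_diff)
    then obtain d where d: "d \<in> carrier A" "proj d = proj (y \<ominus> x)" "cnorm A d < (1/2) ^ k"
      using qnorm_less[of "y \<ominus> x"] x y by (metis alg_minus_closed)
    have "proj (x \<oplus> d) = proj x \<oplus>\<^bsub>Q\<^esub> proj (y \<ominus> x)"
      using proj_add[of x d] x d by simp
    also have "\<dots> = proj y" using proj_add[of x "y \<ominus> x"] x y by (simp add: add_diff_inverse)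
    finally show "\<exists>z. (z \<in> carrier A \<and> proj z = S (n (Suc k))) \<and> cnorm A (z \<ominus> x) < (1/2) ^ k"
      using x y d by (intro exI[of _ "x \<oplus> d"]) (simp add: add_diff_cancel)
  qed
  then obtain x where x: "\<And>k. x k \<in> carrier A" "\<And>k. proj (x k) = S (n k)"
    "\<And>k. cnorm A (x (Suc k) \<ominus> x k) < (1/2) ^ k" by metis
  have "cauchy_in A (cnorm A) x"
    by (rule geometric_cauchy[where r = "1/2" and C = 1]) (use x(1) less_imp_le[OF x(3)] in auto)
  then obtain l where l: "lim_in x l" using cauchy_converges by blast
  note l' = lim_inD(2)[OF l]
  have sub: "(\<lambda>k. cnorm Q (S (n k) \<ominus>\<^bsub>Q\<^esub> proj l)) \<longlonglongrightarrow> 0"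
  proof (rule null_bound[OF lim_inD(3)[OF l]])
    fix k
    show "0 \<le> cnorm Q (S (n k) \<ominus>\<^bsub>Q\<^esub> proj l)" using Sc l' by simp
    show "cnorm Q (S (n k) \<ominus>\<^bsub>Q\<^esub> proj l) \<le> cnorm A (x k \<ominus> l)"
      using qnorm_le_norm[of "x k \<ominus> l"] x(1)[of k] x(2)[of k] l' by (simp add: proj.hom_diff)
  qed
  have "(\<lambda>k. cnorm Q (S k \<ominus>\<^bsub>Q\<^esub> proj l)) \<longlonglongrightarrow> 0"
  proof (rule LIMSEQ_I)
    fix e :: real assume e: "0 < e"
    obtain N where N: "\<forall>i\<ge>N. \<forall>j\<ge>N. cnorm Q (S i \<ominus>\<^bsub>Q\<^esub> S j) < e / 2"
      using quot.cauchy_inD(2)[OF S, of "e / 2"] e by auto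
    have lim0: "(\<lambda>k. (1/2) ^ k) \<longlonglongrightarrow> (0::real)" by (rule LIMSEQ_realpow_zero) auto
    have "\<forall>\<^sub>F k in sequentially. cnorm Q (S (n k) \<ominus>\<^bsub>Q\<^esub> proj l) < e / 4 \<and> (1/2) ^ k < e / 4"
      by (rule eventually_conj[OF order_tendstoD(2)[OF sub] order_tendstoD(2)[OF lim0]]) (use e in auto)
    then obtain K where K: "cnorm Q (S (n K) \<ominus>\<^bsub>Q\<^esub> proj l) < e / 4" "(1/2) ^ K < e / 4"
      by (auto simp: eventually_sequentially)
    have "cnorm Q (S i \<ominus>\<^bsub>Q\<^esub> proj l) < e" if "i \<ge> n K" for i
    proof -
      have "cnorm Q (S i \<ominus>\<^bsub>Q\<^esub> S (n K)) < (1/2) ^ K" using M[of K i "n K"] n[of K] that by simp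
      then show ?thesis
        using quot.p_triangle[OF Sc[of i] Sc[of "n K"] proj_closed[OF l']] K e by force
    qed
    then show "\<exists>M. \<forall>i\<ge>M. norm (cnorm Q (S i \<ominus>\<^bsub>Q\<^esub> proj l) - 0) < e"
      using quot.p_nonneg Sc l' by (intro exI[of _ "n K"]) (simp del: quot.p_nonneg add: quot.p_nonneg)
  qed
  then show ?thesis using l' by (intro bexI[of _ "proj l"]) auto
qed

theorem quotient_cstar_algebra: "cstar_algebra Q"
proof (rule cstar_algebra.intro[OF quotient_star_algebra], unfold_locales)
  show "cstar_seminorm Q (cnorm Q)" by (rule quotient_seminorm)
  show "X = \<zero>\<^bsub>Q\<^esub>" if X: "X \<in> carrier Q" "cnorm Q X = 0" for X
  proof -
    obtain x where x: "x \<in> carrier A" "X = proj x" by (rule quotient_cases[OF X(1)])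
    \<comment> \<open>Norm zero places \<open>x\<close> at distance 0 from \<open>I\<close>, and
      \<open>I\<close> is closed.\<close>
    have "x \<in> I"
    proof (rule closed[unfolded closed_in_def, rule_format, OF x(1)])
      fix e :: real assume "0 < e"
      then obtain y where y: "y \<in> proj x" "y \<in> carrier A" "cnorm A y < e"
        using qnorm_less[OF x(1), of e] X x by auto
      have "x \<ominus> (x \<ominus> y) = y"
        using x y by (simp add: alg_minus_eq alg_minus_add alg_minus_minus alg_r_neg2)
      moreover have "x \<ominus> y \<in> I"
        using I_minus[of "y \<ominus> x"] x y
        by (simp add: mem_proj alg_minus_eq alg_minus_add alg_minus_minus alg_a_comm)
      ultimately show "\<exists>z\<in>I. cnorm A (x \<ominus> z) < e" using y by (intro bexI[of _ "x \<ominus> y"]) auto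
    qed
    then show ?thesis
      using x by (simp add: proj_zero proj_eqI alg_minus_eq ring.minus_zero[OF ring_A] alg_r_zero)
  qed
  show "\<exists>X\<in>carrier Q. (\<lambda>k. cnorm Q (S k \<ominus>\<^bsub>Q\<^esub> X)) \<longlonglongrightarrow> 0" if "cauchy_in Q (cnorm Q) S" for S
    by (rule quotient_complete[OF that])
qed

lemma quotient_hom_exists:
  assumes B: "star_algebra B" and f: "f \<in> star_hom A B" and zero: "\<And>x. x \<in> I \<Longrightarrow> f x = \<zero>\<^bsub>B\<^esub>"
  obtains f' where "f' \<in> star_hom Q B" "\<And>x. x \<in> carrier A \<Longrightarrow> f' (proj x) = f x"
proof -
  interpret B: star_algebra B by fact
  interpret f: star_algebra_hom A B f by unfold_locales fact
  define f' where "f' X = f (SOME x. x \<in> X)" for X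
  have f': "f' (proj x) = f x" if x: "x \<in> carrier A" for x
  proof -
    define y where "y = (SOME y. y \<in> proj x)"
    have "y \<in> proj x" unfolding y_def by (rule someI[of _ x]) (rule self_mem_proj[OF x])
    then have y: "y \<in> carrier A" "y \<ominus> x \<in> I" using x by (simp_all add: mem_proj)
    then have "f y \<ominus>\<^bsub>B\<^esub> f x = \<zero>\<^bsub>B\<^esub>" using zero x by (simp flip: f.hom_diff)
    then have "f y = f x" using B.diff_zero_iff x y by simp
    then show ?thesis by (simp add: f'_def y_def)
  qed
  have "f' \<in> star_hom Q B"
    by (rule star_homI; (elim quotient_cases)?;
      simp add: proj_ops f' f.hom_add f.hom_mult f.hom_one f.hom_scale f.hom_star)
  then show ?thesis using that f' by blast
qed

end

section \<open>Closed ideals generated by a set\<close>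

context cstar_algebra
begin

text \<open>The family of ideals under the intersection must be nonempty; the whole algebra belongs
  to it.\<close>

lemma carrier_ideal: "ideal (carrier A) A" "closed_in A (carrier A)"
  by (rule ideal_criterion) (auto simp: closed_in_def)

context
  fixes S :: "'a set"
  assumes S: "S \<subseteq> carrier A"
begin

abbreviation J :: "'a set" where
  "J \<equiv> closed_ideal_gen A S"

lemma closed_ideal_gen_ideal: "ideal J A"
  unfolding closed_ideal_gen_def
  by (rule ring.i_Intersect[OF ring_A]) (use carrier_ideal S in auto)

lemma closed_ideal_gen_closed: "closed_in A J"
  unfolding closed_in_def[of A J]
proof (intro ballI impI)
  fix x assume x: "x \<in> carrier A" and *: "\<forall>e>0. \<exists>y\<in>J. cnorm A (x \<ominus> y) < e"
  have "x \<in> K" if K: "ideal K A" "closed_in A K" "S \<subseteq> K" for K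
  proof -
    have "J \<subseteq> K" using K by (auto simp: closed_ideal_gen_def)
    then have "\<forall>e>0. \<exists>y\<in>K. cnorm A (x \<ominus> y) < e" using * by blast
    then show ?thesis using K(2) x by (auto simp: closed_in_def)
  qed
  then show "x \<in> J" by (auto simp: closed_ideal_gen_def)
qed

lemma closed_ideal_gen_superset: "S \<subseteq> J"
  unfolding closed_ideal_gen_def by blast

lemma closed_ideal_gen_least: "ideal K A \<Longrightarrow> closed_in A K \<Longrightarrow> S \<subseteq> K \<Longrightarrow> J \<subseteq> K"
  unfolding closed_ideal_gen_def by blast

text \<open>Elements whose adjoint lies in \<open>J\<close> form a closed ideal containing
  \<open>S\<close>, which by minimality contains \<open>J\<close>.\<close>

lemma closed_ideal_gen_star:
  assumes star: "\<And>s. s \<in> S \<Longrightarrow> star A s \<in> J" and x: "x \<in> J"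
  shows "star A x \<in> J"
proof -
  define K where "K = {x \<in> carrier A. star A x \<in> J}"
  note id = closed_ideal_gen_ideal
  note sub = ideal.axioms(1)[OF id]
  have "ideal K A"
    by (rule ideal_criterion)
      (auto simp: K_def star_add star_minus star_mult additive_subgroup.zero_closed[OF sub]
        additive_subgroup.a_closed[OF sub] additive_subgroup.a_inv_closed[OF sub]
        ideal.I_l_closed[OF id] ideal.I_r_closed[OF id])
  moreover have "closed_in A K"
    unfolding closed_in_def
  proof (intro ballI impI)
    fix x assume x: "x \<in> carrier A" and *: "\<forall>e>0. \<exists>y\<in>K. cnorm A (x \<ominus> y) < e"
    have "\<exists>y\<in>J. cnorm A (star A x \<ominus> y) < e" if e: "0 < e" for e
    proof -
      obtain y where "y \<in> K" "cnorm A (x \<ominus> y) < e" using * e by blast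
      then show ?thesis using x by (intro bexI[of _ "star A y"]) (auto simp: K_def p_star_diff)
    qed
    then have "star A x \<in> J" using closed_ideal_gen_closed x by (auto simp: closed_in_def)
    then show "x \<in> K" using x by (simp add: K_def)
  qed
  moreover have "S \<subseteq> K" using star S by (auto simp: K_def)
  ultimately show ?thesis using closed_ideal_gen_least x by (auto simp: K_def)
qed

lemma closed_ideal_gen_cstar_ideal:
  assumes "\<And>s. s \<in> S \<Longrightarrow> star A s \<in> J"
  shows "cstar_ideal A J"
proof (rule cstar_ideal.intro[OF cstar_algebra_axioms cstar_ideal_axioms.intro])
  show "ideal J A" by (rule closed_ideal_gen_ideal)
  show "closed_in A J" by (rule closed_ideal_gen_closed)
  show "star A x \<in> J" if "x \<in> J" for x by (rule closed_ideal_gen_star[OF assms that])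
qed

text \<open>The kernel is an ideal, and closed because homomorphisms are contractive; minimality of
  \<open>J\<close> does the rest.\<close>

lemma closed_ideal_gen_kernel:
  assumes B: "cstar_algebra B" and f: "f \<in> star_hom A B" and zero: "\<And>s. s \<in> S \<Longrightarrow> f s = \<zero>\<^bsub>B\<^esub>"
    and x: "x \<in> J"
  shows "f x = \<zero>\<^bsub>B\<^esub>"
proof -
  interpret B: cstar_algebra B by fact
  interpret f: star_algebra_hom A B f by unfold_locales fact
  define K where "K = {x \<in> carrier A. f x = \<zero>\<^bsub>B\<^esub>}"
  have "ideal K A"
  proof (rule ideal_criterion)
    fix x assume "x \<in> K"
    then show "\<ominus> x \<in> K" using f.hom_scale[of x "-1"] by (simp add: K_def scale_minus_one)
  qed (auto simp: K_def f.hom_add f.hom_mult f.hom_zero B.alg_l_zero)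
  moreover have "closed_in A K"
    unfolding closed_in_def
  proof (intro ballI impI)
    fix x assume x: "x \<in> carrier A" and *: "\<forall>e>0. \<exists>y\<in>K. cnorm A (x \<ominus> y) < e"
    have "cnorm B (f x) \<le> 0"
    proof (rule field_le_epsilon)
      fix e :: real assume "0 < e"
      then obtain y where y: "y \<in> carrier A" "f y = \<zero>\<^bsub>B\<^esub>" "cnorm A (x \<ominus> y) < e" using * by (auto simp: K_def)
      have "f (x \<ominus> y) = f x"
        using x y by (simp add: f.hom_diff B.alg_minus_eq ring.minus_zero[OF B.ring_A] B.alg_r_zero)
      then show "cnorm B (f x) \<le> 0 + e"
        using star_hom_contractive[OF cstar_algebra_axioms B f, of "x \<ominus> y"] x y by simp
    qed
    then have "cnorm B (f x) = 0" by (rule antisym) (simp add: x)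
    then have "f x = \<zero>\<^bsub>B\<^esub>" using B.cnorm_definite[of "f x"] x by simp
    then show "x \<in> K" using x by (simp add: K_def)
  qed
  moreover have "S \<subseteq> K" using zero S by (auto simp: K_def)
  ultimately show ?thesis using closed_ideal_gen_least x by (auto simp: K_def)
qed

end

end

section \<open>Partitions of unity\<close>

context star_algebra
begin

definition pou :: "'i set \<Rightarrow> ('i \<Rightarrow> 'a) \<Rightarrow> bool" where
  "pou V e \<longleftrightarrow> (\<forall>x\<in>V. e x \<in> carrier A) \<and>
     (\<forall>x\<in>V. \<forall>y\<in>V. e x \<otimes> e y = (if x = y then e x else \<zero>)) \<and> (\<Oplus>x\<in>V. e x) = \<one>"

lemma pouD:
  assumes "pou V e"
  shows "x \<in> V \<Longrightarrow> e x \<in> carrier A"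
    "x \<in> V \<Longrightarrow> y \<in> V \<Longrightarrow> e x \<otimes> e y = (if x = y then e x else \<zero>)"
    "(\<Oplus>x\<in>V. e x) = \<one>"
  using assms by (auto simp: pou_def)

lemma sum_scale_mult:
  assumes "finite V" "finite W" "\<And>x. x \<in> V \<Longrightarrow> e x \<in> carrier A" "\<And>y. y \<in> W \<Longrightarrow> e' y \<in> carrier A"
  shows "(\<Oplus>x\<in>V. \<phi> x \<odot> e x) \<otimes> (\<Oplus>y\<in>W. \<psi> y \<odot> e' y) = (\<Oplus>x\<in>V. \<Oplus>y\<in>W. (\<phi> x * \<psi> y) \<odot> (e x \<otimes> e' y))"
proof -
  have "(\<Oplus>x\<in>V. \<phi> x \<odot> e x) \<otimes> (\<Oplus>y\<in>W. \<psi> y \<odot> e' y) = (\<Oplus>x\<in>V. \<phi> x \<odot> e x \<otimes> (\<Oplus>y\<in>W. \<psi> y \<odot> e' y))"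
    using assms by (intro sum_mult_right) auto
  also have "\<dots> = (\<Oplus>x\<in>V. \<Oplus>y\<in>W. (\<phi> x * \<psi> y) \<odot> (e x \<otimes> e' y))"
  proof (intro sum_cong refl)
    fix x assume x: "x \<in> V"
    have "\<phi> x \<odot> e x \<otimes> (\<Oplus>y\<in>W. \<psi> y \<odot> e' y) = (\<Oplus>y\<in>W. \<phi> x \<odot> e x \<otimes> (\<psi> y \<odot> e' y))"
      using assms x by (intro sum_mult_left) auto
    also have "\<dots> = (\<Oplus>y\<in>W. (\<phi> x * \<psi> y) \<odot> (e x \<otimes> e' y))"
      using assms x by (intro sum_cong) (auto simp: scale_mult_left scale_mult_right mult.commute)
    finally show "\<phi> x \<odot> e x \<otimes> (\<Oplus>y\<in>W. \<psi> y \<odot> e' y) = (\<Oplus>y\<in>W. (\<phi> x * \<psi> y) \<odot> (e x \<otimes> e' y))" .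
  qed (use assms in auto)
  finally show ?thesis .
qed

lemma pou_mult_left:
  assumes e: "pou V e" and V: "finite V" and x: "x \<in> V"
  shows "e x \<otimes> (\<Oplus>y\<in>V. \<phi> y \<odot> e y) = \<phi> x \<odot> e x"
    and "(\<Oplus>y\<in>V. \<phi> y \<odot> e y) \<otimes> e x = \<phi> x \<odot> e x"
proof -
  note e = pouD[OF e]
  have "e x \<otimes> (\<Oplus>y\<in>V. \<phi> y \<odot> e y) = (\<Oplus>y\<in>V. \<phi> y \<odot> (e x \<otimes> e y))"
    using V x e(1) by (simp add: sum_mult_left scale_mult_right cong: sum_cong)
  also have "\<dots> = \<phi> x \<odot> e x" using V x e by (subst sum_single[of V x]) auto
  finally show "e x \<otimes> (\<Oplus>y\<in>V. \<phi> y \<odot> e y) = \<phi> x \<odot> e x" .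
  have "(\<Oplus>y\<in>V. \<phi> y \<odot> e y) \<otimes> e x = (\<Oplus>y\<in>V. \<phi> y \<odot> (e y \<otimes> e x))"
    using V x e(1) by (simp add: sum_mult_right scale_mult_left cong: sum_cong)
  also have "\<dots> = \<phi> x \<odot> e x" using V x e by (subst sum_single[of V x]) auto
  finally show "(\<Oplus>y\<in>V. \<phi> y \<odot> e y) \<otimes> e x = \<phi> x \<odot> e x" .
qed

lemma pou_mult:
  assumes e: "pou V e" and V: "finite V"
  shows "(\<Oplus>x\<in>V. \<phi> x \<odot> e x) \<otimes> (\<Oplus>y\<in>V. \<psi> y \<odot> e y) = (\<Oplus>x\<in>V. (\<phi> x * \<psi> x) \<odot> e x)"
proof -
  note ec = pouD(1)[OF e]
  have "(\<Oplus>x\<in>V. \<phi> x \<odot> e x) \<otimes> (\<Oplus>y\<in>V. \<psi> y \<odot> e y) = (\<Oplus>x\<in>V. \<phi> x \<odot> e x \<otimes> (\<Oplus>y\<in>V. \<psi> y \<odot> e y))"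
    using V ec by (intro sum_mult_right) auto
  also have "\<dots> = (\<Oplus>x\<in>V. (\<phi> x * \<psi> x) \<odot> e x)"
    using V ec by (intro sum_cong) (auto simp: scale_mult_left pou_mult_left[OF e V])
  finally show ?thesis .
qed

text \<open>For the common element \<open>s\<close>, computing the product of \<open>e x\<close>,
  \<open>s\<close> and \<open>e' z\<close> in two ways shows that \<open>e x\<close> and
  \<open>e' z\<close> are orthogonal unless \<mu> at \<open>x\<close> equals \<nu> at
  \<open>z\<close>. So in the double sum of all their products only pairs with equal eigenvalues
  survive, and there the two values of \<Phi> agree.\<close>

lemma functional_calculus:
  assumes e: "pou V e" "finite V" and e': "pou W e'" "finite W"
    and eq: "(\<Oplus>x\<in>V. \<mu> x \<odot> e x) = (\<Oplus>z\<in>W. \<nu> z \<odot> e' z)"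
  shows "(\<Oplus>x\<in>V. \<Phi> (\<mu> x) \<odot> e x) = (\<Oplus>z\<in>W. \<Phi> (\<nu> z) \<odot> e' z)"
proof -
  note c = pouD(1)[OF e(1)] and c' = pouD(1)[OF e'(1)]
  define s where "s = (\<Oplus>x\<in>V. \<mu> x \<odot> e x)"
  have s: "s \<in> carrier A" using c by (auto simp: s_def)
  have orth: "e x \<otimes> e' z = \<zero>" if x: "x \<in> V" and z: "z \<in> W" and ne: "\<mu> x \<noteq> \<nu> z" for x z
  proof -
    have "\<mu> x \<odot> (e x \<otimes> e' z) = (e x \<otimes> s) \<otimes> e' z"
      using c[OF x] c'[OF z] pou_mult_left(1)[OF e x] by (simp add: s_def scale_mult_left)
    also have "\<dots> = e x \<otimes> (s \<otimes> e' z)" using c[OF x] c'[OF z] s by (simp add: mult_assoc)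
    also have "\<dots> = \<nu> z \<odot> (e x \<otimes> e' z)"
      using c[OF x] c'[OF z] pou_mult_left(2)[OF e' z] by (simp add: s_def eq scale_mult_right)
    finally have "(\<mu> x - \<nu> z) \<odot> (e x \<otimes> e' z) = \<zero>"
      using c[OF x] c'[OF z] by (simp add: scale_diff_left diff_zero_iff)
    then show ?thesis using scale_cancel[of "e x \<otimes> e' z" "\<mu> x - \<nu> z"] ne c[OF x] c'[OF z] by simp
  qed
  have "(\<Oplus>x\<in>V. \<Phi> (\<mu> x) \<odot> e x) = (\<Oplus>x\<in>V. (\<Phi> (\<mu> x) \<odot> e x)) \<otimes> (\<Oplus>z\<in>W. 1 \<odot> e' z)"
    using c c' pouD(3)[OF e'(1)] by (simp cong: sum_cong)
  also have "\<dots> = (\<Oplus>x\<in>V. \<Oplus>z\<in>W. \<Phi> (\<mu> x) \<odot> (e x \<otimes> e' z))"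
    using c c' e e' by (subst sum_scale_mult) (auto cong: sum_cong)
  also have "\<dots> = (\<Oplus>x\<in>V. \<Oplus>z\<in>W. \<Phi> (\<nu> z) \<odot> (e x \<otimes> e' z))"
  proof (intro sum_cong refl)
    fix x z assume xz: "x \<in> V" "z \<in> W"
    show "\<Phi> (\<mu> x) \<odot> (e x \<otimes> e' z) = \<Phi> (\<nu> z) \<odot> (e x \<otimes> e' z)"
      using orth[OF xz] by (cases "\<mu> x = \<nu> z") auto
  qed (use c c' in auto)
  also have "\<dots> = (\<Oplus>x\<in>V. 1 \<odot> e x) \<otimes> (\<Oplus>z\<in>W. \<Phi> (\<nu> z) \<odot> e' z)"
    using c c' e e' by (subst sum_scale_mult) (auto cong: sum_cong)
  also have "\<dots> = (\<Oplus>z\<in>W. \<Phi> (\<nu> z) \<odot> e' z)"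
    using c c' pouD(3)[OF e(1)] by (simp cong: sum_cong)
  finally show ?thesis .
qed

text \<open>For products of entries in different rows the relations give equality termwise; for
  entries of the same row only the sum of the products is known. Hence the diagonal is compared as a
  sum.\<close>

lemma double_sum_diag:
  assumes K: "finite K" and c: "\<And>j k. j \<in> K \<Longrightarrow> k \<in> K \<Longrightarrow> f j k \<in> carrier A"
    "\<And>j k. j \<in> K \<Longrightarrow> k \<in> K \<Longrightarrow> g j k \<in> carrier A"
    and off: "\<And>j k. j \<in> K \<Longrightarrow> k \<in> K \<Longrightarrow> j \<noteq> k \<Longrightarrow> f j k = g j k"
    and diag: "(\<Oplus>j\<in>K. f j j) = (\<Oplus>j\<in>K. g j j)"
  shows "(\<Oplus>j\<in>K. \<Oplus>k\<in>K. f j k) = (\<Oplus>j\<in>K. \<Oplus>k\<in>K. g j k)"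
proof -
  have "(\<Oplus>j\<in>K. \<Oplus>k\<in>K. f j k) \<ominus> (\<Oplus>j\<in>K. \<Oplus>k\<in>K. g j k) = (\<Oplus>j\<in>K. \<Oplus>k\<in>K. f j k \<ominus> g j k)"
    using K c by (simp add: sum_diff[symmetric] cong: sum_cong)
  also have "\<dots> = (\<Oplus>j\<in>K. f j j \<ominus> g j j)"
  proof (intro sum_cong refl)
    fix j assume j: "j \<in> K"
    show "(\<Oplus>k\<in>K. f j k \<ominus> g j k) = f j j \<ominus> g j j"
      by (rule sum_single[OF K j]) (use c off j in \<open>auto simp: diff_zero_iff\<close>)
  qed (use c in auto)
  also have "\<dots> = \<zero>" using K c diag by (simp add: sum_diff diff_zero_iff)
  finally show ?thesis using c by (subst (asm) diff_zero_iff) auto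
qed

text \<open>Adding the double sum to its transpose doubles it and leaves only twice the
  diagonal.\<close>

lemma double_sum_antisymmetric:
  assumes K: "finite K" and c: "\<And>j k. j \<in> K \<Longrightarrow> k \<in> K \<Longrightarrow> f j k \<in> carrier A"
    and anti: "\<And>j k. j \<in> K \<Longrightarrow> k \<in> K \<Longrightarrow> j \<noteq> k \<Longrightarrow> f j k \<oplus> f k j = \<zero>"
  shows "(\<Oplus>j\<in>K. \<Oplus>k\<in>K. f j k) = (\<Oplus>j\<in>K. f j j)"
proof -
  define X where "X = (\<Oplus>j\<in>K. \<Oplus>k\<in>K. f j k)"
  define D where "D = (\<Oplus>j\<in>K. f j j)"
  have X: "X \<in> carrier A" and D: "D \<in> carrier A" using c by (auto simp: X_def D_def)
  have "X \<oplus> X = X \<oplus> (\<Oplus>j\<in>K. \<Oplus>k\<in>K. f k j)"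
    unfolding X_def using sum_swap[of K K f] K c by simp
  also have "\<dots> = (\<Oplus>j\<in>K. \<Oplus>k\<in>K. f j k \<oplus> f k j)"
    unfolding X_def using K c by (simp add: sum_add cong: sum_cong)
  also have "\<dots> = (\<Oplus>j\<in>K. f j j \<oplus> f j j)"
  proof (intro sum_cong refl)
    fix j assume j: "j \<in> K"
    show "(\<Oplus>k\<in>K. f j k \<oplus> f k j) = f j j \<oplus> f j j"
      by (rule sum_single[OF K j]) (use c anti j in auto)
  qed (use c in auto)
  also have "\<dots> = D \<oplus> D" unfolding D_def using K c by (simp add: sum_add)
  finally have "(1/2) \<odot> (X \<oplus> X) = (1/2) \<odot> (D \<oplus> D)" by simp
  then show ?thesis
    using X D by (simp add: scale_add_right scale_collect flip: X_def D_def)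
qed

end

section \<open>The cube and its characters\<close>

text \<open>An arbitrary index set in place of \<open>{1..n}\<close>, because
  \<open>reflections_pou\<close> inserts one coordinate at a time.\<close>

definition cube :: "'i set \<Rightarrow> ('i \<Rightarrow> real) set" where
  "cube J = J \<rightarrow>\<^sub>E {0, 1}"

text \<open>On the cube, read as the group \<open>(Z/2)^n\<close>, these are the coordinate
  characters; their products over subsets of the index set are all the characters.\<close>

definition chi :: "'i \<Rightarrow> ('i \<Rightarrow> real) \<Rightarrow> complex" where
  "chi i x = (if x i = 0 then 1 else -1)"

definition flip :: "'i \<Rightarrow> ('i \<Rightarrow> real) \<Rightarrow> 'i \<Rightarrow> real" where
  "flip i x = x(i := 1 - x i)"

lemma cube_vertices_eq: "cube_vertices n = cube {1..n}"
  by (simp add: cube_vertices_def cube_def)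

lemma finite_cube: "finite J \<Longrightarrow> finite (cube J)"
  unfolding cube_def by (rule finite_PiE) auto

lemma card_cube: "finite J \<Longrightarrow> card (cube J) = 2 ^ card J"
  unfolding cube_def by (subst card_PiE) (simp_all add: card_insert_if numeral_2_eq_2)

lemma cube_val: "x \<in> cube J \<Longrightarrow> i \<in> J \<Longrightarrow> x i = 0 \<or> x i = 1"
  by (auto simp: cube_def PiE_def Pi_def)

lemma cube_ext: "x \<in> cube J \<Longrightarrow> y \<in> cube J \<Longrightarrow> (\<And>i. i \<in> J \<Longrightarrow> x i = y i) \<Longrightarrow> x = y"
  unfolding cube_def by (rule PiE_ext) auto

lemma chi_square [simp]: "chi i x * chi i x = 1"
  by (simp add: chi_def)

lemma chi_real [simp]: "cnj (chi i x) = chi i x"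
  by (simp add: chi_def)

lemma chi_eq_iff: "x \<in> cube J \<Longrightarrow> y \<in> cube J \<Longrightarrow> i \<in> J \<Longrightarrow> chi i x = chi i y \<longleftrightarrow> x i = y i"
  using cube_val[of x J i] cube_val[of y J i] by (auto simp: chi_def)

lemma chi_mult_chi: "x \<in> cube J \<Longrightarrow> y \<in> cube J \<Longrightarrow> i \<in> J \<Longrightarrow> chi i x * chi i y = (if x i = y i then 1 else -1)"
  using cube_val[of x J i] cube_val[of y J i] by (auto simp: chi_def)

lemma flip_in_cube: "x \<in> cube J \<Longrightarrow> i \<in> J \<Longrightarrow> flip i x \<in> cube J"
  by (auto simp: cube_def flip_def PiE_def Pi_def extensional_def)

lemma flip_flip [simp]: "flip i (flip i x) = x"
  by (simp add: flip_def)

lemma chi_flip: "x \<in> cube J \<Longrightarrow> i \<in> J \<Longrightarrow> chi j (flip i x) = (if i = j then - chi j x else chi j x)"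
  using cube_val[of x J i] by (auto simp: chi_def flip_def)

lemma sum_flip: "i \<in> J \<Longrightarrow> (\<Sum>x\<in>cube J. \<phi> (flip i x)) = (\<Sum>x\<in>cube J. \<phi> x)"
  by (rule sum.reindex_bij_witness[of _ "flip i" "flip i"]) (auto simp: flip_in_cube)

lemma sum_odd:
  assumes "i \<in> J" "\<And>x. x \<in> cube J \<Longrightarrow> \<phi> (flip i x) = - \<phi> x"
  shows "(\<Sum>x\<in>cube J. \<phi> x) = (0::complex)"
proof -
  have "(\<Sum>x\<in>cube J. \<phi> x) = (\<Sum>x\<in>cube J. - \<phi> x)"
    using sum_flip[OF assms(1), of \<phi>] assms(2) by simp
  then show ?thesis by (simp add: sum_negf)
qed

lemma sum_chi2:
  assumes "finite J" "j \<in> J" "k \<in> J"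
  shows "(\<Sum>x\<in>cube J. chi j x * chi k x) = (if j = k then 2 ^ card J else 0)"
proof (cases "j = k")
  case True
  then show ?thesis using assms by (simp add: card_cube)
next
  case False
  then show ?thesis using assms by (simp add: sum_odd[of j J] chi_flip)
qed

text \<open>Equal factors cancel since characters square to 1, and a character left over makes the
  sum vanish by oddness. As \<open>j\<close> and \<open>k\<close> differ, \<open>p\<close> and
  \<open>q\<close> must be the same two indices in one of the two orders.\<close>

lemma sum_chi4:
  assumes "finite J" "j \<in> J" "k \<in> J" "p \<in> J" "q \<in> J" "j \<noteq> k"
  shows "(\<Sum>x\<in>cube J. chi j x * chi k x * (chi p x * chi q x))
      = 2 ^ card J * (of_bool (p = j \<and> q = k) + of_bool (p = k \<and> q = j))"
proof -
  have sq: "chi i x * (chi i x * z) = z" for i :: 'a and x z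
    by (simp flip: mult.assoc)
  note c = mult.assoc mult.commute mult.left_commute
  consider "p = q" | "p \<noteq> q" "p = j" | "p \<noteq> q" "p = k" | "p \<noteq> q" "p \<noteq> j" "p \<noteq> k" by blast
  then show ?thesis
  proof cases
    case 1
    then show ?thesis using assms sum_chi2[of J j k] by auto
  next
    case 2
    then have "(\<Sum>x\<in>cube J. chi j x * chi k x * (chi p x * chi q x)) = (\<Sum>x\<in>cube J. chi k x * chi q x)"
      by (intro sum.cong refl) (simp add: chi_def)
    then show ?thesis using 2 assms sum_chi2[of J k q] by auto
  next
    case 3
    then have "(\<Sum>x\<in>cube J. chi j x * chi k x * (chi p x * chi q x)) = (\<Sum>x\<in>cube J. chi j x * chi q x)"
      by (intro sum.cong refl) (simp add: chi_def)
    then show ?thesis using 3 assms sum_chi2[of J j q] by auto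
  next
    case 4
    then have "(\<Sum>x\<in>cube J. chi j x * chi k x * (chi p x * chi q x)) = 0"
      using assms by (intro sum_odd[of p J]) (simp_all add: chi_flip)
    then show ?thesis using 4 by simp
  qed
qed

text \<open>Expanding the product over \<open>i\<close> of \<open>chi i x * chi i z + 1\<close>
  yields the sum over subsets; a coordinate where \<open>x\<close> and \<open>z\<close> differ makes
  its factor 0.\<close>

lemma characters_complete:
  assumes J: "finite J" and x: "x \<in> cube J" and z: "z \<in> cube J"
  shows "(\<Sum>S\<in>Pow J. (\<Prod>i\<in>S. chi i x) * (\<Prod>i\<in>S. chi i z)) = (if x = z then 2 ^ card J else 0)"
proof -
  have "(\<Sum>S\<in>Pow J. (\<Prod>i\<in>S. chi i x) * (\<Prod>i\<in>S. chi i z)) = (\<Prod>i\<in>J. chi i x * chi i z + 1)"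
    by (subst prod_add[OF J]) (simp add: prod.distrib)
  also have "\<dots> = (if x = z then 2 ^ card J else 0)"
  proof (cases "x = z")
    case False
    then obtain i where "i \<in> J" "x i \<noteq> z i" using cube_ext[OF x z] by blast
    then have "\<exists>i\<in>J. chi i x * chi i z + 1 = 0" using chi_mult_chi[OF x z] by (intro bexI[of _ i]) auto
    then show ?thesis using False J by auto
  qed (use J in \<open>simp add: prod_constant\<close>)
  finally show ?thesis .
qed

text \<open>On vertices this is the dimension minus twice the Hamming distance, so single values of
  it detect equality and adjacency.\<close>

definition cube_dot :: "'i set \<Rightarrow> ('i \<Rightarrow> real) \<Rightarrow> ('i \<Rightarrow> real) \<Rightarrow> complex" where
  "cube_dot J x y = (\<Sum>i\<in>J. chi i x * chi i y)"

definition adjacent :: "'i set \<Rightarrow> ('i \<Rightarrow> real) \<Rightarrow> ('i \<Rightarrow> real) \<Rightarrow> complex" where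
  "adjacent J x y = (if \<exists>i\<in>J. y = flip i x then 1 else 0)"

lemma cube_dot_eq:
  assumes J: "finite J" and x: "x \<in> cube J" and y: "y \<in> cube J"
  shows "cube_dot J x y = of_nat (card J) - 2 * of_nat (card {i \<in> J. x i \<noteq> y i})"
proof -
  have "cube_dot J x y = (\<Sum>i\<in>J. 1 - 2 * of_bool (x i \<noteq> y i))"
    unfolding cube_dot_def by (intro sum.cong refl) (auto simp: chi_mult_chi[OF x y])
  also have "\<dots> = of_nat (card J) - 2 * (\<Sum>i\<in>J. of_bool (x i \<noteq> y i))"
    by (simp add: sum_subtractf sum_distrib_left)
  also have "(\<Sum>i\<in>J. of_bool (x i \<noteq> y i) :: complex) = of_nat (card {i \<in> J. x i \<noteq> y i})"
    using J by (simp add: of_bool_def sum.If_cases Int_def)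
  finally show ?thesis .
qed

lemma cube_dot_max_iff:
  assumes J: "finite J" and x: "x \<in> cube J" and y: "y \<in> cube J"
  shows "cube_dot J x y = of_nat (card J) \<longleftrightarrow> x = y"
proof -
  have "cube_dot J x y = of_nat (card J) \<longleftrightarrow> {i \<in> J. x i \<noteq> y i} = {}"
    using J by (simp add: cube_dot_eq[OF assms])
  also have "\<dots> \<longleftrightarrow> x = y" using cube_ext[OF x y] by auto
  finally show ?thesis .
qed

lemma adjacent_iff:
  assumes J: "finite J" and x: "x \<in> cube J" and y: "y \<in> cube J"
  shows "(\<exists>i\<in>J. y = flip i x) \<longleftrightarrow> (\<exists>!i. i \<in> J \<and> x i \<noteq> y i)"
proof
  assume "\<exists>i\<in>J. y = flip i x"
  then obtain i where i: "i \<in> J" "y = flip i x" by blast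
  then have "x i \<noteq> y i" "\<And>j. j \<noteq> i \<Longrightarrow> x j = y j"
    using cube_val[OF x i(1)] by (auto simp: flip_def)
  then show "\<exists>!i. i \<in> J \<and> x i \<noteq> y i" using i(1) by metis
next
  assume "\<exists>!i. i \<in> J \<and> x i \<noteq> y i"
  then obtain i where i: "i \<in> J" "x i \<noteq> y i" "\<And>j. j \<in> J \<Longrightarrow> x j \<noteq> y j \<Longrightarrow> j = i" by blast
  have "y = flip i x"
  proof (rule cube_ext[OF y flip_in_cube[OF x i(1)]])
    fix j assume j: "j \<in> J"
    show "y j = flip i x j"
    proof (cases "j = i")
      case True
      then show ?thesis using i(1,2) cube_val[OF x i(1)] cube_val[OF y i(1)] by (auto simp: flip_def)
    next
      case False
      then have "x j = y j" using i(3)[OF j] by blast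
      then show ?thesis using False by (simp add: flip_def)
    qed
  qed
  then show "\<exists>i\<in>J. y = flip i x" using i(1) by blast
qed

lemma cube_dot_adjacent_iff:
  assumes J: "finite J" and x: "x \<in> cube J" and y: "y \<in> cube J"
  shows "cube_dot J x y = of_nat (card J) - 2 \<longleftrightarrow> (\<exists>i\<in>J. y = flip i x)"
proof -
  have "cube_dot J x y = of_nat (card J) - 2 \<longleftrightarrow> (of_nat (card {i \<in> J. x i \<noteq> y i}) :: complex) = of_nat 1"
    by (simp add: cube_dot_eq[OF assms])
  also have "\<dots> \<longleftrightarrow> card {i \<in> J. x i \<noteq> y i} = 1" by (simp only: of_nat_eq_iff)
  also have "\<dots> \<longleftrightarrow> (\<exists>!i. i \<in> J \<and> x i \<noteq> y i)"
    unfolding One_nat_def card_1_singleton_iff set_eq_iff mem_Collect_eq singleton_iff by metis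
  finally show ?thesis using adjacent_iff[OF assms] by simp
qed

lemma adjacent_sym: "adjacent J x y = adjacent J y x"
  unfolding adjacent_def by (metis flip_flip)

lemma sum_adjacent:
  assumes J: "finite J" and x: "x \<in> cube J"
  shows "(\<Sum>z\<in>cube J. adjacent J x z * \<phi> z) = (\<Sum>i\<in>J. \<phi> (flip i x))"
proof -
  have inj: "inj_on (\<lambda>i. flip i x) J"
  proof (rule inj_onI)
    fix i j assume ij: "i \<in> J" "j \<in> J" "flip i x = flip j x"
    have "flip i x i \<noteq> x i" using cube_val[OF x ij(1)] by (auto simp: flip_def)
    then show "i = j" using ij(3) by (metis flip_def fun_upd_other)
  qed
  have "(\<Sum>z\<in>cube J. adjacent J x z * \<phi> z) = (\<Sum>z\<in>(\<lambda>i. flip i x) ` J. adjacent J x z * \<phi> z)"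
    by (rule sum.mono_neutral_right) (auto simp: finite_cube[OF J] adjacent_def flip_in_cube[OF x])
  also have "\<dots> = (\<Sum>i\<in>J. adjacent J x (flip i x) * \<phi> (flip i x))" by (subst sum.reindex[OF inj]) simp
  also have "\<dots> = (\<Sum>i\<in>J. \<phi> (flip i x))"
    by (intro sum.cong refl) (auto simp: adjacent_def)
  finally show ?thesis .
qed

text \<open>Of the neighbours of \<open>x\<close>, those obtained by flipping a coordinate in
  \<open>S\<close> reverse the sign of the character and all others preserve it. The eigenvalue
  determines the size of \<open>S\<close>; subsets of size one are the coordinate
  characters.\<close>

lemma adjacent_eigenvector:
  assumes J: "finite J" and x: "x \<in> cube J" and S: "S \<subseteq> J"
  shows "(\<Sum>z\<in>cube J. adjacent J x z * (\<Prod>i\<in>S. chi i z))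
      = (of_nat (card J) - 2 * of_nat (card S)) * (\<Prod>i\<in>S. chi i x)"
proof -
  have fS: "finite S" using J S by (rule finite_subset[rotated])
  have flip_prod: "(\<Prod>j\<in>S. chi j (flip i x)) = (if i \<in> S then -1 else 1) * (\<Prod>j\<in>S. chi j x)" if i: "i \<in> J" for i
  proof -
    have "(\<Prod>j\<in>S. chi j (flip i x)) = (\<Prod>j\<in>S. (if j = i then -1 else 1) * chi j x)"
      by (intro prod.cong refl) (simp add: chi_flip[OF x i])
    also have "\<dots> = (if i \<in> S then -1 else 1) * (\<Prod>j\<in>S. chi j x)"
      using fS by (simp add: prod.distrib)
    finally show ?thesis .
  qed
  have "(\<Sum>z\<in>cube J. adjacent J x z * (\<Prod>i\<in>S. chi i z)) = (\<Sum>i\<in>J. (if i \<in> S then -1 else 1)) * (\<Prod>j\<in>S. chi j x)"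
    unfolding sum_adjacent[OF J x] sum_distrib_right by (intro sum.cong refl) (simp add: flip_prod)
  also have "(\<Sum>i\<in>J. (if i \<in> S then -1 else 1) :: complex) = of_nat (card J) - 2 * of_nat (card S)"
  proof -
    have "card J = card S + card (J - S)"
      using card_Diff_subset[OF fS S] card_mono[OF J S] by simp
    moreover have "(\<Sum>i\<in>J. (if i \<in> S then -1 else 1) :: complex) = of_nat (card (J - S)) - of_nat (card S)"
      using J S by (simp add: sum.If_cases Int_absorb1 Diff_eq)
    ultimately show ?thesis by simp
  qed
  finally show ?thesis .
qed

lemma cube_insert:
  assumes "j \<notin> J"
  shows "cube (insert j J) = (\<lambda>y. y(j := 0)) ` cube J \<union> (\<lambda>y. y(j := 1)) ` cube J"
  unfolding cube_def PiE_insert_eq by (auto simp: image_def)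

lemma cube_outside: "y \<in> cube J \<Longrightarrow> j \<notin> J \<Longrightarrow> y j = undefined"
  by (auto simp: cube_def PiE_def extensional_def)

context star_algebra
begin

lemma sum_cube_insert:
  assumes J: "finite J" "j \<notin> J" and F: "\<And>y. y \<in> cube (insert j J) \<Longrightarrow> F y \<in> carrier A"
  shows "(\<Oplus>y\<in>cube (insert j J). F y) = (\<Oplus>y\<in>cube J. F (y(j := 0)) \<oplus> F (y(j := 1)))"
proof -
  have inj: "inj_on (\<lambda>y. y(j := c)) (cube J)" for c :: real
  proof (rule inj_onI)
    fix y z assume yz: "y \<in> cube J" "z \<in> cube J" "y(j := c) = z(j := c)"
    show "y = z"
      by (rule cube_ext[OF yz(1,2)]) (metis J(2) yz(3) fun_upd_other)
  qed
  have disj: "(\<lambda>y. y(j := 0)) ` cube J \<inter> (\<lambda>y. y(j := 1)) ` cube J = {}"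
    by (auto dest: fun_cong[of _ _ j])
  have Fc: "F (y(j := 0)) \<in> carrier A" "F (y(j := 1)) \<in> carrier A" if "y \<in> cube J" for y
    using F that by (auto simp: cube_insert[OF J(2)])
  have "(\<Oplus>y\<in>cube (insert j J). F y)
      = finsum A F ((\<lambda>y. y(j := 0)) ` cube J) \<oplus> finsum A F ((\<lambda>y. y(j := 1)) ` cube J)"
    unfolding cube_insert[OF J(2)]
    by (rule sum_union_disjoint) (use disj Fc finite_cube[OF J(1)] in auto)
  also have "\<dots> = (\<Oplus>y\<in>cube J. F (y(j := 0))) \<oplus> (\<Oplus>y\<in>cube J. F (y(j := 1)))"
    by (intro arg_cong2[where f = "(\<oplus>)"] sum_reindex[OF inj]) (use Fc in auto)
  also have "\<dots> = (\<Oplus>y\<in>cube J. F (y(j := 0)) \<oplus> F (y(j := 1)))"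
    using Fc by (simp add: sum_add)
  finally show ?thesis .
qed

end

section \<open>Magic unitaries on the cube\<close>

context star_algebra
begin

definition magic :: "'i set \<Rightarrow> ('i \<Rightarrow> 'i \<Rightarrow> 'a) \<Rightarrow> bool" where
  "magic V v \<longleftrightarrow> (\<forall>x\<in>V. \<forall>y\<in>V. v x y \<in> carrier A \<and> star A (v x y) = v x y) \<and>
     (\<forall>x\<in>V. pou V (v x)) \<and> (\<forall>y\<in>V. pou V (\<lambda>x. v x y))"

definition intertwines :: "'i set \<Rightarrow> ('i \<Rightarrow> 'i \<Rightarrow> complex) \<Rightarrow> ('i \<Rightarrow> 'i \<Rightarrow> 'a) \<Rightarrow> bool" where
  "intertwines V d v \<longleftrightarrow> (\<forall>x\<in>V. \<forall>y\<in>V. (\<Oplus>k\<in>V. d x k \<odot> v k y) = (\<Oplus>k\<in>V. d k y \<odot> v x k))"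

text \<open>Self-adjointness is used to drop all stars from the products;
  \<open>neg_orthogonal_iff\<close> matches this form with the two sets of relations.\<close>

definition neg_orthogonal :: "'i set \<Rightarrow> ('i \<Rightarrow> 'i \<Rightarrow> 'a) \<Rightarrow> bool" where
  "neg_orthogonal I u \<longleftrightarrow>
     (\<forall>i\<in>I. \<forall>j\<in>I. u i j \<in> carrier A \<and> star A (u i j) = u i j) \<and>
     (\<forall>i\<in>I. \<forall>k\<in>I. (\<Oplus>j\<in>I. u i j \<otimes> u k j) = (if i = k then \<one> else \<zero>)) \<and>
     (\<forall>i\<in>I. \<forall>k\<in>I. (\<Oplus>j\<in>I. u j i \<otimes> u j k) = (if i = k then \<one> else \<zero>)) \<and>
     (\<forall>i\<in>I. \<forall>j\<in>I. \<forall>k\<in>I. j \<noteq> k \<longrightarrow> u i j \<otimes> u i k \<oplus> u i k \<otimes> u i j = \<zero>) \<and>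
     (\<forall>i\<in>I. \<forall>j\<in>I. \<forall>k\<in>I. j \<noteq> k \<longrightarrow> u j i \<otimes> u k i \<oplus> u k i \<otimes> u j i = \<zero>) \<and>
     (\<forall>i\<in>I. \<forall>j\<in>I. \<forall>k\<in>I. \<forall>l\<in>I. i \<noteq> k \<longrightarrow> j \<noteq> l \<longrightarrow> u i j \<otimes> u k l = u k l \<otimes> u i j)"

lemma magic_transpose: "magic V v \<Longrightarrow> magic V (\<lambda>x y. v y x)"
  by (auto simp: magic_def)

lemma intertwines_transpose:
  assumes "intertwines V d v" "\<And>x y. d x y = d y x"
  shows "intertwines V d (\<lambda>x y. v y x)"
  unfolding intertwines_def
proof (intro ballI)
  fix x y assume "x \<in> V" "y \<in> V"
  then have "(\<Oplus>k\<in>V. d y k \<odot> v k x) = (\<Oplus>k\<in>V. d k x \<odot> v y k)"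
    using assms(1) by (simp add: intertwines_def)
  then show "(\<Oplus>k\<in>V. d x k \<odot> v y k) = (\<Oplus>k\<in>V. d k y \<odot> v k x)"
    by (simp only: assms(2)[of y] assms(2)[of x])
qed

lemma neg_orthogonal_transpose: "neg_orthogonal I u \<Longrightarrow> neg_orthogonal I (\<lambda>i j. u j i)"
  unfolding neg_orthogonal_def by (intro conjI) (elim conjE; blast)+

lemma scale_eq_cancel:
  assumes "\<alpha> \<odot> x = \<beta> \<odot> x" "\<alpha> \<noteq> \<beta>" "x \<in> carrier A"
  shows "x = \<zero>"
  using scale_cancel[of x "\<alpha> - \<beta>"] assms by (simp add: scale_diff_left diff_zero_iff)

lemma sum_scale_scale:
  assumes "finite L" "\<And>l. l \<in> L \<Longrightarrow> a l \<in> carrier A"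
  shows "c \<odot> (\<Oplus>l\<in>L. d l \<odot> a l) = (\<Oplus>l\<in>L. (c * d l) \<odot> a l)"
  using assms by (subst sum_scale) (auto intro!: sum_cong)

lemma sum_scale_swap:
  assumes "finite K" "finite L" "\<And>k l. k \<in> K \<Longrightarrow> l \<in> L \<Longrightarrow> m k l \<in> carrier A"
  shows "(\<Oplus>k\<in>K. c k \<odot> (\<Oplus>l\<in>L. d l \<odot> m k l)) = (\<Oplus>l\<in>L. d l \<odot> (\<Oplus>k\<in>K. c k \<odot> m k l))"
proof -
  have "(\<Oplus>k\<in>K. c k \<odot> (\<Oplus>l\<in>L. d l \<odot> m k l)) = (\<Oplus>k\<in>K. \<Oplus>l\<in>L. (c k * d l) \<odot> m k l)"
    using assms by (intro sum_cong) (auto simp: sum_scale_scale)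
  also have "\<dots> = (\<Oplus>l\<in>L. \<Oplus>k\<in>K. (c k * d l) \<odot> m k l)"
    using assms by (intro sum_swap) auto
  also have "\<dots> = (\<Oplus>l\<in>L. d l \<odot> (\<Oplus>k\<in>K. c k \<odot> m k l))"
    using assms by (intro sum_cong) (auto simp: sum_scale_scale mult.commute)
  finally show ?thesis .
qed

lemma sum_scale_collect:
  assumes "finite K" "finite L" "\<And>l. l \<in> L \<Longrightarrow> a l \<in> carrier A"
  shows "(\<Oplus>k\<in>K. c k \<odot> (\<Oplus>l\<in>L. d k l \<odot> a l)) = (\<Oplus>l\<in>L. (\<Sum>k\<in>K. c k * d k l) \<odot> a l)"
proof -
  have "(\<Oplus>k\<in>K. c k \<odot> (\<Oplus>l\<in>L. d k l \<odot> a l)) = (\<Oplus>k\<in>K. \<Oplus>l\<in>L. (c k * d k l) \<odot> a l)"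
    using assms by (intro sum_cong) (auto simp: sum_scale_scale)
  also have "\<dots> = (\<Oplus>l\<in>L. \<Oplus>k\<in>K. (c k * d k l) \<odot> a l)"
    using assms by (intro sum_swap) auto
  also have "\<dots> = (\<Oplus>l\<in>L. (\<Sum>k\<in>K. c k * d k l) \<odot> a l)"
    using assms by (intro sum_cong) (auto simp: sum_const_scale)
  finally show ?thesis .
qed

lemma sum_delta:
  assumes "finite K" "j \<in> K" "\<And>i. i \<in> K \<Longrightarrow> a i \<in> carrier A"
  shows "(\<Oplus>i\<in>K. (if i = j then c else 0) \<odot> a i) = c \<odot> a j"
  using assms by (subst sum_single[of K j]) auto

text \<open>The functions \<open>chi j\<close> span the eigenspace of the adjacency matrix for the eigenvalue \<open>n - 2\<close>.\<close>

lemma eigenfunction_expansion: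
  fixes a :: "('i \<Rightarrow> real) \<Rightarrow> 'a" and J :: "'i set"
  assumes J: "finite J" and a: "\<And>x. x \<in> cube J \<Longrightarrow> a x \<in> carrier A"
    and eigen: "\<And>x. x \<in> cube J \<Longrightarrow>
      (\<Oplus>z\<in>cube J. adjacent J x z \<odot> a z) = (of_nat (card J) - 2) \<odot> a x"
    and x: "x \<in> cube J"
  shows "a x = (\<Oplus>j\<in>J. chi j x \<odot> ((1 / 2 ^ card J) \<odot> (\<Oplus>z\<in>cube J. chi j z \<odot> a z)))"
proof -
  note V = finite_cube[OF J]
  define c where "c S z = (\<Prod>i\<in>S. chi i z)" for S :: "'i set" and z
  define h where "h S = (\<Oplus>z\<in>cube J. c S z \<odot> a z)" for S
  have h: "h S \<in> carrier A" for S using a by (auto simp: h_def)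
  \<comment> \<open>The adjacency matrix can be applied to \<open>a\<close> or to the character of
    \<open>S\<close>, with eigenvalues \<open>card J - 2\<close> and
    \<open>card J - 2 * card S\<close>; these agree only when \<open>S\<close> has one
    element.\<close>
  have zero: "h S = \<zero>" if S: "S \<subseteq> J" "card S \<noteq> 1" for S
  proof -
    have "(of_nat (card J) - 2) \<odot> h S = (\<Oplus>z\<in>cube J. c S z \<odot> (\<Oplus>w\<in>cube J. adjacent J z w \<odot> a w))"
      unfolding h_def using V a
      by (subst sum_scale_scale) (auto intro!: sum_cong simp: mult.commute simp flip: scale_scale eigen)
    also have "\<dots> = (\<Oplus>w\<in>cube J. (\<Sum>z\<in>cube J. c S z * adjacent J z w) \<odot> a w)"
      using V a by (intro sum_scale_collect) auto
    also have "\<dots> = (\<Oplus>w\<in>cube J. ((of_nat (card J) - 2 * of_nat (card S)) * c S w) \<odot> a w)"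
    proof (intro sum_cong refl)
      fix w assume w: "w \<in> cube J"
      have "(\<Sum>z\<in>cube J. c S z * adjacent J z w) = (\<Sum>z\<in>cube J. adjacent J w z * c S z)"
        by (simp add: adjacent_sym[of J w] mult.commute)
      then show "(\<Sum>z\<in>cube J. c S z * adjacent J z w) \<odot> a w
          = ((of_nat (card J) - 2 * of_nat (card S)) * c S w) \<odot> a w"
        unfolding c_def by (simp add: adjacent_eigenvector[OF J w S(1)])
    qed (use a in auto)
    also have "\<dots> = (of_nat (card J) - 2 * of_nat (card S)) \<odot> h S"
      unfolding h_def using V a by (subst sum_scale_scale) auto
    finally have eq: "(of_nat (card J) - 2) \<odot> h S = (of_nat (card J) - 2 * of_nat (card S)) \<odot> h S" .
    have "of_nat (card J) - 2 \<noteq> (of_nat (card J) - 2 * of_nat (card S) :: complex)"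
    proof
      assume "of_nat (card J) - 2 = (of_nat (card J) - 2 * of_nat (card S) :: complex)"
      then have "of_nat (card S) = (of_nat 1 :: complex)" by simp
      then show False using S(2) by (simp only: of_nat_eq_iff)
    qed
    then show ?thesis by (rule scale_eq_cancel[OF eq _ h])
  qed
  \<comment> \<open>Fourier inversion: completeness of the characters recovers \<open>a x\<close>
    from its coefficients.\<close>
  have "(\<Oplus>S\<in>Pow J. c S x \<odot> h S) = (\<Oplus>z\<in>cube J. (\<Sum>S\<in>Pow J. c S x * c S z) \<odot> a z)"
    using J V a unfolding h_def by (intro sum_scale_collect) auto
  also have "\<dots> = (\<Oplus>z\<in>cube J. (if z = x then 2 ^ card J else 0) \<odot> a z)"
    using a unfolding c_def by (intro sum_cong refl) (auto simp: characters_complete[OF J x])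
  also have "\<dots> = 2 ^ card J \<odot> a x" using V x a by (rule sum_delta)
  finally have "2 ^ card J \<odot> a x = (\<Oplus>S\<in>Pow J. c S x \<odot> h S)" by simp
  also have "\<dots> = (\<Oplus>S\<in>(\<lambda>j. {j}) ` J. c S x \<odot> h S)"
  proof (rule sum_restrict)
    show "c S x \<odot> h S = \<zero>" if "S \<in> Pow J - (\<lambda>j. {j}) ` J" for S
    proof -
      have "\<forall>x. S \<noteq> {x}" using that by blast
      then have "h S = \<zero>" using that zero[of S] by (simp add: card_1_singleton_iff)
      then show ?thesis by simp
    qed
  qed (use J h in auto)
  also have "\<dots> = (\<Oplus>j\<in>J. chi j x \<odot> h {j})"
    using h by (subst sum_reindex) (auto simp: c_def)
  finally have "(1 / 2 ^ card J) \<odot> (2 ^ card J \<odot> a x) = (1 / 2 ^ card J) \<odot> (\<Oplus>j\<in>J. chi j x \<odot> h {j})"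
    by simp
  then have "a x = (\<Oplus>j\<in>J. chi j x \<odot> ((1 / 2 ^ card J) \<odot> h {j}))"
    using J h a x by (simp add: sum_scale mult.commute)
  then show ?thesis by (simp add: h_def c_def)
qed

text \<open>The Fourier coefficient of \<open>v\<close> at the pair of characters
  \<open>chi i\<close> and \<open>chi j\<close>. It is the entry of the orthogonal matrix attached
  to \<open>v\<close>, and it is linear in \<open>v\<close>.\<close>

definition cube_coeff :: "'i set \<Rightarrow> (('i \<Rightarrow> real) \<Rightarrow> ('i \<Rightarrow> real) \<Rightarrow> 'a) \<Rightarrow> 'i \<Rightarrow> 'i \<Rightarrow> 'a" where
  "cube_coeff J v i j = (1 / 2 ^ card J) \<odot> (\<Oplus>x\<in>cube J. chi i x \<odot> (\<Oplus>y\<in>cube J. chi j y \<odot> v x y))"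

lemma cube_coeff_transpose:
  assumes "finite J" "\<And>x y. x \<in> cube J \<Longrightarrow> y \<in> cube J \<Longrightarrow> v x y \<in> carrier A"
  shows "cube_coeff J (\<lambda>x y. v y x) i j = cube_coeff J v j i"
  unfolding cube_coeff_def using assms finite_cube[of J] by (subst sum_scale_swap) auto

lemma cube_coeff_closed:
  assumes "\<And>x y. x \<in> cube J \<Longrightarrow> y \<in> cube J \<Longrightarrow> v x y \<in> carrier A"
  shows "cube_coeff J v i j \<in> carrier A"
  using assms by (auto simp: cube_coeff_def)

text \<open>Orthogonality of the coordinate characters picks out the term with
  \<open>k = i\<close>.\<close>

lemma cube_coeff_of_expansion:
  assumes J: "finite J" and u: "\<And>k. k \<in> J \<Longrightarrow> u k j \<in> carrier A"
    and eq: "\<And>x. x \<in> cube J \<Longrightarrow> (\<Oplus>y\<in>cube J. chi j y \<odot> v x y) = (\<Oplus>k\<in>J. chi k x \<odot> u k j)"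
    and i: "i \<in> J"
  shows "cube_coeff J v i j = u i j"
proof -
  note V = finite_cube[OF J]
  have "(\<Oplus>x\<in>cube J. chi i x \<odot> (\<Oplus>y\<in>cube J. chi j y \<odot> v x y))
      = (\<Oplus>x\<in>cube J. chi i x \<odot> (\<Oplus>k\<in>J. chi k x \<odot> u k j))"
    using eq u by (intro sum_cong) auto
  also have "\<dots> = (\<Oplus>k\<in>J. (\<Sum>x\<in>cube J. chi i x * chi k x) \<odot> u k j)"
    using J V u by (intro sum_scale_collect) auto
  also have "\<dots> = (\<Oplus>k\<in>J. (if k = i then 2 ^ card J else 0) \<odot> u k j)"
    using u i by (intro sum_cong) (auto simp: sum_chi2[OF J])
  also have "\<dots> = 2 ^ card J \<odot> u i j" using J i u by (rule sum_delta)
  finally show ?thesis using u i by (simp add: cube_coeff_def)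
qed

text \<open>\<open>chi i\<close> is an eigenvector for \<open>card J - 2\<close>. As
  \<open>v\<close> commutes with the adjacency matrix, the left-hand side is one too, as a function
  of \<open>x\<close>, and \<open>eigenfunction_expansion\<close> applies; the coefficients it
  yields are those of \<open>cube_coeff\<close>.\<close>

lemma magic_expansion:
  assumes J: "finite J" and v: "magic (cube J) v" "intertwines (cube J) (adjacent J) v"
    and x: "x \<in> cube J" and i: "i \<in> J"
  shows "(\<Oplus>y\<in>cube J. chi i y \<odot> v x y) = (\<Oplus>j\<in>J. chi j x \<odot> cube_coeff J v j i)"
proof -
  note V = finite_cube[OF J]
  have vc: "v x y \<in> carrier A" if "x \<in> cube J" "y \<in> cube J" for x y using v(1) that by (simp add: magic_def)
  show ?thesis
    unfolding cube_coeff_def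
  proof (rule eigenfunction_expansion[OF J _ _ x])
    fix x assume x: "x \<in> cube J"
    show "(\<Oplus>y\<in>cube J. chi i y \<odot> v x y) \<in> carrier A" using vc x by auto
    have "(\<Oplus>z\<in>cube J. adjacent J x z \<odot> (\<Oplus>y\<in>cube J. chi i y \<odot> v z y))
        = (\<Oplus>y\<in>cube J. chi i y \<odot> (\<Oplus>z\<in>cube J. adjacent J x z \<odot> v z y))"
      using V vc by (intro sum_scale_swap) auto
    also have "\<dots> = (\<Oplus>y\<in>cube J. chi i y \<odot> (\<Oplus>z\<in>cube J. adjacent J z y \<odot> v x z))"
      using v(2) x vc by (intro sum_cong) (auto simp: intertwines_def)
    also have "\<dots> = (\<Oplus>z\<in>cube J. (\<Sum>y\<in>cube J. chi i y * adjacent J z y) \<odot> v x z)"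
      using V vc x by (intro sum_scale_collect) auto
    also have "\<dots> = (\<Oplus>z\<in>cube J. ((of_nat (card J) - 2) * chi i z) \<odot> v x z)"
    proof (intro sum_cong refl)
      fix z assume z: "z \<in> cube J"
      show "(\<Sum>y\<in>cube J. chi i y * adjacent J z y) \<odot> v x z = ((of_nat (card J) - 2) * chi i z) \<odot> v x z"
        using adjacent_eigenvector[OF J z, of "{i}"] i by (simp add: mult.commute)
    qed (use vc x in auto)
    also have "\<dots> = (of_nat (card J) - 2) \<odot> (\<Oplus>z\<in>cube J. chi i z \<odot> v x z)"
      using V vc x by (intro sum_scale_scale[symmetric]) auto
    finally show "(\<Oplus>z\<in>cube J. adjacent J x z \<odot> (\<Oplus>y\<in>cube J. chi i y \<odot> v z y))
        = (of_nat (card J) - 2) \<odot> (\<Oplus>z\<in>cube J. chi i z \<odot> v x z)" .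
  qed
qed

text \<open>Weighting the identities for all vertices \<open>x\<close> by \<phi> and adding turns
  them into identities between the coefficients \<open>m p q\<close>. The weights used are the
  constant 1 and \<open>chi j x * chi k x\<close>.\<close>

lemma quadratic_extraction:
  assumes J: "finite J" and m: "\<And>p q. p \<in> J \<Longrightarrow> q \<in> J \<Longrightarrow> m p q \<in> carrier A"
    and eq: "\<And>x. x \<in> cube J \<Longrightarrow> (\<Oplus>p\<in>J. \<Oplus>q\<in>J. (chi p x * chi q x) \<odot> m p q) = c x"
  shows "(\<Oplus>x\<in>cube J. \<phi> x \<odot> c x) = (\<Oplus>p\<in>J. \<Oplus>q\<in>J. (\<Sum>x\<in>cube J. \<phi> x * (chi p x * chi q x)) \<odot> m p q)"
proof -
  note V = finite_cube[OF J]
  have "(\<Oplus>x\<in>cube J. \<phi> x \<odot> c x) = (\<Oplus>x\<in>cube J. \<Oplus>p\<in>J. \<Oplus>q\<in>J. (\<phi> x * (chi p x * chi q x)) \<odot> m p q)"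
  proof (intro sum_cong refl)
    fix x assume x: "x \<in> cube J"
    have "\<phi> x \<odot> c x = (\<Oplus>p\<in>J. \<phi> x \<odot> (\<Oplus>q\<in>J. (chi p x * chi q x) \<odot> m p q))"
      unfolding eq[OF x, symmetric] using J m by (intro sum_scale) auto
    also have "\<dots> = (\<Oplus>p\<in>J. \<Oplus>q\<in>J. (\<phi> x * (chi p x * chi q x)) \<odot> m p q)"
      using J m by (intro sum_cong sum_scale_scale) auto
    finally show "\<phi> x \<odot> c x = (\<Oplus>p\<in>J. \<Oplus>q\<in>J. (\<phi> x * (chi p x * chi q x)) \<odot> m p q)" .
  qed (use m in auto)
  also have "\<dots> = (\<Oplus>p\<in>J. \<Oplus>x\<in>cube J. \<Oplus>q\<in>J. (\<phi> x * (chi p x * chi q x)) \<odot> m p q)"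
    using J V m by (intro sum_swap) auto
  also have "\<dots> = (\<Oplus>p\<in>J. \<Oplus>q\<in>J. \<Oplus>x\<in>cube J. (\<phi> x * (chi p x * chi q x)) \<odot> m p q)"
    using J V m by (intro sum_cong sum_swap) auto
  also have "\<dots> = (\<Oplus>p\<in>J. \<Oplus>q\<in>J. (\<Sum>x\<in>cube J. \<phi> x * (chi p x * chi q x)) \<odot> m p q)"
    using J V m by (intro sum_cong sum_const_scale) auto
  finally show ?thesis .
qed

lemma quadratic_diagonal:
  assumes J: "finite J" and m: "\<And>p q. p \<in> J \<Longrightarrow> q \<in> J \<Longrightarrow> m p q \<in> carrier A"
    and c: "\<And>x. x \<in> cube J \<Longrightarrow> c x \<in> carrier A"
    and eq: "\<And>x. x \<in> cube J \<Longrightarrow> (\<Oplus>p\<in>J. \<Oplus>q\<in>J. (chi p x * chi q x) \<odot> m p q) = c x"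
  shows "(\<Oplus>x\<in>cube J. c x) = 2 ^ card J \<odot> (\<Oplus>p\<in>J. m p p)"
proof -
  have "(\<Oplus>x\<in>cube J. c x) = (\<Oplus>x\<in>cube J. 1 \<odot> c x)" using c by (intro sum_cong) auto
  also have "\<dots> = (\<Oplus>p\<in>J. \<Oplus>q\<in>J. (\<Sum>x\<in>cube J. 1 * (chi p x * chi q x)) \<odot> m p q)"
    by (rule quadratic_extraction[OF J m eq])
  also have "\<dots> = (\<Oplus>p\<in>J. 2 ^ card J \<odot> m p p)"
  proof (intro sum_cong refl)
    fix p assume p: "p \<in> J"
    show "(\<Oplus>q\<in>J. (\<Sum>x\<in>cube J. 1 * (chi p x * chi q x)) \<odot> m p q) = 2 ^ card J \<odot> m p p"
      using J p m by (subst sum_single[OF J p]) (auto simp: sum_chi2[OF J] card_cube[OF J])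
  qed (use m in auto)
  also have "\<dots> = 2 ^ card J \<odot> (\<Oplus>p\<in>J. m p p)" using J m by (subst sum_scale) auto
  finally show ?thesis .
qed

text \<open>The weight \<open>chi j x * chi k x\<close> annihilates the constant \<open>c\<close>,
  and by \<open>sum_chi4\<close> it extracts the coefficients at \<open>(j, k)\<close> and
  \<open>(k, j)\<close> together.\<close>

lemma quadratic_off_diagonal:
  assumes J: "finite J" and m: "\<And>p q. p \<in> J \<Longrightarrow> q \<in> J \<Longrightarrow> m p q \<in> carrier A" and c: "c \<in> carrier A"
    and eq: "\<And>x. x \<in> cube J \<Longrightarrow> (\<Oplus>p\<in>J. \<Oplus>q\<in>J. (chi p x * chi q x) \<odot> m p q) = c"
    and jk: "j \<in> J" "k \<in> J" "j \<noteq> k"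
  shows "m j k \<oplus> m k j = \<zero>"
proof -
  note V = finite_cube[OF J]
  let ?N = "2 ^ card J :: complex"
  have "(\<Oplus>x\<in>cube J. (chi j x * chi k x) \<odot> c) = (\<Sum>x\<in>cube J. chi j x * chi k x) \<odot> c"
    using V c by (rule sum_const_scale)
  also have "\<dots> = \<zero>" using jk c by (simp add: sum_chi2[OF J])
  finally have "\<zero> = (\<Oplus>p\<in>J. \<Oplus>q\<in>J. (\<Sum>x\<in>cube J. chi j x * chi k x * (chi p x * chi q x)) \<odot> m p q)"
    using quadratic_extraction[OF J m eq, where \<phi> = "\<lambda>x. chi j x * chi k x"] by simp
  also have "\<dots> = (\<Oplus>p\<in>J. \<Oplus>q\<in>J.
      (if p = j then if q = k then ?N else 0 else 0) \<odot> m p q \<oplus> (if p = k then if q = j then ?N else 0 else 0) \<odot> m p q)"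
    using jk m by (intro sum_cong) (auto simp: sum_chi4[OF J jk(1,2) _ _ jk(3)] scale_add_left[symmetric])
  also have "\<dots> = (\<Oplus>p\<in>J. (\<Oplus>q\<in>J. (if p = j then if q = k then ?N else 0 else 0) \<odot> m p q)
      \<oplus> (\<Oplus>q\<in>J. (if p = k then if q = j then ?N else 0 else 0) \<odot> m p q))"
    using m by (intro sum_cong sum_add) auto
  also have "\<dots> = (\<Oplus>p\<in>J. \<Oplus>q\<in>J. (if p = j then if q = k then ?N else 0 else 0) \<odot> m p q)
      \<oplus> (\<Oplus>p\<in>J. \<Oplus>q\<in>J. (if p = k then if q = j then ?N else 0 else 0) \<odot> m p q)"
    using m by (intro sum_add) auto
  also have "(\<Oplus>p\<in>J. \<Oplus>q\<in>J. (if p = j then if q = k then ?N else 0 else 0) \<odot> m p q) = ?N \<odot> m j k"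
    using J jk m by (subst sum_single[OF J jk(1)]) (auto intro!: sum_null simp: sum_delta)
  also have "(\<Oplus>p\<in>J. \<Oplus>q\<in>J. (if p = k then if q = j then ?N else 0 else 0) \<odot> m p q) = ?N \<odot> m k j"
    using J jk m by (subst sum_single[OF J jk(2)]) (auto intro!: sum_null simp: sum_delta)
  finally have "?N \<odot> (m j k \<oplus> m k j) = \<zero>" using m jk by (simp add: scale_add_right)
  then show ?thesis using scale_cancel[of "m j k \<oplus> m k j" ?N] m jk by simp
qed

text \<open>One half of the relations; the other half comes from the transposed magic unitary.\<close>

lemma magic_column_relations:
  assumes J: "finite J" and v: "magic (cube J) v" "intertwines (cube J) (adjacent J) v"
  defines "u \<equiv> cube_coeff J v"
  shows "\<And>i j. u i j \<in> carrier A"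
    and "\<And>i k. i \<in> J \<Longrightarrow> k \<in> J \<Longrightarrow> (\<Oplus>j\<in>J. u j i \<otimes> u j k) = (if i = k then \<one> else \<zero>)"
    and "\<And>i j k. i \<in> J \<Longrightarrow> j \<in> J \<Longrightarrow> k \<in> J \<Longrightarrow> j \<noteq> k \<Longrightarrow> u j i \<otimes> u k i \<oplus> u k i \<otimes> u j i = \<zero>"
    and "\<And>i j k l. i \<in> J \<Longrightarrow> j \<in> J \<Longrightarrow> k \<in> J \<Longrightarrow> l \<in> J \<Longrightarrow> j \<noteq> l \<Longrightarrow>
      (u j i \<otimes> u l k \<ominus> u j k \<otimes> u l i) \<oplus> (u l i \<otimes> u j k \<ominus> u l k \<otimes> u j i) = \<zero>"
proof -
  note V = finite_cube[OF J]
  have vc: "v x y \<in> carrier A" if "x \<in> cube J" "y \<in> cube J" for x y using v(1) that by (simp add: magic_def)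
  have pou: "pou (cube J) (v x)" if "x \<in> cube J" for x using v(1) that by (simp add: magic_def)
  have cols: "(\<Oplus>x\<in>cube J. v x y) = \<one>" if "y \<in> cube J" for y using v(1) that by (simp add: magic_def pou_def)
  show uc: "u i j \<in> carrier A" for i j unfolding u_def by (rule cube_coeff_closed[OF vc])
  \<comment> \<open>Both factors are expansions along the same row \<open>x\<close> of
    \<open>v\<close>, a partition of unity, so they multiply like functions of
    \<open>y\<close>.\<close>
  have prod: "(\<Oplus>p\<in>J. \<Oplus>q\<in>J. (chi p x * chi q x) \<odot> (u p i \<otimes> u q k)) = (\<Oplus>y\<in>cube J. (chi i y * chi k y) \<odot> v x y)"
    if x: "x \<in> cube J" and ik: "i \<in> J" "k \<in> J" for x i k
  proof -
    have "(\<Oplus>p\<in>J. \<Oplus>q\<in>J. (chi p x * chi q x) \<odot> (u p i \<otimes> u q k))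
        = (\<Oplus>p\<in>J. chi p x \<odot> u p i) \<otimes> (\<Oplus>q\<in>J. chi q x \<odot> u q k)"
      using J uc by (subst sum_scale_mult) auto
    also have "\<dots> = (\<Oplus>y\<in>cube J. chi i y \<odot> v x y) \<otimes> (\<Oplus>y\<in>cube J. chi k y \<odot> v x y)"
      using magic_expansion[OF J v x] ik by (simp add: u_def)
    also have "\<dots> = (\<Oplus>y\<in>cube J. (chi i y * chi k y) \<odot> v x y)" by (rule pou_mult[OF pou[OF x] V])
    finally show ?thesis .
  qed
  have prod_one: "(\<Oplus>p\<in>J. \<Oplus>q\<in>J. (chi p x * chi q x) \<odot> (u p i \<otimes> u q i)) = \<one>"
    if x: "x \<in> cube J" and i: "i \<in> J" for x i
    using prod[OF x i i] vc x pouD(3)[OF pou[OF x]] by (simp cong: sum_cong)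
  show "u j i \<otimes> u k i \<oplus> u k i \<otimes> u j i = \<zero>" if "i \<in> J" "j \<in> J" "k \<in> J" "j \<noteq> k" for i j k
    using quadratic_off_diagonal[OF J, of "\<lambda>p q. u p i \<otimes> u q i" \<one> j k] prod_one uc that by simp
  show "(\<Oplus>j\<in>J. u j i \<otimes> u j k) = (if i = k then \<one> else \<zero>)" if ik: "i \<in> J" "k \<in> J" for i k
  proof -
    \<comment> \<open>Adding over all \<open>x\<close> brings in that the columns of
      \<open>v\<close> sum to 1; what remains is orthogonality of the characters.\<close>
    have "2 ^ card J \<odot> (\<Oplus>j\<in>J. u j i \<otimes> u j k) = (\<Oplus>x\<in>cube J. \<Oplus>y\<in>cube J. (chi i y * chi k y) \<odot> v x y)"
      by (rule quadratic_diagonal[OF J _ _ prod[OF _ ik], symmetric]) (use uc vc in auto)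
    also have "\<dots> = (\<Oplus>y\<in>cube J. \<Oplus>x\<in>cube J. (chi i y * chi k y) \<odot> v x y)"
      using V vc by (intro sum_swap) auto
    also have "\<dots> = (\<Oplus>y\<in>cube J. (chi i y * chi k y) \<odot> \<one>)"
    proof (intro sum_cong refl)
      fix y assume y: "y \<in> cube J"
      show "(\<Oplus>x\<in>cube J. (chi i y * chi k y) \<odot> v x y) = (chi i y * chi k y) \<odot> \<one>"
        using V vc y by (subst sum_scale[symmetric]) (auto simp: cols)
    qed auto
    also have "\<dots> = (\<Sum>y\<in>cube J. chi i y * chi k y) \<odot> \<one>" by (rule sum_const_scale[OF V]) simp
    also have "\<dots> = 2 ^ card J \<odot> (if i = k then \<one> else \<zero>)" using sum_chi2[OF J ik] by simp
    finally have "(1 / 2 ^ card J) \<odot> (2 ^ card J \<odot> (\<Oplus>j\<in>J. u j i \<otimes> u j k))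
        = (1 / 2 ^ card J) \<odot> (2 ^ card J \<odot> (if i = k then \<one> else \<zero>))" by simp
    then show ?thesis using uc by (simp split: if_splits)
  qed
  \<comment> \<open>By \<open>prod\<close> the product of the two expansions is symmetric in
    \<open>i\<close> and \<open>k\<close>, so the quadratic form of the antisymmetrised coefficients
    vanishes at every \<open>x\<close>.\<close>
  show "(u j i \<otimes> u l k \<ominus> u j k \<otimes> u l i) \<oplus> (u l i \<otimes> u j k \<ominus> u l k \<otimes> u j i) = \<zero>"
    if ijkl: "i \<in> J" "j \<in> J" "k \<in> J" "l \<in> J" "j \<noteq> l" for i j k l
  proof (rule quadratic_off_diagonal[OF J, of "\<lambda>p q. u p i \<otimes> u q k \<ominus> u p k \<otimes> u q i" \<zero> j l])
    fix x assume x: "x \<in> cube J"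
    have "(\<Oplus>p\<in>J. \<Oplus>q\<in>J. (chi p x * chi q x) \<odot> (u p i \<otimes> u q k \<ominus> u p k \<otimes> u q i))
        = (\<Oplus>p\<in>J. \<Oplus>q\<in>J. (chi p x * chi q x) \<odot> (u p i \<otimes> u q k) \<ominus> (chi p x * chi q x) \<odot> (u p k \<otimes> u q i))"
      using uc by (intro sum_cong) (auto simp: scale_diff_right)
    also have "\<dots> = (\<Oplus>p\<in>J. (\<Oplus>q\<in>J. (chi p x * chi q x) \<odot> (u p i \<otimes> u q k))
        \<ominus> (\<Oplus>q\<in>J. (chi p x * chi q x) \<odot> (u p k \<otimes> u q i)))"
      using J uc by (intro sum_cong sum_diff) auto
    also have "\<dots> = (\<Oplus>p\<in>J. \<Oplus>q\<in>J. (chi p x * chi q x) \<odot> (u p i \<otimes> u q k))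
        \<ominus> (\<Oplus>p\<in>J. \<Oplus>q\<in>J. (chi p x * chi q x) \<odot> (u p k \<otimes> u q i))"
      using J uc by (intro sum_diff) auto
    also have "\<dots> = \<zero>"
      using prod[OF x] ijkl vc x by (simp add: diff_zero_iff mult.commute[of "chi k _"])
    finally show "(\<Oplus>p\<in>J. \<Oplus>q\<in>J. (chi p x * chi q x) \<odot> (u p i \<otimes> u q k \<ominus> u p k \<otimes> u q i)) = \<zero>" .
  qed (use uc ijkl in auto)
qed

text \<open>Most relations are those of \<open>magic_column_relations\<close> for \<open>v\<close>
  and for its transpose. Commutation of entries in different rows and columns comes only from
  combining a column relation with a row relation.\<close>

theorem magic_imp_neg_orthogonal:
  assumes J: "finite J" and v: "magic (cube J) v" "intertwines (cube J) (adjacent J) v"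
  shows "neg_orthogonal J (cube_coeff J v)"
proof -
  define u where "u = cube_coeff J v"
  note V = finite_cube[OF J]
  have vc: "v x y \<in> carrier A" "star A (v x y) = v x y" if "x \<in> cube J" "y \<in> cube J" for x y
    using v(1) that by (simp_all add: magic_def)
  have ut: "cube_coeff J (\<lambda>x y. v y x) = (\<lambda>i j. u j i)"
    unfolding u_def by (intro ext cube_coeff_transpose[OF J vc(1)])
  note c = magic_column_relations[OF J v, folded u_def]
  note r = magic_column_relations[OF J magic_transpose[OF v(1)] intertwines_transpose[OF v(2) adjacent_sym],
    unfolded ut]
  have "star A (u i j) = u i j" for i j
    unfolding u_def cube_coeff_def using V vc
    by (auto simp: star_smult sum_star intro!: arg_cong[where f = "\<lambda>z. _ \<odot> z"] sum_cong)
  moreover have "u i j \<otimes> u k l = u k l \<otimes> u i j"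
    if ijkl: "i \<in> J" "j \<in> J" "k \<in> J" "l \<in> J" "i \<noteq> k" "j \<noteq> l" for i j k l
  proof -
    \<comment> \<open>The other two corners of the rectangle enter through \<open>p\<close> and
      \<open>q\<close>: columns give \<open>a - b = p - q\<close>, rows give
      \<open>a - b = q - p\<close>, hence \<open>2 (a - b) = 0\<close>.\<close>
    define a b p q where "a = u i j \<otimes> u k l" and "b = u k l \<otimes> u i j" and "p = u i l \<otimes> u k j" and "q = u k j \<otimes> u i l"
    have cl: "a \<in> carrier A" "b \<in> carrier A" "p \<in> carrier A" "q \<in> carrier A"
      using c(1) by (simp_all add: a_def b_def p_def q_def)
    have 1: "(a \<ominus> p) \<oplus> (q \<ominus> b) = \<zero>"
      using c(4)[OF ijkl(2,1,4,3,5)] by (simp add: a_def b_def p_def q_def)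
    have 2: "(a \<ominus> q) \<oplus> (p \<ominus> b) = \<zero>"
      using r(4)[OF ijkl(1,2,3,4,6)] by (simp add: a_def b_def p_def q_def)
    define x y where "x = a \<ominus> b" and "y = p \<ominus> q"
    have xy: "x \<in> carrier A" "y \<in> carrier A" using cl by (simp_all add: x_def y_def)
    have "x \<ominus> y = (a \<ominus> p) \<oplus> (q \<ominus> b)" "x \<oplus> y = (a \<ominus> q) \<oplus> (p \<ominus> b)"
      using cl by (simp_all add: x_def y_def alg_minus_eq alg_minus_add alg_minus_minus alg_a_ac)
    then have "x = y" "x \<oplus> y = \<zero>" using 1 2 xy diff_zero_iff by auto
    then have "2 \<odot> (a \<ominus> b) = \<zero>" using scale_collect(1)[of x 1 1] xy by (simp add: x_def)
    then have "a \<ominus> b = \<zero>" using scale_cancel[of "a \<ominus> b" 2] cl by simp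
    then show ?thesis using cl by (simp add: diff_zero_iff a_def b_def)
  qed
  ultimately show ?thesis
    unfolding neg_orthogonal_def u_def[symmetric] using c(1,2,3) r(2,3) by auto
qed

section \<open>From commuting reflections to magic unitaries\<close>

text \<open>The projections are products of the factors \<open>(1 + chi i y a i) / 2\<close>, added
  one coordinate at a time. The final clause about commutation strengthens the induction: it makes
  the new reflection commute with the projections already built.\<close>

lemma reflections_pou:
  fixes a :: "'i \<Rightarrow> 'a"
  assumes J: "finite J" and a: "\<And>i. i \<in> J \<Longrightarrow> a i \<in> carrier A" "\<And>i. i \<in> J \<Longrightarrow> star A (a i) = a i"
    "\<And>i. i \<in> J \<Longrightarrow> a i \<otimes> a i = \<one>" "\<And>i j. i \<in> J \<Longrightarrow> j \<in> J \<Longrightarrow> a i \<otimes> a j = a j \<otimes> a i"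
  shows "\<exists>e. pou (cube J) e \<and> (\<forall>y\<in>cube J. star A (e y) = e y) \<and>
    (\<forall>i\<in>J. (\<Oplus>y\<in>cube J. chi i y \<odot> e y) = a i) \<and>
    (\<forall>y\<in>cube J. \<forall>b\<in>carrier A. (\<forall>i\<in>J. b \<otimes> a i = a i \<otimes> b) \<longrightarrow> b \<otimes> e y = e y \<otimes> b)"
  using J a
proof (induction J rule: finite_induct)
  case empty
  have "cube {} = {\<lambda>_::'i. undefined}" by (simp add: cube_def)
  then show ?case
    by (intro exI[of _ "\<lambda>_. \<one>"]) (simp add: pou_def sum_insert alg_r_zero)
next
  case (insert j J)
  have "\<exists>e. pou (cube J) e \<and> (\<forall>y\<in>cube J. star A (e y) = e y) \<and>
    (\<forall>i\<in>J. (\<Oplus>y\<in>cube J. chi i y \<odot> e y) = a i) \<and>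
    (\<forall>y\<in>cube J. \<forall>b\<in>carrier A. (\<forall>i\<in>J. b \<otimes> a i = a i \<otimes> b) \<longrightarrow> b \<otimes> e y = e y \<otimes> b)"
    by (rule insert.IH) (use insert.prems in \<open>blast+\<close>)
  then obtain e where e: "pou (cube J) e" and es: "\<forall>y\<in>cube J. star A (e y) = e y"
    and ea: "\<forall>i\<in>J. (\<Oplus>y\<in>cube J. chi i y \<odot> e y) = a i"
    and ec: "\<forall>y\<in>cube J. \<forall>b\<in>carrier A. (\<forall>i\<in>J. b \<otimes> a i = a i \<otimes> b) \<longrightarrow> b \<otimes> e y = e y \<otimes> b"
    by (elim exE conjE)
  note es = es[rule_format] and ea = ea[rule_format] and ec = ec[rule_format]
  note V = finite_cube[OF insert.hyps(1)] and e' = pouD[OF e]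
  define r where "r = a j"
  have r: "r \<in> carrier A" "star A r = r" "r \<otimes> r = \<one>"
    unfolding r_def using insert.prems(1-3)[of j] by blast+
  \<comment> \<open>For \<open>s = 1\<close> and \<open>s = -1\<close> these are the spectral
    projections of \<open>r\<close>.\<close>
  define t where "t s = (1/2) \<odot> (\<one> \<oplus> s \<odot> r)" for s :: complex
  have t: "t s \<in> carrier A" for s using r by (simp add: t_def)
  have tt: "t s \<otimes> t s' = (if s = s' then t s else \<zero>)" if "s \<in> {1, -1}" "s' \<in> {1, -1}" for s s'
  proof -
    have "t s \<otimes> t s' = (1/4) \<odot> ((1 + s * s') \<odot> \<one> \<oplus> (s + s') \<odot> r)"
      using r by (simp add: t_def scale_mult_left scale_mult_right distrib_left distrib_right scale_add_right
          scale_add_left alg_a_ac mult.commute)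
    then show ?thesis using that r by (auto simp: t_def scale_add_right)
  qed
  have ts: "star A (t s) = t s" if "s \<in> {1, -1}" for s
    using that r by (auto simp: t_def star_smult star_add)
  have tsum: "t 1 \<oplus> t (-1) = \<one>"
  proof -
    have "t 1 \<oplus> t (-1) = ((1/2) \<odot> \<one> \<oplus> (1/2) \<odot> \<one>) \<oplus> ((1/2) \<odot> r \<oplus> (-(1/2)) \<odot> r)"
      using r by (simp add: t_def scale_add_right alg_a_ac)
    then show ?thesis using r by (simp add: scale_collect alg_r_zero)
  qed
  have tdiff: "t 1 \<ominus> t (-1) = r"
  proof -
    have "t 1 \<ominus> t (-1) = ((1/2) \<odot> \<one> \<oplus> (-(1/2)) \<odot> \<one>) \<oplus> ((1/2) \<odot> r \<oplus> (1/2) \<odot> r)"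
      using r by (simp add: t_def scale_add_right minus_as_scale alg_a_ac)
    then show ?thesis using r by (simp add: scale_collect alg_l_zero)
  qed
  have re: "r \<otimes> e y = e y \<otimes> r" if "y \<in> cube J" for y
    unfolding r_def by (rule ec[OF that]) (use insert.prems in blast)+
  have te: "t s \<otimes> e y = e y \<otimes> t s" if "y \<in> cube J" for y s
    using re[OF that] e'(1)[OF that] r
    by (simp add: t_def scale_mult_left scale_mult_right distrib_left distrib_right)
  \<comment> \<open>Points of \<open>cube J\<close> are \<open>undefined\<close> at
    \<open>j\<close>, so forgetting the coordinate \<open>j\<close> means resetting it to that
    value.\<close>
  define q where "q y = y(j := undefined)" for y :: "'i \<Rightarrow> real"
  have q_upd: "q (y(j := c)) = y" if "y \<in> cube J" for y c
    using cube_outside[OF that insert.hyps(2)] by (auto simp: q_def)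
  have q_cube: "q y \<in> cube J" if "y \<in> cube (insert j J)" for y
    using that q_upd by (auto simp: cube_insert[OF insert.hyps(2)])
  have q_eq: "y = z \<longleftrightarrow> q y = q z \<and> chi j y = chi j z" if "y \<in> cube (insert j J)" "z \<in> cube (insert j J)" for y z
    using chi_eq_iff[OF that, of j] by (auto simp: q_def fun_eq_iff)
  have s: "chi j y \<in> {1, -1}" for y :: "'i \<Rightarrow> real" by (simp add: chi_def)
  define f where "f y = e (q y) \<otimes> t (chi j y)" for y
  have fc: "f y \<in> carrier A" if "y \<in> cube (insert j J)" for y
    using e'(1)[OF q_cube[OF that]] t by (simp add: f_def)
  have f0: "f (y(j := 0)) = e y \<otimes> t 1" and f1: "f (y(j := 1)) = e y \<otimes> t (-1)" if "y \<in> cube J" for y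
    using q_upd[OF that] by (simp_all add: f_def chi_def)
  have upd: "y(j := 0) \<in> cube (insert j J)" "y(j := 1) \<in> cube (insert j J)" if "y \<in> cube J" for y
    using that by (auto simp: cube_insert[OF insert.hyps(2)])
  have fsum: "(\<Oplus>y\<in>cube (insert j J). \<psi> y \<odot> f y)
      = (\<Oplus>y\<in>cube J. \<psi> (y(j := 0)) \<odot> (e y \<otimes> t 1) \<oplus> \<psi> (y(j := 1)) \<odot> (e y \<otimes> t (-1)))" for \<psi>
  proof -
    have "(\<Oplus>y\<in>cube (insert j J). \<psi> y \<odot> f y)
        = (\<Oplus>y\<in>cube J. \<psi> (y(j := 0)) \<odot> f (y(j := 0)) \<oplus> \<psi> (y(j := 1)) \<odot> f (y(j := 1)))"
      by (rule sum_cube_insert[OF insert.hyps(1,2)]) (use fc in auto)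
    also have "\<dots> = (\<Oplus>y\<in>cube J. \<psi> (y(j := 0)) \<odot> (e y \<otimes> t 1) \<oplus> \<psi> (y(j := 1)) \<odot> (e y \<otimes> t (-1)))"
      by (intro sum_cong refl) (simp_all add: f0 f1 e'(1) t)
    finally show ?thesis .
  qed
  have pou_f: "pou (cube (insert j J)) f"
    unfolding pou_def
  proof (intro conjI ballI)
    fix y z assume y: "y \<in> cube (insert j J)" and z: "z \<in> cube (insert j J)"
    note qy = q_cube[OF y] and qz = q_cube[OF z]
    have "f y \<otimes> f z = e (q y) \<otimes> (t (chi j y) \<otimes> e (q z)) \<otimes> t (chi j z)"
      using e'(1)[OF qy] e'(1)[OF qz] t by (simp add: f_def mult_assoc)
    also have "\<dots> = (e (q y) \<otimes> e (q z)) \<otimes> (t (chi j y) \<otimes> t (chi j z))"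
      unfolding te[OF qz] using e'(1)[OF qy] e'(1)[OF qz] t by (simp add: mult_assoc)
    also have "\<dots> = (if y = z then f y else \<zero>)"
      unfolding e'(2)[OF qy qz] tt[OF s s] q_eq[OF y z] using e'(1)[OF qy] t by (auto simp: f_def)
    finally show "f y \<otimes> f z = (if y = z then f y else \<zero>)" .
  next
    have "(\<Oplus>y\<in>cube (insert j J). f y) = (\<Oplus>y\<in>cube (insert j J). 1 \<odot> f y)"
      using fc by (intro sum_cong) auto
    also have "\<dots> = (\<Oplus>y\<in>cube J. e y)"
      unfolding fsum using e'(1) t by (intro sum_cong) (auto simp: tsum simp flip: distrib_left)
    finally show "(\<Oplus>y\<in>cube (insert j J). f y) = \<one>" using e'(3) by simp
  qed (rule fc)
  moreover have "star A (f y) = f y" if y: "y \<in> cube (insert j J)" for y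
    using e'(1)[OF q_cube[OF y]] es[OF q_cube[OF y]] t te[OF q_cube[OF y]] ts[OF s] by (simp add: f_def star_mult)
  moreover have "(\<Oplus>y\<in>cube (insert j J). chi i y \<odot> f y) = a i" if i: "i \<in> insert j J" for i
  proof (cases "i = j")
    case True
    have "(\<Oplus>y\<in>cube (insert j J). chi i y \<odot> f y) = (\<Oplus>y\<in>cube J. e y \<otimes> r)"
      unfolding fsum True
    proof (intro sum_cong refl)
      fix y assume y: "y \<in> cube J"
      have "chi j (y(j := 0)) \<odot> (e y \<otimes> t 1) \<oplus> chi j (y(j := 1)) \<odot> (e y \<otimes> t (-1)) = e y \<otimes> t 1 \<ominus> e y \<otimes> t (-1)"
        using e'(1)[OF y] t by (simp add: chi_def minus_as_scale)
      also have "\<dots> = e y \<otimes> r" using e'(1)[OF y] t tdiff by (simp flip: diff_distrib_left)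
      finally show "chi j (y(j := 0)) \<odot> (e y \<otimes> t 1) \<oplus> chi j (y(j := 1)) \<odot> (e y \<otimes> t (-1)) = e y \<otimes> r" .
    qed (use e'(1) r in auto)
    also have "\<dots> = r" using V e' r by (simp flip: sum_mult_right)
    finally show ?thesis using True by (simp add: r_def)
  next
    case False
    have "(\<Oplus>y\<in>cube (insert j J). chi i y \<odot> f y) = (\<Oplus>y\<in>cube J. chi i y \<odot> e y)"
      unfolding fsum
    proof (intro sum_cong refl)
      fix y assume y: "y \<in> cube J"
      have "chi i (y(j := 0)) \<odot> (e y \<otimes> t 1) \<oplus> chi i (y(j := 1)) \<odot> (e y \<otimes> t (-1))
          = chi i y \<odot> (e y \<otimes> (t 1 \<oplus> t (-1)))"
        using False e'(1)[OF y] t by (simp add: chi_def distrib_left scale_add_right)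
      then show "chi i (y(j := 0)) \<odot> (e y \<otimes> t 1) \<oplus> chi i (y(j := 1)) \<odot> (e y \<otimes> t (-1)) = chi i y \<odot> e y"
        using e'(1)[OF y] by (simp add: tsum)
    qed (use e'(1) in auto)
    then show ?thesis using ea i False by simp
  qed
  moreover have "b \<otimes> f y = f y \<otimes> b"
    if y: "y \<in> cube (insert j J)" and b: "b \<in> carrier A" "\<forall>i\<in>insert j J. b \<otimes> a i = a i \<otimes> b" for y b
  proof -
    note qy = q_cube[OF y] and eq = e'(1)[OF q_cube[OF y]]
    have be: "b \<otimes> e (q y) = e (q y) \<otimes> b" using ec[OF qy b(1)] b(2) by blast
    have "b \<otimes> r = r \<otimes> b" using b(2) by (simp add: r_def)
    then have bt: "b \<otimes> t (chi j y) = t (chi j y) \<otimes> b"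
      using b(1) r by (simp add: t_def scale_mult_left scale_mult_right distrib_left distrib_right)
    have "b \<otimes> f y = (b \<otimes> e (q y)) \<otimes> t (chi j y)" using b(1) eq t by (simp add: f_def mult_assoc)
    also have "\<dots> = e (q y) \<otimes> (b \<otimes> t (chi j y))" unfolding be using b(1) eq t by (simp add: mult_assoc)
    also have "\<dots> = f y \<otimes> b" unfolding bt using b(1) eq t by (simp add: f_def mult_assoc)
    finally show ?thesis .
  qed
  ultimately show ?case by blast
qed

lemma cube_dot_expansion:
  assumes J: "finite J" and e: "pou (cube J) e"
  shows "(\<Oplus>i\<in>J. chi i y \<odot> (\<Oplus>z\<in>cube J. chi i z \<odot> e z)) = (\<Oplus>z\<in>cube J. cube_dot J y z \<odot> e z)"
  using sum_scale_collect[OF J finite_cube[OF J] pouD(1)[OF e], where c = "\<lambda>i. chi i y" and d = chi]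
  by (simp add: cube_dot_def)

text \<open>Only \<open>z = y\<close> attains the maximal value of \<open>cube_dot J y\<close>, so
  the indicator of this value selects a single projection.\<close>

lemma cube_pou_pick:
  assumes J: "finite J" and e: "\<And>z. z \<in> cube J \<Longrightarrow> e z \<in> carrier A" and y: "y \<in> cube J"
  shows "(\<Oplus>z\<in>cube J. of_bool (cube_dot J y z = of_nat (card J)) \<odot> e z) = e y"
proof -
  have "(\<Oplus>z\<in>cube J. of_bool (cube_dot J y z = of_nat (card J)) \<odot> e z)
      = (\<Oplus>z\<in>cube J. (if z = y then 1 else 0) \<odot> e z)"
    using e by (intro sum_cong) (auto simp: cube_dot_max_iff[OF J y])
  then show ?thesis using sum_delta[OF finite_cube[OF J] y e, where c = 1] e y by simp
qed

text \<open>The character sums determine the element with eigenvalues \<open>cube_dot J y z\<close>.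
  By \<open>functional_calculus\<close> they also determine its projection for the eigenvalue
  \<open>card J\<close>, which is \<open>e y\<close>.\<close>

lemma cube_pou_unique:
  assumes J: "finite J" and e: "pou (cube J) e" and e': "pou (cube J) e'"
    and eq: "\<And>i. i \<in> J \<Longrightarrow> (\<Oplus>z\<in>cube J. chi i z \<odot> e z) = (\<Oplus>z\<in>cube J. chi i z \<odot> e' z)"
    and y: "y \<in> cube J"
  shows "e y = e' y"
proof -
  note V = finite_cube[OF J]
  have "(\<Oplus>i\<in>J. chi i y \<odot> (\<Oplus>z\<in>cube J. chi i z \<odot> e z)) = (\<Oplus>i\<in>J. chi i y \<odot> (\<Oplus>z\<in>cube J. chi i z \<odot> e' z))"
    using eq pouD(1)[OF e'] by (intro sum_cong) auto
  then have "(\<Oplus>z\<in>cube J. cube_dot J y z \<odot> e z) = (\<Oplus>z\<in>cube J. cube_dot J y z \<odot> e' z)"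
    by (simp only: cube_dot_expansion[OF J e] cube_dot_expansion[OF J e'])
  from functional_calculus[OF e V e' V this, where \<Phi> = "\<lambda>t. of_bool (t = of_nat (card J))"]
  show ?thesis by (simp add: cube_pou_pick[OF J pouD(1)[OF e] y] cube_pou_pick[OF J pouD(1)[OF e'] y])
qed

text \<open>Let \<open>a i\<close> be the right-hand side. Anticommutation within a column removes
  the mixed terms from the square of \<open>a i\<close>, leaving the sum of squares of that column,
  which is 1. Commutation of entries in different rows and columns, together with orthogonality of
  the columns, makes \<open>a i\<close> and \<open>a k\<close> commute. So
  \<open>reflections_pou\<close> applies.\<close>

lemma neg_orthogonal_rows:
  assumes J: "finite J" and u: "neg_orthogonal J u" and x: "x \<in> cube J"
  shows "\<exists>e. pou (cube J) e \<and> (\<forall>y\<in>cube J. star A (e y) = e y) \<and>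
    (\<forall>i\<in>J. (\<Oplus>y\<in>cube J. chi i y \<odot> e y) = (\<Oplus>j\<in>J. chi j x \<odot> u j i))"
proof -
  have uc: "u i j \<in> carrier A" "star A (u i j) = u i j" if "i \<in> J" "j \<in> J" for i j
    using u that by (simp_all add: neg_orthogonal_def)
  have orth: "(\<Oplus>j\<in>J. u j i \<otimes> u j k) = (if i = k then \<one> else \<zero>)" if "i \<in> J" "k \<in> J" for i k
    using u that by (simp add: neg_orthogonal_def)
  have anti: "u j i \<otimes> u k i \<oplus> u k i \<otimes> u j i = \<zero>" if "i \<in> J" "j \<in> J" "k \<in> J" "j \<noteq> k" for i j k
    using u that by (simp add: neg_orthogonal_def)
  have comm: "u i j \<otimes> u k l = u k l \<otimes> u i j" if "i \<in> J" "j \<in> J" "k \<in> J" "l \<in> J" "i \<noteq> k" "j \<noteq> l" for i j k l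
    using u that unfolding neg_orthogonal_def by blast
  define a where "a i = (\<Oplus>j\<in>J. chi j x \<odot> u j i)" for i
  have ac: "a i \<in> carrier A" if "i \<in> J" for i using uc that by (auto simp: a_def)
  have mult: "a i \<otimes> a k = (\<Oplus>j\<in>J. \<Oplus>l\<in>J. (chi j x * chi l x) \<odot> (u j i \<otimes> u l k))" if "i \<in> J" "k \<in> J" for i k
    unfolding a_def using J uc that by (intro sum_scale_mult) auto
  have "star A (a i) = a i" if "i \<in> J" for i
    unfolding a_def using J uc that by (auto simp: sum_star star_smult intro!: sum_cong)
  moreover have "a i \<otimes> a i = \<one>" if i: "i \<in> J" for i
  proof -
    have "a i \<otimes> a i = (\<Oplus>j\<in>J. (chi j x * chi j x) \<odot> (u j i \<otimes> u j i))"
      unfolding mult[OF i i]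
    proof (rule double_sum_antisymmetric[OF J])
      fix j k assume jk: "j \<in> J" "k \<in> J" "j \<noteq> k"
      have "(chi j x * chi k x) \<odot> (u j i \<otimes> u k i) \<oplus> (chi k x * chi j x) \<odot> (u k i \<otimes> u j i)
          = (chi j x * chi k x) \<odot> (u j i \<otimes> u k i \<oplus> u k i \<otimes> u j i)"
        using uc i jk by (simp add: scale_add_right mult.commute)
      then show "(chi j x * chi k x) \<odot> (u j i \<otimes> u k i) \<oplus> (chi k x * chi j x) \<odot> (u k i \<otimes> u j i) = \<zero>"
        using anti[OF i jk] by simp
    qed (use uc i in auto)
    also have "\<dots> = (\<Oplus>j\<in>J. u j i \<otimes> u j i)" using uc i by (intro sum_cong) auto
    finally show ?thesis using orth[OF i i] by simp
  qed
  moreover have "a i \<otimes> a k = a k \<otimes> a i" if ik: "i \<in> J" "k \<in> J" for i k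
  proof (cases "i = k")
    case False
    have "a k \<otimes> a i = (\<Oplus>j\<in>J. \<Oplus>l\<in>J. (chi j x * chi l x) \<odot> (u l k \<otimes> u j i))"
      unfolding mult[OF ik(2,1)] using J uc ik by (subst sum_swap) (auto simp: mult.commute)
    moreover have "a i \<otimes> a k = (\<Oplus>j\<in>J. \<Oplus>l\<in>J. (chi j x * chi l x) \<odot> (u l k \<otimes> u j i))"
      unfolding mult[OF ik]
    proof (rule double_sum_diag[OF J])
      fix j l assume jl: "j \<in> J" "l \<in> J" "j \<noteq> l"
      show "(chi j x * chi l x) \<odot> (u j i \<otimes> u l k) = (chi j x * chi l x) \<odot> (u l k \<otimes> u j i)"
        using comm[OF jl(1) ik(1) jl(2) ik(2) jl(3) False] by simp
    next
      have "(\<Oplus>j\<in>J. (chi j x * chi j x) \<odot> (u j i \<otimes> u j k)) = (\<Oplus>j\<in>J. u j i \<otimes> u j k)"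
        "(\<Oplus>j\<in>J. (chi j x * chi j x) \<odot> (u j k \<otimes> u j i)) = (\<Oplus>j\<in>J. u j k \<otimes> u j i)"
        using uc ik by (auto intro!: sum_cong)
      then show "(\<Oplus>j\<in>J. (chi j x * chi j x) \<odot> (u j i \<otimes> u j k)) = (\<Oplus>j\<in>J. (chi j x * chi j x) \<odot> (u j k \<otimes> u j i))"
        using orth ik False by simp
    qed (use uc ik in auto)
    ultimately show ?thesis by simp
  qed simp
  ultimately show ?thesis using reflections_pou[OF J, of a] ac unfolding a_def[symmetric] by blast
qed

text \<open>The projections obtained from the rows and from the columns of \<open>u\<close> are spectral projections of the same
  elements \<open>\<Sum> chi j x * chi i y * u j i\<close>: the eigenvalue \<open>n\<close> shows that they agree, and the eigenvalue \<open>n - 2\<close>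
  that they commute with the adjacency matrix.\<close>

theorem neg_orthogonal_imp_magic:
  assumes J: "finite J" and u: "neg_orthogonal J u"
  shows "\<exists>v. magic (cube J) v \<and> intertwines (cube J) (adjacent J) v \<and>
    (\<forall>x\<in>cube J. \<forall>i\<in>J. (\<Oplus>y\<in>cube J. chi i y \<odot> v x y) = (\<Oplus>j\<in>J. chi j x \<odot> u j i))"
proof -
  note V = finite_cube[OF J]
  have uc: "u i j \<in> carrier A" if "i \<in> J" "j \<in> J" for i j
    using u that by (simp add: neg_orthogonal_def)
  have "\<forall>x\<in>cube J. \<exists>e. pou (cube J) e \<and> (\<forall>y\<in>cube J. star A (e y) = e y) \<and>
      (\<forall>i\<in>J. (\<Oplus>y\<in>cube J. chi i y \<odot> e y) = (\<Oplus>j\<in>J. chi j x \<odot> u j i))"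
    using neg_orthogonal_rows[OF J u] by blast
  from bchoice[OF this] obtain v where v': "\<forall>x\<in>cube J. pou (cube J) (v x) \<and>
      (\<forall>y\<in>cube J. star A (v x y) = v x y) \<and>
      (\<forall>i\<in>J. (\<Oplus>y\<in>cube J. chi i y \<odot> v x y) = (\<Oplus>j\<in>J. chi j x \<odot> u j i))"
    by (elim exE)
  have v: "\<And>x. x \<in> cube J \<Longrightarrow> pou (cube J) (v x)"
    "\<And>x y. x \<in> cube J \<Longrightarrow> y \<in> cube J \<Longrightarrow> star A (v x y) = v x y"
    "\<And>x i. x \<in> cube J \<Longrightarrow> i \<in> J \<Longrightarrow> (\<Oplus>y\<in>cube J. chi i y \<odot> v x y) = (\<Oplus>j\<in>J. chi j x \<odot> u j i)"
    using v' by blast+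
  have "\<forall>y\<in>cube J. \<exists>e. pou (cube J) e \<and> (\<forall>x\<in>cube J. star A (e x) = e x) \<and>
      (\<forall>i\<in>J. (\<Oplus>x\<in>cube J. chi i x \<odot> e x) = (\<Oplus>j\<in>J. chi j y \<odot> u i j))"
    using neg_orthogonal_rows[OF J neg_orthogonal_transpose[OF u]] by blast
  from bchoice[OF this] obtain w where w': "\<forall>y\<in>cube J. pou (cube J) (w y) \<and>
      (\<forall>x\<in>cube J. star A (w y x) = w y x) \<and>
      (\<forall>i\<in>J. (\<Oplus>x\<in>cube J. chi i x \<odot> w y x) = (\<Oplus>j\<in>J. chi j y \<odot> u i j))"
    by (elim exE)
  have w: "\<And>y. y \<in> cube J \<Longrightarrow> pou (cube J) (w y)"
    "\<And>y i. y \<in> cube J \<Longrightarrow> i \<in> J \<Longrightarrow> (\<Oplus>x\<in>cube J. chi i x \<odot> w y x) = (\<Oplus>j\<in>J. chi j y \<odot> u i j)"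
    using w' by blast+
  note vc = pouD(1)[OF v(1)] and wc = pouD(1)[OF w(1)]
  have calc: "(\<Oplus>z\<in>cube J. \<Phi> (cube_dot J y z) \<odot> v x z) = (\<Oplus>z\<in>cube J. \<Phi> (cube_dot J x z) \<odot> w y z)"
    if x: "x \<in> cube J" and y: "y \<in> cube J" for x y \<Phi>
  proof (rule functional_calculus[OF v(1)[OF x] V w(1)[OF y] V, where \<Phi> = \<Phi> and \<mu> = "cube_dot J y"
        and \<nu> = "cube_dot J x"])
    have "(\<Oplus>z\<in>cube J. cube_dot J y z \<odot> v x z) = (\<Oplus>i\<in>J. chi i y \<odot> (\<Oplus>j\<in>J. chi j x \<odot> u j i))"
      unfolding cube_dot_expansion[OF J v(1)[OF x], symmetric] using v(3)[OF x] uc by (intro sum_cong) auto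
    also have "\<dots> = (\<Oplus>j\<in>J. chi j x \<odot> (\<Oplus>i\<in>J. chi i y \<odot> u j i))"
      using J uc by (intro sum_scale_swap) auto
    also have "\<dots> = (\<Oplus>z\<in>cube J. cube_dot J x z \<odot> w y z)"
      unfolding cube_dot_expansion[OF J w(1)[OF y], symmetric] using w(2)[OF y] uc by (intro sum_cong) auto
    finally show "(\<Oplus>z\<in>cube J. cube_dot J y z \<odot> v x z) = (\<Oplus>z\<in>cube J. cube_dot J x z \<odot> w y z)" .
  qed
  have vw: "v x y = w y x" if x: "x \<in> cube J" and y: "y \<in> cube J" for x y
    using calc[OF x y, of "\<lambda>t. of_bool (t = of_nat (card J))"]
    by (simp add: cube_pou_pick[OF J vc[OF x] y] cube_pou_pick[OF J wc[OF y] x])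
  have adj: "(\<Oplus>z\<in>cube J. of_bool (cube_dot J y z = of_nat (card J) - 2) \<odot> e z) = (\<Oplus>z\<in>cube J. adjacent J y z \<odot> e z)"
    if "y \<in> cube J" "\<And>z. z \<in> cube J \<Longrightarrow> e z \<in> carrier A" for y e
    using that by (intro sum_cong) (auto simp: cube_dot_adjacent_iff[OF J] adjacent_def)
  have "pou (cube J) (\<lambda>x. v x y)" if y: "y \<in> cube J" for y
    using w(1)[OF y] vw y unfolding pou_def by (auto cong: sum_cong)
  then have "magic (cube J) v" using v(1,2) vc by (simp add: magic_def)
  moreover have "intertwines (cube J) (adjacent J) v"
    unfolding intertwines_def
  proof (intro ballI)
    fix x y assume x: "x \<in> cube J" and y: "y \<in> cube J"
    have "(\<Oplus>k\<in>cube J. adjacent J x k \<odot> v k y) = (\<Oplus>k\<in>cube J. adjacent J x k \<odot> w y k)"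
      using vw y wc by (intro sum_cong) auto
    also have "\<dots> = (\<Oplus>k\<in>cube J. adjacent J y k \<odot> v x k)"
      using calc[OF x y, of "\<lambda>t. of_bool (t = of_nat (card J) - 2)"]
      by (simp add: adj[OF y vc[OF x]] adj[OF x wc[OF y]])
    finally show "(\<Oplus>k\<in>cube J. adjacent J x k \<odot> v k y) = (\<Oplus>k\<in>cube J. adjacent J k y \<odot> v x k)"
      by (simp only: adjacent_sym[of J y])
  qed
  ultimately show ?thesis using v(3) by blast
qed

end

section \<open>Presented quotients\<close>

declare free_simps [simp del]

text \<open>Both algebras of the theorem arise in two stages: a universal C*-algebra for
  \<open>R\<close>, then its quotient by the closed ideal generated by further relations
  \<open>S\<close> inside it.\<close>

locale presented_quotient = presentation G R for G :: "'g set" and R +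
  fixes S :: "'g free_alg completion set"
  assumes S_closed: "S \<subseteq> carrier (universal_cstar G R)"
    and S_star: "s \<in> S \<Longrightarrow> star (universal_cstar G R) s \<in> S"

sublocale presented_quotient \<subseteq> quot: cstar_ideal U "closed_ideal_gen U S"
proof (rule cstar_algebra.closed_ideal_gen_cstar_ideal[OF universal_cstar_algebra S_closed])
  show "star U s \<in> closed_ideal_gen U S" if "s \<in> S" for s
    using cstar_algebra.closed_ideal_gen_superset[OF universal_cstar_algebra S_closed] S_star[OF that] by blast
qed

context presented_quotient
begin

abbreviation PQ :: "'g free_alg completion set cstar_alg" where
  "PQ \<equiv> cstar_quotient U (closed_ideal_gen U S)"

abbreviation pgen :: "'g \<Rightarrow> 'g free_alg completion set" where
  "pgen g \<equiv> closed_ideal_gen U S +>\<^bsub>U\<^esub> universal_gen G R g"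

lemma PQ_cstar_algebra: "cstar_algebra PQ"
  by (rule quot.quotient_cstar_algebra)

lemma PQ_rel: "s \<in> S \<Longrightarrow> closed_ideal_gen U S +>\<^bsub>U\<^esub> s = \<zero>\<^bsub>PQ\<^esub>"
proof -
  assume s: "s \<in> S"
  have sc: "s \<in> carrier U" using s S_closed by blast
  have "s \<in> closed_ideal_gen U S"
    using s cstar_algebra.closed_ideal_gen_superset[OF universal_cstar_algebra S_closed] by blast
  then have "s \<ominus>\<^bsub>U\<^esub> \<zero>\<^bsub>U\<^esub> \<in> closed_ideal_gen U S"
    using sc by (simp add: quot.alg_minus_eq ring.minus_zero[OF quot.ring_A] quot.alg_r_zero)
  then show ?thesis using sc by (simp add: quot.proj_zero quot.proj_eqI)
qed

theorem PQ_hom_exists: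
  assumes B: "cstar_algebra B" and b: "\<And>g. g \<in> G \<Longrightarrow> b g \<in> carrier B"
    and R: "\<And>h r. h \<in> star_hom F B \<Longrightarrow> (\<And>g. g \<in> G \<Longrightarrow> h (gen g) = b g) \<Longrightarrow> r \<in> R \<Longrightarrow> h r = \<zero>\<^bsub>B\<^esub>"
    and S: "\<And>f s. f \<in> star_hom U B \<Longrightarrow> (\<And>g. g \<in> G \<Longrightarrow> f (universal_gen G R g) = b g) \<Longrightarrow> s \<in> S \<Longrightarrow> f s = \<zero>\<^bsub>B\<^esub>"
  obtains f where "f \<in> star_hom PQ B" "\<And>g. g \<in> G \<Longrightarrow> f (pgen g) = b g"
proof -
  obtain f where f: "f \<in> star_hom U B" "\<And>g. g \<in> G \<Longrightarrow> f (universal_gen G R g) = b g"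
  proof (rule universal_hom_exists[of B b])
    show "h r = \<zero>\<^bsub>B\<^esub>" if "h \<in> star_hom F B" "\<And>g. g \<in> G \<Longrightarrow> h (gen g) = b g" "r \<in> R" for h r
      by (rule R[OF that])
  qed (use B b in blast)+
  have "f x = \<zero>\<^bsub>B\<^esub>" if "x \<in> closed_ideal_gen U S" for x
    by (rule cstar_algebra.closed_ideal_gen_kernel[OF universal_cstar_algebra S_closed B f(1) S[OF f] that])
  then obtain f' where f': "f' \<in> star_hom PQ B"
    "\<And>x. x \<in> carrier U \<Longrightarrow> f' (closed_ideal_gen U S +>\<^bsub>U\<^esub> x) = f x"
    using quot.quotient_hom_exists[OF cstar_algebra.axioms(1)[OF B] f(1)] by blast
  show ?thesis by (rule that[OF f'(1)]) (simp add: f'(2) universal_gen_closed f(2))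
qed

theorem PQ_hom_unique:
  assumes B: "cstar_algebra B" and f: "f \<in> star_hom PQ B" and h: "h \<in> star_hom PQ B"
    and eq: "\<And>g. g \<in> G \<Longrightarrow> f (pgen g) = h (pgen g)" and X: "X \<in> carrier PQ"
  shows "f X = h X"
proof -
  obtain x where x: "x \<in> carrier U" "X = closed_ideal_gen U S +>\<^bsub>U\<^esub> x" by (rule quot.quotient_cases[OF X])
  have "(f \<circ> (\<lambda>x. closed_ideal_gen U S +>\<^bsub>U\<^esub> x)) x = (h \<circ> (\<lambda>x. closed_ideal_gen U S +>\<^bsub>U\<^esub> x)) x"
    by (rule universal_hom_unique[OF B star_hom_compose[OF quot.proj_hom f] star_hom_compose[OF quot.proj_hom h] _ x(1)])
      (simp add: eq)
  then show ?thesis by (simp add: x(2))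
qed

end

text \<open>Turns an admissible seminorm into the norm of a C*-algebra in which the relations hold,
  so that boundedness of generators can be proved with results that require completeness.\<close>

lemma admissible_completion:
  fixes G :: "'g set"
  assumes R: "R \<subseteq> carrier (free_star_algebra G)" and q: "admissible G R q"
  obtains C h where "cstar_algebra (C :: 'g free_alg completion cstar_alg)" "h \<in> star_hom (free_star_algebra G) C"
    "\<And>x. x \<in> carrier (free_star_algebra G) \<Longrightarrow> cnorm C (h x) = q x" "\<And>r. r \<in> R \<Longrightarrow> h r = \<zero>\<^bsub>C\<^esub>"
proof -
  interpret cstar_completion "free_star_algebra G" q
    by (rule cstar_completion.intro, rule cstar_seminormed.intro[OF free_star_algebra cstar_seminormed_axioms.intro])
      (use q in \<open>simp add: admissible_def\<close>)
  interpret K: cstar_algebra C by (rule completion_cstar_algebra)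
  have "emb r = \<zero>\<^bsub>C\<^esub>" if "r \<in> R" for r
    using K.cnorm_definite[of "emb r"] cnorm_emb[of r] q that R by (auto simp: admissible_def)
  with that[OF completion_cstar_algebra emb_hom cnorm_emb] show ?thesis by blast
qed

section \<open>Relations\<close>

lemma image_Collect1:
  "(\<And>i. P i \<Longrightarrow> f (g i) = h i) \<Longrightarrow> f ` {g i |i. P i} = {h i |i. P i}"
  by (auto simp: image_iff; metis)

lemma image_Collect2:
  "(\<And>i j. P i j \<Longrightarrow> f (g i j) = h i j) \<Longrightarrow> f ` {g i j |i j. P i j} = {h i j |i j. P i j}"
  by (auto simp: image_iff; metis)

lemma image_Collect3:
  "(\<And>i j k. P i j k \<Longrightarrow> f (g i j k) = h i j k) \<Longrightarrow> f ` {g i j k |i j k. P i j k} = {h i j k |i j k. P i j k}"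
  by (auto simp: image_iff; metis)

lemma image_Collect4:
  "(\<And>i j k l. P i j k l \<Longrightarrow> f (g i j k l) = h i j k l) \<Longrightarrow>
     f ` {g i j k l |i j k l. P i j k l} = {h i j k l |i j k l. P i j k l}"
  by (auto simp: image_iff; metis)

context star_algebra_hom
begin

context
  fixes I :: "'i set" and u :: "'i \<Rightarrow> 'i \<Rightarrow> 'a" and v :: "'i \<Rightarrow> 'i \<Rightarrow> 'b"
  assumes I: "finite I" and u: "\<And>i j. i \<in> I \<Longrightarrow> j \<in> I \<Longrightarrow> u i j \<in> carrier A"
    and fu: "\<And>i j. i \<in> I \<Longrightarrow> j \<in> I \<Longrightarrow> f (u i j) = v i j"
begin

lemma hom_matrix_sum:
  assumes "\<And>k. k \<in> I \<Longrightarrow> g k \<in> carrier A" "\<And>k. k \<in> I \<Longrightarrow> f (g k) = g' k"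
  shows "f (finsum A g I) = finsum B g' I"
proof -
  have "f (finsum A g I) = (\<Oplus>\<^bsub>B\<^esub>k\<in>I. f (g k))" by (rule hom_sum[OF I assms(1)])
  also have "\<dots> = finsum B g' I"
  proof (rule B.sum_cong[OF refl])
    show "g' k \<in> carrier B" if "k \<in> I" for k using hom_closed[OF assms(1)[OF that]] assms(2)[OF that] by simp
  qed (rule assms(2))
  finally show ?thesis .
qed

text \<open>Equality of images serves in both directions: relations that hold in \<open>A\<close>
  also hold in \<open>B\<close>, and when they hold in \<open>B\<close>, \<open>f\<close>
  annihilates the corresponding elements of \<open>A\<close>. The same applies to the other sets of
  relations.\<close>

lemma hom_orthogonal_rels: "f ` orthogonal_rels A I u = orthogonal_rels B I v"
proof -
  have "f (\<Oplus>\<^bsub>A\<^esub>k\<in>I. u i k \<otimes>\<^bsub>A\<^esub> star A (u j k)) = (\<Oplus>\<^bsub>B\<^esub>k\<in>I. v i k \<otimes>\<^bsub>B\<^esub> star B (v j k))"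
    "f (\<Oplus>\<^bsub>A\<^esub>k\<in>I. star A (u k i) \<otimes>\<^bsub>A\<^esub> u k j) = (\<Oplus>\<^bsub>B\<^esub>k\<in>I. star B (v k i) \<otimes>\<^bsub>B\<^esub> v k j)"
    if "i \<in> I" "j \<in> I" for i j
    using u that by (auto intro!: hom_matrix_sum simp: hom_mult hom_star fu)
  then show ?thesis
    unfolding orthogonal_rels_def image_Un
    by (intro arg_cong2[where f = "(\<union>)"] image_Collect2)
      (use u in \<open>auto simp: hom_diff hom_star hom_one hom_zero fu\<close>)
qed

lemma hom_O_neg_rels: "f ` O_neg_rels A I u = O_neg_rels B I v"
  unfolding O_neg_rels_def image_Un
  by (intro arg_cong2[where f = "(\<union>)"] image_Collect3 image_Collect4)
    (use u in \<open>auto simp: hom_add hom_diff hom_mult fu\<close>)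

lemma hom_magic_unitary_rels: "f ` magic_unitary_rels A I u = magic_unitary_rels B I v"
proof -
  have "f (\<Oplus>\<^bsub>A\<^esub>j\<in>I. u i j) = (\<Oplus>\<^bsub>B\<^esub>j\<in>I. v i j)" "f (\<Oplus>\<^bsub>A\<^esub>j\<in>I. u j i) = (\<Oplus>\<^bsub>B\<^esub>j\<in>I. v j i)"
    if "i \<in> I" for i
    using u that fu by (auto intro!: hom_matrix_sum)
  then show ?thesis
    unfolding magic_unitary_rels_def image_Un
    by (intro arg_cong2[where f = "(\<union>)"] image_Collect3 image_Collect2 image_Collect1)
      (use u in \<open>auto simp: hom_diff hom_star hom_one hom_mult fu\<close>)
qed

lemma hom_commutation_rels: "f ` commutation_rels A I d u = commutation_rels B I d v"
proof -
  have "f (\<Oplus>\<^bsub>A\<^esub>k\<in>I. d i k \<odot>\<^bsub>A\<^esub> u k j) = (\<Oplus>\<^bsub>B\<^esub>k\<in>I. d i k \<odot>\<^bsub>B\<^esub> v k j)"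
    "f (\<Oplus>\<^bsub>A\<^esub>k\<in>I. d k j \<odot>\<^bsub>A\<^esub> u i k) = (\<Oplus>\<^bsub>B\<^esub>k\<in>I. d k j \<odot>\<^bsub>B\<^esub> v i k)" if "i \<in> I" "j \<in> I" for i j
    using u that by (auto intro!: hom_matrix_sum simp: hom_scale fu)
  then show ?thesis
    unfolding commutation_rels_def
    by (intro image_Collect2) (use u in \<open>auto simp: hom_diff\<close>)
qed

end

end

context star_algebra
begin

context
  fixes I :: "'i set" and u :: "'i \<Rightarrow> 'i \<Rightarrow> 'a"
  assumes u: "\<And>i j. i \<in> I \<Longrightarrow> j \<in> I \<Longrightarrow> u i j \<in> carrier A"
begin

lemma rels_closed:
  "orthogonal_rels A I u \<subseteq> carrier A" "O_neg_rels A I u \<subseteq> carrier A"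
  "magic_unitary_rels A I u \<subseteq> carrier A" "commutation_rels A I d u \<subseteq> carrier A"
  unfolding orthogonal_rels_def O_neg_rels_def magic_unitary_rels_def commutation_rels_def
  by (auto intro!: u alg_minus_closed sum_closed)

lemma self_adjoint_rel: "star A (u i j) \<ominus> u i j = \<zero> \<Longrightarrow> i \<in> I \<Longrightarrow> j \<in> I \<Longrightarrow> star A (u i j) = u i j"
  by (simp add: diff_zero_iff u)

lemma orthogonal_rels_D:
  assumes "orthogonal_rels A I u \<subseteq> {\<zero>}" and ik: "i \<in> I" "k \<in> I"
  shows "star A (u i k) = u i k"
    and "(\<Oplus>j\<in>I. u i j \<otimes> u k j) = (if i = k then \<one> else \<zero>)"
    and "(\<Oplus>j\<in>I. u j i \<otimes> u j k) = (if i = k then \<one> else \<zero>)"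
proof -
  have o: "r = \<zero>" if "r \<in> orthogonal_rels A I u" for r using that assms(1) by blast
  have sa: "star A (u i j) = u i j" if "i \<in> I" "j \<in> I" for i j
    using o[of "star A (u i j) \<ominus> u i j"] that self_adjoint_rel unfolding orthogonal_rels_def by blast
  then show "star A (u i k) = u i k" using ik by simp
  show "(\<Oplus>j\<in>I. u i j \<otimes> u k j) = (if i = k then \<one> else \<zero>)"
  proof -
    have "(\<Oplus>j\<in>I. u i j \<otimes> star A (u k j)) \<ominus> (if i = k then \<one> else \<zero>) = \<zero>"
      by (rule o) (use ik in \<open>unfold orthogonal_rels_def, blast\<close>)
    then have "(\<Oplus>j\<in>I. u i j \<otimes> star A (u k j)) = (if i = k then \<one> else \<zero>)"
      using u ik by (subst (asm) diff_zero_iff) auto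
    moreover have "(\<Oplus>j\<in>I. u i j \<otimes> star A (u k j)) = (\<Oplus>j\<in>I. u i j \<otimes> u k j)" using sa u ik by (intro sum_cong) auto
    ultimately show ?thesis by simp
  qed
  show "(\<Oplus>j\<in>I. u j i \<otimes> u j k) = (if i = k then \<one> else \<zero>)"
  proof -
    have "(\<Oplus>j\<in>I. star A (u j i) \<otimes> u j k) \<ominus> (if i = k then \<one> else \<zero>) = \<zero>"
      by (rule o) (use ik in \<open>unfold orthogonal_rels_def, blast\<close>)
    then have "(\<Oplus>j\<in>I. star A (u j i) \<otimes> u j k) = (if i = k then \<one> else \<zero>)"
      using u ik by (subst (asm) diff_zero_iff) auto
    moreover have "(\<Oplus>j\<in>I. star A (u j i) \<otimes> u j k) = (\<Oplus>j\<in>I. u j i \<otimes> u j k)" using sa u ik by (intro sum_cong) auto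
    ultimately show ?thesis by simp
  qed
qed

lemma neg_orthogonal_iff:
  "neg_orthogonal I u \<longleftrightarrow> orthogonal_rels A I u \<subseteq> {\<zero>} \<and> O_neg_rels A I u \<subseteq> {\<zero>}"
proof
  assume n: "neg_orthogonal I u"
  have sa: "star A (u i j) = u i j" if "i \<in> I" "j \<in> I" for i j using n that by (simp add: neg_orthogonal_def)
  have rows: "(\<Oplus>j\<in>I. u i j \<otimes> star A (u k j)) = (if i = k then \<one> else \<zero>)" if "i \<in> I" "k \<in> I" for i k
  proof -
    have "(\<Oplus>j\<in>I. u i j \<otimes> star A (u k j)) = (\<Oplus>j\<in>I. u i j \<otimes> u k j)" using sa u that by (intro sum_cong) auto
    then show ?thesis using n that by (simp add: neg_orthogonal_def)
  qed
  have cols: "(\<Oplus>j\<in>I. star A (u j i) \<otimes> u j k) = (if i = k then \<one> else \<zero>)" if "i \<in> I" "k \<in> I" for i k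
  proof -
    have "(\<Oplus>j\<in>I. star A (u j i) \<otimes> u j k) = (\<Oplus>j\<in>I. u j i \<otimes> u j k)" using sa u that by (intro sum_cong) auto
    then show ?thesis using n that by (simp add: neg_orthogonal_def)
  qed
  have "r = \<zero>" if "r \<in> orthogonal_rels A I u" for r
    using that[unfolded orthogonal_rels_def]
  proof (elim UnE CollectE exE conjE)
    fix i j assume r: "r = star A (u i j) \<ominus> u i j" and ij: "i \<in> I" "j \<in> I"
    show ?thesis unfolding r sa[OF ij] using u[OF ij] by (simp add: diff_zero_iff)
  next
    fix i j assume r: "r = (\<Oplus>k\<in>I. u i k \<otimes> star A (u j k)) \<ominus> (if i = j then \<one> else \<zero>)"
      and ij: "i \<in> I" "j \<in> I"
    show ?thesis unfolding r rows[OF ij] by (subst diff_zero_iff) auto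
  next
    fix i j assume r: "r = (\<Oplus>k\<in>I. star A (u k i) \<otimes> u k j) \<ominus> (if i = j then \<one> else \<zero>)"
      and ij: "i \<in> I" "j \<in> I"
    show ?thesis unfolding r cols[OF ij] by (subst diff_zero_iff) auto
  qed
  then have "orthogonal_rels A I u \<subseteq> {\<zero>}" by blast
  moreover have "O_neg_rels A I u \<subseteq> {\<zero>}"
    using n u unfolding O_neg_rels_def neg_orthogonal_def by (auto simp: diff_zero_iff)
  ultimately show "orthogonal_rels A I u \<subseteq> {\<zero>} \<and> O_neg_rels A I u \<subseteq> {\<zero>}" by blast
next
  assume *: "orthogonal_rels A I u \<subseteq> {\<zero>} \<and> O_neg_rels A I u \<subseteq> {\<zero>}"
  have q: "r = \<zero>" if "r \<in> O_neg_rels A I u" for r using that * by blast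
  note sa = orthogonal_rels_D(1)[OF conjunct1[OF *]]
  note rows = orthogonal_rels_D(2)[OF conjunct1[OF *]] and cols = orthogonal_rels_D(3)[OF conjunct1[OF *]]
  have anti1: "u i j \<otimes> u i k \<oplus> u i k \<otimes> u i j = \<zero>" if "i \<in> I" "j \<in> I" "k \<in> I" "j \<noteq> k" for i j k
    by (rule q) (use that in \<open>unfold O_neg_rels_def, blast\<close>)
  have anti2: "u j i \<otimes> u k i \<oplus> u k i \<otimes> u j i = \<zero>" if "i \<in> I" "j \<in> I" "k \<in> I" "j \<noteq> k" for i j k
    by (rule q) (use that in \<open>unfold O_neg_rels_def, blast\<close>)
  have "u i j \<otimes> u k l \<ominus> u k l \<otimes> u i j = \<zero>" if "i \<in> I" "j \<in> I" "k \<in> I" "l \<in> I" "i \<noteq> k" "j \<noteq> l" for i j k l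
    by (rule q) (use that in \<open>unfold O_neg_rels_def, blast\<close>)
  then have comm: "u i j \<otimes> u k l = u k l \<otimes> u i j" if "i \<in> I" "j \<in> I" "k \<in> I" "l \<in> I" "i \<noteq> k" "j \<noteq> l" for i j k l
    using that u by (simp add: diff_zero_iff)
  show "neg_orthogonal I u"
    unfolding neg_orthogonal_def
    by (intro conjI ballI impI; rule u sa rows cols anti1 anti2 comm; assumption)
qed

lemma magic_iff: "magic I u \<longleftrightarrow> magic_unitary_rels A I u \<subseteq> {\<zero>}"
proof
  assume m: "magic I u"
  then show "magic_unitary_rels A I u \<subseteq> {\<zero>}"
    unfolding magic_unitary_rels_def magic_def pou_def by (auto simp: diff_zero_iff)
next
  assume *: "magic_unitary_rels A I u \<subseteq> {\<zero>}"
  then have o: "r = \<zero>" if "r \<in> magic_unitary_rels A I u" for r using that by blast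
  have sa: "star A (u i j) = u i j" if "i \<in> I" "j \<in> I" for i j
    using o[of "star A (u i j) \<ominus> u i j"] that self_adjoint_rel unfolding magic_unitary_rels_def by blast
  have "u i j \<otimes> u i j \<ominus> u i j = \<zero>" if "i \<in> I" "j \<in> I" for i j
    by (rule o) (use that in \<open>unfold magic_unitary_rels_def, blast\<close>)
  then have idem: "u i j \<otimes> u i j = u i j" if "i \<in> I" "j \<in> I" for i j
    using that u by (simp add: diff_zero_iff)
  have rows: "u i j \<otimes> u i k = \<zero>" if "i \<in> I" "j \<in> I" "k \<in> I" "j \<noteq> k" for i j k
    by (rule o) (use that in \<open>unfold magic_unitary_rels_def, blast\<close>)
  have cols: "u j i \<otimes> u k i = \<zero>" if "i \<in> I" "j \<in> I" "k \<in> I" "j \<noteq> k" for i j k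
    by (rule o) (use that in \<open>unfold magic_unitary_rels_def, blast\<close>)
  have rsum: "(\<Oplus>j\<in>I. u i j) = \<one>" if i: "i \<in> I" for i
  proof -
    have "(\<Oplus>j\<in>I. u i j) \<ominus> \<one> = \<zero>"
      by (rule o) (use i in \<open>unfold magic_unitary_rels_def, blast\<close>)
    then show ?thesis using u i by (subst (asm) diff_zero_iff) auto
  qed
  have csum: "(\<Oplus>j\<in>I. u j i) = \<one>" if i: "i \<in> I" for i
  proof -
    have "(\<Oplus>j\<in>I. u j i) \<ominus> \<one> = \<zero>"
      by (rule o) (use i in \<open>unfold magic_unitary_rels_def, blast\<close>)
    then show ?thesis using u i by (subst (asm) diff_zero_iff) auto
  qed
  show "magic I u"
    unfolding magic_def pou_def by (auto simp: u sa idem rows cols rsum csum)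
qed

lemma intertwines_iff: "intertwines I d u \<longleftrightarrow> commutation_rels A I d u \<subseteq> {\<zero>}"
proof -
  have "((\<Oplus>k\<in>I. d i k \<odot> u k j) \<ominus> (\<Oplus>k\<in>I. d k j \<odot> u i k) = \<zero>)
      \<longleftrightarrow> (\<Oplus>k\<in>I. d i k \<odot> u k j) = (\<Oplus>k\<in>I. d k j \<odot> u i k)" if "i \<in> I" "j \<in> I" for i j
    using u that by (intro diff_zero_iff) auto
  then show ?thesis unfolding intertwines_def commutation_rels_def by blast
qed

text \<open>Anticommutators of self-adjoint entries are self-adjoint; the adjoint of a commutator is
  the commutator of the same entries in exchanged order, which is again in the list.\<close>

lemma O_neg_rels_star:
  assumes sa: "\<And>i j. i \<in> I \<Longrightarrow> j \<in> I \<Longrightarrow> star A (u i j) = u i j" and s: "s \<in> O_neg_rels A I u"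
  shows "star A s \<in> O_neg_rels A I u"
  using s[unfolded O_neg_rels_def]
proof (elim UnE CollectE exE conjE)
  fix i j k assume r: "s = u i j \<otimes> u i k \<oplus> u i k \<otimes> u i j" and ij: "i \<in> I" "j \<in> I" "k \<in> I" "j \<noteq> k"
  have "star A s = s" using ij u sa by (simp add: r star_add star_mult alg_a_comm)
  then show ?thesis using s by simp
next
  fix i j k assume r: "s = u j i \<otimes> u k i \<oplus> u k i \<otimes> u j i" and ij: "i \<in> I" "j \<in> I" "k \<in> I" "j \<noteq> k"
  have "star A s = s" using ij u sa by (simp add: r star_add star_mult alg_a_comm)
  then show ?thesis using s by simp
next
  fix i j k l assume r: "s = u i j \<otimes> u k l \<ominus> u k l \<otimes> u i j"
    and ij: "i \<in> I" "j \<in> I" "k \<in> I" "l \<in> I" "i \<noteq> k" "j \<noteq> l"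
  have "star A s = u k l \<otimes> u i j \<ominus> u i j \<otimes> u k l" using ij u sa by (simp add: r star_diff star_mult)
  then show ?thesis unfolding O_neg_rels_def using ij by blast
qed

text \<open>With a real matrix \<open>d\<close> and self-adjoint entries, every relation is its own
  adjoint.\<close>

lemma commutation_rels_star:
  assumes I: "finite I" and sa: "\<And>i j. i \<in> I \<Longrightarrow> j \<in> I \<Longrightarrow> star A (u i j) = u i j"
    and d: "\<And>i j. cnj (d i j) = d i j" and s: "s \<in> commutation_rels A I d u"
  shows "star A s \<in> commutation_rels A I d u"
  using s[unfolded commutation_rels_def]
proof (elim CollectE exE conjE)
  fix i j assume r: "s = (\<Oplus>k\<in>I. d i k \<odot> u k j) \<ominus> (\<Oplus>k\<in>I. d k j \<odot> u i k)" and ij: "i \<in> I" "j \<in> I"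
  have "(\<Oplus>k\<in>I. star A (d i k \<odot> u k j)) = (\<Oplus>k\<in>I. d i k \<odot> u k j)"
    "(\<Oplus>k\<in>I. star A (d k j \<odot> u i k)) = (\<Oplus>k\<in>I. d k j \<odot> u i k)"
    using u ij sa d by (auto intro!: sum_cong simp: star_smult)
  then have "star A s = s" using ij u I by (simp add: r star_diff sum_star)
  then show ?thesis using s by simp
qed

end

end

lemma gen_matrix_closed:
  "i \<in> I \<Longrightarrow> j \<in> I \<Longrightarrow> gen_matrix i j \<in> carrier (free_star_algebra (I \<times> I))"
  by (simp add: gen_closed)

section \<open>The algebra of functions on \<open>O_n^{-1}\<close>\<close>

lemma rels_vanish:
  assumes "f ` X = Y" "Y \<subseteq> {z}" "r \<in> X"
  shows "f r = z"
  using assms by auto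

text \<open>Along a row the squares of the self-adjoint entries add up to 1, so
  \<open>square_le_unit_bound\<close> bounds every generator by 1.\<close>

lemma A_o_presentation: "presentation ({1..n} \<times> {1..n}) (A_o_rels n)"
proof
  let ?I = "{1..n}" and ?G = "{1..n} \<times> {1..n}"
  interpret F: star_algebra "free_star_algebra ?G" by (rule free_star_algebra)
  show closed: "A_o_rels n \<subseteq> carrier (free_star_algebra ?G)"
    unfolding A_o_rels_def by (rule F.rels_closed(1)) (rule gen_matrix_closed)
  fix g :: "nat \<times> nat" assume "g \<in> ?G"
  then obtain i j where g: "g = (i, j)" "i \<in> ?I" "j \<in> ?I" by blast
  have "q (gen g) \<le> 1" if q: "admissible ?G (A_o_rels n) q" for q
  proof -
    obtain C h where C: "cstar_algebra (C :: nat matrix_univ cstar_alg)" and h: "h \<in> star_hom (free_star_algebra ?G) C"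
      and n: "\<And>x. x \<in> carrier (free_star_algebra ?G) \<Longrightarrow> cnorm C (h x) = q x"
      and z: "\<And>r. r \<in> A_o_rels n \<Longrightarrow> h r = \<zero>\<^bsub>C\<^esub>"
      using admissible_completion[OF closed q] by blast
    interpret C: cstar_algebra C by fact
    interpret h: star_algebra_hom "free_star_algebra ?G" C h by unfold_locales fact
    define u where "u i j = h (gen_matrix i j)" for i j
    have uc: "u i j \<in> carrier C" if "i \<in> ?I" "j \<in> ?I" for i j
      unfolding u_def using that by (intro h.hom_closed gen_matrix_closed)
    have rels: "orthogonal_rels C ?I u \<subseteq> {\<zero>\<^bsub>C\<^esub>}"
      using h.hom_orthogonal_rels[of ?I gen_matrix u] gen_matrix_closed[of _ ?I] z
      unfolding A_o_rels_def[symmetric] by (auto simp: u_def)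
    have sa: "star C (u i j) = u i j" if "i \<in> ?I" "j \<in> ?I" for i j
      using C.orthogonal_rels_D(1)[OF uc rels] that by blast
    have "(\<Oplus>\<^bsub>C\<^esub>k\<in>?I. u i k \<otimes>\<^bsub>C\<^esub> u i k) = \<one>\<^bsub>C\<^esub>"
      using C.orthogonal_rels_D(2)[OF uc rels g(2) g(2)] by simp
    then have "cnorm C (u i j) \<le> 1"
      by (intro C.square_le_unit_bound[of ?I "u i" j]) (use uc sa g in auto)
    then show ?thesis using n[OF gen_matrix_closed[OF g(2,3)]] by (simp add: u_def g(1))
  qed
  then show "\<exists>C. \<forall>q. admissible ?G (A_o_rels n) q \<longrightarrow> q (gen g) \<le> C" by blast
qed

text \<open>The norm of a projection equals its own square, hence is at most 1.\<close>

lemma A_s_presentation: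
  assumes V: "finite V"
  shows "presentation (V \<times> V) (A_s_rels V)"
proof
  interpret F: star_algebra "free_star_algebra (V \<times> V)" by (rule free_star_algebra)
  show closed: "A_s_rels V \<subseteq> carrier (free_star_algebra (V \<times> V))"
    unfolding A_s_rels_def by (rule F.rels_closed(3)) (rule gen_matrix_closed)
  fix g assume "g \<in> V \<times> V"
  then obtain i j where g: "g = (i, j)" "i \<in> V" "j \<in> V" by blast
  have "q (gen g) \<le> 1" if q: "admissible (V \<times> V) (A_s_rels V) q" for q
  proof -
    obtain C h where C: "cstar_algebra (C :: 'a matrix_univ cstar_alg)" and h: "h \<in> star_hom (free_star_algebra (V \<times> V)) C"
      and n: "\<And>x. x \<in> carrier (free_star_algebra (V \<times> V)) \<Longrightarrow> cnorm C (h x) = q x"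
      and z: "\<And>r. r \<in> A_s_rels V \<Longrightarrow> h r = \<zero>\<^bsub>C\<^esub>"
      using admissible_completion[OF closed q] by blast
    interpret C: cstar_algebra C by fact
    interpret h: star_algebra_hom "free_star_algebra (V \<times> V)" C h by unfold_locales fact
    define u where "u i j = h (gen_matrix i j)" for i j
    have uc: "u i j \<in> carrier C" if "i \<in> V" "j \<in> V" for i j
      unfolding u_def using that by (intro h.hom_closed gen_matrix_closed)
    have "magic_unitary_rels C V u \<subseteq> {\<zero>\<^bsub>C\<^esub>}"
      using h.hom_magic_unitary_rels[OF V, of gen_matrix u] gen_matrix_closed[of _ V] z
      unfolding A_s_rels_def[symmetric] by (auto simp: u_def)
    then have "C.magic V u" using C.magic_iff[of V u] uc by blast
    then have "star C (u i j) \<otimes>\<^bsub>C\<^esub> u i j = u i j" using g by (simp add: C.magic_def C.pou_def)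
    then have "cnorm C (u i j) * cnorm C (u i j) = cnorm C (u i j)"
      using C.p_star_mult[OF uc[OF g(2,3)]] by (simp add: power2_eq_square)
    then have "cnorm C (u i j) \<le> 1" by auto
    then show ?thesis using n[OF gen_matrix_closed[OF g(2,3)]] by (simp add: u_def g(1))
  qed
  then show "\<exists>C. \<forall>q. admissible (V \<times> V) (A_s_rels V) q \<longrightarrow> q (gen g) \<le> C" by blast
qed

lemma image_vanish: "f ` X = Y \<Longrightarrow> (\<And>x. x \<in> X \<Longrightarrow> f x = z) \<Longrightarrow> Y \<subseteq> {z}"
  by auto

lemma A_o_gen_facts:
  shows "\<And>i j. i \<in> {1..n} \<Longrightarrow> j \<in> {1..n} \<Longrightarrow> A_o_gen n i j \<in> carrier (A_o n)"
    and "orthogonal_rels (A_o n) {1..n} (A_o_gen n) \<subseteq> {\<zero>\<^bsub>A_o n\<^esub>}"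
proof -
  interpret P: presentation "{1..n} \<times> {1..n}" "A_o_rels n" by (rule A_o_presentation)
  interpret U: cstar_algebra "A_o n" unfolding A_o_def by (rule P.universal_cstar_algebra)
  interpret E: star_algebra_hom P.F "A_o n" P.emb
    by unfold_locales (unfold A_o_def, rule P.universal_hom)
  show c: "A_o_gen n i j \<in> carrier (A_o n)" if "i \<in> {1..n}" "j \<in> {1..n}" for i j
    unfolding A_o_gen_def A_o_def by (rule P.universal_gen_closed) (use that in blast)
  have im: "P.emb ` orthogonal_rels P.F {1..n} gen_matrix = orthogonal_rels (A_o n) {1..n} (A_o_gen n)"
  proof (rule E.hom_orthogonal_rels)
    show "gen_matrix i j \<in> carrier P.F" if "i \<in> {1..n}" "j \<in> {1..n}" for i j
      by (rule gen_matrix_closed[OF that])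
    show "P.emb (gen_matrix i j) = A_o_gen n i j" for i j
      unfolding A_o_gen_def by (rule P.universal_gen_eq[symmetric])
  qed simp
  have "P.emb r = \<zero>\<^bsub>A_o n\<^esub>" if "r \<in> orthogonal_rels P.F {1..n} gen_matrix" for r
    using P.universal_rel[of r] that unfolding A_o_def A_o_rels_def by blast
  then show "orthogonal_rels (A_o n) {1..n} (A_o_gen n) \<subseteq> {\<zero>\<^bsub>A_o n\<^esub>}"
    unfolding im[symmetric] by blast
qed

lemma A_s_gen_facts:
  assumes V: "finite V"
  shows "\<And>i j. i \<in> V \<Longrightarrow> j \<in> V \<Longrightarrow> A_s_gen V i j \<in> carrier (A_s V)"
    and "magic_unitary_rels (A_s V) V (A_s_gen V) \<subseteq> {\<zero>\<^bsub>A_s V\<^esub>}"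
proof -
  interpret P: presentation "V \<times> V" "A_s_rels V" by (rule A_s_presentation[OF V])
  interpret U: cstar_algebra "A_s V" unfolding A_s_def by (rule P.universal_cstar_algebra)
  interpret E: star_algebra_hom P.F "A_s V" P.emb
    by unfold_locales (unfold A_s_def, rule P.universal_hom)
  show c: "A_s_gen V i j \<in> carrier (A_s V)" if "i \<in> V" "j \<in> V" for i j
    unfolding A_s_gen_def A_s_def by (rule P.universal_gen_closed) (use that in blast)
  have im: "P.emb ` magic_unitary_rels P.F V gen_matrix = magic_unitary_rels (A_s V) V (A_s_gen V)"
  proof (rule E.hom_magic_unitary_rels[OF V])
    show "gen_matrix i j \<in> carrier P.F" if "i \<in> V" "j \<in> V" for i j
      by (rule gen_matrix_closed[OF that])
    show "P.emb (gen_matrix i j) = A_s_gen V i j" for i j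
      unfolding A_s_gen_def by (rule P.universal_gen_eq[symmetric])
  qed
  have "P.emb r = \<zero>\<^bsub>A_s V\<^esub>" if "r \<in> magic_unitary_rels P.F V gen_matrix" for r
    using P.universal_rel[of r] that unfolding A_s_def A_s_rels_def by blast
  then show "magic_unitary_rels (A_s V) V (A_s_gen V) \<subseteq> {\<zero>\<^bsub>A_s V\<^esub>}"
    unfolding im[symmetric] by blast
qed

lemma C_O_neg_presented:
  "presented_quotient ({1..n} \<times> {1..n}) (A_o_rels n) (O_neg_rels (A_o n) {1..n} (A_o_gen n))"
proof -
  interpret P: presentation "{1..n} \<times> {1..n}" "A_o_rels n" by (rule A_o_presentation)
  interpret U: cstar_algebra "A_o n" unfolding A_o_def by (rule P.universal_cstar_algebra)
  note g = A_o_gen_facts[where n = n]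
  have sa: "star (A_o n) (A_o_gen n i j) = A_o_gen n i j" if "i \<in> {1..n}" "j \<in> {1..n}" for i j
    using U.orthogonal_rels_D(1)[OF g] that by blast
  show ?thesis
  proof (unfold_locales, unfold A_o_def[symmetric])
    show "O_neg_rels (A_o n) {1..n} (A_o_gen n) \<subseteq> carrier (A_o n)"
      by (rule U.rels_closed(2)) (rule g(1))
    show "star (A_o n) s \<in> O_neg_rels (A_o n) {1..n} (A_o_gen n)"
      if "s \<in> O_neg_rels (A_o n) {1..n} (A_o_gen n)" for s
      by (rule U.O_neg_rels_star[OF _ _ that]; rule g(1) sa; assumption)
  qed
qed

lemma quantum_sym_presented:
  assumes V: "finite V"
  shows "presented_quotient (V \<times> V) (A_s_rels V) (commutation_rels (A_s V) V (adjacency E) (A_s_gen V))"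
proof -
  interpret P: presentation "V \<times> V" "A_s_rels V" by (rule A_s_presentation[OF V])
  interpret U: cstar_algebra "A_s V" unfolding A_s_def by (rule P.universal_cstar_algebra)
  note g = A_s_gen_facts[OF V]
  have "U.magic V (A_s_gen V)" using U.magic_iff[of V "A_s_gen V"] g by blast
  then have sa: "star (A_s V) (A_s_gen V i j) = A_s_gen V i j" if "i \<in> V" "j \<in> V" for i j
    using that by (simp add: U.magic_def)
  show ?thesis
  proof (unfold_locales, unfold A_s_def[symmetric])
    show "commutation_rels (A_s V) V (adjacency E) (A_s_gen V) \<subseteq> carrier (A_s V)"
      by (rule U.rels_closed(4)) (rule g(1))
    show "star (A_s V) s \<in> commutation_rels (A_s V) V (adjacency E) (A_s_gen V)"
      if s: "s \<in> commutation_rels (A_s V) V (adjacency E) (A_s_gen V)" for s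
    proof (rule U.commutation_rels_star[OF _ V _ _ s])
      show "cnj (adjacency E i j) = adjacency E i j" for i j by (simp add: adjacency_def)
    qed (rule g(1) sa; assumption)+
  qed
qed

theorem C_O_neg_cstar_algebra: "cstar_algebra (C_O_neg n)"
  using presented_quotient.PQ_cstar_algebra[OF C_O_neg_presented[of n]]
  by (simp add: C_O_neg_def C_O_neg_ideal_def A_o_def)

theorem C_O_neg_neg_orthogonal: "star_algebra.neg_orthogonal (C_O_neg n) {1..n} (C_O_neg_gen n)"
proof -
  let ?S = "O_neg_rels (A_o n) {1..n} (A_o_gen n)"
  interpret P: presented_quotient "{1..n} \<times> {1..n}" "A_o_rels n" ?S by (rule C_O_neg_presented)
  have fold: "P.U = A_o n" "closed_ideal_gen (A_o n) ?S = C_O_neg_ideal n"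
    "cstar_quotient (A_o n) (C_O_neg_ideal n) = C_O_neg n"
    by (simp_all only: A_o_def C_O_neg_ideal_def C_O_neg_def)
  interpret Q: cstar_algebra "C_O_neg n" by (rule C_O_neg_cstar_algebra)
  interpret p: star_algebra_hom "A_o n" "C_O_neg n" "\<lambda>x. C_O_neg_ideal n +>\<^bsub>A_o n\<^esub> x"
    using P.quot.proj.star_algebra_hom_axioms unfolding fold .
  have rel: "C_O_neg_ideal n +>\<^bsub>A_o n\<^esub> s = \<zero>\<^bsub>C_O_neg n\<^esub>" if "s \<in> ?S" for s
    using P.PQ_rel[OF that] unfolding fold .
  note g = A_o_gen_facts[where n = n]
  have c: "C_O_neg_gen n i j \<in> carrier (C_O_neg n)" if "i \<in> {1..n}" "j \<in> {1..n}" for i j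
    unfolding C_O_neg_gen_def by (rule p.hom_closed[OF g(1)[OF that]])
  have "(\<lambda>x. C_O_neg_ideal n +>\<^bsub>A_o n\<^esub> x) ` orthogonal_rels (A_o n) {1..n} (A_o_gen n)
      = orthogonal_rels (C_O_neg n) {1..n} (C_O_neg_gen n)"
    by (rule p.hom_orthogonal_rels) (simp_all add: g(1)[simplified] C_O_neg_gen_def)
  then have "orthogonal_rels (C_O_neg n) {1..n} (C_O_neg_gen n) \<subseteq> {\<zero>\<^bsub>C_O_neg n\<^esub>}"
    by (rule image_vanish) (use g(2) p.hom_zero in auto)
  moreover have "(\<lambda>x. C_O_neg_ideal n +>\<^bsub>A_o n\<^esub> x) ` ?S = O_neg_rels (C_O_neg n) {1..n} (C_O_neg_gen n)"
    by (rule p.hom_O_neg_rels) (simp_all add: g(1)[simplified] C_O_neg_gen_def)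
  then have "O_neg_rels (C_O_neg n) {1..n} (C_O_neg_gen n) \<subseteq> {\<zero>\<^bsub>C_O_neg n\<^esub>}"
    by (rule image_vanish) (rule rel)
  ultimately show ?thesis using Q.neg_orthogonal_iff[of "{1..n}" "C_O_neg_gen n"] c by blast
qed

theorem C_O_neg_hom_exists:
  assumes B: "cstar_algebra B" and u: "star_algebra.neg_orthogonal B {1..n} u"
  obtains f where "f \<in> star_hom (C_O_neg n) B"
    "\<And>i j. i \<in> {1..n} \<Longrightarrow> j \<in> {1..n} \<Longrightarrow> f (C_O_neg_gen n i j) = u i j"
proof -
  let ?S = "O_neg_rels (A_o n) {1..n} (A_o_gen n)"
  interpret P: presented_quotient "{1..n} \<times> {1..n}" "A_o_rels n" ?S by (rule C_O_neg_presented)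
  have Q: "P.PQ = C_O_neg n" by (simp add: C_O_neg_def C_O_neg_ideal_def A_o_def)
  have gen: "P.pgen (i, j) = C_O_neg_gen n i j" for i j
    by (simp add: C_O_neg_gen_def C_O_neg_ideal_def A_o_def A_o_gen_def)
  interpret B: cstar_algebra B by fact
  have uc: "u i j \<in> carrier B" if "i \<in> {1..n}" "j \<in> {1..n}" for i j
    using u that by (simp add: B.neg_orthogonal_def)
  have rels: "orthogonal_rels B {1..n} u \<subseteq> {\<zero>\<^bsub>B\<^esub>}" "O_neg_rels B {1..n} u \<subseteq> {\<zero>\<^bsub>B\<^esub>}"
    using B.neg_orthogonal_iff[of "{1..n}" u] uc u by blast+
  obtain f where f: "f \<in> star_hom P.PQ B" "\<And>g. g \<in> {1..n} \<times> {1..n} \<Longrightarrow> f (P.pgen g) = u (fst g) (snd g)"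
  proof (rule P.PQ_hom_exists[OF B, of "\<lambda>g. u (fst g) (snd g)"])
    show "u (fst g) (snd g) \<in> carrier B" if "g \<in> {1..n} \<times> {1..n}" for g using that uc by auto
    show "h r = \<zero>\<^bsub>B\<^esub>" if h: "h \<in> star_hom P.F B" "\<And>g. g \<in> {1..n} \<times> {1..n} \<Longrightarrow> h (gen g) = u (fst g) (snd g)"
      and r: "r \<in> A_o_rels n" for h r
    proof -
      interpret h: star_algebra_hom P.F B h by unfold_locales fact
      have "h ` A_o_rels n = orthogonal_rels B {1..n} u"
        unfolding A_o_rels_def by (rule h.hom_orthogonal_rels) (simp_all add: gen_matrix_closed h(2))
      then show ?thesis by (rule rels_vanish[OF _ rels(1) r])
    qed
    show "h s = \<zero>\<^bsub>B\<^esub>" if h: "h \<in> star_hom P.U B"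
      "\<And>g. g \<in> {1..n} \<times> {1..n} \<Longrightarrow> h (universal_gen ({1..n} \<times> {1..n}) (A_o_rels n) g) = u (fst g) (snd g)"
      and s: "s \<in> ?S" for h s
    proof -
      interpret U: cstar_algebra "A_o n" unfolding A_o_def by (rule P.universal_cstar_algebra)
      interpret h: star_algebra_hom "A_o n" B h by unfold_locales (use h(1) in \<open>simp add: A_o_def\<close>)
      have "h ` ?S = O_neg_rels B {1..n} u"
      proof (rule h.hom_O_neg_rels)
        show "A_o_gen n i j \<in> carrier (A_o n)" "h (A_o_gen n i j) = u i j"
          if "i \<in> {1..n}" "j \<in> {1..n}" for i j
          using A_o_gen_facts(1)[OF that] h(2)[of "(i, j)"] that by (simp_all add: A_o_gen_def)
      qed simp
      then show ?thesis by (rule rels_vanish[OF _ rels(2) s])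
    qed
  qed blast
  show ?thesis
  proof (rule that[of f])
    show "f \<in> star_hom (C_O_neg n) B" using f(1) unfolding Q .
    show "f (C_O_neg_gen n i j) = u i j" if "i \<in> {1..n}" "j \<in> {1..n}" for i j
      using f(2)[of "(i, j)"] that unfolding gen by simp
  qed
qed

theorem C_O_neg_hom_unique:
  assumes B: "cstar_algebra B" and f: "f \<in> star_hom (C_O_neg n) B" and h: "h \<in> star_hom (C_O_neg n) B"
    and eq: "\<And>i j. i \<in> {1..n} \<Longrightarrow> j \<in> {1..n} \<Longrightarrow> f (C_O_neg_gen n i j) = h (C_O_neg_gen n i j)"
    and X: "X \<in> carrier (C_O_neg n)"
  shows "f X = h X"
proof -
  let ?S = "O_neg_rels (A_o n) {1..n} (A_o_gen n)"
  interpret P: presented_quotient "{1..n} \<times> {1..n}" "A_o_rels n" ?S by (rule C_O_neg_presented)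
  have Q: "P.PQ = C_O_neg n" by (simp add: C_O_neg_def C_O_neg_ideal_def A_o_def)
  have gen: "P.pgen (i, j) = C_O_neg_gen n i j" for i j
    by (simp add: C_O_neg_gen_def C_O_neg_ideal_def A_o_def A_o_gen_def)
  have "f (P.pgen g) = h (P.pgen g)" if "g \<in> {1..n} \<times> {1..n}" for g
    using that by (elim SigmaE) (simp only: gen eq)
  then show ?thesis using P.PQ_hom_unique[OF B, unfolded Q, OF f h _ X] by blast
qed

section \<open>Quantum symmetry algebras\<close>

theorem quantum_sym_cstar_algebra: "finite V \<Longrightarrow> cstar_algebra (quantum_sym V E)"
  using presented_quotient.PQ_cstar_algebra[OF quantum_sym_presented[of V E]]
  by (simp add: quantum_sym_def quantum_sym_ideal_def A_s_def)

theorem quantum_sym_magic: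
  assumes V: "finite V"
  shows "star_algebra.magic (quantum_sym V E) V (quantum_sym_gen V E)"
    and "star_algebra.intertwines (quantum_sym V E) V (adjacency E) (quantum_sym_gen V E)"
proof -
  let ?S = "commutation_rels (A_s V) V (adjacency E) (A_s_gen V)"
  interpret P: presented_quotient "V \<times> V" "A_s_rels V" ?S by (rule quantum_sym_presented[OF V])
  have fold: "P.U = A_s V" "closed_ideal_gen (A_s V) ?S = quantum_sym_ideal V E"
    "cstar_quotient (A_s V) (quantum_sym_ideal V E) = quantum_sym V E"
    by (simp_all only: A_s_def quantum_sym_ideal_def quantum_sym_def)
  interpret Q: cstar_algebra "quantum_sym V E" by (rule quantum_sym_cstar_algebra[OF V])
  interpret p: star_algebra_hom "A_s V" "quantum_sym V E" "\<lambda>x. quantum_sym_ideal V E +>\<^bsub>A_s V\<^esub> x"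
    using P.quot.proj.star_algebra_hom_axioms unfolding fold .
  have rel: "quantum_sym_ideal V E +>\<^bsub>A_s V\<^esub> s = \<zero>\<^bsub>quantum_sym V E\<^esub>" if "s \<in> ?S" for s
    using P.PQ_rel[OF that] unfolding fold .
  note g = A_s_gen_facts[OF V]
  have c: "quantum_sym_gen V E i j \<in> carrier (quantum_sym V E)" if "i \<in> V" "j \<in> V" for i j
    unfolding quantum_sym_gen_def by (rule p.hom_closed[OF g(1)[OF that]])
  have "(\<lambda>x. quantum_sym_ideal V E +>\<^bsub>A_s V\<^esub> x) ` magic_unitary_rels (A_s V) V (A_s_gen V)
      = magic_unitary_rels (quantum_sym V E) V (quantum_sym_gen V E)"
    by (rule p.hom_magic_unitary_rels[OF V]) (simp_all add: g(1) quantum_sym_gen_def)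
  then have "magic_unitary_rels (quantum_sym V E) V (quantum_sym_gen V E) \<subseteq> {\<zero>\<^bsub>quantum_sym V E\<^esub>}"
    by (rule image_vanish) (use g(2) p.hom_zero in auto)
  then show "Q.magic V (quantum_sym_gen V E)" using Q.magic_iff[of V "quantum_sym_gen V E"] c by blast
  have "(\<lambda>x. quantum_sym_ideal V E +>\<^bsub>A_s V\<^esub> x) ` ?S
      = commutation_rels (quantum_sym V E) V (adjacency E) (quantum_sym_gen V E)"
    by (rule p.hom_commutation_rels[OF V]) (simp_all add: g(1) quantum_sym_gen_def)
  then have "commutation_rels (quantum_sym V E) V (adjacency E) (quantum_sym_gen V E) \<subseteq> {\<zero>\<^bsub>quantum_sym V E\<^esub>}"
    by (rule image_vanish) (rule rel)
  then show "Q.intertwines V (adjacency E) (quantum_sym_gen V E)"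
    using Q.intertwines_iff[of V "quantum_sym_gen V E"] c by blast
qed

theorem quantum_sym_hom_exists:
  assumes V: "finite V" and B: "cstar_algebra B" and v: "star_algebra.magic B V v"
    "star_algebra.intertwines B V (adjacency E) v"
  obtains f where "f \<in> star_hom (quantum_sym V E) B"
    "\<And>i j. i \<in> V \<Longrightarrow> j \<in> V \<Longrightarrow> f (quantum_sym_gen V E i j) = v i j"
proof -
  let ?S = "commutation_rels (A_s V) V (adjacency E) (A_s_gen V)"
  interpret P: presented_quotient "V \<times> V" "A_s_rels V" ?S by (rule quantum_sym_presented[OF V])
  have Q: "P.PQ = quantum_sym V E" by (simp add: quantum_sym_def quantum_sym_ideal_def A_s_def)
  have gen: "P.pgen (i, j) = quantum_sym_gen V E i j" for i j
    by (simp add: quantum_sym_gen_def quantum_sym_ideal_def A_s_def A_s_gen_def)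
  interpret B: cstar_algebra B by fact
  have vc: "v i j \<in> carrier B" if "i \<in> V" "j \<in> V" for i j
    using v that by (simp add: B.magic_def)
  have rels: "magic_unitary_rels B V v \<subseteq> {\<zero>\<^bsub>B\<^esub>}" "commutation_rels B V (adjacency E) v \<subseteq> {\<zero>\<^bsub>B\<^esub>}"
    using B.magic_iff[of V v] B.intertwines_iff[of V v] vc v by blast+
  obtain f where f: "f \<in> star_hom P.PQ B" "\<And>g. g \<in> V \<times> V \<Longrightarrow> f (P.pgen g) = v (fst g) (snd g)"
  proof (rule P.PQ_hom_exists[OF B, of "\<lambda>g. v (fst g) (snd g)"])
    show "v (fst g) (snd g) \<in> carrier B" if "g \<in> V \<times> V" for g using that vc by auto
    show "h r = \<zero>\<^bsub>B\<^esub>" if h: "h \<in> star_hom P.F B" "\<And>g. g \<in> V \<times> V \<Longrightarrow> h (gen g) = v (fst g) (snd g)"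
      and r: "r \<in> A_s_rels V" for h r
    proof -
      interpret h: star_algebra_hom P.F B h by unfold_locales fact
      have "h ` A_s_rels V = magic_unitary_rels B V v"
        unfolding A_s_rels_def by (rule h.hom_magic_unitary_rels[OF V]) (simp_all add: gen_matrix_closed h(2))
      then show ?thesis by (rule rels_vanish[OF _ rels(1) r])
    qed
    show "h s = \<zero>\<^bsub>B\<^esub>" if h: "h \<in> star_hom P.U B"
      "\<And>g. g \<in> V \<times> V \<Longrightarrow> h (universal_gen (V \<times> V) (A_s_rels V) g) = v (fst g) (snd g)"
      and s: "s \<in> ?S" for h s
    proof -
      interpret U: cstar_algebra "A_s V" unfolding A_s_def by (rule P.universal_cstar_algebra)
      interpret h: star_algebra_hom "A_s V" B h by unfold_locales (use h(1) in \<open>simp add: A_s_def\<close>)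
      have "h ` ?S = commutation_rels B V (adjacency E) v"
      proof (rule h.hom_commutation_rels[OF V])
        show "A_s_gen V i j \<in> carrier (A_s V)" "h (A_s_gen V i j) = v i j" if "i \<in> V" "j \<in> V" for i j
          using A_s_gen_facts(1)[OF V that] h(2)[of "(i, j)"] that by (simp_all add: A_s_gen_def)
      qed
      then show ?thesis by (rule rels_vanish[OF _ rels(2) s])
    qed
  qed blast
  show ?thesis
  proof (rule that[of f])
    show "f \<in> star_hom (quantum_sym V E) B" using f(1) unfolding Q .
    show "f (quantum_sym_gen V E i j) = v i j" if "i \<in> V" "j \<in> V" for i j
      using f(2)[of "(i, j)"] that unfolding gen by simp
  qed
qed

theorem quantum_sym_hom_unique:
  assumes V: "finite V" and B: "cstar_algebra B" and f: "f \<in> star_hom (quantum_sym V E) B"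
    and h: "h \<in> star_hom (quantum_sym V E) B"
    and eq: "\<And>i j. i \<in> V \<Longrightarrow> j \<in> V \<Longrightarrow> f (quantum_sym_gen V E i j) = h (quantum_sym_gen V E i j)"
    and X: "X \<in> carrier (quantum_sym V E)"
  shows "f X = h X"
proof -
  let ?S = "commutation_rels (A_s V) V (adjacency E) (A_s_gen V)"
  interpret P: presented_quotient "V \<times> V" "A_s_rels V" ?S by (rule quantum_sym_presented[OF V])
  have Q: "P.PQ = quantum_sym V E" by (simp add: quantum_sym_def quantum_sym_ideal_def A_s_def)
  have gen: "P.pgen (i, j) = quantum_sym_gen V E i j" for i j
    by (simp add: quantum_sym_gen_def quantum_sym_ideal_def A_s_def A_s_gen_def)
  have "f (P.pgen g) = h (P.pgen g)" if "g \<in> V \<times> V" for g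
    using that by (elim SigmaE) (simp only: gen eq)
  then show ?thesis using P.PQ_hom_unique[OF B, unfolded Q, OF f h _ X] by blast
qed

section \<open>Tensor products\<close>

text \<open>What a map on pairs needs in order to factor through the tensor product: the relations
  of \<open>tensor_rels\<close>, read as equations in \<open>C\<close> without reference to free
  algebras.\<close>

definition tensor_like ::
  "('a, 'm) star_alg_scheme \<Rightarrow> ('b, 'n) star_alg_scheme \<Rightarrow> ('c, 'k) star_alg_scheme \<Rightarrow> ('a \<Rightarrow> 'b \<Rightarrow> 'c) \<Rightarrow> bool"
  where
  "tensor_like A B C t \<longleftrightarrow>
     (\<forall>a\<in>carrier A. \<forall>b\<in>carrier B. t a b \<in> carrier C) \<and>
     (\<forall>a\<in>carrier A. \<forall>a'\<in>carrier A. \<forall>b\<in>carrier B. t (a \<oplus>\<^bsub>A\<^esub> a') b = t a b \<oplus>\<^bsub>C\<^esub> t a' b) \<and>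
     (\<forall>a\<in>carrier A. \<forall>b\<in>carrier B. \<forall>b'\<in>carrier B. t a (b \<oplus>\<^bsub>B\<^esub> b') = t a b \<oplus>\<^bsub>C\<^esub> t a b') \<and>
     (\<forall>c. \<forall>a\<in>carrier A. \<forall>b\<in>carrier B. t (c \<odot>\<^bsub>A\<^esub> a) b = c \<odot>\<^bsub>C\<^esub> t a b) \<and>
     (\<forall>c. \<forall>a\<in>carrier A. \<forall>b\<in>carrier B. t a (c \<odot>\<^bsub>B\<^esub> b) = c \<odot>\<^bsub>C\<^esub> t a b) \<and>
     (\<forall>a\<in>carrier A. \<forall>a'\<in>carrier A. \<forall>b\<in>carrier B. \<forall>b'\<in>carrier B.
        t a b \<otimes>\<^bsub>C\<^esub> t a' b' = t (a \<otimes>\<^bsub>A\<^esub> a') (b \<otimes>\<^bsub>B\<^esub> b')) \<and>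
     (\<forall>a\<in>carrier A. \<forall>b\<in>carrier B. star C (t a b) = t (star A a) (star B b)) \<and>
     t \<one>\<^bsub>A\<^esub> \<one>\<^bsub>B\<^esub> = \<one>\<^bsub>C\<^esub>"

lemma tensor_likeD:
  assumes "tensor_like A B C t"
  shows "\<And>a b. a \<in> carrier A \<Longrightarrow> b \<in> carrier B \<Longrightarrow> t a b \<in> carrier C"
    and "\<And>a a' b. a \<in> carrier A \<Longrightarrow> a' \<in> carrier A \<Longrightarrow> b \<in> carrier B \<Longrightarrow> t (a \<oplus>\<^bsub>A\<^esub> a') b = t a b \<oplus>\<^bsub>C\<^esub> t a' b"
    and "\<And>a b b'. a \<in> carrier A \<Longrightarrow> b \<in> carrier B \<Longrightarrow> b' \<in> carrier B \<Longrightarrow> t a (b \<oplus>\<^bsub>B\<^esub> b') = t a b \<oplus>\<^bsub>C\<^esub> t a b'"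
    and "\<And>c a b. a \<in> carrier A \<Longrightarrow> b \<in> carrier B \<Longrightarrow> t (c \<odot>\<^bsub>A\<^esub> a) b = c \<odot>\<^bsub>C\<^esub> t a b"
    and "\<And>c a b. a \<in> carrier A \<Longrightarrow> b \<in> carrier B \<Longrightarrow> t a (c \<odot>\<^bsub>B\<^esub> b) = c \<odot>\<^bsub>C\<^esub> t a b"
    and "\<And>a a' b b'. a \<in> carrier A \<Longrightarrow> a' \<in> carrier A \<Longrightarrow> b \<in> carrier B \<Longrightarrow> b' \<in> carrier B \<Longrightarrow>
      t a b \<otimes>\<^bsub>C\<^esub> t a' b' = t (a \<otimes>\<^bsub>A\<^esub> a') (b \<otimes>\<^bsub>B\<^esub> b')"
    and "\<And>a b. a \<in> carrier A \<Longrightarrow> b \<in> carrier B \<Longrightarrow> star C (t a b) = t (star A a) (star B b)"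
    and "t \<one>\<^bsub>A\<^esub> \<one>\<^bsub>B\<^esub> = \<one>\<^bsub>C\<^esub>"
  using assms unfolding tensor_like_def by simp_all

lemma tensor_like_swap: "tensor_like A B C t \<Longrightarrow> tensor_like B A C (\<lambda>b a. t a b)"
  unfolding tensor_like_def by simp

lemma tensor_like_compose:
  assumes "star_algebra A" "star_algebra B" "star_algebra A'" "star_algebra B'"
    and t: "tensor_like A' B' C t" and f: "f \<in> star_hom A A'" and g: "g \<in> star_hom B B'"
  shows "tensor_like A B C (\<lambda>a b. t (f a) (g b))"
proof -
  interpret A: star_algebra A by fact
  interpret B: star_algebra B by fact
  interpret A': star_algebra A' by fact
  interpret B': star_algebra B' by fact
  interpret f: star_algebra_hom A A' f by unfold_locales fact
  interpret g: star_algebra_hom B B' g by unfold_locales fact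
  note d = tensor_likeD[OF t]
  show ?thesis
    unfolding tensor_like_def
    by (simp add: d f.hom_add g.hom_add f.hom_scale g.hom_scale f.hom_mult g.hom_mult f.hom_star g.hom_star
        f.hom_one g.hom_one)
qed

lemma tensor_rels_iff:
  assumes "star_algebra A" "star_algebra B" "star_algebra C"
    and h: "h \<in> star_hom (free_star_algebra (carrier A \<times> carrier B)) C"
  shows "(\<forall>r\<in>tensor_rels A B. h r = \<zero>\<^bsub>C\<^esub>) \<longleftrightarrow> tensor_like A B C (\<lambda>a b. h (gen (a, b)))"
proof -
  interpret A: star_algebra A by fact
  interpret B: star_algebra B by fact
  interpret C: star_algebra C by fact
  define F where "F = free_star_algebra (carrier A \<times> carrier B)"
  interpret F: star_algebra F unfolding F_def by (rule free_star_algebra)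
  interpret h: star_algebra_hom F C h by unfold_locales (use h in \<open>simp add: F_def\<close>)
  have gc: "gen (a, b) \<in> carrier F" if "a \<in> carrier A" "b \<in> carrier B" for a b
    unfolding F_def using that by (intro gen_closed) auto
  note hs = h.hom_add h.hom_scale h.hom_mult h.hom_star h.hom_one
  show ?thesis
  proof
    assume *: "\<forall>r\<in>tensor_rels A B. h r = \<zero>\<^bsub>C\<^esub>"
    have eq: "h x = h y" if "x \<ominus>\<^bsub>F\<^esub> y \<in> tensor_rels A B" "x \<in> carrier F" "y \<in> carrier F" for x y
    proof -
      have "h x \<ominus>\<^bsub>C\<^esub> h y = \<zero>\<^bsub>C\<^esub>" using * that by (simp flip: h.hom_diff)
      then show ?thesis using that C.diff_zero_iff by simp
    qed
    have rels:
      "\<And>a a' b. a \<in> carrier A \<Longrightarrow> a' \<in> carrier A \<Longrightarrow> b \<in> carrier B \<Longrightarrow>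
        gen (a \<oplus>\<^bsub>A\<^esub> a', b) \<ominus>\<^bsub>F\<^esub> (gen (a, b) \<oplus>\<^bsub>F\<^esub> gen (a', b)) \<in> tensor_rels A B"
      "\<And>a b b'. a \<in> carrier A \<Longrightarrow> b \<in> carrier B \<Longrightarrow> b' \<in> carrier B \<Longrightarrow>
        gen (a, b \<oplus>\<^bsub>B\<^esub> b') \<ominus>\<^bsub>F\<^esub> (gen (a, b) \<oplus>\<^bsub>F\<^esub> gen (a, b')) \<in> tensor_rels A B"
      "\<And>c a b. a \<in> carrier A \<Longrightarrow> b \<in> carrier B \<Longrightarrow>
        gen (c \<odot>\<^bsub>A\<^esub> a, b) \<ominus>\<^bsub>F\<^esub> c \<odot>\<^bsub>F\<^esub> gen (a, b) \<in> tensor_rels A B"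
      "\<And>c a b. a \<in> carrier A \<Longrightarrow> b \<in> carrier B \<Longrightarrow>
        gen (a, c \<odot>\<^bsub>B\<^esub> b) \<ominus>\<^bsub>F\<^esub> c \<odot>\<^bsub>F\<^esub> gen (a, b) \<in> tensor_rels A B"
      "\<And>a a' b b'. a \<in> carrier A \<Longrightarrow> a' \<in> carrier A \<Longrightarrow> b \<in> carrier B \<Longrightarrow> b' \<in> carrier B \<Longrightarrow>
        gen (a, b) \<otimes>\<^bsub>F\<^esub> gen (a', b') \<ominus>\<^bsub>F\<^esub> gen (a \<otimes>\<^bsub>A\<^esub> a', b \<otimes>\<^bsub>B\<^esub> b') \<in> tensor_rels A B"
      "\<And>a b. a \<in> carrier A \<Longrightarrow> b \<in> carrier B \<Longrightarrow>
        star F (gen (a, b)) \<ominus>\<^bsub>F\<^esub> gen (star A a, star B b) \<in> tensor_rels A B"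
      "gen (\<one>\<^bsub>A\<^esub>, \<one>\<^bsub>B\<^esub>) \<ominus>\<^bsub>F\<^esub> \<one>\<^bsub>F\<^esub> \<in> tensor_rels A B"
      unfolding tensor_rels_def Let_def F_def[symmetric] by blast+
    note e = rels[THEN eq]
    show "tensor_like A B C (\<lambda>a b. h (gen (a, b)))"
      unfolding tensor_like_def
      using e by (simp add: gc hs)
  next
    assume t: "tensor_like A B C (\<lambda>a b. h (gen (a, b)))"
    note d = tensor_likeD[OF t]
    have z: "x \<ominus>\<^bsub>C\<^esub> y = \<zero>\<^bsub>C\<^esub>" if "x = y" "y \<in> carrier C" for x y
      using that C.diff_zero_iff by simp
    show "\<forall>r\<in>tensor_rels A B. h r = \<zero>\<^bsub>C\<^esub>"
      unfolding tensor_rels_def Let_def F_def[symmetric]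
      by (auto simp: h.hom_diff gc hs d intro!: z)
  qed
qed

text \<open>For an admissible seminorm, \<open>t a\<close> at the unit and \<open>t\<close> at the
  unit and \<open>b\<close> are star-homomorphisms of \<open>A\<close> and \<open>B\<close> into its
  completion, hence contractive. Since \<open>t a b\<close> is their product, it is bounded by the
  product of the norms.\<close>

lemma tensor_presentation:
  assumes A: "cstar_algebra (A :: 'a cstar_alg)" and B: "cstar_algebra (B :: 'b cstar_alg)"
  shows "presentation (carrier A \<times> carrier B) (tensor_rels A B)"
proof
  let ?F = "free_star_algebra (carrier A \<times> carrier B)"
  interpret A: cstar_algebra A by fact
  interpret B: cstar_algebra B by fact
  interpret F: star_algebra ?F by (rule free_star_algebra)
  have gc: "gen (a, b) \<in> carrier ?F" if "a \<in> carrier A" "b \<in> carrier B" for a b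
    using that by (intro gen_closed) auto
  show closed: "tensor_rels A B \<subseteq> carrier ?F"
    unfolding tensor_rels_def Let_def
    by (auto intro!: F.alg_minus_closed F.alg_a_closed F.mult_closed F.scale_closed F.star_closed gc)
  fix g assume "g \<in> carrier A \<times> carrier B"
  then obtain a b where g: "g = (a, b)" and ab: "a \<in> carrier A" "b \<in> carrier B" by blast
  have "q (gen g) \<le> cnorm A a * cnorm B b" if q: "admissible (carrier A \<times> carrier B) (tensor_rels A B) q" for q
  proof -
    obtain C h where C: "cstar_algebra (C :: ('a \<times> 'b) free_alg completion cstar_alg)" and h: "h \<in> star_hom ?F C"
      and n: "\<And>x. x \<in> carrier ?F \<Longrightarrow> cnorm C (h x) = q x"
      and z: "\<And>r. r \<in> tensor_rels A B \<Longrightarrow> h r = \<zero>\<^bsub>C\<^esub>"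
      using admissible_completion[OF closed q] by blast
    interpret C: cstar_algebra C by fact
    define t where "t = (\<lambda>a b. h (gen (a, b)))"
    have t: "tensor_like A B C t"
      using tensor_rels_iff[OF A.star_algebra_axioms B.star_algebra_axioms C.star_algebra_axioms h] z
      by (simp add: t_def)
    note d = tensor_likeD[OF t]
    have "(\<lambda>a. t a \<one>\<^bsub>B\<^esub>) \<in> star_hom A C" by (rule star_homI) (simp_all add: d)
    from star_hom_contractive[OF A C this ab(1)] have 1: "cnorm C (t a \<one>\<^bsub>B\<^esub>) \<le> cnorm A a" .
    have "(\<lambda>b. t \<one>\<^bsub>A\<^esub> b) \<in> star_hom B C" by (rule star_homI) (simp_all add: d)
    from star_hom_contractive[OF B C this ab(2)] have 2: "cnorm C (t \<one>\<^bsub>A\<^esub> b) \<le> cnorm B b" .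
    have "t a b = t a \<one>\<^bsub>B\<^esub> \<otimes>\<^bsub>C\<^esub> t \<one>\<^bsub>A\<^esub> b" using ab by (simp add: d(6))
    then have "cnorm C (t a b) \<le> cnorm C (t a \<one>\<^bsub>B\<^esub>) * cnorm C (t \<one>\<^bsub>A\<^esub> b)"
      using C.p_mult[of "t a \<one>\<^bsub>B\<^esub>" "t \<one>\<^bsub>A\<^esub> b"] ab by (simp add: d(1))
    also have "\<dots> \<le> cnorm A a * cnorm B b"
      by (rule mult_mono[OF 1 2]) (use ab in \<open>simp_all add: d(1)\<close>)
    finally show ?thesis using n[OF gc[OF ab]] by (simp add: t_def g)
  qed
  then show "\<exists>c. \<forall>q. admissible (carrier A \<times> carrier B) (tensor_rels A B) q \<longrightarrow> q (gen g) \<le> c" by blast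
qed

context
  fixes A :: "'a cstar_alg" and B :: "'b cstar_alg"
  assumes A: "cstar_algebra A" and B: "cstar_algebra B"
begin

lemma tensor_cstar_algebra: "cstar_algebra (cstar_tensor A B)"
  unfolding cstar_tensor_def by (rule presentation.universal_cstar_algebra[OF tensor_presentation[OF A B]])

lemma tensor_like_pure: "tensor_like A B (cstar_tensor A B) (pure_tensor A B)"
proof -
  interpret P: presentation "carrier A \<times> carrier B" "tensor_rels A B" by (rule tensor_presentation[OF A B])
  have "tensor_like A B (cstar_tensor A B) (\<lambda>a b. P.emb (gen (a, b)))"
    unfolding cstar_tensor_def
    using tensor_rels_iff[OF cstar_algebra.axioms(1)[OF A] cstar_algebra.axioms(1)[OF B]
        cstar_algebra.axioms(1)[OF P.universal_cstar_algebra] P.universal_hom] P.universal_rel by blast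
  then show ?thesis by (simp add: pure_tensor_def[abs_def] P.universal_gen_eq)
qed

lemma tensor_hom_exists:
  assumes C: "cstar_algebra C" and t: "tensor_like A B C t"
  obtains f where "f \<in> star_hom (cstar_tensor A B) C"
    "\<And>a b. a \<in> carrier A \<Longrightarrow> b \<in> carrier B \<Longrightarrow> f (pure_tensor A B a b) = t a b"
proof -
  interpret P: presentation "carrier A \<times> carrier B" "tensor_rels A B" by (rule tensor_presentation[OF A B])
  obtain f where f: "f \<in> star_hom P.U C"
    "\<And>g. g \<in> carrier A \<times> carrier B \<Longrightarrow> f (universal_gen (carrier A \<times> carrier B) (tensor_rels A B) g) = t (fst g) (snd g)"
  proof (rule P.universal_hom_exists[OF C, of "\<lambda>g. t (fst g) (snd g)"])
    show "t (fst g) (snd g) \<in> carrier C" if "g \<in> carrier A \<times> carrier B" for g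
      using that tensor_likeD(1)[OF t] by auto
    show "h r = \<zero>\<^bsub>C\<^esub>" if h: "h \<in> star_hom P.F C"
      "\<And>g. g \<in> carrier A \<times> carrier B \<Longrightarrow> h (gen g) = t (fst g) (snd g)" and r: "r \<in> tensor_rels A B" for h r
    proof -
      interpret A: cstar_algebra A by (rule A)
      interpret B: cstar_algebra B by (rule B)
      have "tensor_like A B C (\<lambda>a b. h (gen (a, b)))"
        using t h(2) unfolding tensor_like_def by simp
      then show ?thesis
        using tensor_rels_iff[OF A.star_algebra_axioms B.star_algebra_axioms cstar_algebra.axioms(1)[OF C] h(1)] r
        by blast
    qed
  qed blast
  show ?thesis
  proof (rule that[of f])
    show "f \<in> star_hom (cstar_tensor A B) C" using f(1) by (simp add: cstar_tensor_def)
    show "f (pure_tensor A B a b) = t a b" if "a \<in> carrier A" "b \<in> carrier B" for a b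
      using f(2)[of "(a, b)"] that by (simp add: pure_tensor_def)
  qed
qed

lemma tensor_hom_unique:
  assumes C: "cstar_algebra C" and f: "f \<in> star_hom (cstar_tensor A B) C" and h: "h \<in> star_hom (cstar_tensor A B) C"
    and eq: "\<And>a b. a \<in> carrier A \<Longrightarrow> b \<in> carrier B \<Longrightarrow> f (pure_tensor A B a b) = h (pure_tensor A B a b)"
    and X: "X \<in> carrier (cstar_tensor A B)"
  shows "f X = h X"
proof -
  interpret P: presentation "carrier A \<times> carrier B" "tensor_rels A B" by (rule tensor_presentation[OF A B])
  show ?thesis
    by (rule P.universal_hom_unique[OF C, folded cstar_tensor_def, OF f h _ X])
      (use eq in \<open>auto simp: pure_tensor_def\<close>)
qed

end

locale tensor_map = A: star_algebra A + B: star_algebra B + C: star_algebra C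
  for A :: "('a, 'm) star_alg_scheme" and B :: "('b, 'n) star_alg_scheme" and C :: "('c, 'k) star_alg_scheme" +
  fixes t :: "'a \<Rightarrow> 'b \<Rightarrow> 'c"
  assumes tensor_like: "tensor_like A B C t"
begin

lemmas t_rules = tensor_likeD[OF tensor_like]
lemmas t_closed [simp, intro] = t_rules(1)

lemma t_zero_left: "b \<in> carrier B \<Longrightarrow> t \<zero>\<^bsub>A\<^esub> b = \<zero>\<^bsub>C\<^esub>"
  and t_zero_right: "a \<in> carrier A \<Longrightarrow> t a \<zero>\<^bsub>B\<^esub> = \<zero>\<^bsub>C\<^esub>"
  using t_rules(4)[of "\<one>\<^bsub>A\<^esub>" b 0] t_rules(5)[of a "\<one>\<^bsub>B\<^esub>" 0] by simp_all

lemma t_sum_left: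
  "finite K \<Longrightarrow> (\<And>k. k \<in> K \<Longrightarrow> g k \<in> carrier A) \<Longrightarrow> b \<in> carrier B \<Longrightarrow>
     t (finsum A g K) b = (\<Oplus>\<^bsub>C\<^esub>k\<in>K. t (g k) b)"
  by (induction K rule: finite_induct) (simp_all add: A.sum_insert C.sum_insert t_rules(2) t_zero_left)

lemma t_sum_right:
  "finite K \<Longrightarrow> (\<And>k. k \<in> K \<Longrightarrow> g k \<in> carrier B) \<Longrightarrow> a \<in> carrier A \<Longrightarrow>
     t a (finsum B g K) = (\<Oplus>\<^bsub>C\<^esub>k\<in>K. t a (g k))"
  by (induction K rule: finite_induct) (simp_all add: B.sum_insert C.sum_insert t_rules(3) t_zero_right)

lemma t_scaled_sum_left:
  "finite K \<Longrightarrow> (\<And>k. k \<in> K \<Longrightarrow> g k \<in> carrier A) \<Longrightarrow> b \<in> carrier B \<Longrightarrow>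
     t (\<Oplus>\<^bsub>A\<^esub>k\<in>K. c k \<odot>\<^bsub>A\<^esub> g k) b = (\<Oplus>\<^bsub>C\<^esub>k\<in>K. c k \<odot>\<^bsub>C\<^esub> t (g k) b)"
  by (subst t_sum_left) (auto intro!: C.sum_cong simp: t_rules(4))

lemma t_scaled_sum_right:
  "finite K \<Longrightarrow> (\<And>k. k \<in> K \<Longrightarrow> g k \<in> carrier B) \<Longrightarrow> a \<in> carrier A \<Longrightarrow>
     t a (\<Oplus>\<^bsub>B\<^esub>k\<in>K. c k \<odot>\<^bsub>B\<^esub> g k) = (\<Oplus>\<^bsub>C\<^esub>k\<in>K. c k \<odot>\<^bsub>C\<^esub> t a (g k))"
  by (subst t_sum_right) (auto intro!: C.sum_cong simp: t_rules(5))

end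

locale tensor_square = tensor_map A A C t for A :: "('a, 'm) star_alg_scheme" and C :: "('c, 'k) star_alg_scheme" and t
begin

text \<open>The comultiplication formula for an arbitrary tensor-like \<open>t\<close>; in this
  generality \<open>t\<close> may be replaced by its flip, which exchanges the roles of rows and
  columns.\<close>

definition comult :: "'i set \<Rightarrow> ('i \<Rightarrow> 'i \<Rightarrow> 'a) \<Rightarrow> 'i \<Rightarrow> 'i \<Rightarrow> 'c" where
  "comult V v x y = (\<Oplus>\<^bsub>C\<^esub>z\<in>V. t (v x z) (v z y))"

context
  fixes V :: "'i set" and v :: "'i \<Rightarrow> 'i \<Rightarrow> 'a"
  assumes V: "finite V" and vc: "\<And>x y. x \<in> V \<Longrightarrow> y \<in> V \<Longrightarrow> v x y \<in> carrier A"
begin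

lemma comult_closed: "x \<in> V \<Longrightarrow> y \<in> V \<Longrightarrow> comult V v x y \<in> carrier C"
  unfolding comult_def using vc by auto

lemma comult_row_pou:
  assumes v: "A.magic V v" and x: "x \<in> V"
  shows "C.pou V (comult V v x)"
  unfolding C.pou_def
proof (intro conjI ballI)
  note p = A.pouD[of V "v _"]
  have pou: "A.pou V (v z)" if "z \<in> V" for z using v that by (simp add: A.magic_def)
  fix y y' assume y: "y \<in> V" "y' \<in> V"
  have "comult V v x y \<otimes>\<^bsub>C\<^esub> comult V v x y'
      = (\<Oplus>\<^bsub>C\<^esub>z\<in>V. \<Oplus>\<^bsub>C\<^esub>z'\<in>V. t (v x z) (v z y) \<otimes>\<^bsub>C\<^esub> t (v x z') (v z' y'))"
    unfolding comult_def using V vc x y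
    by (subst C.sum_mult_right) (auto intro!: C.sum_cong simp: C.sum_mult_left)
  also have "\<dots> = (\<Oplus>\<^bsub>C\<^esub>z\<in>V. t (v x z) (v z y \<otimes>\<^bsub>A\<^esub> v z y'))"
  proof (intro C.sum_cong refl)
    fix z assume z: "z \<in> V"
    \<comment> \<open>Orthogonality within row \<open>x\<close>, in the first tensor factor, removes
      the mixed terms.\<close>
    have e: "t (v x z) (v z y) \<otimes>\<^bsub>C\<^esub> t (v x z') (v z' y')
        = (if z = z' then t (v x z) (v z y \<otimes>\<^bsub>A\<^esub> v z' y') else \<zero>\<^bsub>C\<^esub>)" if z': "z' \<in> V" for z'
      using A.pouD(2)[OF pou[OF x] z z'] vc x y z z' by (simp add: t_rules(6) t_zero_left)
    show "(\<Oplus>\<^bsub>C\<^esub>z'\<in>V. t (v x z) (v z y) \<otimes>\<^bsub>C\<^esub> t (v x z') (v z' y')) = t (v x z) (v z y \<otimes>\<^bsub>A\<^esub> v z y')"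
      by (subst C.sum_single[OF V z]) (use e vc x y z in auto)
  qed (use vc x y in auto)
  also have "\<dots> = (if y = y' then comult V v x y else \<zero>\<^bsub>C\<^esub>)"
  proof (cases "y = y'")
    case True
    then show ?thesis unfolding comult_def
      using A.pouD(2)[OF pou _ y(2)] vc x y by (auto intro!: C.sum_cong)
  next
    case False
    then show ?thesis
      using A.pouD(2)[OF pou y] vc x y by (auto intro!: C.sum_null simp: t_zero_right)
  qed
  finally show "comult V v x y \<otimes>\<^bsub>C\<^esub> comult V v x y' = (if y = y' then comult V v x y else \<zero>\<^bsub>C\<^esub>)" .
next
  have pou: "A.pou V (v z)" if "z \<in> V" for z using v that by (simp add: A.magic_def)
  have "(\<Oplus>\<^bsub>C\<^esub>y\<in>V. comult V v x y) = (\<Oplus>\<^bsub>C\<^esub>z\<in>V. \<Oplus>\<^bsub>C\<^esub>y\<in>V. t (v x z) (v z y))"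
    unfolding comult_def using V vc x by (intro C.sum_swap) auto
  also have "\<dots> = (\<Oplus>\<^bsub>C\<^esub>z\<in>V. t (v x z) \<one>\<^bsub>A\<^esub>)"
  proof (intro C.sum_cong refl)
    fix z assume z: "z \<in> V"
    have "(\<Oplus>\<^bsub>C\<^esub>y\<in>V. t (v x z) (v z y)) = t (v x z) (\<Oplus>\<^bsub>A\<^esub>y\<in>V. v z y)"
      using V vc x z by (intro t_sum_right[symmetric]) auto
    then show "(\<Oplus>\<^bsub>C\<^esub>y\<in>V. t (v x z) (v z y)) = t (v x z) \<one>\<^bsub>A\<^esub>" by (simp add: A.pouD(3)[OF pou[OF z]])
  qed (use vc x in auto)
  also have "\<dots> = t (\<Oplus>\<^bsub>A\<^esub>z\<in>V. v x z) \<one>\<^bsub>A\<^esub>" using V vc x by (intro t_sum_left[symmetric]) auto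
  also have "\<dots> = \<one>\<^bsub>C\<^esub>" by (simp add: A.pouD(3)[OF pou[OF x]] t_rules(8))
  finally show "(\<Oplus>\<^bsub>C\<^esub>y\<in>V. comult V v x y) = \<one>\<^bsub>C\<^esub>" .
qed (rule comult_closed[OF x])

lemma comult_star:
  assumes v: "A.magic V v" and x: "x \<in> V" "y \<in> V"
  shows "star C (comult V v x y) = comult V v x y"
proof -
  have "star A (v x y) = v x y" if "x \<in> V" "y \<in> V" for x y using v that by (simp add: A.magic_def)
  then show ?thesis
    unfolding comult_def using V vc x
    by (subst C.sum_star) (auto intro!: C.sum_cong simp: t_rules(7))
qed

text \<open>The matrix \<open>d\<close> is moved past \<open>v\<close> in the first tensor factor,
  then once more in the second.\<close>

lemma comult_intertwines:
  assumes v: "A.intertwines V d v"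
  shows "C.intertwines V d (comult V v)"
  unfolding C.intertwines_def
proof (intro ballI)
  fix x y assume x: "x \<in> V" and y: "y \<in> V"
  have comm: "(\<Oplus>\<^bsub>A\<^esub>k\<in>V. d x k \<odot>\<^bsub>A\<^esub> v k y) = (\<Oplus>\<^bsub>A\<^esub>k\<in>V. d k y \<odot>\<^bsub>A\<^esub> v x k)" if "x \<in> V" "y \<in> V" for x y
    using v that by (simp add: A.intertwines_def)
  have "(\<Oplus>\<^bsub>C\<^esub>k\<in>V. d x k \<odot>\<^bsub>C\<^esub> comult V v k y) = (\<Oplus>\<^bsub>C\<^esub>k\<in>V. \<Oplus>\<^bsub>C\<^esub>z\<in>V. d x k \<odot>\<^bsub>C\<^esub> t (v k z) (v z y))"
    unfolding comult_def using V vc y by (intro C.sum_cong) (auto intro!: C.sum_scale)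
  also have "\<dots> = (\<Oplus>\<^bsub>C\<^esub>z\<in>V. \<Oplus>\<^bsub>C\<^esub>k\<in>V. d x k \<odot>\<^bsub>C\<^esub> t (v k z) (v z y))"
    using V vc y by (intro C.sum_swap) auto
  also have "\<dots> = (\<Oplus>\<^bsub>C\<^esub>z\<in>V. t (\<Oplus>\<^bsub>A\<^esub>k\<in>V. d x k \<odot>\<^bsub>A\<^esub> v k z) (v z y))"
    using V vc y by (intro C.sum_cong refl t_scaled_sum_left[symmetric]) auto
  also have "\<dots> = (\<Oplus>\<^bsub>C\<^esub>z\<in>V. t (\<Oplus>\<^bsub>A\<^esub>k\<in>V. d k z \<odot>\<^bsub>A\<^esub> v x k) (v z y))"
    using V vc x y by (intro C.sum_cong) (auto simp: comm)
  also have "\<dots> = (\<Oplus>\<^bsub>C\<^esub>z\<in>V. \<Oplus>\<^bsub>C\<^esub>k\<in>V. d k z \<odot>\<^bsub>C\<^esub> t (v x k) (v z y))"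
    using V vc x y by (intro C.sum_cong refl t_scaled_sum_left) auto
  also have "\<dots> = (\<Oplus>\<^bsub>C\<^esub>k\<in>V. \<Oplus>\<^bsub>C\<^esub>z\<in>V. d k z \<odot>\<^bsub>C\<^esub> t (v x k) (v z y))"
    using V vc x y by (intro C.sum_swap) auto
  also have "\<dots> = (\<Oplus>\<^bsub>C\<^esub>k\<in>V. t (v x k) (\<Oplus>\<^bsub>A\<^esub>z\<in>V. d k z \<odot>\<^bsub>A\<^esub> v z y))"
    using V vc x y by (intro C.sum_cong refl t_scaled_sum_right[symmetric]) auto
  also have "\<dots> = (\<Oplus>\<^bsub>C\<^esub>k\<in>V. t (v x k) (\<Oplus>\<^bsub>A\<^esub>z\<in>V. d z y \<odot>\<^bsub>A\<^esub> v k z))"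
    using V vc x y by (intro C.sum_cong) (auto simp: comm)
  also have "\<dots> = (\<Oplus>\<^bsub>C\<^esub>k\<in>V. \<Oplus>\<^bsub>C\<^esub>z\<in>V. d z y \<odot>\<^bsub>C\<^esub> t (v x k) (v k z))"
    using V vc x y by (intro C.sum_cong refl t_scaled_sum_right) auto
  also have "\<dots> = (\<Oplus>\<^bsub>C\<^esub>z\<in>V. \<Oplus>\<^bsub>C\<^esub>k\<in>V. d z y \<odot>\<^bsub>C\<^esub> t (v x k) (v k z))"
    using V vc x y by (intro C.sum_swap) auto
  also have "\<dots> = (\<Oplus>\<^bsub>C\<^esub>z\<in>V. d z y \<odot>\<^bsub>C\<^esub> comult V v x z)"
    unfolding comult_def using V vc x by (intro C.sum_cong C.sum_scale[symmetric] refl) auto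
  finally show "(\<Oplus>\<^bsub>C\<^esub>k\<in>V. d x k \<odot>\<^bsub>C\<^esub> comult V v k y) = (\<Oplus>\<^bsub>C\<^esub>k\<in>V. d k y \<odot>\<^bsub>C\<^esub> comult V v x k)" .
qed

end

lemma comult_magic:
  assumes V: "finite V" and v: "A.magic V v"
  shows "C.magic V (comult V v)"
proof -
  have vc: "v x y \<in> carrier A" if "x \<in> V" "y \<in> V" for x y using v that by (simp add: A.magic_def)
  \<comment> \<open>Columns of the coproduct are rows of the coproduct of the transposed matrix with
    respect to the flipped tensor map.\<close>
  interpret S: tensor_square A C "\<lambda>a b. t b a"
    by unfold_locales (rule tensor_like_swap[OF tensor_like])
  have swap: "(\<lambda>x. comult V v x y) = S.comult V (\<lambda>x y. v y x) y" for y
    by (simp add: comult_def S.comult_def fun_eq_iff)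
  show ?thesis
    unfolding C.magic_def swap
    using comult_row_pou[OF V vc v] comult_star[OF V vc v] comult_closed[OF V vc]
      S.comult_row_pou[OF V _ A.magic_transpose[OF v]] vc by simp
qed

text \<open>The equation linking \<open>p\<close> and \<open>u\<close> is applied in the second
  tensor factor and then in the first. Thus the coproducts of the magic matrix and of the orthogonal
  matrix are linked by the same equation.\<close>

lemma comult_expansion:
  assumes J: "finite J" and p: "\<And>x y. x \<in> cube J \<Longrightarrow> y \<in> cube J \<Longrightarrow> p x y \<in> carrier A"
    and u: "\<And>i j. i \<in> J \<Longrightarrow> j \<in> J \<Longrightarrow> u i j \<in> carrier A"
    and eq: "\<And>x i. x \<in> cube J \<Longrightarrow> i \<in> J \<Longrightarrow>
      (\<Oplus>\<^bsub>A\<^esub>y\<in>cube J. chi i y \<odot>\<^bsub>A\<^esub> p x y) = (\<Oplus>\<^bsub>A\<^esub>j\<in>J. chi j x \<odot>\<^bsub>A\<^esub> u j i)"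
    and x: "x \<in> cube J" and j: "j \<in> J"
  shows "(\<Oplus>\<^bsub>C\<^esub>y\<in>cube J. chi j y \<odot>\<^bsub>C\<^esub> comult (cube J) p x y) = (\<Oplus>\<^bsub>C\<^esub>k\<in>J. chi k x \<odot>\<^bsub>C\<^esub> comult J u k j)"
proof -
  note V = finite_cube[OF J]
  have "(\<Oplus>\<^bsub>C\<^esub>y\<in>cube J. chi j y \<odot>\<^bsub>C\<^esub> comult (cube J) p x y)
      = (\<Oplus>\<^bsub>C\<^esub>y\<in>cube J. \<Oplus>\<^bsub>C\<^esub>z\<in>cube J. chi j y \<odot>\<^bsub>C\<^esub> t (p x z) (p z y))"
    unfolding comult_def using V p x by (intro C.sum_cong C.sum_scale refl) auto
  also have "\<dots> = (\<Oplus>\<^bsub>C\<^esub>z\<in>cube J. \<Oplus>\<^bsub>C\<^esub>y\<in>cube J. chi j y \<odot>\<^bsub>C\<^esub> t (p x z) (p z y))"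
    using V p x by (intro C.sum_swap) auto
  also have "\<dots> = (\<Oplus>\<^bsub>C\<^esub>z\<in>cube J. t (p x z) (\<Oplus>\<^bsub>A\<^esub>y\<in>cube J. chi j y \<odot>\<^bsub>A\<^esub> p z y))"
    using V p x by (intro C.sum_cong refl t_scaled_sum_right[symmetric]) auto
  also have "\<dots> = (\<Oplus>\<^bsub>C\<^esub>z\<in>cube J. t (p x z) (\<Oplus>\<^bsub>A\<^esub>l\<in>J. chi l z \<odot>\<^bsub>A\<^esub> u l j))"
    using p u x j by (intro C.sum_cong) (auto simp: eq)
  also have "\<dots> = (\<Oplus>\<^bsub>C\<^esub>z\<in>cube J. \<Oplus>\<^bsub>C\<^esub>l\<in>J. chi l z \<odot>\<^bsub>C\<^esub> t (p x z) (u l j))"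
    using J p u x j by (intro C.sum_cong refl t_scaled_sum_right) auto
  also have "\<dots> = (\<Oplus>\<^bsub>C\<^esub>l\<in>J. \<Oplus>\<^bsub>C\<^esub>z\<in>cube J. chi l z \<odot>\<^bsub>C\<^esub> t (p x z) (u l j))"
    using J V p u x j by (intro C.sum_swap) auto
  also have "\<dots> = (\<Oplus>\<^bsub>C\<^esub>l\<in>J. t (\<Oplus>\<^bsub>A\<^esub>z\<in>cube J. chi l z \<odot>\<^bsub>A\<^esub> p x z) (u l j))"
    using V p u x j by (intro C.sum_cong refl t_scaled_sum_left[symmetric]) auto
  also have "\<dots> = (\<Oplus>\<^bsub>C\<^esub>l\<in>J. t (\<Oplus>\<^bsub>A\<^esub>k\<in>J. chi k x \<odot>\<^bsub>A\<^esub> u k l) (u l j))"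
    using p u x j by (intro C.sum_cong) (auto simp: eq)
  also have "\<dots> = (\<Oplus>\<^bsub>C\<^esub>l\<in>J. \<Oplus>\<^bsub>C\<^esub>k\<in>J. chi k x \<odot>\<^bsub>C\<^esub> t (u k l) (u l j))"
    using J u j by (intro C.sum_cong refl t_scaled_sum_left) auto
  also have "\<dots> = (\<Oplus>\<^bsub>C\<^esub>k\<in>J. \<Oplus>\<^bsub>C\<^esub>l\<in>J. chi k x \<odot>\<^bsub>C\<^esub> t (u k l) (u l j))"
    using J u j by (intro C.sum_swap) auto
  also have "\<dots> = (\<Oplus>\<^bsub>C\<^esub>k\<in>J. chi k x \<odot>\<^bsub>C\<^esub> comult J u k j)"
    unfolding comult_def using J u j by (intro C.sum_cong C.sum_scale[symmetric] refl) auto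
  finally show ?thesis .
qed

end

section \<open>The scalars and the opposite algebra\<close>

lemma complex_cstar_simps [simp]:
  "carrier complex_cstar = UNIV" "mult complex_cstar = (*)" "one complex_cstar = 1"
  "zero complex_cstar = 0" "add complex_cstar = (+)" "smult complex_cstar = (*)"
  "star complex_cstar = cnj" "cnorm complex_cstar = cmod"
  by (simp_all add: complex_cstar_def)

lemma complex_cstar_algebra: "cstar_algebra complex_cstar"
proof -
  have ab: "abelian_group complex_cstar"
    by (rule abelian_groupI) (auto simp: algebra_simps intro: exI[of _ "- _"])
  moreover have "Group.monoid complex_cstar"
    by (rule monoidI) auto
  ultimately have "ring complex_cstar"
    by (rule ringI) (simp_all add: algebra_simps)
  moreover have "module complex_ring complex_cstar"
    by (rule moduleI[OF cring_complex_ring ab]) (simp_all add: algebra_simps)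
  moreover have "star_algebra_axioms complex_cstar"
    by unfold_locales auto
  ultimately have sa: "star_algebra complex_cstar" by (rule star_algebra.intro)
  interpret star_algebra complex_cstar by (rule sa)
  have minus: "x \<ominus>\<^bsub>complex_cstar\<^esub> y = x - y" for x y :: complex
    using minus_as_scale[of x y] by simp
  show ?thesis
  proof (rule cstar_algebra.intro[OF sa], unfold_locales)
    show "cstar_seminorm complex_cstar (cnorm complex_cstar)"
      by (simp add: cstar_seminorm_def norm_triangle_ineq norm_mult power2_eq_square)
    fix s assume s: "cauchy_in complex_cstar (cnorm complex_cstar) s"
    have "Cauchy s"
      by (rule CauchyI) (use s in \<open>simp add: cauchy_in_def minus\<close>)
    then obtain l where "s \<longlonglongrightarrow> l" using Cauchy_convergent convergent_def by blast
    then have "(\<lambda>k. norm (s k - l)) \<longlonglongrightarrow> 0" by (simp only: LIM_zero_iff tendsto_norm_zero_iff)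
    then show "\<exists>x\<in>carrier complex_cstar. (\<lambda>k. cnorm complex_cstar (s k \<ominus>\<^bsub>complex_cstar\<^esub> x)) \<longlonglongrightarrow> 0"
      by (auto simp: minus)
  qed auto
qed

lemma opposite_simps [simp]:
  "carrier (opposite A) = carrier A" "mult (opposite A) = (\<lambda>x y. y \<otimes>\<^bsub>A\<^esub> x)" "one (opposite A) = one A"
  "zero (opposite A) = zero A" "add (opposite A) = add A" "smult (opposite A) = smult A"
  "star (opposite A) = star A" "cnorm (opposite (B :: 'b cstar_alg)) = cnorm B"
  by (simp_all add: opposite_def)

lemma finsum_opposite: "finsum (opposite A) f K = finsum A f K"
  by (simp add: finsum_def)

lemma opposite_cstar_algebra:
  assumes "cstar_algebra (A :: 'a cstar_alg)"
  shows "cstar_algebra (opposite A)"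
proof -
  interpret cstar_algebra A by fact
  have ab: "abelian_group (opposite A)"
  proof (rule abelian_groupI)
    show "\<exists>y\<in>carrier (opposite A). y \<oplus>\<^bsub>opposite A\<^esub> x = \<zero>\<^bsub>opposite A\<^esub>" if "x \<in> carrier (opposite A)" for x
      using that by (intro bexI[of _ "\<ominus>\<^bsub>A\<^esub> x"]) (simp_all add: alg_l_neg)
  qed (simp_all add: alg_a_ac alg_l_zero)
  moreover have "Group.monoid (opposite A)"
    by (rule monoidI) (simp_all add: mult_assoc)
  ultimately have "ring (opposite A)"
    by (rule ringI) (simp_all add: distrib_left distrib_right)
  moreover have "module complex_ring (opposite A)"
    by (rule moduleI[OF cring_complex_ring ab]) (simp_all add: scale_add_left scale_add_right)
  moreover have "star_algebra_axioms (opposite A)"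
    by unfold_locales (simp_all add: scale_mult_left scale_mult_right star_add star_smult star_mult)
  ultimately have sa: "star_algebra (opposite A)" by (rule star_algebra.intro)
  interpret O: star_algebra "opposite A" by (rule sa)
  have minus: "x \<ominus>\<^bsub>opposite A\<^esub> y = x \<ominus>\<^bsub>A\<^esub> y" if "x \<in> carrier A" "y \<in> carrier A" for x y
    using O.minus_as_scale[of x y] minus_as_scale[of x y] that by simp
  have sn: "cnorm A (x \<otimes>\<^bsub>A\<^esub> star A x) = (cnorm A x)\<^sup>2" if "x \<in> carrier A" for x
    using p_star_mult[of "star A x"] that by simp
  show ?thesis
  proof (rule cstar_algebra.intro[OF sa], unfold_locales)
    show "cstar_seminorm (opposite A) (cnorm (opposite A))"
      using p_add p_mult unfolding cstar_seminorm_def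
      by (simp add: p_scale sn mult.commute) (metis mult.commute)
    fix s assume s: "cauchy_in (opposite A) (cnorm (opposite A)) s"
    then have sc: "s k \<in> carrier A" for k by (simp add: cauchy_in_def)
    have "cauchy_in A (cnorm A) s" using s sc by (simp add: cauchy_in_def minus)
    then obtain l where "lim_in s l" using cauchy_converges by blast
    then show "\<exists>x\<in>carrier (opposite A). (\<lambda>k. cnorm (opposite A) (s k \<ominus>\<^bsub>opposite A\<^esub> x)) \<longlonglongrightarrow> 0"
      by (auto simp: lim_in_def minus)
  qed (use cnorm_definite in auto)
qed

lemma star_hom_opposite: "f \<in> star_hom A B \<Longrightarrow> f \<in> star_hom (opposite A) (opposite B)"
  by (auto simp: star_hom_def ring_hom_def)

text \<open>The coefficients involve sums and scalars, never products, so reversing the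
  multiplication does not affect them.\<close>

lemma cube_coeff_opposite:
  "star_algebra A \<Longrightarrow> star_algebra (opposite A) \<Longrightarrow>
     star_algebra.cube_coeff (opposite A) J v i j = star_algebra.cube_coeff A J v i j"
  by (simp add: star_algebra.cube_coeff_def finsum_opposite)

lemma pou_opposite:
  assumes A: "star_algebra A" "star_algebra (opposite A)" and e: "star_algebra.pou A V e"
  shows "star_algebra.pou (opposite A) V e"
proof -
  note e = star_algebra.pouD[OF A(1) e]
  show ?thesis unfolding star_algebra.pou_def[OF A(2)] using e by (auto simp: finsum_opposite)
qed

lemma magic_opposite:
  assumes A: "star_algebra A" "star_algebra (opposite A)" and v: "star_algebra.magic A V v"
  shows "star_algebra.magic (opposite A) V v"
  using v unfolding star_algebra.magic_def[OF A(1)] star_algebra.magic_def[OF A(2)]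
  by (auto simp: star_algebra.magic_def intro: pou_opposite[OF A])

lemma intertwines_opposite:
  assumes "star_algebra A" "star_algebra (opposite A)" "star_algebra.intertwines A V d v"
  shows "star_algebra.intertwines (opposite A) V d v"
  using assms by (simp add: star_algebra.intertwines_def finsum_opposite)

context star_algebra
begin

text \<open>Over the scalars, this matrix provides the counit through the universal
  property.\<close>

lemma identity_magic:
  assumes V: "finite V"
  shows "magic V (\<lambda>x y. if x = y then \<one> else \<zero>)"
    and "intertwines V d (\<lambda>x y. if x = y then \<one> else \<zero>)"
proof -
  have "(\<Oplus>y\<in>V. if x = y then \<one> else \<zero>) = \<one>" "(\<Oplus>y\<in>V. if y = x then \<one> else \<zero>) = \<one>" if "x \<in> V" for x
    using V that by (subst sum_single[of V x]; simp)+
  then show "magic V (\<lambda>x y. if x = y then \<one> else \<zero>)"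
    by (auto simp: magic_def pou_def)
  have "(\<Oplus>k\<in>V. d x k \<odot> (if k = y then \<one> else \<zero>)) = d x y \<odot> \<one>"
    "(\<Oplus>k\<in>V. d k y \<odot> (if x = k then \<one> else \<zero>)) = d x y \<odot> \<one>" if "x \<in> V" "y \<in> V" for x y
    using V that sum_single[of V y "\<lambda>k. d x k \<odot> (if k = y then \<one> else \<zero>)"]
      sum_single[of V x "\<lambda>k. d k y \<odot> (if x = k then \<one> else \<zero>)"] by simp_all
  then show "intertwines V d (\<lambda>x y. if x = y then \<one> else \<zero>)"
    by (simp add: intertwines_def)
qed

lemma cube_coeff_identity:
  assumes J: "finite J" and ij: "i \<in> J" "j \<in> J"
  shows "cube_coeff J (\<lambda>x y. if x = y then \<one> else \<zero>) i j = (if i = j then \<one> else \<zero>)"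
proof (rule cube_coeff_of_expansion[OF J _ _ ij(1)])
  fix x assume x: "x \<in> cube J"
  have "(\<Oplus>y\<in>cube J. chi j y \<odot> (if x = y then \<one> else \<zero>)) = chi j x \<odot> \<one>"
    using finite_cube[OF J] x by (subst sum_single[of _ x]) auto
  also have "\<dots> = (\<Oplus>k\<in>J. chi k x \<odot> (if k = j then \<one> else \<zero>))"
    using J ij by (subst sum_single[of _ j]) auto
  finally show "(\<Oplus>y\<in>cube J. chi j y \<odot> (if x = y then \<one> else \<zero>)) = (\<Oplus>k\<in>J. chi k x \<odot> (if k = j then \<one> else \<zero>))" .
qed auto

lemma cube_coeff_cong:
  assumes "\<And>x y. x \<in> cube J \<Longrightarrow> y \<in> cube J \<Longrightarrow> v x y = w x y" "\<And>x y. x \<in> cube J \<Longrightarrow> y \<in> cube J \<Longrightarrow> w x y \<in> carrier A"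
  shows "cube_coeff J v i j = cube_coeff J w i j"
  unfolding cube_coeff_def using assms
  by (intro arg_cong[where f = "\<lambda>z. _ \<odot> z"] sum_cong refl arg_cong2[where f = "\<lambda>c z. c \<odot> z"]) auto

lemma intertwines_cong:
  assumes "\<And>x y. x \<in> V \<Longrightarrow> y \<in> V \<Longrightarrow> d x y = d' x y" "\<And>x y. x \<in> V \<Longrightarrow> y \<in> V \<Longrightarrow> v x y \<in> carrier A"
  shows "intertwines V d v \<longleftrightarrow> intertwines V d' v"
proof -
  have "(\<Oplus>k\<in>V. d x k \<odot> v k y) = (\<Oplus>k\<in>V. d' x k \<odot> v k y)" "(\<Oplus>k\<in>V. d k y \<odot> v x k) = (\<Oplus>k\<in>V. d' k y \<odot> v x k)"
    if "x \<in> V" "y \<in> V" for x y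
    using assms that by (auto intro!: sum_cong)
  then show ?thesis by (simp add: intertwines_def)
qed

end

context star_algebra_hom
begin

lemma hom_scaled_sum:
  "finite K \<Longrightarrow> (\<And>k. k \<in> K \<Longrightarrow> g k \<in> carrier A) \<Longrightarrow>
     f (\<Oplus>\<^bsub>A\<^esub>k\<in>K. c k \<odot>\<^bsub>A\<^esub> g k) = (\<Oplus>\<^bsub>B\<^esub>k\<in>K. c k \<odot>\<^bsub>B\<^esub> f (g k))"
  by (subst hom_sum) (auto intro!: B.sum_cong simp: hom_scale)

lemma hom_cube_coeff:
  assumes J: "finite J" and v: "\<And>x y. x \<in> cube J \<Longrightarrow> y \<in> cube J \<Longrightarrow> v x y \<in> carrier A"
  shows "f (A.cube_coeff J v i j) = B.cube_coeff J (\<lambda>x y. f (v x y)) i j"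
proof -
  note V = finite_cube[OF J]
  have "f (\<Oplus>\<^bsub>A\<^esub>x\<in>cube J. chi i x \<odot>\<^bsub>A\<^esub> (\<Oplus>\<^bsub>A\<^esub>y\<in>cube J. chi j y \<odot>\<^bsub>A\<^esub> v x y))
      = (\<Oplus>\<^bsub>B\<^esub>x\<in>cube J. chi i x \<odot>\<^bsub>B\<^esub> f (\<Oplus>\<^bsub>A\<^esub>y\<in>cube J. chi j y \<odot>\<^bsub>A\<^esub> v x y))"
    using V v by (intro hom_scaled_sum) auto
  also have "\<dots> = (\<Oplus>\<^bsub>B\<^esub>x\<in>cube J. chi i x \<odot>\<^bsub>B\<^esub> (\<Oplus>\<^bsub>B\<^esub>y\<in>cube J. chi j y \<odot>\<^bsub>B\<^esub> f (v x y)))"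
    using V v by (intro B.sum_cong) (auto simp: hom_scaled_sum)
  finally show ?thesis
    unfolding A.cube_coeff_def B.cube_coeff_def using V v by (subst hom_scale) auto
qed

lemma hom_pou:
  assumes "finite V" "A.pou V e"
  shows "B.pou V (\<lambda>x. f (e x))"
proof -
  note e = A.pouD[OF assms(2)]
  have "(\<Oplus>\<^bsub>B\<^esub>x\<in>V. f (e x)) = \<one>\<^bsub>B\<^esub>" using hom_sum[OF assms(1), where g = e, OF e(1)] by (simp add: e(3) hom_one)
  then show ?thesis using e(1,2) by (simp add: B.pou_def hom_zero flip: hom_mult)
qed

end

section \<open>Transport of Hopf algebra structures\<close>

lemma tensor_square_hom:
  assumes A: "cstar_algebra (A :: 'a cstar_alg)" and B: "cstar_algebra (B :: 'b cstar_alg)" and f: "f \<in> star_hom A B"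
  obtains T where "T \<in> star_hom (cstar_tensor A A) (cstar_tensor B B)"
    "\<And>x y. x \<in> carrier A \<Longrightarrow> y \<in> carrier A \<Longrightarrow> T (pure_tensor A A x y) = pure_tensor B B (f x) (f y)"
proof -
  interpret A: cstar_algebra A by (rule A)
  interpret B: cstar_algebra B by (rule B)
  have t: "tensor_like A A (cstar_tensor B B) (\<lambda>x y. pure_tensor B B (f x) (f y))"
    by (rule tensor_like_compose[OF A.star_algebra_axioms A.star_algebra_axioms
          B.star_algebra_axioms B.star_algebra_axioms tensor_like_pure[OF B B] f f])
  show ?thesis
    by (rule tensor_hom_exists[OF A A tensor_cstar_algebra[OF B B] t]) (rule that)
qed

text \<open>The structure maps of \<open>A\<close> are defined by conjugating those of
  \<open>B\<close> with \<open>f\<close>, so \<open>f\<close> respects them by construction; what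
  remains are their values on \<open>u\<close>, which are the premises \<open>D\<close>,
  \<open>e\<close> and \<open>S\<close>. The premise \<open>D\<close> quantifies over every
  \<open>T\<close> acting as \<open>g\<close> on both tensor factors, because such a map is only
  obtained inside the proof.\<close>

lemma hopf_isomorphic_transport:
  assumes A: "cstar_algebra A" and B: "hopf_structure B J v D e S"
    and f: "f \<in> star_hom A B" and g: "g \<in> star_hom B A"
    and gf: "\<And>x. x \<in> carrier A \<Longrightarrow> g (f x) = x" and fg: "\<And>y. y \<in> carrier B \<Longrightarrow> f (g y) = y"
    and D: "\<And>T i j. T \<in> star_hom (cstar_tensor B B) (cstar_tensor A A) \<Longrightarrow>
      (\<And>x y. x \<in> carrier B \<Longrightarrow> y \<in> carrier B \<Longrightarrow> T (pure_tensor B B x y) = pure_tensor A A (g x) (g y)) \<Longrightarrow>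
      i \<in> I \<Longrightarrow> j \<in> I \<Longrightarrow>
      T (D (f (u i j))) = (\<Oplus>\<^bsub>cstar_tensor A A\<^esub>k\<in>I. pure_tensor A A (u i k) (u k j))"
    and e: "\<And>i j. i \<in> I \<Longrightarrow> j \<in> I \<Longrightarrow> e (f (u i j)) = (if i = j then 1 else 0)"
    and S: "\<And>i j. i \<in> I \<Longrightarrow> j \<in> I \<Longrightarrow> g (S (f (u i j))) = u j i"
  shows "hopf_isomorphic A I u B J v"
proof -
  have Bc: "cstar_algebra B" and DB: "D \<in> star_hom B (cstar_tensor B B)"
    and eB: "e \<in> star_hom B complex_cstar" and SB: "S \<in> star_hom B (opposite B)"
    using B by (simp_all add: hopf_structure_def)
  interpret A: cstar_algebra A by (rule A)
  interpret B: cstar_algebra B by (rule Bc)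
  interpret AA: cstar_algebra "cstar_tensor A A" by (rule tensor_cstar_algebra[OF A A])
  interpret BB: cstar_algebra "cstar_tensor B B" by (rule tensor_cstar_algebra[OF Bc Bc])
  interpret OB: cstar_algebra "opposite B" by (rule opposite_cstar_algebra[OF Bc])
  interpret f: star_algebra_hom A B f by unfold_locales (rule f)
  interpret g: star_algebra_hom B A g by unfold_locales (rule g)
  interpret D: star_algebra_hom B "cstar_tensor B B" D by unfold_locales (rule DB)
  interpret S: star_algebra_hom B "opposite B" S by unfold_locales (rule SB)
  obtain T where T: "T \<in> star_hom (cstar_tensor A A) (cstar_tensor B B)"
    and Tp: "\<And>x y. x \<in> carrier A \<Longrightarrow> y \<in> carrier A \<Longrightarrow> T (pure_tensor A A x y) = pure_tensor B B (f x) (f y)"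
    by (rule tensor_square_hom[OF A Bc f]) (rule that)
  obtain T' where T': "T' \<in> star_hom (cstar_tensor B B) (cstar_tensor A A)"
    and Tp': "\<And>x y. x \<in> carrier B \<Longrightarrow> y \<in> carrier B \<Longrightarrow> T' (pure_tensor B B x y) = pure_tensor A A (g x) (g y)"
    by (rule tensor_square_hom[OF Bc A g]) (rule that)
  \<comment> \<open>Checked on pure tensors, where it reduces to \<open>fg\<close>; it makes the
    conjugated comultiplication compatible with that of \<open>B\<close>.\<close>
  have TT': "T (T' X) = X" if "X \<in> carrier (cstar_tensor B B)" for X
  proof -
    have "(T \<circ> T') X = (\<lambda>x. x) X"
    proof (rule tensor_hom_unique[OF Bc Bc BB.cstar_algebra_axioms star_hom_compose[OF T' T] star_hom_id _ that])
      show "(T \<circ> T') (pure_tensor B B a b) = pure_tensor B B a b"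
        if "a \<in> carrier B" "b \<in> carrier B" for a b
        using that by (simp add: Tp Tp' fg)
    qed
    then show ?thesis by simp
  qed
  have S_closed: "S x \<in> carrier B" if "x \<in> carrier B" for x using S.hom_closed[OF that] by simp
  have hA: "hopf_structure A I u (T' \<circ> (D \<circ> f)) (e \<circ> f) (g \<circ> (S \<circ> f))"
    unfolding hopf_structure_def
  proof (intro conjI ballI)
    show "cstar_algebra A" by (rule A)
    show "T' \<circ> (D \<circ> f) \<in> star_hom A (cstar_tensor A A)"
      by (rule star_hom_compose[OF star_hom_compose[OF f DB] T'])
    show "e \<circ> f \<in> star_hom A complex_cstar" by (rule star_hom_compose[OF f eB])
    show "g \<circ> (S \<circ> f) \<in> star_hom A (opposite A)"
      by (rule star_hom_compose[OF star_hom_compose[OF f SB] star_hom_opposite[OF g]])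
  qed (use D[OF T' Tp'] e S in simp_all)
  show ?thesis
    unfolding hopf_isomorphic_def
  proof (intro exI conjI ballI)
    show "bij_betw f (carrier A) (carrier B)"
      by (rule bij_betwI[of f _ _ g]) (simp_all add: gf fg)
  qed (rule hA B f T Tp | simp add: TT' fg S_closed)+
qed

section \<open>The Hopf algebra structure of quantum symmetry algebras\<close>

text \<open>Each structure map comes from the universal property, applied to a magic unitary that
  commutes with the adjacency matrix: the coproduct of \<open>v\<close> over the tensor square, the
  identity matrix over the scalars, and the transpose of \<open>v\<close> over the opposite algebra,
  where symmetry of the adjacency matrix enters.\<close>

lemma quantum_sym_hopf_structure:
  assumes V: "finite V"
  obtains D e S where "hopf_structure (quantum_sym V E) V (quantum_sym_gen V E) D e S"
proof -
  define B v where "B = quantum_sym V E" and "v = quantum_sym_gen V E"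
  have B: "cstar_algebra B" unfolding B_def by (rule quantum_sym_cstar_algebra[OF V])
  interpret B: cstar_algebra B by (rule B)
  have v: "B.magic V v" "B.intertwines V (adjacency E) v"
    unfolding B_def v_def by (rule quantum_sym_magic[OF V])+
  have vc: "v x y \<in> carrier B" if "x \<in> V" "y \<in> V" for x y
    using v(1) that by (simp add: B.magic_def)
  have BB: "cstar_algebra (cstar_tensor B B)" by (rule tensor_cstar_algebra[OF B B])
  have OB: "cstar_algebra (opposite B)" by (rule opposite_cstar_algebra[OF B])
  interpret BB: cstar_algebra "cstar_tensor B B" by (rule BB)
  interpret OB: cstar_algebra "opposite B" by (rule OB)
  interpret CC: cstar_algebra complex_cstar by (rule complex_cstar_algebra)
  interpret Q: tensor_square B "cstar_tensor B B" "pure_tensor B B"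
    by unfold_locales (rule tensor_like_pure[OF B B])
  obtain D where D: "D \<in> star_hom B (cstar_tensor B B)" "\<And>x y. x \<in> V \<Longrightarrow> y \<in> V \<Longrightarrow> D (v x y) = Q.comult V v x y"
    using quantum_sym_hom_exists[OF V BB Q.comult_magic[OF V v(1)] Q.comult_intertwines[OF V vc v(2)]]
    unfolding B_def v_def by blast
  obtain e where e: "e \<in> star_hom B complex_cstar"
      "\<And>x y. x \<in> V \<Longrightarrow> y \<in> V \<Longrightarrow> e (v x y) = (if x = y then \<one>\<^bsub>complex_cstar\<^esub> else \<zero>\<^bsub>complex_cstar\<^esub>)"
    using quantum_sym_hom_exists[OF V complex_cstar_algebra CC.identity_magic(1)[OF V] CC.identity_magic(2)[OF V]]
    unfolding B_def v_def by blast
  have sym: "adjacency E x y = adjacency E y x" for x y by (simp add: adjacency_def insert_commute)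
  obtain S where S: "S \<in> star_hom B (opposite B)" "\<And>x y. x \<in> V \<Longrightarrow> y \<in> V \<Longrightarrow> S (v x y) = v y x"
    using quantum_sym_hom_exists[OF V OB
      magic_opposite[OF B.star_algebra_axioms OB.star_algebra_axioms B.magic_transpose[OF v(1)]]
      intertwines_opposite[OF B.star_algebra_axioms OB.star_algebra_axioms B.intertwines_transpose[OF v(2) sym]]]
    unfolding B_def v_def by blast
  have "hopf_structure B V v D e S"
    unfolding hopf_structure_def using B D e S by (simp add: Q.comult_def)
  then show ?thesis using that unfolding B_def v_def by blast
qed

section \<open>The cube graph\<close>

lemma cube_edges_eq: "cube_edges n = {{x, flip i x} | i x. i \<in> {1..n} \<and> x \<in> cube {1..n}}"
proof (intro Set.set_eqI iffI)
  fix X assume "X \<in> cube_edges n"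
  then obtain x y where xy: "x \<in> cube {1..n}" "y \<in> cube {1..n}" "X = {x, y}"
      "\<exists>!i. i \<in> {1..n} \<and> x i \<noteq> y i"
    unfolding cube_edges_def cube_vertices_eq by blast
  then obtain i where "i \<in> {1..n}" "y = flip i x"
    using adjacent_iff[OF _ xy(1,2)] by blast
  then show "X \<in> {{x, flip i x} | i x. i \<in> {1..n} \<and> x \<in> cube {1..n}}"
    using xy(1,3) by blast
next
  fix X assume "X \<in> {{x, flip i x} | i x. i \<in> {1..n} \<and> x \<in> cube {1..n}}"
  then obtain i x where ix: "i \<in> {1..n}" "x \<in> cube {1..n}" "X = {x, flip i x}" by blast
  have y: "flip i x \<in> cube {1..n}" by (rule flip_in_cube[OF ix(2,1)])
  have "\<exists>!k. k \<in> {1..n} \<and> x k \<noteq> flip i x k"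
    using adjacent_iff[OF _ ix(2) y] ix(1) by blast
  then show "X \<in> cube_edges n"
    unfolding cube_edges_def cube_vertices_eq using ix(2,3) y by blast
qed

lemma cube_adjacency:
  assumes "x \<in> cube {1..n}" "y \<in> cube {1..n}"
  shows "adjacency (cube_edges n) x y = adjacent {1..n} x y"
proof -
  have "{x, y} \<in> cube_edges n \<longleftrightarrow> (\<exists>i\<in>{1..n}. y = flip i x)"
  proof
    assume "{x, y} \<in> cube_edges n"
    then obtain i z where iz: "i \<in> {1..n}" "{x, y} = {z, flip i z}" unfolding cube_edges_eq by blast
    then have "(x = z \<and> y = flip i z) \<or> (x = flip i z \<and> y = z)" by (simp add: doubleton_eq_iff)
    then show "\<exists>i\<in>{1..n}. y = flip i x" using iz(1) by (auto intro!: bexI[of _ i])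
  next
    assume "\<exists>i\<in>{1..n}. y = flip i x"
    then show "{x, y} \<in> cube_edges n" using assms(1) unfolding cube_edges_eq by blast
  qed
  then show ?thesis by (simp add: adjacency_def adjacent_def)
qed

text \<open>Flipping the coordinate \<open>i\<close> exchanges the two halves of the cube.\<close>

lemma card_cube_zero:
  assumes J: "finite J" and i: "i \<in> J"
  shows "card {x \<in> cube J. x i = 0} = 2 ^ (card J - 1)"
proof -
  have flip_at: "flip i x i = 1 - x i" for x by (simp add: flip_def)
  let ?Z = "{x \<in> cube J. x i = 0}" and ?O = "{x \<in> cube J. x i = 1}"
  have "card ?Z = card ?O"
    by (rule bij_betw_same_card[of "flip i"], rule bij_betwI[of _ _ _ "flip i"])
      (use flip_in_cube[OF _ i] in \<open>auto simp: flip_at\<close>)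
  moreover have "cube J = ?Z \<union> ?O" using cube_val[OF _ i] by auto
  moreover have "card (?Z \<union> ?O) = card ?Z + card ?O"
    using finite_cube[OF J] by (intro card_Un_disjoint) auto
  ultimately have two: "2 * card ?Z = 2 ^ card J" using card_cube[OF J] by simp
  obtain m where "card J = Suc m" using i J card_gt_0_iff[of J] gr0_implies_Suc by blast
  then show ?thesis using two by simp
qed

text \<open>Each edge has exactly one endpoint at which the coordinate in the direction of the edge
  is 0, so edges correspond to pairs of a direction \<open>i\<close> and a vertex with
  \<open>x i = 0\<close>.\<close>

lemma card_cube_edges: "card (cube_edges n) = n * 2 ^ (n - 1)"
proof -
  let ?P = "SIGMA i:{1..n}. {x \<in> cube {1..n}. x i = 0}" and ?F = "\<lambda>(i, x). {x, flip i x}"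
  have "p = q" if p: "p \<in> ?P" and q: "q \<in> ?P" and eq: "?F p = ?F q" for p q
  proof -
    obtain i x where p': "p = (i, x)" by (cases p)
    obtain j y where q': "q = (j, y)" by (cases q)
    note pq = p' q'
    have i: "x i = 0" using p by (simp add: pq)
    have j: "y j = 0" using q by (simp add: pq)
    from eq have "{x, flip i x} = {y, flip j y}" by (simp add: pq)
    then consider "x = y" "flip i x = flip j y" | "x = flip j y" "flip i x = y"
      unfolding doubleton_eq_iff by blast
    then show "p = q"
    proof cases
      case 1
      have "flip j y i = 1" using fun_cong[OF 1(2), of i] i by (simp add: flip_def)
      then show ?thesis using 1(1) i j by (cases "i = j") (simp_all add: pq flip_def)
    next
      case 2
      then have "x j = 1" using j by (simp add: flip_def)
      moreover have "flip i x j = 0" using 2(2) j by simp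
      ultimately have "j = i" by (simp add: flip_def split: if_splits)
      then show ?thesis using i \<open>x j = 1\<close> by simp
    qed
  qed
  then have inj: "inj_on ?F ?P" by (rule inj_onI)
  have img: "?F ` ?P = cube_edges n"
  proof
    show "?F ` ?P \<subseteq> cube_edges n"
    proof (rule image_subsetI)
      fix p assume "p \<in> ?P"
      then obtain i x where ix: "p = (i, x)" "i \<in> {1..n}" "x \<in> cube {1..n}" by blast
      then show "?F p \<in> cube_edges n" unfolding cube_edges_eq prod.case ix(1) by blast
    qed
    show "cube_edges n \<subseteq> ?F ` ?P"
    proof
      fix X assume "X \<in> cube_edges n"
      then obtain i x where ix: "i \<in> {1..n}" "x \<in> cube {1..n}" "X = {x, flip i x}"
        unfolding cube_edges_eq by blast
      show "X \<in> ?F ` ?P"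
      proof (cases "x i = 0")
        case True
        then show ?thesis using ix by (intro image_eqI[of _ _ "(i, x)"]) simp_all
      next
        case False
        then have "flip i x i = 0" using cube_val[OF ix(2,1)] by (simp add: flip_def)
        then show ?thesis using ix flip_in_cube[OF ix(2,1)]
          by (intro image_eqI[of _ _ "(i, flip i x)"]) (simp_all add: insert_commute)
      qed
    qed
  qed
  have "card (cube_edges n) = card ?P" using card_image[OF inj] unfolding img .
  also have "\<dots> = (\<Sum>i\<in>{1..n}. card {x \<in> cube {1..n}. x i = 0})"
    using finite_cube[of "{1..n}"] by (intro card_SigmaI) auto
  also have "\<dots> = n * 2 ^ (n - 1)" using card_cube_zero[of "{1..n}"] by simp
  finally show ?thesis .
qed

section \<open>The isomorphism\<close>

text \<open>\<open>f\<close> sends \<open>u\<close> to the Fourier coefficients of \<open>v\<close>,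
  and \<open>g\<close> sends \<open>v\<close> to the joint spectral projections \<open>p\<close> of
  the reflections formed from \<open>u\<close>. Both composites are compared with the identity on
  generators: on \<open>u\<close> by orthogonality of characters, on \<open>v\<close> by uniqueness
  of the projections.\<close>

lemma C_O_neg_hopf_isomorphic:
  fixes n :: nat
  defines "I \<equiv> {1..n}"
  defines "V \<equiv> cube I"
  shows "hopf_isomorphic (C_O_neg n) I (C_O_neg_gen n) (quantum_sym V (cube_edges n)) V (quantum_sym_gen V (cube_edges n))"
proof -
  define E A u B v where "E = cube_edges n" and "A = C_O_neg n" and "u = C_O_neg_gen n"
    and "B = quantum_sym V E" and "v = quantum_sym_gen V E"
  have I: "finite I" by (simp add: I_def)
  have V: "finite V" unfolding V_def by (rule finite_cube[OF I])
  have adj: "adjacency E x y = adjacent I x y" if "x \<in> V" "y \<in> V" for x y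
    using that unfolding E_def I_def V_def by (rule cube_adjacency)
  have A: "cstar_algebra A" unfolding A_def by (rule C_O_neg_cstar_algebra)
  have B: "cstar_algebra B" unfolding B_def by (rule quantum_sym_cstar_algebra[OF V])
  interpret A: cstar_algebra A by (rule A)
  interpret B: cstar_algebra B by (rule B)
  have u: "A.neg_orthogonal I u" unfolding A_def I_def u_def by (rule C_O_neg_neg_orthogonal)
  then have uc: "u i j \<in> carrier A" if "i \<in> I" "j \<in> I" for i j
    using that by (simp add: A.neg_orthogonal_def)
  have v: "B.magic V v" "B.intertwines V (adjacency E) v"
    unfolding B_def v_def by (rule quantum_sym_magic[OF V])+
  have vc: "v x y \<in> carrier B" if "x \<in> V" "y \<in> V" for x y
    using v(1) that by (simp add: B.magic_def)
  have v2: "B.intertwines V (adjacent I) v"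
    using v(2) B.intertwines_cong[of V "adjacency E" "adjacent I" v] adj vc by simp
  obtain f where f: "f \<in> star_hom A B" and fu: "\<And>i j. i \<in> I \<Longrightarrow> j \<in> I \<Longrightarrow> f (u i j) = B.cube_coeff I v i j"
    using C_O_neg_hom_exists[OF B B.magic_imp_neg_orthogonal[OF I v(1)[unfolded V_def] v2[unfolded V_def], unfolded I_def]]
    unfolding A_def u_def I_def by blast
  obtain p where p: "A.magic V p" "A.intertwines V (adjacent I) p"
    and pu: "\<And>x i. x \<in> V \<Longrightarrow> i \<in> I \<Longrightarrow> (\<Oplus>\<^bsub>A\<^esub>y\<in>V. chi i y \<odot>\<^bsub>A\<^esub> p x y) = (\<Oplus>\<^bsub>A\<^esub>j\<in>I. chi j x \<odot>\<^bsub>A\<^esub> u j i)"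
    using A.neg_orthogonal_imp_magic[OF I u] unfolding V_def by blast
  have pc: "p x y \<in> carrier A" if "x \<in> V" "y \<in> V" for x y
    using p(1) that by (simp add: A.magic_def)
  have p2: "A.intertwines V (adjacency E) p"
    using p(2) A.intertwines_cong[of V "adjacency E" "adjacent I" p] adj pc by simp
  obtain g where g: "g \<in> star_hom B A" and gv: "\<And>x y. x \<in> V \<Longrightarrow> y \<in> V \<Longrightarrow> g (v x y) = p x y"
    using quantum_sym_hom_exists[OF V A p(1) p2] unfolding B_def v_def by blast
  interpret f: star_algebra_hom A B f by unfold_locales (rule f)
  interpret g: star_algebra_hom B A g by unfold_locales (rule g)
  have pcoeff: "A.cube_coeff I p i j = u i j" if "i \<in> I" "j \<in> I" for i j
    by (rule A.cube_coeff_of_expansion[where u = u]) (use I uc pu that in \<open>simp_all add: V_def\<close>)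
  have gcoeff: "g (B.cube_coeff I v i j) = u i j" if "i \<in> I" "j \<in> I" for i j
  proof -
    have "g (B.cube_coeff I v i j) = A.cube_coeff I (\<lambda>x y. g (v x y)) i j"
      by (rule g.hom_cube_coeff[OF I]) (use vc in \<open>simp add: V_def\<close>)
    also have "\<dots> = A.cube_coeff I p i j"
      by (rule A.cube_coeff_cong) (use gv pc in \<open>simp_all add: V_def\<close>)
    finally show ?thesis using pcoeff[OF that] by simp
  qed
  have gf: "g (f x) = x" if "x \<in> carrier A" for x
  proof -
    have "(g \<circ> f) x = (\<lambda>x. x) x"
    proof (rule C_O_neg_hom_unique[OF A, of _ n])
      show "g \<circ> f \<in> star_hom (C_O_neg n) A" using star_hom_compose[OF f g] by (simp only: A_def)
      show "(\<lambda>x. x) \<in> star_hom (C_O_neg n) A" unfolding A_def by (rule star_hom_id)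
      show "(g \<circ> f) (C_O_neg_gen n i j) = C_O_neg_gen n i j" if "i \<in> {1..n}" "j \<in> {1..n}" for i j
        using gcoeff fu that[folded I_def] unfolding u_def by (simp only: o_apply)
      show "x \<in> carrier (C_O_neg n)" using that by (simp only: A_def)
    qed
    then show ?thesis by simp
  qed
  \<comment> \<open>Along row \<open>x\<close> the families \<open>f (p x y)\<close> and
    \<open>v x y\<close> are partitions of unity with the same character sums, and these determine
    them.\<close>
  have fp: "f (p x y) = v x y" if x: "x \<in> V" and y: "y \<in> V" for x y
  proof (rule B.cube_pou_unique[OF I, folded V_def, OF _ _ _ y])
    show "B.pou V (\<lambda>y. f (p x y))"
      by (rule f.hom_pou[OF V]) (use p(1) x in \<open>simp add: A.magic_def\<close>)
    show "B.pou V (\<lambda>y. v x y)" using v(1) x by (simp add: B.magic_def)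
    fix i assume i: "i \<in> I"
    have "(\<Oplus>\<^bsub>B\<^esub>y\<in>V. chi i y \<odot>\<^bsub>B\<^esub> f (p x y)) = f (\<Oplus>\<^bsub>A\<^esub>y\<in>V. chi i y \<odot>\<^bsub>A\<^esub> p x y)"
      using f.hom_scaled_sum[OF V, of "p x" "chi i"] pc x by simp
    also have "\<dots> = (\<Oplus>\<^bsub>B\<^esub>j\<in>I. chi j x \<odot>\<^bsub>B\<^esub> f (u j i))"
      using f.hom_scaled_sum[OF I, of "\<lambda>j. u j i" "\<lambda>j. chi j x"] uc i by (simp add: pu[OF x i])
    also have "\<dots> = (\<Oplus>\<^bsub>B\<^esub>j\<in>I. chi j x \<odot>\<^bsub>B\<^esub> B.cube_coeff I v j i)"
      using i B.cube_coeff_closed[of I v] vc by (intro B.sum_cong) (auto simp: fu V_def)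
    also have "\<dots> = (\<Oplus>\<^bsub>B\<^esub>y\<in>V. chi i y \<odot>\<^bsub>B\<^esub> v x y)"
      using B.magic_expansion[OF I v(1)[unfolded V_def] v2[unfolded V_def] x[unfolded V_def] i]
      by (simp add: V_def)
    finally show "(\<Oplus>\<^bsub>B\<^esub>y\<in>V. chi i y \<odot>\<^bsub>B\<^esub> f (p x y)) = (\<Oplus>\<^bsub>B\<^esub>y\<in>V. chi i y \<odot>\<^bsub>B\<^esub> v x y)" .
  qed
  have fg: "f (g x) = x" if "x \<in> carrier B" for x
  proof -
    have "(f \<circ> g) x = (\<lambda>x. x) x"
    proof (rule quantum_sym_hom_unique[OF V B, of _ E])
      show "f \<circ> g \<in> star_hom (quantum_sym V E) B" using star_hom_compose[OF g f] by (simp only: B_def)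
      show "(\<lambda>x. x) \<in> star_hom (quantum_sym V E) B" unfolding B_def by (rule star_hom_id)
      show "(f \<circ> g) (quantum_sym_gen V E x y) = quantum_sym_gen V E x y" if "x \<in> V" "y \<in> V" for x y
        using gv[OF that] fp[OF that] unfolding v_def by (simp only: o_apply)
      show "x \<in> carrier (quantum_sym V E)" using that by (simp only: B_def)
    qed
    then show ?thesis by simp
  qed
  obtain D e S where hB: "hopf_structure B V v D e S"
    using quantum_sym_hopf_structure[OF V] unfolding B_def v_def by blast
  have D: "D \<in> star_hom B (cstar_tensor B B)"
      "\<And>x y. x \<in> V \<Longrightarrow> y \<in> V \<Longrightarrow> D (v x y) = (\<Oplus>\<^bsub>cstar_tensor B B\<^esub>z\<in>V. pure_tensor B B (v x z) (v z y))"
    and e: "e \<in> star_hom B complex_cstar" "\<And>x y. x \<in> V \<Longrightarrow> y \<in> V \<Longrightarrow> e (v x y) = (if x = y then 1 else 0)"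
    and S: "S \<in> star_hom B (opposite B)" "\<And>x y. x \<in> V \<Longrightarrow> y \<in> V \<Longrightarrow> S (v x y) = v y x"
    using hB by (simp_all add: hopf_structure_def)
  interpret AA: cstar_algebra "cstar_tensor A A" by (rule tensor_cstar_algebra[OF A A])
  interpret BB: cstar_algebra "cstar_tensor B B" by (rule tensor_cstar_algebra[OF B B])
  interpret OB: cstar_algebra "opposite B" by (rule opposite_cstar_algebra[OF B])
  interpret CC: cstar_algebra complex_cstar by (rule complex_cstar_algebra)
  interpret Q: tensor_square A "cstar_tensor A A" "pure_tensor A A"
    by unfold_locales (rule tensor_like_pure[OF A A])
  interpret R: tensor_square B "cstar_tensor B B" "pure_tensor B B"
    by unfold_locales (rule tensor_like_pure[OF B B])
  interpret e: star_algebra_hom B complex_cstar e by unfold_locales (rule e(1))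
  interpret S: star_algebra_hom B "opposite B" S by unfold_locales (rule S(1))
  have "hopf_isomorphic A I u B V v"
  proof (rule hopf_isomorphic_transport[OF A hB f g gf fg])
    fix T i j
    assume T: "T \<in> star_hom (cstar_tensor B B) (cstar_tensor A A)"
      and Tp: "\<And>x y. x \<in> carrier B \<Longrightarrow> y \<in> carrier B \<Longrightarrow> T (pure_tensor B B x y) = pure_tensor A A (g x) (g y)"
      and i: "i \<in> I" and j: "j \<in> I"
    have TD: "T \<circ> D \<in> star_hom B (cstar_tensor A A)" by (rule star_hom_compose[OF D(1) T])
    interpret T: star_algebra_hom "cstar_tensor B B" "cstar_tensor A A" T by unfold_locales (rule T)
    interpret TD: star_algebra_hom B "cstar_tensor A A" "T \<circ> D" by unfold_locales (rule TD)
    have c: "Q.comult V p x y \<in> carrier (cstar_tensor A A)" if "x \<in> V" "y \<in> V" for x y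
      by (rule Q.comult_closed[where v = p, OF V pc that])
    have TDv: "(T \<circ> D) (v x y) = Q.comult V p x y" if "x \<in> V" "y \<in> V" for x y
    proof -
      have "T (D (v x y)) = (\<Oplus>\<^bsub>cstar_tensor A A\<^esub>z\<in>V. T (pure_tensor B B (v x z) (v z y)))"
        unfolding D(2)[OF that] using vc that by (intro T.hom_sum[OF V]) auto
      also have "\<dots> = Q.comult V p x y"
        unfolding Q.comult_def using vc pc gv that by (intro AA.sum_cong) (auto simp: Tp)
      finally show ?thesis by simp
    qed
    \<comment> \<open>\<open>f (u i j)\<close> is a coefficient of \<open>v\<close>, and
      \<open>T \<circ> D\<close> maps \<open>v\<close> to the coproduct of \<open>p\<close>; by
      \<open>comult_expansion\<close> the coefficients of the latter form the coproduct of
      \<open>u\<close>.\<close>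
    have "(T \<circ> D) (f (u i j)) = AA.cube_coeff I (\<lambda>x y. (T \<circ> D) (v x y)) i j"
      unfolding fu[OF i j] by (rule TD.hom_cube_coeff[OF I]) (use vc in \<open>simp add: V_def\<close>)
    also have "\<dots> = AA.cube_coeff I (Q.comult V p) i j"
      by (rule AA.cube_coeff_cong) (use TDv c in \<open>simp_all add: V_def\<close>)
    also have "\<dots> = Q.comult I u i j"
    proof (rule AA.cube_coeff_of_expansion[where u = "Q.comult I u"])
      show "finite I" "i \<in> I" by fact+
      show "Q.comult I u k j \<in> carrier (cstar_tensor A A)" if "k \<in> I" for k
        by (rule Q.comult_closed[where v = u, OF I uc that j])
      show "(\<Oplus>\<^bsub>cstar_tensor A A\<^esub>y\<in>cube I. chi j y \<odot>\<^bsub>cstar_tensor A A\<^esub> Q.comult V p x y)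
          = (\<Oplus>\<^bsub>cstar_tensor A A\<^esub>k\<in>I. chi k x \<odot>\<^bsub>cstar_tensor A A\<^esub> Q.comult I u k j)" if "x \<in> cube I" for x
        unfolding V_def
        by (rule Q.comult_expansion[where p = p and u = u])
          (use I pc uc pu that j in \<open>simp_all add: V_def\<close>)
    qed
    finally show "T (D (f (u i j))) = (\<Oplus>\<^bsub>cstar_tensor A A\<^esub>k\<in>I. pure_tensor A A (u i k) (u k j))"
      by (simp add: Q.comult_def)
  next
    fix i j assume i: "i \<in> I" and j: "j \<in> I"
    \<comment> \<open>The counit maps \<open>v\<close> to the identity matrix on the vertices, whose
      coefficients form the identity matrix on the coordinates.\<close>
    have "e (f (u i j)) = CC.cube_coeff I (\<lambda>x y. e (v x y)) i j"
      unfolding fu[OF i j] by (rule e.hom_cube_coeff[OF I]) (use vc in \<open>simp add: V_def\<close>)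
    also have "\<dots> = CC.cube_coeff I (\<lambda>x y. if x = y then \<one>\<^bsub>complex_cstar\<^esub> else \<zero>\<^bsub>complex_cstar\<^esub>) i j"
      by (rule CC.cube_coeff_cong) (use e(2) in \<open>simp_all add: V_def\<close>)
    finally show "e (f (u i j)) = (if i = j then 1 else 0)"
      by (simp add: CC.cube_coeff_identity[OF I i j])
    \<comment> \<open>The antipode transposes \<open>v\<close>, and the coefficients of the
      transpose are the transposed coefficients.\<close>
    have "S (f (u i j)) = OB.cube_coeff I (\<lambda>x y. S (v x y)) i j"
      unfolding fu[OF i j] by (rule S.hom_cube_coeff[OF I]) (use vc in \<open>simp add: V_def\<close>)
    also have "\<dots> = OB.cube_coeff I (\<lambda>x y. v y x) i j"
      by (rule OB.cube_coeff_cong) (use S(2) vc in \<open>simp_all add: V_def\<close>)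
    also have "\<dots> = B.cube_coeff I (\<lambda>x y. v y x) i j"
      by (rule cube_coeff_opposite[OF B.star_algebra_axioms OB.star_algebra_axioms])
    also have "\<dots> = B.cube_coeff I v j i"
      by (rule B.cube_coeff_transpose[OF I]) (use vc in \<open>simp add: V_def\<close>)
    finally show "g (S (f (u i j))) = u j i" using gcoeff[OF j i] by simp
  qed
  then show ?thesis unfolding A_def u_def B_def v_def E_def .
qed

theorem theorem4p2:
  fixes n :: nat
  assumes "n \<ge> 1"
  shows "card (cube_vertices n) = 2 ^ n \<and>
    card (cube_edges n) = n * 2 ^ (n - 1) \<and>
    hopf_isomorphic
      (C_O_neg n) {1..n} (C_O_neg_gen n)
      (quantum_sym (cube_vertices n) (cube_edges n)) (cube_vertices n)
      (quantum_sym_gen (cube_vertices n) (cube_edges n))"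
proof (intro conjI)
  show "card (cube_vertices n) = 2 ^ n" by (simp add: cube_vertices_eq card_cube)
  show "card (cube_edges n) = n * 2 ^ (n - 1)" by (rule card_cube_edges)
qed (unfold cube_vertices_eq, rule C_O_neg_hopf_isomorphic)

end
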